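(* Suppose two non-degenerate CR structures $(H,J)$ and $(\widehat H,\widehat J)$ on a manifold $M$ have the same sufficiently big family of chains (i.e. there is a sufficiently big set of curves on $M$ that are chains, up to reparameterization, for both structures). Then these two CR structures coincide or are conjugate: that is, $H=\widehat H$, and either $J=\widehat J$ or $J=-\widehat J$.
   Context: A set of curves on $M$ is called sufficiently big if for every $p\in M$ the set of tangent vectors at $p$ to curves of the set contains a nonempty open subset of $T_pM$. CR manifolds. A CR structure $(H,J)$ on a $(2n+1)$-dimensional manifold $M$ is a corank-1 distribution $H\subset TM$ with a complex structure $J$ on $H$ such that the sections of $T^{1,0}M=\{Z\in\mathbb{C}H: JZ=iZ\}$ are closed under Lie bracket. For a 1-form $\theta$ with $\ker\theta=H$ the Levi form is $h_\theta(X,Y)=d\theta(X,JY)$, $X,Y\in H$. The structure is non-degenerate if $h_\theta$ is non-degenerate; then $H$ is a contact distribution. The Reeb field $T$ of $\theta$ is defined by $\theta(T)=1$, $T\lrcorner d\theta=0$. An admissible coframe $\{\theta,\theta^\alpha,\theta^{\overline\alpha}\}$ is the dual of a local frame $\{T,Z_\alpha,Z_{\overline\alpha}=\overline{Z_\alpha}\}_{1\le\alpha\le n}$ of $\mathbb{C}TM$ with $\{Z_\alpha\}$ a frame of $T^{1,0}M$. One has $d\theta=i h_{\alpha\overline\beta}\theta^\alpha\wedge\theta^{\overline\beta}$ with $h_{\alpha\overline\beta}=h_\theta(Z_\alpha,Z_{\overline\beta})$; indices are raised and lowered with $h$. Tanaka-Webster connection. The forms $\omega_\beta{}^\alpha$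 and the torsion $A_{\overline\beta}{}^\alpha$ are uniquely determined by $d\theta^\alpha=\theta^\beta\wedge\omega_\beta{}^\alpha+A_{\overline\beta}{}^\alpha\theta\wedge\theta^{\overline\beta}$, $dh_{\alpha\overline\beta}=\omega_{\alpha\overline\beta}+\omega_{\overline\beta\alpha}$, $A_{\alpha\beta}=A_{\beta\alpha}$, where $\omega_{\overline\alpha}{}^{\overline\beta}=\overline{\omega_\alpha{}^\beta}$ and $A_\beta{}^{\overline\alpha}=\overline{A_{\overline\beta}{}^\alpha}$. The Ricci tensor $R_{\beta\overline\gamma}$ is defined by $d\omega_\alpha{}^\alpha\equiv R_{\beta\overline\gamma}\theta^\beta\wedge\theta^{\overline\gamma}$ modulo $\theta$, and $R=R_\beta{}^\beta$. Fefferman metric and chains. Let $K_M=\{\zeta\in\wedge^{n+1}\mathbb{C}T^*M:\overline Z\lrcorner\zeta=0\ \forall Z\in T^{1,0}M\}$, let $K_M^*$ be $K_M$ minus its zero section, and $\mathcal{C}=K_M^*/\mathbb{R}_+$, a circle bundle over $M$. An admissible coframe gives the local section $\zeta_0=[\theta\wedge\theta^1\wedge\cdots\wedge\theta^n]$ and the fiber coordinate $s\in\mathbb{R}/2\pi\mathbb{Z}$ with $\zeta=e^{is}\zeta_0$. Put $\sigma=\frac1{n+2}\bigl(ds-\mathrm{Im}\,\omega_\alpha{}^\alpha-\frac{R}{2(n+1)}\theta\bigr)$ and $G=h_{\alpha\overline\beta}\theta^\alpha\cdot\theta^{\overline\beta}+2\theta\cdot\sigma$ (the Fefferman metric, a pseudo-Riemannian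 metric on $\mathcal{C}$ whose conformal class does not depend on $\theta$), where $\cdot$ is the symmetric product with $(a\cdot b)(\xi,\xi)=a(\xi)b(\xi)$. Let $K=(n+2)S$, where $S$ is the infinitesimal generator of the circle action; $K$ is a null Killing field of $G$ with $K\lrcorner G=\theta$. A chain is a curve on $M$ which is the projection of a null geodesic $\widetilde\gamma$ of $G$ with $G(K,\dot{\widetilde\gamma}(0))\neq0$. Chains are considered up to reparameterization.
   Formalization: The alternative "either J = Ĵ or J = −Ĵ" is proved on each connected component of M (globally when M is connected); on a disconnected M the sign may differ between components, so the global alternative would be false. H = Ĥ is proved everywhere. *)

theory Defs
  imports "HOL-Analysis.Analysis"
begin

section \<open>Calculus on open sets of a Euclidean space\<close>

text \<open>The index type \<open>'n bit1\<close> has \<open>2 * CARD('n) + 1\<close> elements, so that with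
  \<open>n = CARD('n)\<close> the type \<open>'n rvec\<close> is the model space of a \<open>(2n+1)\<close>-dimensional manifold.
  Vectors in \<open>'n cvec\<close> serve both as complexified tangent vectors and, through the bilinear
  pairing \<open>ev\<close>, as complex covectors.\<close>

type_synonym 'n rvec = "real ^ ('n bit1)"
type_synonym 'n cvec = "complex ^ ('n bit1)"

primrec Ck_on :: "nat \<Rightarrow> 'a::real_normed_vector set \<Rightarrow> ('a \<Rightarrow> 'b::real_normed_vector) \<Rightarrow> bool"
where
  "Ck_on 0 S f = continuous_on S f"
| "Ck_on (Suc k) S f = ((\<forall>x\<in>S. f differentiable (at x)) \<and>
     (\<forall>v. Ck_on k S (\<lambda>x. frechet_derivative f (at x) v)))"

text \<open>Meant for open \<open>S\<close> only.\<close>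

definition smooth_on :: "'a::real_normed_vector set \<Rightarrow> ('a \<Rightarrow> 'b::real_normed_vector) \<Rightarrow> bool"
  where "smooth_on S f \<longleftrightarrow> (\<forall>k. Ck_on k S f)"

definition pd :: "'i \<Rightarrow> (real ^ 'i::finite \<Rightarrow> 'b::real_normed_vector) \<Rightarrow> real ^ 'i \<Rightarrow> 'b"
  where "pd i f x = frechet_derivative f (at x) (axis i 1)"

definition cv :: "'n::finite rvec \<Rightarrow> 'n cvec"
  where "cv v = (\<chi> i. complex_of_real (v $ i))"

definition Rev :: "'n::finite cvec \<Rightarrow> 'n rvec"
  where "Rev Z = (\<chi> i. Re (Z $ i))"

definition Imv :: "'n::finite cvec \<Rightarrow> 'n rvec"
  where "Imv Z = (\<chi> i. Im (Z $ i))"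

definition cnjv :: "'n::finite cvec \<Rightarrow> 'n cvec"
  where "cnjv Z = (\<chi> i. cnj (Z $ i))"

definition ev :: "'n::finite cvec \<Rightarrow> 'n cvec \<Rightarrow> complex"
  where "ev a Z = (\<Sum>i\<in>UNIV. a $ i * Z $ i)"

definition wedge :: "'n::finite cvec \<Rightarrow> 'n cvec \<Rightarrow> 'n cvec \<Rightarrow> 'n cvec \<Rightarrow> complex"
  where "wedge a b Z W = ev a Z * ev b W - ev a W * ev b Z"

definition diff0 :: "('n::finite rvec \<Rightarrow> complex) \<Rightarrow> 'n rvec \<Rightarrow> 'n cvec"
  where "diff0 f x = (\<chi> i. pd i f x)"

text \<open>Exterior derivative of 1-forms, normalised by
  \<open>d\<eta>(X,Y) = X(\<eta>(Y)) - Y(\<eta>(X)) - \<eta>([X,Y])\<close> (matching \<open>wedge\<close>).\<close>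

definition diff1 :: "('n::finite rvec \<Rightarrow> 'n cvec) \<Rightarrow> 'n rvec \<Rightarrow> 'n cvec \<Rightarrow> 'n cvec \<Rightarrow> complex"
  where "diff1 \<eta> x Z W =
    (\<Sum>i\<in>UNIV. \<Sum>j\<in>UNIV. (pd i (\<lambda>y. \<eta> y $ j) x - pd j (\<lambda>y. \<eta> y $ i) x) * (Z $ i) * (W $ j))"

definition lie_bracket ::
  "('n::finite rvec \<Rightarrow> 'n cvec) \<Rightarrow> ('n rvec \<Rightarrow> 'n cvec) \<Rightarrow> 'n rvec \<Rightarrow> 'n cvec"
  where "lie_bracket X Y x =
    (\<chi> j. \<Sum>i\<in>UNIV. X x $ i * pd i (\<lambda>y. Y y $ j) x - Y x $ i * pd i (\<lambda>y. X y $ j) x)"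

section \<open>Null geodesics of pseudo-Riemannian metrics in coordinates\<close>

text \<open>Christoffel symbols of the Levi-Civita connection, as the vector-valued bilinear map
  \<open>(u, v) \<mapsto> \<Gamma>(u, v)\<close> given by the Koszul formula for constant vector fields.\<close>

definition christoffel ::
  "('a::euclidean_space \<Rightarrow> 'a \<Rightarrow> 'a \<Rightarrow> real) \<Rightarrow> 'a \<Rightarrow> 'a \<Rightarrow> 'a \<Rightarrow> 'a"
  where "christoffel g x u v = (THE z. \<forall>w. 2 * g x z w =
      frechet_derivative (\<lambda>y. g y v w) (at x) u
    + frechet_derivative (\<lambda>y. g y u w) (at x) v
    - frechet_derivative (\<lambda>y. g y u v) (at x) w)"

definition null_geodesic ::
  "('a::euclidean_space \<Rightarrow> 'a \<Rightarrow> 'a \<Rightarrow> real) \<Rightarrow> real set \<Rightarrow> (real \<Rightarrow> 'a) \<Rightarrow> (real \<Rightarrow> 'a) \<Rightarrow> bool"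
  where "null_geodesic g I c c' \<longleftrightarrow> (\<exists>c''. \<forall>t\<in>I.
      (c has_vector_derivative c' t) (at t) \<and> (c' has_vector_derivative c'' t) (at t) \<and>
      c'' t + christoffel g (c t) (c' t) (c' t) = 0 \<and>
      g (c t) (c' t) (c' t) = 0)"

section \<open>CR structures on open sets of the model space\<close>

definition smooth_distribution :: "'n::finite rvec set \<Rightarrow> ('n rvec \<Rightarrow> 'n rvec set) \<Rightarrow> bool"
  where "smooth_distribution \<Omega> H \<longleftrightarrow> (\<forall>x\<in>\<Omega>. \<exists>V E. open V \<and> x \<in> V \<and> V \<subseteq> \<Omega> \<and> finite E \<and>
    (\<forall>X\<in>E. smooth_on V X) \<and> (\<forall>y\<in>V. H y = span ((\<lambda>X. X y) ` E)))"

text \<open>Complex-linear extension of an endomorphism of \<open>H x\<close> to \<open>\<complex>H x\<close>.\<close>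

definition cext :: "('n::finite rvec \<Rightarrow> 'n rvec) \<Rightarrow> 'n cvec \<Rightarrow> 'n cvec"
  where "cext J Z = cv (J (Rev Z)) + \<i> *s cv (J (Imv Z))"

definition T10 :: "('n::finite rvec \<Rightarrow> 'n rvec set) \<Rightarrow> ('n rvec \<Rightarrow> 'n rvec \<Rightarrow> 'n rvec)
    \<Rightarrow> 'n rvec \<Rightarrow> 'n cvec set"
  where "T10 H J x = {Z. Rev Z \<in> H x \<and> Imv Z \<in> H x \<and> cext (J x) Z = \<i> *s Z}"

definition cr_structure_on ::
  "'n::finite rvec set \<Rightarrow> ('n rvec \<Rightarrow> 'n rvec set) \<Rightarrow> ('n rvec \<Rightarrow> 'n rvec \<Rightarrow> 'n rvec) \<Rightarrow> bool"
  where "cr_structure_on \<Omega> H J \<longleftrightarrow>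
    (\<forall>x\<in>\<Omega>. subspace (H x) \<and> dim (H x) = 2 * CARD('n)) \<and>
    smooth_distribution \<Omega> H \<and>
    (\<forall>x\<in>\<Omega>. (\<forall>u\<in>H x. J x u \<in> H x \<and> J x (J x u) = - u) \<and>
       (\<forall>u\<in>H x. \<forall>v\<in>H x. \<forall>a b. J x (a *\<^sub>R u + b *\<^sub>R v) = a *\<^sub>R J x u + b *\<^sub>R J x v)) \<and>
    (\<forall>V X. open V \<longrightarrow> V \<subseteq> \<Omega> \<longrightarrow> smooth_on V X \<longrightarrow> (\<forall>x\<in>V. X x \<in> H x) \<longrightarrow>
       smooth_on V (\<lambda>x. J x (X x))) \<and>
    (\<forall>V Z W. open V \<longrightarrow> V \<subseteq> \<Omega> \<longrightarrow> smooth_on V Z \<longrightarrow> smooth_on V W \<longrightarrow>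
       (\<forall>x\<in>V. Z x \<in> T10 H J x \<and> W x \<in> T10 H J x) \<longrightarrow>
       (\<forall>x\<in>V. lie_bracket Z W x \<in> T10 H J x))"

text \<open>A real 1-form is given by its coefficient vector field.\<close>

definition contact_form ::
  "'n::finite rvec set \<Rightarrow> ('n rvec \<Rightarrow> 'n rvec set) \<Rightarrow> ('n rvec \<Rightarrow> 'n rvec) \<Rightarrow> bool"
  where "contact_form V H \<theta> \<longleftrightarrow> smooth_on V \<theta> \<and> (\<forall>x\<in>V. {v. \<theta> x \<bullet> v = 0} = H x)"

definition levi_form :: "('n::finite rvec \<Rightarrow> 'n rvec \<Rightarrow> 'n rvec) \<Rightarrow> ('n rvec \<Rightarrow> 'n rvec) \<Rightarrow>
    'n rvec \<Rightarrow> 'n cvec \<Rightarrow> 'n cvec \<Rightarrow> complex"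
  where "levi_form J \<theta> x Z W = diff1 (\<lambda>y. cv (\<theta> y)) x Z (cext (J x) W)"

definition nondegenerate_on ::
  "'n::finite rvec set \<Rightarrow> ('n rvec \<Rightarrow> 'n rvec set) \<Rightarrow> ('n rvec \<Rightarrow> 'n rvec \<Rightarrow> 'n rvec) \<Rightarrow> bool"
  where "nondegenerate_on \<Omega> H J \<longleftrightarrow>
    (\<forall>V \<theta>. open V \<longrightarrow> V \<subseteq> \<Omega> \<longrightarrow> contact_form V H \<theta> \<longrightarrow>
      (\<forall>x\<in>V. \<forall>u\<in>H x. (\<forall>v\<in>H x. levi_form J \<theta> x (cv u) (cv v) = 0) \<longrightarrow> u = 0))"

section \<open>Admissible coframes and the Tanaka--Webster connection\<close>

text \<open>\<open>coframe \<alpha>\<close> is \<open>\<theta>\<^sup>\<alpha>\<close>, \<open>conn \<beta> \<alpha>\<close> is the form with lower index \<open>\<beta>\<close> and upper index \<open>\<alpha>\<close>,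
  \<open>tors \<beta> \<alpha>\<close> is the torsion coefficient with lower index \<open>\<beta>\<close>-bar and upper index \<open>\<alpha>\<close>, and
  \<open>ricci \<beta> \<gamma>\<close> is the Ricci coefficient with lower indices \<open>\<beta>\<close> and \<open>\<gamma>\<close>-bar.\<close>

record 'n ph_data =
  theta :: "'n rvec \<Rightarrow> 'n rvec"
  reeb :: "'n rvec \<Rightarrow> 'n rvec"
  frame :: "'n \<Rightarrow> 'n rvec \<Rightarrow> 'n cvec"
  coframe :: "'n \<Rightarrow> 'n rvec \<Rightarrow> 'n cvec"
  conn :: "'n \<Rightarrow> 'n \<Rightarrow> 'n rvec \<Rightarrow> 'n cvec"
  tors :: "'n \<Rightarrow> 'n \<Rightarrow> 'n rvec \<Rightarrow> complex"
  ricci :: "'n \<Rightarrow> 'n \<Rightarrow> 'n rvec \<Rightarrow> complex"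

definition ctheta :: "'n::finite ph_data \<Rightarrow> 'n rvec \<Rightarrow> 'n cvec"
  where "ctheta P x = cv (theta P x)"

definition cobar :: "'n::finite ph_data \<Rightarrow> 'n \<Rightarrow> 'n rvec \<Rightarrow> 'n cvec"
  where "cobar P \<alpha> x = cnjv (coframe P \<alpha> x)"

definition admissible_coframe :: "'n::finite rvec set \<Rightarrow> ('n rvec \<Rightarrow> 'n rvec set) \<Rightarrow>
    ('n rvec \<Rightarrow> 'n rvec \<Rightarrow> 'n rvec) \<Rightarrow> 'n ph_data \<Rightarrow> bool"
  where "admissible_coframe V H J P \<longleftrightarrow>
    contact_form V H (theta P) \<and> smooth_on V (reeb P) \<and>
    (\<forall>\<alpha>. smooth_on V (frame P \<alpha>) \<and> smooth_on V (coframe P \<alpha>)) \<and>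
    (\<forall>x\<in>V.
      theta P x \<bullet> reeb P x = 1 \<and>
      (\<forall>W. diff1 (ctheta P) x (cv (reeb P x)) W = 0) \<and>
      (\<forall>\<alpha>. frame P \<alpha> x \<in> T10 H J x) \<and>
      (\<forall>Z\<in>T10 H J x. \<exists>!a :: complex ^ 'n. Z = (\<Sum>\<alpha>\<in>UNIV. a $ \<alpha> *s frame P \<alpha> x)) \<and>
      (\<forall>\<alpha>. ev (coframe P \<alpha> x) (cv (reeb P x)) = 0) \<and>
      (\<forall>\<alpha> \<beta>. ev (coframe P \<alpha> x) (frame P \<beta> x) = (if \<alpha> = \<beta> then 1 else 0) \<and>
             ev (coframe P \<alpha> x) (cnjv (frame P \<beta> x)) = 0))"

definition hmat :: "('n::finite rvec \<Rightarrow> 'n rvec \<Rightarrow> 'n rvec) \<Rightarrow> 'n ph_data \<Rightarrow> 'n rvec \<Rightarrow> complex ^ 'n ^ 'n"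
  where "hmat J P x = (\<chi> \<alpha> \<beta>. levi_form J (theta P) x (frame P \<alpha> x) (cnjv (frame P \<beta> x)))"

definition tanaka_webster :: "'n::finite rvec set \<Rightarrow> ('n rvec \<Rightarrow> 'n rvec \<Rightarrow> 'n rvec) \<Rightarrow> 'n ph_data \<Rightarrow> bool"
  where "tanaka_webster V J P \<longleftrightarrow>
    (\<forall>\<beta> \<alpha>. smooth_on V (conn P \<beta> \<alpha>)) \<and>
    (\<forall>x\<in>V.
      (\<forall>\<alpha> Z W. diff1 (coframe P \<alpha>) x Z W =
         (\<Sum>\<beta>\<in>UNIV. wedge (coframe P \<beta> x) (conn P \<beta> \<alpha> x) Z W)
       + (\<Sum>\<beta>\<in>UNIV. tors P \<beta> \<alpha> x * wedge (ctheta P x) (cobar P \<beta> x) Z W)) \<and>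
      (\<forall>\<alpha> \<beta>. diff0 (\<lambda>y. hmat J P y $ \<alpha> $ \<beta>) x =
         (\<Sum>\<gamma>\<in>UNIV. (hmat J P x $ \<gamma> $ \<beta>) *s conn P \<alpha> \<gamma> x)
       + (\<Sum>\<gamma>\<in>UNIV. (hmat J P x $ \<alpha> $ \<gamma>) *s cnjv (conn P \<beta> \<gamma> x))) \<and>
      (\<forall>\<alpha> \<beta>. (\<Sum>\<gamma>\<in>UNIV. hmat J P x $ \<beta> $ \<gamma> * cnj (tors P \<alpha> \<gamma> x)) =
             (\<Sum>\<gamma>\<in>UNIV. hmat J P x $ \<alpha> $ \<gamma> * cnj (tors P \<beta> \<gamma> x))))"

definition conn_trace :: "'n::finite ph_data \<Rightarrow> 'n rvec \<Rightarrow> 'n cvec"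
  where "conn_trace P x = (\<Sum>\<alpha>\<in>UNIV. conn P \<alpha> \<alpha> x)"

definition ricci_tensor :: "'n::finite rvec set \<Rightarrow> 'n ph_data \<Rightarrow> bool"
  where "ricci_tensor V P \<longleftrightarrow> (\<forall>x\<in>V. \<exists>\<eta>. \<forall>Z W.
    diff1 (conn_trace P) x Z W =
      (\<Sum>\<beta>\<in>UNIV. \<Sum>\<gamma>\<in>UNIV. ricci P \<beta> \<gamma> x * wedge (coframe P \<beta> x) (cobar P \<gamma> x) Z W)
    + wedge (ctheta P x) \<eta> Z W)"

definition pseudohermitian :: "'n::finite rvec set \<Rightarrow> ('n rvec \<Rightarrow> 'n rvec set) \<Rightarrow>
    ('n rvec \<Rightarrow> 'n rvec \<Rightarrow> 'n rvec) \<Rightarrow> 'n ph_data \<Rightarrow> bool"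
  where "pseudohermitian V H J P \<longleftrightarrow>
    admissible_coframe V H J P \<and> tanaka_webster V J P \<and> ricci_tensor V P"

text \<open>The entry of \<open>matrix_inv (hmat J P x)\<close> in row \<open>\<gamma>\<close> and column \<open>\<beta>\<close> is the raised
  coefficient with indices \<open>\<beta>\<close> and \<open>\<gamma>\<close>-bar. The contraction is real (the Ricci coefficients
  are Hermitian), so \<open>Re\<close> only adjusts the type.\<close>

definition scalar_curv :: "('n::finite rvec \<Rightarrow> 'n rvec \<Rightarrow> 'n rvec) \<Rightarrow> 'n ph_data \<Rightarrow> 'n rvec \<Rightarrow> real"
  where "scalar_curv J P x =
    Re (\<Sum>\<beta>\<in>UNIV. \<Sum>\<gamma>\<in>UNIV. matrix_inv (hmat J P x) $ \<gamma> $ \<beta> * ricci P \<beta> \<gamma> x)"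

section \<open>The circle bundle and the Fefferman metric\<close>

text \<open>An \<open>(n+1)\<close>-form at a point is a function of tuples of complex vectors indexed by
  \<open>'n option\<close>; \<open>None\<close> is the slot paired with \<open>\<theta>\<close> in \<open>\<theta> \<and> \<theta>\<^sup>1 \<and> \<dots> \<and> \<theta>\<^sup>n\<close>.\<close>

type_synonym 'n cform = "('n option \<Rightarrow> 'n cvec) \<Rightarrow> complex"

definition alternating_form :: "'n::finite cform \<Rightarrow> bool"
  where "alternating_form \<zeta> \<longleftrightarrow>
    (\<forall>v k a X Y. \<zeta> (v(k := a *s X + Y)) = a * \<zeta> (v(k := X)) + \<zeta> (v(k := Y))) \<and>
    (\<forall>v k l. k \<noteq> l \<longrightarrow> v k = v l \<longrightarrow> \<zeta> v = 0)"

definition canonical_fibre :: "('n::finite rvec \<Rightarrow> 'n rvec set) \<Rightarrow>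
    ('n rvec \<Rightarrow> 'n rvec \<Rightarrow> 'n rvec) \<Rightarrow> 'n rvec \<Rightarrow> 'n cform set"
  where "canonical_fibre H J x =
    {\<zeta>. alternating_form \<zeta> \<and> (\<forall>Z\<in>T10 H J x. \<forall>v. \<zeta> (v(None := cnjv Z)) = 0)}"

definition pos_ray :: "'n cform \<Rightarrow> 'n cform set"
  where "pos_ray \<zeta> = {\<lambda>v. complex_of_real r * \<zeta> v | r. r > 0}"

definition circle_bundle :: "'n::finite rvec set \<Rightarrow> ('n rvec \<Rightarrow> 'n rvec set) \<Rightarrow>
    ('n rvec \<Rightarrow> 'n rvec \<Rightarrow> 'n rvec) \<Rightarrow> ('n rvec \<times> 'n cform set) set"
  where "circle_bundle \<Omega> H J =
    {(x, pos_ray \<zeta>) | x \<zeta>. x \<in> \<Omega> \<and> \<zeta> \<in> canonical_fibre H J x \<and> \<zeta> \<noteq> (\<lambda>v. 0)}"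

definition zeta0 :: "'n::finite ph_data \<Rightarrow> 'n rvec \<Rightarrow> 'n cform"
  where "zeta0 P x v = det (\<chi> k l.
    ev (case k of None \<Rightarrow> ctheta P x | Some \<alpha> \<Rightarrow> coframe P \<alpha> x) (v l))"

text \<open>The point of the circle bundle over \<open>x\<close> with fibre coordinate \<open>s\<close>. We let \<open>s\<close> range
  over the reals instead of the reals modulo \<open>2\<pi>\<close>: the metric does not depend on \<open>s\<close>, and
  curves in the bundle lift to the covering.\<close>

definition bundle_point :: "'n::finite ph_data \<Rightarrow> 'n rvec \<times> real \<Rightarrow> 'n rvec \<times> 'n cform set"
  where "bundle_point P = (\<lambda>(x, s). (x, pos_ray (\<lambda>v. exp (\<i> * complex_of_real s) * zeta0 P x v)))"

definition fefferman_sigma :: "('n::finite rvec \<Rightarrow> 'n rvec \<Rightarrow> 'n rvec) \<Rightarrow> 'n ph_data \<Rightarrow>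
    'n rvec \<times> real \<Rightarrow> 'n rvec \<times> real \<Rightarrow> real"
  where "fefferman_sigma J P = (\<lambda>(x, s) (v, \<tau>).
    (\<tau> - Im (ev (conn_trace P x) (cv v))
       - scalar_curv J P x / (2 * (real CARD('n) + 1)) * (theta P x \<bullet> v)) / (real CARD('n) + 2))"

text \<open>The metric in the coordinates \<open>(x, s)\<close>, polarised from
  \<open>(a \<cdot> b)(\<xi>,\<xi>) = a(\<xi>) b(\<xi>)\<close>; the first sum is real because \<open>hmat\<close> is Hermitian.\<close>

definition fefferman_metric :: "('n::finite rvec \<Rightarrow> 'n rvec \<Rightarrow> 'n rvec) \<Rightarrow> 'n ph_data \<Rightarrow>
    'n rvec \<times> real \<Rightarrow> 'n rvec \<times> real \<Rightarrow> 'n rvec \<times> real \<Rightarrow> real"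
  where "fefferman_metric J P p \<xi> \<eta> =
    Re (\<Sum>\<alpha>\<in>UNIV. \<Sum>\<beta>\<in>UNIV. hmat J P (fst p) $ \<alpha> $ \<beta> *
      ((ev (coframe P \<alpha> (fst p)) (cv (fst \<xi>)) * ev (cobar P \<beta> (fst p)) (cv (fst \<eta>)) +
        ev (coframe P \<alpha> (fst p)) (cv (fst \<eta>)) * ev (cobar P \<beta> (fst p)) (cv (fst \<xi>))) / 2))
    + (theta P (fst p) \<bullet> fst \<xi>) * fefferman_sigma J P p \<eta>
    + (theta P (fst p) \<bullet> fst \<eta>) * fefferman_sigma J P p \<xi>"

text \<open>\<open>K = (n+2) \<partial>/\<partial>s\<close>.\<close>

definition fefferman_K :: "'n::finite rvec \<times> real"
  where "fefferman_K = (0, real CARD('n) + 2)"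

section \<open>Chains in coordinates\<close>

definition transversal_null_geodesic :: "'n::finite rvec set \<Rightarrow> ('n rvec \<Rightarrow> 'n rvec set) \<Rightarrow>
    ('n rvec \<Rightarrow> 'n rvec \<Rightarrow> 'n rvec) \<Rightarrow> 'n ph_data \<Rightarrow> real set \<Rightarrow>
    (real \<Rightarrow> 'n rvec \<times> 'n cform set) \<Rightarrow> bool"
  where "transversal_null_geodesic V H J P I \<Gamma> \<longleftrightarrow>
    (\<forall>t\<in>I. \<Gamma> t \<in> circle_bundle V H J) \<and>
    (\<exists>g g'. (\<forall>t\<in>I. \<Gamma> t = bundle_point P (g t)) \<and>
       null_geodesic (fefferman_metric J P) I g g' \<and>
       fefferman_metric J P (g 0) fefferman_K (g' 0) \<noteq> 0)"

definition open_interval :: "real set \<Rightarrow> bool"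
  where "open_interval I \<longleftrightarrow> open I \<and> connected I \<and> I \<noteq> {}"

text \<open>\<open>\<phi>\<close> is the change of parameter.\<close>

definition coordinate_chain :: "'n::finite rvec set \<Rightarrow> ('n rvec \<Rightarrow> 'n rvec set) \<Rightarrow>
    ('n rvec \<Rightarrow> 'n rvec \<Rightarrow> 'n rvec) \<Rightarrow> real set \<Rightarrow> (real \<Rightarrow> 'n rvec) \<Rightarrow> bool"
  where "coordinate_chain \<Omega> H J N y \<longleftrightarrow>
    (\<exists>V P I \<Gamma> \<phi>. open V \<and> V \<subseteq> \<Omega> \<and> pseudohermitian V H J P \<and>
       open_interval I \<and> 0 \<in> I \<and> transversal_null_geodesic V H J P I \<Gamma> \<and>
       smooth_on N \<phi> \<and> (\<forall>t\<in>N. deriv \<phi> t \<noteq> 0) \<and> \<phi> ` N = I \<and>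
       (\<forall>t\<in>N. y t = fst (\<Gamma> (\<phi> t))))"

section \<open>Manifolds\<close>

type_synonym ('m, 'n) chart = "'m set \<times> ('m \<Rightarrow> 'n rvec)"

definition chart_inv :: "('m, 'n::finite) chart \<Rightarrow> 'n rvec \<Rightarrow> 'm"
  where "chart_inv c = inv_into (fst c) (snd c)"

definition transition :: "('m, 'n::finite) chart \<Rightarrow> ('m, 'n) chart \<Rightarrow> 'n rvec \<Rightarrow> 'n rvec"
  where "transition c d = snd d \<circ> chart_inv c"

definition smooth_atlas :: "('m::topological_space, 'n::finite) chart set \<Rightarrow> bool"
  where "smooth_atlas A \<longleftrightarrow>
    (\<forall>c\<in>A. open (fst c) \<and> open (snd c ` fst c) \<and>
       homeomorphism (fst c) (snd c ` fst c) (snd c) (chart_inv c)) \<and>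
    (\<Union>c\<in>A. fst c) = UNIV \<and>
    (\<forall>c\<in>A. \<forall>d\<in>A. smooth_on (snd c ` (fst c \<inter> fst d)) (transition c d))"

text \<open>A tangent vector at \<open>p\<close> is the family of its components in all charts at \<open>p\<close>,
  transforming by the differentials of the coordinate changes; the components in other
  charts are \<open>0\<close> by convention. Its vector space structure is pointwise.\<close>

type_synonym ('m, 'n) tvec = "('m, 'n) chart \<Rightarrow> 'n rvec"

definition tvec_of :: "('m, 'n::finite) chart set \<Rightarrow> 'm \<Rightarrow> ('m, 'n) chart \<Rightarrow> 'n rvec \<Rightarrow> ('m, 'n) tvec"
  where "tvec_of A p c u = (\<lambda>d. if d \<in> A \<and> p \<in> fst d
    then frechet_derivative (transition c d) (at (snd c p)) u else 0)"

definition tangent_space :: "('m, 'n::finite) chart set \<Rightarrow> 'm \<Rightarrow> ('m, 'n) tvec set"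
  where "tangent_space A p = {v. \<forall>c\<in>A. p \<in> fst c \<longrightarrow> v = tvec_of A p c (v c)}"

text \<open>Coordinate expressions of a distribution and of an endomorphism field on it.\<close>

definition chart_H :: "('m, 'n::finite) chart set \<Rightarrow> ('m \<Rightarrow> ('m, 'n) tvec set) \<Rightarrow> ('m, 'n) chart \<Rightarrow>
    'n rvec \<Rightarrow> 'n rvec set"
  where "chart_H A H c x = {u. tvec_of A (chart_inv c x) c u \<in> H (chart_inv c x)}"

definition chart_J :: "('m, 'n::finite) chart set \<Rightarrow> ('m \<Rightarrow> ('m, 'n) tvec \<Rightarrow> ('m, 'n) tvec) \<Rightarrow>
    ('m, 'n) chart \<Rightarrow> 'n rvec \<Rightarrow> 'n rvec \<Rightarrow> 'n rvec"
  where "chart_J A J c x u = J (chart_inv c x) (tvec_of A (chart_inv c x) c u) c"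

definition cr_structure :: "('m, 'n::finite) chart set \<Rightarrow> ('m \<Rightarrow> ('m, 'n) tvec set) \<Rightarrow>
    ('m \<Rightarrow> ('m, 'n) tvec \<Rightarrow> ('m, 'n) tvec) \<Rightarrow> bool"
  where "cr_structure A H J \<longleftrightarrow>
    (\<forall>p. H p \<subseteq> tangent_space A p \<and> (\<forall>v\<in>H p. J p v \<in> H p)) \<and>
    (\<forall>c\<in>A. cr_structure_on (snd c ` fst c) (chart_H A H c) (chart_J A J c))"

definition nondegenerate_cr_structure :: "('m, 'n::finite) chart set \<Rightarrow> ('m \<Rightarrow> ('m, 'n) tvec set) \<Rightarrow>
    ('m \<Rightarrow> ('m, 'n) tvec \<Rightarrow> ('m, 'n) tvec) \<Rightarrow> bool"
  where "nondegenerate_cr_structure A H J \<longleftrightarrow> cr_structure A H J \<and>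
    (\<forall>c\<in>A. nondegenerate_on (snd c ` fst c) (chart_H A H c) (chart_J A J c))"

text \<open>A curve is a pair of an open parameter interval and a map.

  Contact forms and coframes exist only locally, so the metric is only available on pieces of
  the circle bundle, and a chain is a curve each of whose small pieces is a chain in
  coordinates. Pieces of lifts fit together: the null lift of a direction transversal to \<open>H\<close> is
  unique up to the (isometric) circle action, and changing \<open>\<theta>\<close> changes the metric conformally.\<close>

type_synonym 'm curve = "real set \<times> (real \<Rightarrow> 'm)"

definition is_chain :: "('m, 'n::finite) chart set \<Rightarrow> ('m \<Rightarrow> ('m, 'n) tvec set) \<Rightarrow>
    ('m \<Rightarrow> ('m, 'n) tvec \<Rightarrow> ('m, 'n) tvec) \<Rightarrow> 'm curve \<Rightarrow> bool"
  where "is_chain A H J = (\<lambda>(I, \<gamma>). open_interval I \<and>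
    (\<forall>t0\<in>I. \<exists>c\<in>A. \<exists>N. open_interval N \<and> t0 \<in> N \<and> N \<subseteq> I \<and> \<gamma> ` N \<subseteq> fst c \<and>
       coordinate_chain (snd c ` fst c) (chart_H A H c) (chart_J A J c) N (snd c \<circ> \<gamma>)))"

definition tangent_vectors :: "('m, 'n::finite) chart set \<Rightarrow> 'm curve set \<Rightarrow> 'm \<Rightarrow> ('m, 'n) tvec set"
  where "tangent_vectors A C p = {v \<in> tangent_space A p. \<exists>(I, \<gamma>)\<in>C. \<exists>t\<in>I. \<gamma> t = p \<and>
    (\<forall>c\<in>A. p \<in> fst c \<longrightarrow> ((snd c \<circ> \<gamma>) has_vector_derivative v c) (at t))}"

text \<open>The topology of the tangent space is the one transported from the model space by any chart.\<close>

definition sufficiently_big :: "('m, 'n::finite) chart set \<Rightarrow> 'm curve set \<Rightarrow> bool"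
  where "sufficiently_big A C \<longleftrightarrow> (\<forall>p. \<forall>c\<in>A. p \<in> fst c \<longrightarrow>
    (\<exists>U. open U \<and> U \<noteq> {} \<and> tvec_of A p c ` U \<subseteq> tangent_vectors A C p))"

end

theory Submission
  imports Defs
begin

text \<open>In coordinates a Fefferman metric has the form \<open>L(v, v) + 2 \<theta>(v) \<tau> / (n + 2)\<close>. Its null
  geodesics conserve \<open>\<theta>(v)\<close>, and eliminating the fibre component \<open>\<tau>\<close> leaves a
  reparametrisation-invariant second order equation for chains, the Euler-Lagrange equation of the
  Kropina function \<open>L(v, v) / \<theta>(v)\<close>. Replacing \<open>\<theta>\<close> by \<open>f \<theta>\<close> multiplies \<open>L\<close> by \<open>f\<close> up to a term
  \<open>\<theta> \<cdot> \<beta>\<close> with \<open>\<beta>\<close> closed, which does not affect this equation; so the acceleration of a chain at a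
  point depends only on its velocity \<open>v\<close> there, modulo \<open>v\<close>, and is \<open>p(v) / \<theta>(v)\<close> for a cubic
  polynomial map \<open>p\<close>. On \<open>H = ker \<theta>\<close> the value \<open>p(v)\<close> is a multiple of \<open>L(v, v) J v\<close>.

  If two structures share the chains in an open set of directions, the polynomial map
  \<open>\<theta>' p - \<theta> p'\<close> is everywhere parallel to the identity. At \<open>v \<in> H - H'\<close> this forces \<open>L(v, v) = 0\<close>,
  contradicting non-degeneracy, so \<open>H = H'\<close>; then \<open>L(v, v)\<^sup>2 = L'(v, v)\<^sup>2\<close> on \<open>H\<close> for matching
  contact forms, so \<open>L = \<plusminus> L'\<close> there and \<open>J = \<plusminus> J'\<close>. The sign is locally constant.\<close>

section \<open>Differentiable functions on open sets\<close>

text \<open>The Kropina function shows why the choice of \<theta> is harmless: if \<theta>' = f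
  \<theta> and L' = f (L + \<theta> \<beta>), then L' / \<theta>' = L / \<theta> + \<beta>, and a
  closed 1-form is a null Lagrangian. The delicate point is closedness. Here \<beta> is a constant
  multiple of d arg det U, with U the change of (1,0)-frame; it has this shape only because the
  changes of the Hermitian part, of the connection trace and of the scalar curvature cancel, and the
  factor 1/(2(n+1)) of R in the metric is made for that.

  All information is taken from the 2-jets of common chains at one point. Pieces of chains come with
  their own charts, coframes and parameters, so invariance of the chain equation under each of these
  changes is proved before jets are compared.

  No chain is tangent to H. The behaviour on H is reached by extrapolation: multiplication by
  \<theta>(v) makes the acceleration polynomial in v, and a polynomial identity spreads from an open
  set of directions to all vectors. This is where the family of chains has to be sufficiently
  big.\<close>

lemma Ck_on_cong:
  assumes "open S" "\<And>x. x \<in> S \<Longrightarrow> f x = g x"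
  shows "Ck_on k S f = Ck_on k S g"
  using assms(2)
proof (induction k arbitrary: f g)
  case 0
  then show ?case by (simp cong: continuous_on_cong)
next
  case (Suc k)
  have ev: "eventually (\<lambda>y. f y = g y) (at x)" if "x \<in> S" for x
    using assms(1) Suc.prems that by (auto simp: eventually_at_topological)
  have D: "(f has_derivative D) (at x) = (g has_derivative D) (at x)" if "x \<in> S" for x D
    using has_derivative_transform_within_open[OF _ assms(1) that, of f D UNIV g]
      has_derivative_transform_within_open[OF _ assms(1) that, of g D UNIV f] Suc.prems by auto
  have 1: "(\<forall>x\<in>S. f differentiable at x) = (\<forall>x\<in>S. g differentiable at x)"
    using D by (auto simp: differentiable_def)
  have 2: "frechet_derivative f (at x) v = frechet_derivative g (at x) v" if "x \<in> S" for x v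
    unfolding frechet_derivative_def using D[OF that] by simp
  have 3: "Ck_on k S (\<lambda>x. frechet_derivative f (at x) v) = Ck_on k S (\<lambda>x. frechet_derivative g (at x) v)" for v
    by (rule Suc.IH) (use 2 in auto)
  show ?case using 1 3 by simp
qed

lemma frechet_eqI: "(f has_derivative D) (at x) \<Longrightarrow> frechet_derivative f (at x) v = D v"
  using frechet_derivative_at[of f D x] by simp

lemma frechet_derivative_cong_open:
  assumes "open S" "x \<in> S" "\<And>y. y \<in> S \<Longrightarrow> f y = g y"
  shows "frechet_derivative f (at x) = frechet_derivative g (at x)"
proof -
  have "(f has_derivative D) (at x) = (g has_derivative D) (at x)" for D
    using has_derivative_transform_within_open[OF _ assms(1,2), of f D UNIV g]
      has_derivative_transform_within_open[OF _ assms(1,2), of g D UNIV f] assms(3) by auto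
  then show ?thesis unfolding frechet_derivative_def by simp
qed

lemma Ck_on_subset: "Ck_on k S f \<Longrightarrow> T \<subseteq> S \<Longrightarrow> Ck_on k T f"
  by (induction k arbitrary: f) (auto intro: continuous_on_subset)

lemma Ck_on_SucD: "Ck_on (Suc k) S f \<Longrightarrow> Ck_on k S f"
proof (induction k arbitrary: f)
  case 0
  then show ?case
    by (auto intro!: continuous_at_imp_continuous_on differentiable_imp_continuous_within)
qed auto

lemma Ck_on_const: "Ck_on k S (\<lambda>x. c)"
  by (induction k arbitrary: c) auto

lemma Ck_on_SucI:
  assumes "open S" "\<And>x. x \<in> S \<Longrightarrow> (f has_derivative D x) (at x)" "\<And>v. Ck_on k S (\<lambda>x. D x v)"
  shows "Ck_on (Suc k) S f"
proof -
  have "Ck_on k S (\<lambda>x. frechet_derivative f (at x) v)" for v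
    by (rule Ck_on_cong[THEN iffD2, OF assms(1) _ assms(3)[of v]]) (rule frechet_eqI[OF assms(2)])
  moreover have "f differentiable at x" if "x \<in> S" for x
    using assms(2)[OF that] differentiable_def by blast
  ultimately show ?thesis by simp
qed

lemma Ck_on_bounded_linear:
  assumes "bounded_linear L" shows "open S \<Longrightarrow> Ck_on k S f \<Longrightarrow> Ck_on k S (\<lambda>x. L (f x))"
proof (induction k arbitrary: f)
  case 0
  then show ?case using assms by (simp add: bounded_linear.continuous_on)
next
  case (Suc k)
  have d: "((\<lambda>x. L (f x)) has_derivative (\<lambda>v. L (frechet_derivative f (at x) v))) (at x)" if "x \<in> S" for x
    using that Suc.prems bounded_linear.has_derivative[OF assms] by (auto simp: frechet_derivative_works)
  show ?case
    by (rule Ck_on_SucI[OF Suc.prems(1) d]) (use Suc.prems in \<open>auto intro: Suc.IH\<close>)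
qed

lemma Ck_on_add: "open S \<Longrightarrow> Ck_on k S f \<Longrightarrow> Ck_on k S g \<Longrightarrow> Ck_on k S (\<lambda>x. f x + g x)"
proof (induction k arbitrary: f g)
  case 0
  then show ?case by (simp add: continuous_on_add)
next
  case (Suc k)
  have d: "((\<lambda>x. f x + g x) has_derivative (\<lambda>v. frechet_derivative f (at x) v + frechet_derivative g (at x) v)) (at x)"
    if "x \<in> S" for x
    using that Suc.prems by (auto simp: frechet_derivative_works intro!: has_derivative_add)
  show ?case
    by (rule Ck_on_SucI[OF Suc.prems(1) d]) (use Suc.prems in \<open>auto intro: Suc.IH\<close>)
qed

lemma Ck_on_bilinear:
  assumes "bounded_bilinear B"
  shows "open S \<Longrightarrow> Ck_on k S f \<Longrightarrow> Ck_on k S g \<Longrightarrow> Ck_on k S (\<lambda>x. B (f x) (g x))"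
proof (induction k arbitrary: f g)
  case 0
  then show ?case using assms by (simp add: bounded_bilinear.continuous_on)
next
  case (Suc k)
  have d: "((\<lambda>x. B (f x) (g x)) has_derivative
      (\<lambda>v. B (f x) (frechet_derivative g (at x) v) + B (frechet_derivative f (at x) v) (g x))) (at x)"
    if "x \<in> S" for x
    using that Suc.prems by (auto simp: frechet_derivative_works intro!: bounded_bilinear.FDERIV[OF assms])
  have "Ck_on k S f" "Ck_on k S g" using Suc.prems Ck_on_SucD by blast+
  then have "Ck_on k S (\<lambda>x. B (f x) (frechet_derivative g (at x) v) + B (frechet_derivative f (at x) v) (g x))" for v
    using Suc.prems by (intro Ck_on_add Suc.IH) auto
  then show ?case
    using Ck_on_SucI[OF Suc.prems(1) d] by blast
qed

lemma Ck_on_sum: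
  assumes "open S" shows "(\<And>i. i \<in> I \<Longrightarrow> Ck_on k S (f i)) \<Longrightarrow> Ck_on k S (\<lambda>x. \<Sum>i\<in>I. f i x)"
  by (induction I rule: infinite_finite_induct) (auto intro!: Ck_on_add Ck_on_const assms)

lemma Ck_on_compose:
  fixes f :: "'a::real_normed_vector \<Rightarrow> 'b::euclidean_space" and g :: "'b \<Rightarrow> 'c::real_normed_vector"
  shows "open S \<Longrightarrow> Ck_on k S f \<Longrightarrow> Ck_on k T g \<Longrightarrow> f ` S \<subseteq> T \<Longrightarrow> Ck_on k S (\<lambda>x. g (f x))"
proof (induction k arbitrary: g)
  case 0
  then show ?case by (auto intro: continuous_on_compose2)
next
  case (Suc k)
  let ?D = "\<lambda>x. \<lambda>v. frechet_derivative g (at (f x)) (frechet_derivative f (at x) v)"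
  have d: "((\<lambda>x. g (f x)) has_derivative ?D x) (at x)" if "x \<in> S" for x
    by (rule has_derivative_compose[where f=f and g=g])
      (use that Suc.prems in \<open>auto simp: frechet_derivative_works\<close>)
  have lin: "linear (frechet_derivative g (at (f x)))" if "x \<in> S" for x
    using that Suc.prems by (intro linear_frechet_derivative) auto
  \<comment> \<open>\<open>Ck_on\<close> differentiates in fixed directions only, whereas the chain
    rule puts a moving direction into the derivative of g. Expanding it over a basis separates the
    two dependences on x.\<close>
  have eq: "?D x v = (\<Sum>b\<in>Basis. (frechet_derivative f (at x) v \<bullet> b) *\<^sub>R frechet_derivative g (at (f x)) b)"
    if "x \<in> S" for x v
    by (subst (1) euclidean_representation[of "frechet_derivative f (at x) v", symmetric])
      (simp add: linear_sum[OF lin[OF that]] linear_scale[OF lin[OF that]])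
  have f: "Ck_on k S f" using Suc.prems Ck_on_SucD by blast
  have "Ck_on k S (\<lambda>x. \<Sum>b\<in>Basis. (frechet_derivative f (at x) v \<bullet> b) *\<^sub>R frechet_derivative g (at (f x)) b)" for v
    using Suc.prems f
    by (intro Ck_on_sum Ck_on_bilinear[OF bounded_bilinear_scaleR] Ck_on_bounded_linear[OF bounded_linear_inner_left]
        Suc.IH) auto
  then have "Ck_on k S (\<lambda>x. ?D x v)" for v
    by (rule Ck_on_cong[THEN iffD2, OF Suc.prems(1), rotated]) (use eq in auto)
  then show ?case
    using Ck_on_SucI[OF Suc.prems(1) d] by blast
qed

lemma smooth_onD: "smooth_on S f \<Longrightarrow> Ck_on k S f"
  by (simp add: smooth_on_def)

lemma smooth_on_cong: "open S \<Longrightarrow> (\<And>x. x \<in> S \<Longrightarrow> f x = g x) \<Longrightarrow> smooth_on S f = smooth_on S g"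
  using Ck_on_cong[of S f g] by (simp add: smooth_on_def)

lemma smooth_on_subset: "smooth_on S f \<Longrightarrow> T \<subseteq> S \<Longrightarrow> smooth_on T f"
  using Ck_on_subset[of _ S f T] by (simp add: smooth_on_def)

lemma smooth_on_const: "smooth_on S (\<lambda>x. c)"
  by (simp add: smooth_on_def Ck_on_const)

lemma smooth_on_bounded_linear:
  "bounded_linear L \<Longrightarrow> open S \<Longrightarrow> smooth_on S f \<Longrightarrow> smooth_on S (\<lambda>x. L (f x))"
  using Ck_on_bounded_linear[of L S _ f] by (simp add: smooth_on_def)

lemma smooth_on_bilinear:
  "bounded_bilinear B \<Longrightarrow> open S \<Longrightarrow> smooth_on S f \<Longrightarrow> smooth_on S g \<Longrightarrow> smooth_on S (\<lambda>x. B (f x) (g x))"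
  using Ck_on_bilinear[of B S _ f g] by (simp add: smooth_on_def)

lemma smooth_on_add: "open S \<Longrightarrow> smooth_on S f \<Longrightarrow> smooth_on S g \<Longrightarrow> smooth_on S (\<lambda>x. f x + g x)"
  using Ck_on_add[of S _ f g] by (simp add: smooth_on_def)

lemma smooth_on_sum:
  "open S \<Longrightarrow> (\<And>i. i \<in> I \<Longrightarrow> smooth_on S (f i)) \<Longrightarrow> smooth_on S (\<lambda>x. \<Sum>i\<in>I. f i x)"
  using Ck_on_sum[of S I _ f] by (simp add: smooth_on_def)

lemma smooth_on_mult:
  fixes f g :: "'a::real_normed_vector \<Rightarrow> 'b::real_normed_algebra"
  shows "open S \<Longrightarrow> smooth_on S f \<Longrightarrow> smooth_on S g \<Longrightarrow> smooth_on S (\<lambda>x. f x * g x)"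
  using smooth_on_bilinear[OF bounded_bilinear_mult] .

lemma smooth_on_compose:
  fixes f :: "'a::real_normed_vector \<Rightarrow> 'b::euclidean_space" and g :: "'b \<Rightarrow> 'c::real_normed_vector"
  shows "open S \<Longrightarrow> smooth_on S f \<Longrightarrow> smooth_on T g \<Longrightarrow> f ` S \<subseteq> T \<Longrightarrow> smooth_on S (\<lambda>x. g (f x))"
  using Ck_on_compose[of S _ f T g] by (simp add: smooth_on_def)

lemma smooth_on_frechet: "smooth_on S f \<Longrightarrow> smooth_on S (\<lambda>x. frechet_derivative f (at x) v)"
  unfolding smooth_on_def
proof
  fix k assume "\<forall>k. Ck_on k S f"
  then have "Ck_on (Suc k) S f" ..
  then show "Ck_on k S (\<lambda>x. frechet_derivative f (at x) v)" by simp
qed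

lemma smooth_on_pd: "smooth_on S f \<Longrightarrow> smooth_on S (pd i f)"
  using smooth_on_frechet[of S f "axis i 1"] by (simp add: pd_def[abs_def])

lemma smooth_on_differentiable: "smooth_on S f \<Longrightarrow> x \<in> S \<Longrightarrow> f differentiable (at x)"
  using smooth_onD[of S f "Suc 0"] by simp

lemma smooth_on_continuous: "smooth_on S f \<Longrightarrow> continuous_on S f"
  using smooth_onD[of S f 0] by simp

lemma smooth_on_nth: "open S \<Longrightarrow> smooth_on S f \<Longrightarrow> smooth_on S (\<lambda>x. f x $ i)"
  for f :: "'a::real_normed_vector \<Rightarrow> 'b::real_normed_vector ^ 'i::finite"
  by (rule smooth_on_bounded_linear[OF bounded_linear_vec_nth])

lemma bounded_linear_axis: "bounded_linear (axis i :: 'b::real_normed_vector \<Rightarrow> 'b ^ 'i::finite)"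
proof (rule bounded_linear_intro[where K=1])
  fix x :: 'b
  have "norm (axis i x :: 'b ^ 'i) \<le> (\<Sum>j\<in>UNIV. norm ((axis i x :: 'b ^ 'i) $ j))"
    unfolding norm_vec_def by (rule L2_set_le_sum) simp
  also have "\<dots> = norm x" by (simp add: axis_def if_distrib cong: if_cong)
  finally show "norm (axis i x :: 'b ^ 'i) \<le> norm x * 1" by simp
qed (auto simp: axis_def vec_eq_iff)

lemma sum_axis_nth: "(\<Sum>i\<in>UNIV. axis i (v $ i)) = (v :: 'b::real_normed_vector ^ 'i::finite)"
  by (simp add: vec_eq_iff axis_def if_distrib sum.delta' cong: if_cong)

lemma smooth_on_vec:
  fixes f :: "'a::real_normed_vector \<Rightarrow> 'b::real_normed_vector ^ 'i::finite"
  assumes "open S" "\<And>i. smooth_on S (\<lambda>x. f x $ i)" shows "smooth_on S f"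
proof -
  have "smooth_on S (\<lambda>x. \<Sum>i\<in>UNIV. axis i (f x $ i))"
    by (intro smooth_on_sum assms smooth_on_bounded_linear[OF bounded_linear_axis])
  then show ?thesis by (simp add: sum_axis_nth)
qed

text \<open>The second difference of f over the parallelogram spanned by h u and h v is h^2 times
  either mixed derivative at some interior point, by the mean value theorem in one direction and
  then in the other. Continuity of the mixed derivatives lets h tend to 0.\<close>

lemma second_derivative_real:
  fixes f :: "'a::real_normed_vector \<Rightarrow> real"
  assumes S: "open S" "x \<in> S" and f: "Ck_on 2 S f"
  shows "frechet_derivative (\<lambda>y. frechet_derivative f (at y) u) (at x) v =
         frechet_derivative (\<lambda>y. frechet_derivative f (at y) v) (at x) u"
proof -
  let ?D = "\<lambda>f y v. frechet_derivative f (at y) v"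
  let ?F = "\<lambda>u v y. ?D (\<lambda>y. ?D f y u) y v"
  have f1: "\<And>y. y \<in> S \<Longrightarrow> (f has_derivative ?D f y) (at y)"
    and f2: "\<And>y u. y \<in> S \<Longrightarrow> ((\<lambda>y. ?D f y u) has_derivative ?D (\<lambda>y. ?D f y u) y) (at y)"
    and fc: "\<And>u v. continuous_on S (?F u v)"
    using f by (auto simp: numeral_2_eq_2 frechet_derivative_works)
  obtain r where r: "r > 0" "ball x r \<subseteq> S" using S openE by blast
  \<comment> \<open>The summand 1 keeps \<open>M\<close> positive when u = v = 0 and makes the bound
    on the norms strict. As \<open>M\<close> is symmetric in u and v, it serves both orders of
    differentiation.\<close>
  define M where "M = norm u + norm v + 1"
  have M: "M > 0" by (simp add: M_def add_nonneg_pos)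
  have dir: "((\<lambda>s. g (p + s *\<^sub>R w)) has_real_derivative ?D g (p + s *\<^sub>R w) w) (at s)"
    if "(g has_derivative ?D g (p + s *\<^sub>R w)) (at (p + s *\<^sub>R w))" for g :: "'a \<Rightarrow> real" and p w s
  proof -
    have "((\<lambda>s. g (p + s *\<^sub>R w)) has_derivative (\<lambda>h. ?D g (p + s *\<^sub>R w) (h *\<^sub>R w))) (at s)"
      by (rule has_derivative_compose[where f="\<lambda>s. p + s *\<^sub>R w", OF _ that]) (auto intro!: derivative_eq_intros)
    moreover have "?D g (p + s *\<^sub>R w) (h *\<^sub>R w) = h * ?D g (p + s *\<^sub>R w) w" for h
      using has_derivative_bounded_linear[OF that] by (simp add: bounded_linear.linear linear_scale)
    ultimately show ?thesis by (simp add: has_field_derivative_def mult_commute_abs)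
  qed
  have key: "\<exists>a b. 0 < a \<and> a < h \<and> 0 < b \<and> b < h \<and>
      f (x + h *\<^sub>R u + h *\<^sub>R v) - f (x + h *\<^sub>R u) - f (x + h *\<^sub>R v) + f x = h * h * ?F u v (x + a *\<^sub>R u + b *\<^sub>R v)"
    if h: "0 < h" "h * M < r" and uv: "norm u + norm v < M" for h u v
  proof -
    have inS: "x + a *\<^sub>R u + b *\<^sub>R v \<in> S" if "0 \<le> a" "a \<le> h" "0 \<le> b" "b \<le> h" for a b
    proof -
      have "norm (a *\<^sub>R u + b *\<^sub>R v) \<le> a * norm u + b * norm v"
        using that norm_triangle_ineq[of "a *\<^sub>R u" "b *\<^sub>R v"] by simp
      also have "\<dots> \<le> h * norm u + h * norm v" using that by (intro add_mono mult_right_mono) auto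
      also have "\<dots> = h * (norm u + norm v)" by (simp add: algebra_simps)
      also have "\<dots> \<le> h * M" using h uv by (intro mult_left_mono) auto
      finally have le: "norm (a *\<^sub>R u + b *\<^sub>R v) < r" using h by simp
      have "x - (x + a *\<^sub>R u + b *\<^sub>R v) = - (a *\<^sub>R u + b *\<^sub>R v)" by simp
      then have "norm (x - (x + a *\<^sub>R u + b *\<^sub>R v)) = norm (a *\<^sub>R u + b *\<^sub>R v)"
        by (simp only: norm_minus_cancel)
      with le have "x + a *\<^sub>R u + b *\<^sub>R v \<in> ball x r" by (simp only: mem_ball dist_norm)
      then show ?thesis using r(2) by blast
    qed
    have "\<exists>a>0. a < h \<and> (f (x + h *\<^sub>R v + h *\<^sub>R u) - f (x + h *\<^sub>R u)) - (f (x + h *\<^sub>R v + 0 *\<^sub>R u) - f (x + 0 *\<^sub>R u))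
        = (h - 0) * (?D f (x + h *\<^sub>R v + a *\<^sub>R u) u - ?D f (x + a *\<^sub>R u) u)"
      using h inS[of _ h] inS[of _ 0]
      by (intro MVT2[where f="\<lambda>s. f (x + h *\<^sub>R v + s *\<^sub>R u) - f (x + s *\<^sub>R u)"] DERIV_diff dir f1)
        (auto simp: add_ac)
    then obtain a where a: "0 < a" "a < h" "(f (x + h *\<^sub>R v + h *\<^sub>R u) - f (x + h *\<^sub>R u)) - (f (x + h *\<^sub>R v) - f x)
        = h * (?D f (x + h *\<^sub>R v + a *\<^sub>R u) u - ?D f (x + a *\<^sub>R u) u)" by auto
    have "\<exists>b>0. b < h \<and> ?D f (x + a *\<^sub>R u + h *\<^sub>R v) u - ?D f (x + a *\<^sub>R u + 0 *\<^sub>R v) u = (h - 0) * ?F u v (x + a *\<^sub>R u + b *\<^sub>R v)"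
      using h inS[of a] a
      by (intro MVT2[where f="\<lambda>s. ?D f (x + a *\<^sub>R u + s *\<^sub>R v) u"] dir f2) auto
    then obtain b where b: "0 < b" "b < h" "?D f (x + a *\<^sub>R u + h *\<^sub>R v) u - ?D f (x + a *\<^sub>R u) u = h * ?F u v (x + a *\<^sub>R u + b *\<^sub>R v)"
      by auto
    show ?thesis using a b by (intro exI[of _ a] exI[of _ b]) (simp add: add_ac)
  qed
  have lim: "\<exists>d>0. \<forall>a b. 0 < a \<and> a < d \<and> 0 < b \<and> b < d \<longrightarrow> \<bar>?F u v (x + a *\<^sub>R u + b *\<^sub>R v) - ?F u v x\<bar> < e"
    if e: "e > 0" and uv: "norm u + norm v < M" for e u v
  proof -
    have "isCont (?F u v) x" using fc[of u v] S by (simp add: continuous_on_eq_continuous_at)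
    then obtain d where d: "d > 0" "\<And>y. dist y x < d \<Longrightarrow> \<bar>?F u v y - ?F u v x\<bar> < e"
      using e unfolding continuous_at_eps_delta dist_real_def by blast
    have "dist (x + a *\<^sub>R u + b *\<^sub>R v) x < d" if "0 < a" "a < d / M" "0 < b" "b < d / M" for a b
    proof -
      have "norm (a *\<^sub>R u + b *\<^sub>R v) \<le> a * norm u + b * norm v"
        using that norm_triangle_ineq[of "a *\<^sub>R u" "b *\<^sub>R v"] by simp
      also have "\<dots> \<le> d / M * norm u + d / M * norm v" using that by (intro add_mono mult_right_mono) auto
      also have "\<dots> = d / M * (norm u + norm v)" by (simp add: algebra_simps)
      also have "\<dots> < d / M * M" using d M uv by (intro mult_strict_left_mono) auto
      finally have le: "norm (a *\<^sub>R u + b *\<^sub>R v) < d" using M by simp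
      have "x + a *\<^sub>R u + b *\<^sub>R v - x = a *\<^sub>R u + b *\<^sub>R v" by simp
      with le show ?thesis by (simp only: dist_norm)
    qed
    then show ?thesis using d M by (intro exI[of _ "d / M"]) auto
  qed
  have uv: "norm u + norm v < M" "norm v + norm u < M" by (auto simp: M_def)
  have "\<bar>?F u v x - ?F v u x\<bar> < e" if "e > 0" for e
  proof -
    obtain d1 where d1: "d1 > 0" "\<And>a b. 0 < a \<and> a < d1 \<and> 0 < b \<and> b < d1 \<longrightarrow> \<bar>?F u v (x + a *\<^sub>R u + b *\<^sub>R v) - ?F u v x\<bar> < e / 2"
      using lim[OF _ uv(1), of "e/2"] \<open>e > 0\<close> by auto
    obtain d2 where d2: "d2 > 0" "\<And>a b. 0 < a \<and> a < d2 \<and> 0 < b \<and> b < d2 \<longrightarrow> \<bar>?F v u (x + a *\<^sub>R v + b *\<^sub>R u) - ?F v u x\<bar> < e / 2"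
      using lim[OF _ uv(2), of "e/2"] \<open>e > 0\<close> by auto
    define m where "m = min (min d1 d2) (r / M)"
    have m: "0 < m" "m \<le> d1" "m \<le> d2" "m \<le> r / M" using d1 d2 r M by (auto simp: m_def)
    define h where "h = m / 2"
    have hm: "h > 0" "h < m" using m(1) by (simp_all add: h_def)
    have h: "h > 0" "h < d1" "h < d2" "h < r / M"
      using hm m(2-4) by (blast intro: less_le_trans)+
    have hM: "h * M < r" using h(4) M by (simp add: pos_less_divide_eq)
    obtain a b where ab: "0 < a" "a < h" "0 < b" "b < h"
      "f (x + h *\<^sub>R u + h *\<^sub>R v) - f (x + h *\<^sub>R u) - f (x + h *\<^sub>R v) + f x = h * h * ?F u v (x + a *\<^sub>R u + b *\<^sub>R v)"
      using key[OF h(1) hM uv(1)] by blast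
    obtain a' b' where ab': "0 < a'" "a' < h" "0 < b'" "b' < h"
      "f (x + h *\<^sub>R v + h *\<^sub>R u) - f (x + h *\<^sub>R v) - f (x + h *\<^sub>R u) + f x = h * h * ?F v u (x + a' *\<^sub>R v + b' *\<^sub>R u)"
      using key[OF h(1) hM uv(2)] by blast
    have sw: "x + h *\<^sub>R v + h *\<^sub>R u = x + h *\<^sub>R u + h *\<^sub>R v" by (simp add: add_ac)
    have "h * h * ?F u v (x + a *\<^sub>R u + b *\<^sub>R v) = h * h * ?F v u (x + a' *\<^sub>R v + b' *\<^sub>R u)"
      using ab(5) ab'(5)[unfolded sw] by linarith
    then have "?F u v (x + a *\<^sub>R u + b *\<^sub>R v) = ?F v u (x + a' *\<^sub>R v + b' *\<^sub>R u)" using h by simp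
    moreover have "\<bar>?F u v (x + a *\<^sub>R u + b *\<^sub>R v) - ?F u v x\<bar> < e / 2" using d1 ab h by auto
    moreover have "\<bar>?F v u (x + a' *\<^sub>R v + b' *\<^sub>R u) - ?F v u x\<bar> < e / 2" using d2 ab' h by auto
    ultimately show ?thesis by linarith
  qed
  from this[of "\<bar>?F u v x - ?F v u x\<bar>"] show ?thesis by (cases "?F u v x = ?F v u x") auto
qed

text \<open>The mean value argument is scalar, so it is applied to the components of f.\<close>

lemma second_derivative_symmetric:
  fixes f :: "'a::real_normed_vector \<Rightarrow> 'b::euclidean_space"
  assumes S: "open S" "x \<in> S" and f: "smooth_on S f"
  shows "frechet_derivative (\<lambda>y. frechet_derivative f (at y) u) (at x) v =
         frechet_derivative (\<lambda>y. frechet_derivative f (at y) v) (at x) u"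
proof (rule euclidean_eqI)
  fix b :: 'b
  have comm: "frechet_derivative (\<lambda>y. g y \<bullet> b) (at y) w = frechet_derivative g (at y) w \<bullet> b"
    if "smooth_on S g" "y \<in> S" for g :: "'a \<Rightarrow> 'b" and y w
    using smooth_on_differentiable[OF that]
    by (intro frechet_eqI has_derivative_inner_left) (auto simp: frechet_derivative_works)
  have sm: "smooth_on S (\<lambda>y. f y \<bullet> b)"
    by (rule smooth_on_bounded_linear[OF bounded_linear_inner_left S(1) f])
  have 2: "frechet_derivative (\<lambda>y. frechet_derivative (\<lambda>y. f y \<bullet> b) (at y) u) (at x) v =
      frechet_derivative (\<lambda>y. frechet_derivative f (at y) u) (at x) v \<bullet> b" for u v
    using S f
    by (subst frechet_derivative_cong_open[OF S, where g="\<lambda>y. frechet_derivative f (at y) u \<bullet> b"])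
      (auto simp: comm smooth_on_frechet)
  show "frechet_derivative (\<lambda>y. frechet_derivative f (at y) u) (at x) v \<bullet> b =
     frechet_derivative (\<lambda>y. frechet_derivative f (at y) v) (at x) u \<bullet> b"
    using second_derivative_real[OF S smooth_onD[OF sm], of u v] by (simp add: 2)
qed

section \<open>Partial derivatives of vector-valued functions\<close>

lemma frechet_pd:
  fixes f :: "real ^ 'i::finite \<Rightarrow> 'b::real_normed_vector"
  assumes "f differentiable (at x)"
  shows "frechet_derivative f (at x) v = (\<Sum>i\<in>UNIV. v $ i *\<^sub>R pd i f x)"
proof -
  have lin: "linear (frechet_derivative f (at x))" by (rule linear_frechet_derivative[OF assms])
  have "v = (\<Sum>i\<in>UNIV. v $ i *\<^sub>R axis i 1)"
    by (simp add: vec_eq_iff axis_def if_distrib sum.delta' cong: if_cong)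
  then have "frechet_derivative f (at x) v = frechet_derivative f (at x) (\<Sum>i\<in>UNIV. v $ i *\<^sub>R axis i 1)"
    by simp
  also have "\<dots> = (\<Sum>i\<in>UNIV. v $ i *\<^sub>R pd i f x)"
    by (simp add: linear_sum[OF lin] linear_scale[OF lin] pd_def)
  finally show ?thesis .
qed

lemma pd_eqI: "(f has_derivative D) (at x) \<Longrightarrow> pd i f x = D (axis i 1)"
  by (simp add: pd_def frechet_eqI)

lemma pd_cong: "open S \<Longrightarrow> x \<in> S \<Longrightarrow> (\<And>y. y \<in> S \<Longrightarrow> f y = g y) \<Longrightarrow> pd i f x = pd i g x"
  unfolding pd_def using frechet_derivative_cong_open[of S x f g] by simp

lemma pd_const [simp]: "pd i (\<lambda>y. c) x = 0"
  by (simp add: pd_def)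

lemma pd_add:
  "f differentiable (at x) \<Longrightarrow> g differentiable (at x) \<Longrightarrow> pd i (\<lambda>y. f y + g y) x = pd i f x + pd i g x"
  unfolding pd_def by (intro frechet_eqI has_derivative_add) (simp_all add: frechet_derivative_works)

lemma pd_linear:
  "bounded_linear L \<Longrightarrow> f differentiable (at x) \<Longrightarrow> pd i (\<lambda>y. L (f y)) x = L (pd i f x)"
  unfolding pd_def
  by (intro frechet_eqI bounded_linear.has_derivative[of L f]) (simp_all add: frechet_derivative_works)

lemma pd_bilinear:
  "bounded_bilinear B \<Longrightarrow> f differentiable (at x) \<Longrightarrow> g differentiable (at x) \<Longrightarrow>
    pd i (\<lambda>y. B (f y) (g y)) x = B (f x) (pd i g x) + B (pd i f x) (g x)"
  unfolding pd_def by (intro frechet_eqI bounded_bilinear.FDERIV[of B f]) (simp_all add: frechet_derivative_works)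

lemma pd_mult:
  fixes f g :: "real ^ 'i::finite \<Rightarrow> 'b::real_normed_algebra"
  shows "f differentiable (at x) \<Longrightarrow> g differentiable (at x) \<Longrightarrow>
    pd i (\<lambda>y. f y * g y) x = f x * pd i g x + pd i f x * g x"
  by (rule pd_bilinear[OF bounded_bilinear_mult])

lemma pd_sum:
  assumes "\<And>j. j \<in> I \<Longrightarrow> f j differentiable (at x)"
  shows "pd i (\<lambda>y. \<Sum>j\<in>I. f j y) x = (\<Sum>j\<in>I. pd i (f j) x)"
  unfolding pd_def
  by (rule frechet_eqI[where D="\<lambda>v. \<Sum>j\<in>I. frechet_derivative (f j) (at x) v"], rule has_derivative_sum)
    (use assms in \<open>simp add: frechet_derivative_works\<close>)

lemma pd_cnj: "f differentiable (at x) \<Longrightarrow> pd i (\<lambda>y. cnj (f y)) x = cnj (pd i f x)"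
  by (rule pd_linear[OF bounded_linear_cnj])

lemma pd_of_real: "f differentiable (at x) \<Longrightarrow> pd i (\<lambda>y. complex_of_real (f y)) x = complex_of_real (pd i f x)"
  by (rule pd_linear[OF bounded_linear_of_real])

lemma differentiable_linear:
  "bounded_linear L \<Longrightarrow> f differentiable (at x) \<Longrightarrow> (\<lambda>y. L (f y)) differentiable (at x)"
  unfolding frechet_derivative_works[of f] by (rule differentiableI) (rule bounded_linear.has_derivative[of L f])

lemma differentiable_nth:
  fixes f :: "'a::real_normed_vector \<Rightarrow> 'b::real_normed_vector ^ 'j::finite"
  shows "f differentiable (at x) \<Longrightarrow> (\<lambda>y. f y $ k) differentiable (at x)"
  by (rule differentiable_linear[OF bounded_linear_vec_nth])

lemma differentiable_cong:
  assumes "open S" "x \<in> S" "\<And>y. y \<in> S \<Longrightarrow> f y = g y" "g differentiable (at x)"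
  shows "f differentiable (at x)"
proof -
  obtain D where "(g has_derivative D) (at x)" using assms(4) differentiable_def by blast
  then have "(f has_derivative D) (at x)"
    by (rule has_derivative_transform_within_open[OF _ assms(1,2)]) (simp add: assms(3))
  then show ?thesis by (rule differentiableI)
qed

lemma differentiable_vec:
  fixes f :: "'a::real_normed_vector \<Rightarrow> 'b::real_normed_vector ^ 'j::finite"
  assumes "\<And>k. (\<lambda>y. f y $ k) differentiable (at x)"
  shows "f differentiable (at x)"
proof -
  have "(\<lambda>y. \<Sum>k\<in>UNIV. axis k (f y $ k)) differentiable (at x)"
    by (intro differentiable_sum ballI finite differentiable_linear[OF bounded_linear_axis] assms)
  then show ?thesis by (simp add: sum_axis_nth)
qed

lemma differentiable_of_real: "f differentiable (at x) \<Longrightarrow> (\<lambda>y. complex_of_real (f y)) differentiable (at x)"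
  by (rule differentiable_linear[OF bounded_linear_of_real])

lemma differentiable_cnj: "f differentiable (at x) \<Longrightarrow> (\<lambda>y. cnj (f y)) differentiable (at x)"
  by (rule differentiable_linear[OF bounded_linear_cnj])

section \<open>Pointwise algebra of complex covectors\<close>

lemma cv_nth [simp]: "cv v $ i = complex_of_real (v $ i)" by (simp add: cv_def)
lemma cnjv_nth [simp]: "cnjv Z $ i = cnj (Z $ i)" by (simp add: cnjv_def)
lemma Rev_nth [simp]: "Rev Z $ i = Re (Z $ i)" by (simp add: Rev_def)
lemma Imv_nth [simp]: "Imv Z $ i = Im (Z $ i)" by (simp add: Imv_def)

lemma cv_add: "cv (u + v) = cv u + cv v" by (simp add: vec_eq_iff)
lemma cv_scaleR: "cv (r *\<^sub>R v) = complex_of_real r *s cv v" by (simp add: vec_eq_iff)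
lemma cv_0 [simp]: "cv 0 = 0" by (simp add: vec_eq_iff)
lemma cnjv_cv [simp]: "cnjv (cv v) = cv v" by (simp add: vec_eq_iff)
lemma cnjv_cnjv [simp]: "cnjv (cnjv Z) = Z" by (simp add: vec_eq_iff)
lemma cnjv_smult: "cnjv (a *s Z) = cnj a *s cnjv Z" by (simp add: vec_eq_iff)
lemma cnjv_sum: "cnjv (\<Sum>i\<in>I. f i) = (\<Sum>i\<in>I. cnjv (f i))" by (simp add: vec_eq_iff)

lemma cvec_decomp: "Z = cv (Rev Z) + \<i> *s cv (Imv Z)"
  by (simp add: vec_eq_iff complex_eq_iff)

lemma ev_add_left: "ev (a + b) Z = ev a Z + ev b Z" by (simp add: ev_def sum.distrib algebra_simps)
lemma ev_add_right: "ev a (Z + W) = ev a Z + ev a W" by (simp add: ev_def sum.distrib algebra_simps)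
lemma ev_diff_left: "ev (a - b) Z = ev a Z - ev b Z" by (simp add: ev_def sum_subtractf algebra_simps)
lemma ev_diff_right: "ev a (Z - W) = ev a Z - ev a W" by (simp add: ev_def sum_subtractf algebra_simps)
lemma ev_minus_left: "ev (- a) Z = - ev a Z" by (simp add: ev_def sum_negf)
lemma ev_minus_right: "ev a (- Z) = - ev a Z" by (simp add: ev_def sum_negf)
lemma ev_smult_left: "ev (c *s a) Z = c * ev a Z" by (simp add: ev_def sum_distrib_left mult.assoc)
lemma ev_smult_right: "ev a (c *s Z) = c * ev a Z" by (simp add: ev_def sum_distrib_left algebra_simps)
lemma ev_0_left [simp]: "ev 0 Z = 0" by (simp add: ev_def)
lemma ev_0_right [simp]: "ev a 0 = 0" by (simp add: ev_def)
lemma ev_sum_left: "ev (\<Sum>i\<in>I. f i) Z = (\<Sum>i\<in>I. ev (f i) Z)"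
  by (induction I rule: infinite_finite_induct) (auto simp: ev_add_left)
lemma ev_sum_right: "ev a (\<Sum>i\<in>I. f i) = (\<Sum>i\<in>I. ev a (f i))"
  by (induction I rule: infinite_finite_induct) (auto simp: ev_add_right)
lemma ev_cnjv: "ev (cnjv a) (cnjv Z) = cnj (ev a Z)" by (simp add: ev_def)
lemma ev_cv: "ev (cv a) (cv v) = complex_of_real (a \<bullet> v)" by (simp add: ev_def inner_vec_def)
lemma ev_axis [simp]: "ev a (axis i 1) = a $ i"
  by (simp add: ev_def axis_def if_distrib cong: if_cong)

lemmas ev_simps = ev_add_left ev_add_right ev_diff_left ev_diff_right ev_minus_left ev_minus_right
  ev_smult_left ev_smult_right ev_sum_left ev_sum_right

lemma ev_eqI: "(\<And>Z. ev a Z = ev b Z) \<Longrightarrow> a = b"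
  unfolding vec_eq_iff by (auto simp: ev_axis[symmetric] simp del: ev_axis)

section \<open>Exterior derivatives of functions and 1-forms\<close>

lemma diff0_nth [simp]: "diff0 f x $ i = pd i f x" by (simp add: diff0_def)

lemma diff0_cv:
  assumes "f differentiable (at x)"
  shows "ev (diff0 f x) (cv v) = frechet_derivative f (at x) v"
  unfolding ev_def frechet_pd[OF assms] by (simp add: scaleR_conv_of_real mult.commute)

lemma diff0_cong: "open S \<Longrightarrow> x \<in> S \<Longrightarrow> (\<And>y. y \<in> S \<Longrightarrow> f y = g y) \<Longrightarrow> diff0 f x = diff0 g x"
  using pd_cong[of S x f g] by (simp add: vec_eq_iff)

lemma diff0_mult: "f differentiable (at x) \<Longrightarrow> g differentiable (at x) \<Longrightarrow>
    diff0 (\<lambda>y. f y * g y) x = f x *s diff0 g x + g x *s diff0 f x"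
  by (simp add: vec_eq_iff pd_mult)

lemma diff0_sum: "(\<And>j. j \<in> I \<Longrightarrow> f j differentiable (at x)) \<Longrightarrow>
    diff0 (\<lambda>y. \<Sum>j\<in>I. f j y) x = (\<Sum>j\<in>I. diff0 (f j) x)"
  by (simp add: vec_eq_iff pd_sum)

lemma diff0_const [simp]: "diff0 (\<lambda>y. c) x = 0" by (simp add: vec_eq_iff)

lemma diff0_cnj: "f differentiable (at x) \<Longrightarrow> diff0 (\<lambda>y. cnj (f y)) x = cnjv (diff0 f x)"
  by (simp add: vec_eq_iff pd_cnj)

lemma diff1_add_left: "diff1 \<eta> x (Z + Z') W = diff1 \<eta> x Z W + diff1 \<eta> x Z' W"
  unfolding diff1_def sum.distrib[symmetric] by (intro sum.cong refl) (simp add: algebra_simps)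
lemma diff1_add_right: "diff1 \<eta> x Z (W + W') = diff1 \<eta> x Z W + diff1 \<eta> x Z W'"
  unfolding diff1_def sum.distrib[symmetric] by (intro sum.cong refl) (simp add: algebra_simps)
lemma diff1_smult_left: "diff1 \<eta> x (c *s Z) W = c * diff1 \<eta> x Z W"
  unfolding diff1_def sum_distrib_left by (intro sum.cong refl) (simp add: algebra_simps)
lemma diff1_smult_right: "diff1 \<eta> x Z (c *s W) = c * diff1 \<eta> x Z W"
  unfolding diff1_def sum_distrib_left by (intro sum.cong refl) (simp add: algebra_simps)
lemma diff1_0_left [simp]: "diff1 \<eta> x 0 W = 0" by (simp add: diff1_def)
lemma diff1_0_right [simp]: "diff1 \<eta> x Z 0 = 0" by (simp add: diff1_def)
lemma diff1_sum_left: "diff1 \<eta> x (\<Sum>i\<in>I. f i) W = (\<Sum>i\<in>I. diff1 \<eta> x (f i) W)"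
  by (induction I rule: infinite_finite_induct) (auto simp: diff1_add_left)
lemma diff1_sum_right: "diff1 \<eta> x Z (\<Sum>i\<in>I. f i) = (\<Sum>i\<in>I. diff1 \<eta> x Z (f i))"
  by (induction I rule: infinite_finite_induct) (auto simp: diff1_add_right)
lemma diff1_minus_left: "diff1 \<eta> x (- Z) W = - diff1 \<eta> x Z W"
  unfolding vector_sneg_minus1[of Z] diff1_smult_left by simp
lemma diff1_minus_right: "diff1 \<eta> x Z (- W) = - diff1 \<eta> x Z W"
  unfolding vector_sneg_minus1[of W] diff1_smult_right by simp
lemma diff1_diff_left: "diff1 \<eta> x (Z - Z') W = diff1 \<eta> x Z W - diff1 \<eta> x Z' W"
  using diff1_add_left[of \<eta> x Z "- Z'" W] by (simp add: diff1_minus_left)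
lemma diff1_diff_right: "diff1 \<eta> x Z (W - W') = diff1 \<eta> x Z W - diff1 \<eta> x Z W'"
  using diff1_add_right[of \<eta> x Z W "- W'"] by (simp add: diff1_minus_right)

lemmas diff1_simps = diff1_add_left diff1_add_right diff1_smult_left diff1_smult_right
  diff1_sum_left diff1_sum_right diff1_minus_left diff1_minus_right diff1_diff_left diff1_diff_right

lemma diff1_antisym: "diff1 \<eta> x W Z = - diff1 \<eta> x Z W"
proof -
  have "diff1 \<eta> x W Z = (\<Sum>j\<in>UNIV. \<Sum>i\<in>UNIV.
      (pd i (\<lambda>y. \<eta> y $ j) x - pd j (\<lambda>y. \<eta> y $ i) x) * W $ i * Z $ j)"
    unfolding diff1_def by (rule sum.swap)
  also have "\<dots> = - diff1 \<eta> x Z W"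
    unfolding diff1_def sum_negf[symmetric] by (intro sum.cong refl) (simp add: algebra_simps)
  finally show ?thesis .
qed

lemma diff1_self [simp]: "diff1 \<eta> x Z Z = 0"
  using diff1_antisym[of \<eta> x Z Z] by simp

lemma diff1_cong:
  "open S \<Longrightarrow> x \<in> S \<Longrightarrow> (\<And>y. y \<in> S \<Longrightarrow> \<eta> y = \<xi> y) \<Longrightarrow> diff1 \<eta> x Z W = diff1 \<xi> x Z W"
  unfolding diff1_def using pd_cong[of S x "\<lambda>y. \<eta> y $ j" "\<lambda>y. \<xi> y $ j" for j] by simp

lemma diff1_add:
  assumes "\<eta> differentiable (at x)" "\<xi> differentiable (at x)"
  shows "diff1 (\<lambda>y. \<eta> y + \<xi> y) x Z W = diff1 \<eta> x Z W + diff1 \<xi> x Z W"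
  unfolding diff1_def sum.distrib[symmetric]
  by (intro sum.cong refl) (simp add: pd_add differentiable_nth assms algebra_simps)

lemma diff1_sum:
  assumes "finite I" "\<And>i. i \<in> I \<Longrightarrow> \<eta> i differentiable (at x)"
  shows "diff1 (\<lambda>y. \<Sum>i\<in>I. \<eta> i y) x Z W = (\<Sum>i\<in>I. diff1 (\<eta> i) x Z W)"
  using assms
proof (induction I rule: finite_induct)
  case empty
  then show ?case by (simp add: diff1_def)
next
  case (insert a I)
  then show ?case using diff1_add[of "\<eta> a" x "\<lambda>y. \<Sum>i\<in>I. \<eta> i y" Z W] by (simp add: differentiable_sum)
qed

lemma differentiable_smult:
  fixes \<eta> :: "'a::real_normed_vector \<Rightarrow> complex ^ 'j::finite"
  assumes "f differentiable (at x)" "\<eta> differentiable (at x)"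
  shows "(\<lambda>y. f y *s \<eta> y) differentiable (at x)"
  by (rule differentiable_vec) (simp add: differentiable_mult differentiable_nth assms)

lemma diff1_smult:
  assumes "f differentiable (at x)" "\<eta> differentiable (at x)"
  shows "diff1 (\<lambda>y. f y *s \<eta> y) x Z W = wedge (diff0 f x) (\<eta> x) Z W + f x * diff1 \<eta> x Z W"
proof -
  have 1: "diff1 (\<lambda>y. f y *s \<eta> y) x Z W = (\<Sum>i\<in>UNIV. \<Sum>j\<in>UNIV.
      (pd i f x * Z $ i) * (\<eta> x $ j * W $ j) - (pd j f x * W $ j) * (\<eta> x $ i * Z $ i)
      + f x * ((pd i (\<lambda>y. \<eta> y $ j) x - pd j (\<lambda>y. \<eta> y $ i) x) * Z $ i * W $ j))"
    unfolding diff1_def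
    by (intro sum.cong refl) (simp add: pd_mult differentiable_nth assms algebra_simps)
  have 2: "(\<Sum>i\<in>UNIV. \<Sum>j\<in>UNIV. (pd i f x * Z $ i) * (\<eta> x $ j * W $ j)) = ev (diff0 f x) Z * ev (\<eta> x) W"
    unfolding ev_def diff0_nth by (rule sum_product[symmetric])
  have 3: "(\<Sum>i\<in>UNIV. \<Sum>j\<in>UNIV. (pd j f x * W $ j) * (\<eta> x $ i * Z $ i)) = ev (diff0 f x) W * ev (\<eta> x) Z"
    unfolding ev_def diff0_nth by (subst sum.swap) (rule sum_product[symmetric])
  show ?thesis
    unfolding 1 sum.distrib sum_subtractf 2 3 wedge_def by (simp add: diff1_def sum_distrib_left)
qed

lemma differentiable_cnjv:
  fixes \<eta> :: "'a::real_normed_vector \<Rightarrow> 'n::finite cvec"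
  assumes "\<eta> differentiable (at x)"
  shows "(\<lambda>y. cnjv (\<eta> y)) differentiable (at x)"
  by (rule differentiable_vec) (simp add: differentiable_nth assms differentiable_cnj)

lemma diff1_cnjv:
  assumes "\<eta> differentiable (at x)"
  shows "diff1 (\<lambda>y. cnjv (\<eta> y)) x Z W = cnj (diff1 \<eta> x (cnjv Z) (cnjv W))"
  unfolding diff1_def by (simp add: pd_cnj differentiable_nth assms)

lemma differentiable_cv:
  fixes \<eta> :: "'a::real_normed_vector \<Rightarrow> 'n::finite rvec"
  assumes "\<eta> differentiable (at x)"
  shows "(\<lambda>y. cv (\<eta> y)) differentiable (at x)"
  by (rule differentiable_vec) (simp add: differentiable_nth assms differentiable_of_real)

lemma diff1_cv_cnj:
  assumes "\<eta> differentiable (at x)"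
  shows "cnj (diff1 (\<lambda>y. cv (\<eta> y)) x Z W) = diff1 (\<lambda>y. cv (\<eta> y)) x (cnjv Z) (cnjv W)"
  using diff1_cnjv[OF differentiable_cv[OF assms], of "cnjv Z" "cnjv W"] by simp

lemma pd_symmetric:
  fixes f :: "real ^ 'i::finite \<Rightarrow> 'b::euclidean_space"
  assumes "open S" "x \<in> S" "smooth_on S f"
  shows "pd i (pd j f) x = pd j (pd i f) x"
  using second_derivative_symmetric[OF assms] unfolding pd_def[abs_def] by blast

lemma diff1_diff0:
  assumes "open S" "x \<in> S" "smooth_on S f"
  shows "diff1 (diff0 f) x Z W = 0"
  unfolding diff1_def by (simp add: pd_symmetric[OF assms])

lemma diff0_ev:
  assumes "\<eta> differentiable (at x)" "Y differentiable (at x)"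
  shows "ev (diff0 (\<lambda>y. ev (\<eta> y) (Y y)) x) Z =
    (\<Sum>j\<in>UNIV. \<eta> x $ j * ev (diff0 (\<lambda>y. Y y $ j) x) Z + Y x $ j * ev (diff0 (\<lambda>y. \<eta> y $ j) x) Z)"
proof -
  have "diff0 (\<lambda>y. ev (\<eta> y) (Y y)) x = (\<Sum>j\<in>UNIV. \<eta> x $ j *s diff0 (\<lambda>y. Y y $ j) x + Y x $ j *s diff0 (\<lambda>y. \<eta> y $ j) x)"
    unfolding ev_def
    by (subst diff0_sum) (simp_all add: diff0_mult differentiable_nth differentiable_mult assms)
  then show ?thesis by (simp add: ev_simps)
qed

text \<open>Cartan's formula: in X(\<eta>(Y)) - Y(\<eta>(X)) the derivatives of the coefficients of
  the two fields add up to \<eta>([X, Y]). Through it, integrability of \<open>T10\<close> becomes a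
  statement about d\<theta>.\<close>

lemma diff1_lie_bracket:
  assumes "\<eta> differentiable (at x)" "X differentiable (at x)" "Y differentiable (at x)"
  shows "diff1 \<eta> x (X x) (Y x) = ev (diff0 (\<lambda>y. ev (\<eta> y) (Y y)) x) (X x)
    - ev (diff0 (\<lambda>y. ev (\<eta> y) (X y)) x) (Y x) - ev (\<eta> x) (lie_bracket X Y x)"
proof -
  have 1: "diff1 \<eta> x (X x) (Y x) = (\<Sum>j\<in>UNIV. Y x $ j * ev (diff0 (\<lambda>y. \<eta> y $ j) x) (X x))
      - (\<Sum>j\<in>UNIV. X x $ j * ev (diff0 (\<lambda>y. \<eta> y $ j) x) (Y x))"
  proof -
    have "diff1 \<eta> x (X x) (Y x) = (\<Sum>i\<in>UNIV. \<Sum>j\<in>UNIV. Y x $ j * (pd i (\<lambda>y. \<eta> y $ j) x * X x $ i))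
      - (\<Sum>i\<in>UNIV. \<Sum>j\<in>UNIV. X x $ i * (pd j (\<lambda>y. \<eta> y $ i) x * Y x $ j))"
      unfolding diff1_def sum_subtractf[symmetric] by (intro sum.cong refl) (simp add: algebra_simps)
    also have "(\<Sum>i\<in>UNIV. \<Sum>j\<in>UNIV. Y x $ j * (pd i (\<lambda>y. \<eta> y $ j) x * X x $ i)) =
       (\<Sum>j\<in>UNIV. Y x $ j * ev (diff0 (\<lambda>y. \<eta> y $ j) x) (X x))"
      by (subst sum.swap) (simp add: ev_def sum_distrib_left)
    finally show ?thesis by (simp add: ev_def sum_distrib_left)
  qed
  have 2: "ev (\<eta> x) (lie_bracket X Y x) = (\<Sum>j\<in>UNIV. \<eta> x $ j * ev (diff0 (\<lambda>y. Y y $ j) x) (X x))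
      - (\<Sum>j\<in>UNIV. \<eta> x $ j * ev (diff0 (\<lambda>y. X y $ j) x) (Y x))"
    by (simp add: ev_def lie_bracket_def sum_subtractf sum_distrib_left algebra_simps)
  show ?thesis
    unfolding diff0_ev[OF assms(1,2)] diff0_ev[OF assms(1,3)] 1 2 by (simp add: sum.distrib)
qed

lemma differentiable_ev:
  "a differentiable (at x) \<Longrightarrow> (\<lambda>y. ev (a y) Z) differentiable (at x)"
  unfolding ev_def by (intro differentiable_sum finite ballI differentiable_mult differentiable_nth differentiable_const)

lemma diff1_cv:
  assumes "\<eta> differentiable (at x)"
  shows "diff1 \<eta> x (cv v) (cv w) = frechet_derivative (\<lambda>y. ev (\<eta> y) (cv w)) (at x) v - frechet_derivative (\<lambda>y. ev (\<eta> y) (cv v)) (at x) w"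
proof -
  have "lie_bracket (\<lambda>_. cv v) (\<lambda>_. cv w) x = 0" by (simp add: lie_bracket_def vec_eq_iff)
  then show ?thesis
    using diff1_lie_bracket[OF assms, of "\<lambda>_. cv v" "\<lambda>_. cv w"] by (simp add: diff0_cv differentiable_ev assms)
qed

section \<open>Pseudohermitian structures\<close>

lemma ev_cnjv_left: "ev (cnjv a) Z = cnj (ev a (cnjv Z))"
  using ev_cnjv[of a "cnjv Z"] by simp

text \<open>Contact form, frame and connection live on \<open>V\<close> only, which may be smaller
  than the set \<open>\<Omega>\<close> carrying the CR structure.\<close>

locale pseudohermitian_chart =
  fixes \<Omega> V :: "'n::finite rvec set" and H J P
  assumes open_V: "open V" and V_sub: "V \<subseteq> \<Omega>"
    and cr: "cr_structure_on \<Omega> H J" and nondeg: "nondegenerate_on \<Omega> H J"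
    and ph: "pseudohermitian V H J P"
begin

abbreviation "TT x \<equiv> cv (reeb P x)"
abbreviation "E \<alpha> x \<equiv> frame P \<alpha> x"
abbreviation "Eb \<alpha> x \<equiv> cnjv (frame P \<alpha> x)"

lemma adm: "admissible_coframe V H J P" and tw: "tanaka_webster V J P" and ric: "ricci_tensor V P"
  using ph by (auto simp: pseudohermitian_def)

lemmas cr_unfold = cr[unfolded cr_structure_on_def]

lemma H_subspace: "x \<in> V \<Longrightarrow> subspace (H x)"
  using cr_unfold[THEN conjunct1] V_sub by auto

lemma J_in_H: "x \<in> V \<Longrightarrow> u \<in> H x \<Longrightarrow> J x u \<in> H x"
  and J_J: "x \<in> V \<Longrightarrow> u \<in> H x \<Longrightarrow> J x (J x u) = - u"
  and J_linear: "x \<in> V \<Longrightarrow> u \<in> H x \<Longrightarrow> v \<in> H x \<Longrightarrow> J x (a *\<^sub>R u + b *\<^sub>R v) = a *\<^sub>R J x u + b *\<^sub>R J x v"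
  using cr_unfold[THEN conjunct2, THEN conjunct2, THEN conjunct1] V_sub by auto

lemma T10_bracket:
  assumes "x \<in> V" "smooth_on V Z" "smooth_on V W" "\<And>y. y \<in> V \<Longrightarrow> Z y \<in> T10 H J y" "\<And>y. y \<in> V \<Longrightarrow> W y \<in> T10 H J y"
  shows "lie_bracket Z W x \<in> T10 H J x"
  using cr_unfold[THEN conjunct2, THEN conjunct2, THEN conjunct2, THEN conjunct2, rule_format, OF open_V V_sub] assms by auto

lemma J_minus: "x \<in> V \<Longrightarrow> u \<in> H x \<Longrightarrow> J x (- u) = - J x u"
  using J_linear[of x u u "-1" 0] by simp

lemma smooth_theta: "smooth_on V (theta P)" and smooth_reeb: "smooth_on V (reeb P)"
  and smooth_frame: "smooth_on V (frame P \<alpha>)" and smooth_coframe: "smooth_on V (coframe P \<alpha>)"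
  using adm by (auto simp: admissible_coframe_def contact_form_def)

lemma smooth_conn: "smooth_on V (conn P \<beta> \<alpha>)"
  using tw by (auto simp: tanaka_webster_def)

lemma theta_kernel: "x \<in> V \<Longrightarrow> theta P x \<bullet> u = 0 \<longleftrightarrow> u \<in> H x"
  using adm by (auto simp: admissible_coframe_def contact_form_def)

lemma diff_theta: "x \<in> V \<Longrightarrow> theta P differentiable (at x)"
  and diff_ctheta: "x \<in> V \<Longrightarrow> ctheta P differentiable (at x)"
  and diff_frame: "x \<in> V \<Longrightarrow> frame P \<alpha> differentiable (at x)"
  and diff_coframe: "x \<in> V \<Longrightarrow> coframe P \<alpha> differentiable (at x)"
  and diff_cobar: "x \<in> V \<Longrightarrow> cobar P \<alpha> differentiable (at x)"
  and diff_conn: "x \<in> V \<Longrightarrow> conn P \<beta> \<alpha> differentiable (at x)"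
  and diff_conn_trace: "x \<in> V \<Longrightarrow> conn_trace P differentiable (at x)"
  using smooth_on_differentiable[OF smooth_theta] smooth_on_differentiable[OF smooth_frame]
    smooth_on_differentiable[OF smooth_coframe] smooth_on_differentiable[OF smooth_conn]
  by (auto simp: ctheta_def[abs_def] cobar_def[abs_def] conn_trace_def[abs_def]
      intro!: differentiable_cv differentiable_cnjv differentiable_sum)

lemma theta_T [simp]: "x \<in> V \<Longrightarrow> ev (ctheta P x) (TT x) = 1"
  using adm by (auto simp: admissible_coframe_def ctheta_def ev_cv)

lemma dtheta_T [simp]: "x \<in> V \<Longrightarrow> diff1 (ctheta P) x (TT x) W = 0"
  using adm by (auto simp: admissible_coframe_def)

lemma dtheta_T' [simp]: "x \<in> V \<Longrightarrow> diff1 (ctheta P) x W (TT x) = 0"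
  using diff1_antisym[of "ctheta P" x "TT x" W] by simp

lemma frame_T10: "x \<in> V \<Longrightarrow> E \<alpha> x \<in> T10 H J x"
  using adm by (auto simp: admissible_coframe_def)

lemma T10_span: "x \<in> V \<Longrightarrow> Z \<in> T10 H J x \<Longrightarrow> \<exists>a. Z = (\<Sum>\<alpha>\<in>UNIV. a \<alpha> *s E \<alpha> x)"
  using adm by (auto simp: admissible_coframe_def) blast

lemma coframe_dual [simp]:
  assumes "x \<in> V"
  shows "ev (coframe P \<alpha> x) (TT x) = 0"
    "ev (coframe P \<alpha> x) (E \<beta> x) = (if \<alpha> = \<beta> then 1 else 0)"
    "ev (coframe P \<alpha> x) (Eb \<beta> x) = 0"
    "ev (cobar P \<alpha> x) (TT x) = 0"
    "ev (cobar P \<alpha> x) (E \<beta> x) = 0"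
    "ev (cobar P \<alpha> x) (Eb \<beta> x) = (if \<alpha> = \<beta> then 1 else 0)"
  using adm assms by (auto simp: admissible_coframe_def cobar_def ev_cnjv_left)

lemma theta_T10 [simp]: "x \<in> V \<Longrightarrow> Z \<in> T10 H J x \<Longrightarrow> ev (ctheta P x) Z = 0"
  using theta_kernel[of x "Rev Z"] theta_kernel[of x "Imv Z"]
  by (subst cvec_decomp[of Z]) (auto simp: T10_def ev_simps ctheta_def ev_cv)

lemma theta_cnj [simp]: "ev (ctheta P x) (cnjv Z) = cnj (ev (ctheta P x) Z)"
  unfolding ctheta_def by (metis cnjv_cv ev_cnjv)

lemma theta_frame [simp]: "x \<in> V \<Longrightarrow> ev (ctheta P x) (E \<alpha> x) = 0"
  and theta_frame_bar [simp]: "x \<in> V \<Longrightarrow> ev (ctheta P x) (Eb \<alpha> x) = 0"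
  by (simp_all add: frame_T10)

lemma T10_add: "x \<in> V \<Longrightarrow> Z \<in> T10 H J x \<Longrightarrow> W \<in> T10 H J x \<Longrightarrow> Z + W \<in> T10 H J x"
proof -
  assume a: "x \<in> V" "Z \<in> T10 H J x" "W \<in> T10 H J x"
  have r: "Rev (Z + W) = Rev Z + Rev W" "Imv (Z + W) = Imv Z + Imv W" by (simp_all add: vec_eq_iff)
  have "J x (u + v) = J x u + J x v" if "u \<in> H x" "v \<in> H x" for u v
    using J_linear[OF a(1) that, of 1 1] by simp
  moreover have "Rev Z \<in> H x" "Rev W \<in> H x" "Imv Z \<in> H x" "Imv W \<in> H x"
    using a by (auto simp: T10_def)
  ultimately have "cext (J x) (Z + W) = cext (J x) Z + cext (J x) W"
    unfolding cext_def r by (simp add: cv_add vec.scale_right_distrib)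
  then show ?thesis using a H_subspace[OF a(1)]
    by (auto simp: T10_def r subspace_add vec.scale_right_distrib)
qed

lemma T10_smult: "x \<in> V \<Longrightarrow> Z \<in> T10 H J x \<Longrightarrow> a *s Z \<in> T10 H J x"
proof -
  assume a: "x \<in> V" "Z \<in> T10 H J x"
  have h: "Rev Z \<in> H x" "Imv Z \<in> H x" "cext (J x) Z = \<i> *s Z" using a by (auto simp: T10_def)
  have r: "Rev (a *s Z) = Re a *\<^sub>R Rev Z + (- Im a) *\<^sub>R Imv Z" "Imv (a *s Z) = Im a *\<^sub>R Rev Z + Re a *\<^sub>R Imv Z"
    by (simp_all add: vec_eq_iff)
  have "cext (J x) (a *s Z) = a *s cext (J x) Z"
    unfolding cext_def r J_linear[OF a(1) h(1,2)]
    by (simp add: vec_eq_iff complex_eq_iff)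
  also have "\<dots> = \<i> *s (a *s Z)" unfolding h(3) by (simp add: vector_smult_assoc mult.commute)
  finally show ?thesis using h H_subspace[OF a(1)]
    by (auto simp: T10_def r intro!: subspace_add subspace_diff subspace_scale)
qed

text \<open>Z is the image of u under the projection (1 - i J) / 2 onto the i-eigenspace of J. It
  reduces statements about real vectors of H to computations in the frame.\<close>

lemma half_T10:
  assumes "x \<in> V" "u \<in> H x"
  defines "Z \<equiv> (1/2) *s (cv u - \<i> *s cv (J x u))"
  shows "Z \<in> T10 H J x" "cv u = Z + cnjv Z" "cv (J x u) = \<i> *s Z - \<i> *s cnjv Z"
proof -
  have r: "Rev Z = (1/2) *\<^sub>R u" "Imv Z = (-1/2) *\<^sub>R J x u" by (simp_all add: vec_eq_iff Z_def)
  have J0: "J x (c *\<^sub>R w) = c *\<^sub>R J x w" if "w \<in> H x" for c w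
    using J_linear[OF assms(1) that that, of c 0] by simp
  have JR: "J x (Rev Z) = (1/2) *\<^sub>R J x u" and JI: "J x (Imv Z) = (1/2) *\<^sub>R u"
    unfolding r using J0[OF assms(2), of "1/2"] J0[OF J_in_H[OF assms(1,2)], of "-1/2"] J_J[OF assms(1,2)]
    by simp_all
  have "Rev Z \<in> H x" "Imv Z \<in> H x"
    unfolding r using H_subspace[OF assms(1)] assms(2) J_in_H[OF assms(1,2)]
    by (blast intro: subspace_scale)+
  moreover have "cext (J x) Z = \<i> *s Z"
    unfolding cext_def JR JI by (simp add: vec_eq_iff Z_def algebra_simps)
  ultimately show "Z \<in> T10 H J x" by (simp add: T10_def)
  show "cv u = Z + cnjv Z" "cv (J x u) = \<i> *s Z - \<i> *s cnjv Z"
    by (simp_all add: vec_eq_iff Z_def algebra_simps)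
qed

lemma decomposition:
  assumes x: "x \<in> V"
  shows "X = ev (ctheta P x) X *s TT x + (\<Sum>\<alpha>\<in>UNIV. ev (coframe P \<alpha> x) X *s E \<alpha> x)
    + (\<Sum>\<alpha>\<in>UNIV. ev (cobar P \<alpha> x) X *s Eb \<alpha> x)"
proof -
  define Y where "Y = X - ev (ctheta P x) X *s TT x"
  have "ev (ctheta P x) Y = 0" using x by (simp add: Y_def ev_simps)
  then have "theta P x \<bullet> Rev Y = 0 \<and> theta P x \<bullet> Imv Y = 0"
    by (subst (asm) cvec_decomp[of Y]) (simp add: ev_simps ctheta_def ev_cv complex_eq_iff)
  then have YH: "Rev Y \<in> H x" "Imv Y \<in> H x" using theta_kernel[OF x] by auto
  obtain Z1 where Z1: "Z1 \<in> T10 H J x" "cv (Rev Y) = Z1 + cnjv Z1" using half_T10[OF x YH(1)] by blast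
  obtain Z2 where Z2: "Z2 \<in> T10 H J x" "cv (Imv Y) = Z2 + cnjv Z2" using half_T10[OF x YH(2)] by blast
  \<comment> \<open>The (1,0)-part of Y is Z1 + i Z2. Its (0,1)-part cnj Z1 + i cnj Z2 is the
    conjugate of Z1 - i Z2, so both \<open>A\<close> and \<open>B\<close> lie in \<open>T10\<close>
    and can be expanded in the frame.\<close>
  define A B where "A = Z1 + \<i> *s Z2" and "B = Z1 + (- \<i>) *s Z2"
  have "A \<in> T10 H J x" "B \<in> T10 H J x" unfolding A_def B_def using Z1 Z2 x by (blast intro: T10_add T10_smult)+
  then obtain a b where ab: "A = (\<Sum>\<alpha>\<in>UNIV. a \<alpha> *s E \<alpha> x)" "B = (\<Sum>\<alpha>\<in>UNIV. b \<alpha> *s E \<alpha> x)"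
    using T10_span[OF x] by meson
  have "Y = A + cnjv B"
    by (subst cvec_decomp[of Y]) (simp add: Z1 Z2 A_def B_def cnjv_smult vec.scale_right_distrib vec_eq_iff algebra_simps)
  then have Y: "Y = (\<Sum>\<alpha>\<in>UNIV. a \<alpha> *s E \<alpha> x) + (\<Sum>\<alpha>\<in>UNIV. cnj (b \<alpha>) *s Eb \<alpha> x)"
    by (simp add: ab cnjv_sum cnjv_smult)
  have X: "X = ev (ctheta P x) X *s TT x + Y" by (simp add: Y_def)
  have "ev (coframe P \<alpha> x) X = a \<alpha>" for \<alpha>
    by (subst X) (use x in \<open>simp add: ev_simps Y if_distrib cong: if_cong\<close>)
  moreover have "ev (cobar P \<alpha> x) X = cnj (b \<alpha>)" for \<alpha>
    by (subst X) (use x in \<open>simp add: ev_simps Y if_distrib cong: if_cong\<close>)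
  ultimately show ?thesis
    using X Y by (simp add: add.assoc)
qed

lemma covector_eqI:
  assumes "x \<in> V" "ev a (TT x) = ev b (TT x)" "\<And>\<alpha>. ev a (E \<alpha> x) = ev b (E \<alpha> x)" "\<And>\<alpha>. ev a (Eb \<alpha> x) = ev b (Eb \<alpha> x)"
  shows "a = b"
proof (rule ev_eqI)
  fix X show "ev a X = ev b X"
    by (subst (1 2) decomposition[OF assms(1), of X]) (simp add: ev_simps assms)
qed

lemma cext_frame_bar: "x \<in> V \<Longrightarrow> cext (J x) (Eb \<beta> x) = - \<i> *s Eb \<beta> x"
proof -
  assume x: "x \<in> V"
  have h: "Rev (E \<beta> x) \<in> H x" "Imv (E \<beta> x) \<in> H x" "cext (J x) (E \<beta> x) = \<i> *s E \<beta> x"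
    using frame_T10[OF x] by (auto simp: T10_def)
  have r: "Rev (Eb \<beta> x) = Rev (E \<beta> x)" "Imv (Eb \<beta> x) = - Imv (E \<beta> x)" by (simp_all add: vec_eq_iff)
  have "cext (J x) (Eb \<beta> x) = cnjv (cext (J x) (E \<beta> x))"
    unfolding cext_def r J_minus[OF x h(2)] by (simp add: vec_eq_iff)
  then show ?thesis by (simp add: h(3) cnjv_smult)
qed

lemma hmat_eq: "x \<in> V \<Longrightarrow> hmat J P x $ \<alpha> $ \<beta> = - \<i> * diff1 (ctheta P) x (E \<alpha> x) (Eb \<beta> x)"
  by (simp add: hmat_def levi_form_def cext_frame_bar diff1_simps ctheta_def[abs_def])

lemma dtheta_EEb: "x \<in> V \<Longrightarrow> diff1 (ctheta P) x (E \<alpha> x) (Eb \<beta> x) = \<i> * hmat J P x $ \<alpha> $ \<beta>"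
  by (simp add: hmat_eq)

lemma dtheta_EbE: "x \<in> V \<Longrightarrow> diff1 (ctheta P) x (Eb \<beta> x) (E \<alpha> x) = - \<i> * hmat J P x $ \<alpha> $ \<beta>"
  using diff1_antisym[of "ctheta P" x "E \<alpha> x" "Eb \<beta> x"] by (simp add: hmat_eq)

lemma dtheta_cnj: "x \<in> V \<Longrightarrow> diff1 (ctheta P) x (cnjv Z) (cnjv W) = cnj (diff1 (ctheta P) x Z W)"
  unfolding ctheta_def[abs_def] using diff1_cv_cnj[OF diff_theta] by simp

lemma hmat_hermitian: "x \<in> V \<Longrightarrow> cnj (hmat J P x $ \<alpha> $ \<beta>) = hmat J P x $ \<beta> $ \<alpha>"
  using dtheta_cnj[of x "E \<alpha> x" "Eb \<beta> x"] diff1_antisym[of "ctheta P" x "E \<beta> x" "Eb \<alpha> x"]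
  by (simp add: hmat_eq)

text \<open>Integrability puts the bracket of two frame fields into \<open>T10\<close>, where
  \<theta> vanishes; the other terms of Cartan's formula differentiate the zero functions
  \<theta>(E).\<close>

lemma dtheta_EE [simp]: assumes x: "x \<in> V" shows "diff1 (ctheta P) x (E \<alpha> x) (E \<beta> x) = 0"
proof -
  have br: "lie_bracket (frame P \<alpha>) (frame P \<beta>) x \<in> T10 H J x"
    by (rule T10_bracket[OF x smooth_frame smooth_frame frame_T10 frame_T10])
  have z: "diff0 (\<lambda>y. ev (ctheta P y) (E \<gamma> y)) x = 0" for \<gamma>
    using diff0_cong[OF open_V x, of "\<lambda>y. ev (ctheta P y) (E \<gamma> y)" "\<lambda>y. 0"] by simp
  show ?thesis
    using diff1_lie_bracket[OF diff_ctheta[OF x] diff_frame[OF x] diff_frame[OF x], of \<alpha> \<beta>] br x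
    by (simp add: z)
qed

lemma dtheta_EbEb [simp]: assumes x: "x \<in> V" shows "diff1 (ctheta P) x (Eb \<alpha> x) (Eb \<beta> x) = 0"
  using dtheta_cnj[OF x, of "E \<alpha> x" "E \<beta> x"] x by simp

text \<open>Coefficients annihilated by the matrix give a (1,0) vector whose contraction with
  d\<theta> is 0. Non-degeneracy is formulated for real vectors, so it is applied to the real and
  imaginary parts, which are combinations of this vector and its conjugate.\<close>

lemma hmat_nondegenerate:
  assumes x: "x \<in> V" and a: "\<And>\<beta>. (\<Sum>\<alpha>\<in>UNIV. a \<alpha> * hmat J P x $ \<alpha> $ \<beta>) = 0"
  shows "a \<alpha> = 0"
proof -
  define Z where "Z = (\<Sum>\<alpha>\<in>UNIV. a \<alpha> *s E \<alpha> x)"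
  have ZT: "Z \<in> T10 H J x"
  proof -
    have "(\<Sum>\<alpha>\<in>A. a \<alpha> *s E \<alpha> x) \<in> T10 H J x" if "finite A" for A
      using that
    proof (induction A)
      case empty
      have "0 *s E \<alpha> x \<in> T10 H J x" by (rule T10_smult[OF x frame_T10[OF x]])
      then show ?case by simp
    qed (auto intro!: T10_add T10_smult frame_T10 x)
    then show ?thesis by (simp add: Z_def)
  qed
  have Zbar: "diff1 (ctheta P) x Z (Eb \<beta> x) = 0" for \<beta>
  proof -
    have "diff1 (ctheta P) x Z (Eb \<beta> x) = \<i> * (\<Sum>\<alpha>\<in>UNIV. a \<alpha> * hmat J P x $ \<alpha> $ \<beta>)"
      by (simp add: Z_def diff1_simps dtheta_EEb[OF x] sum_distrib_left mult_ac)
    then show ?thesis by (simp add: a)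
  qed
  have ZZ: "diff1 (ctheta P) x Z (E \<beta> x) = 0" for \<beta>
    using x by (simp add: Z_def diff1_simps)
  have Z0: "diff1 (ctheta P) x Z X = 0" for X
    by (subst decomposition[OF x, of X]) (simp add: diff1_simps Zbar ZZ x)
  have Zb0: "diff1 (ctheta P) x (cnjv Z) X = 0" for X
    using dtheta_cnj[OF x, of Z "cnjv X"] Z0 by simp
  have 0: "u = 0" if u: "u \<in> H x" "cv u = b *s Z + c *s cnjv Z" for u b c
  proof -
    have cf: "contact_form V H (theta P)" using adm by (simp add: admissible_coframe_def)
    have "levi_form J (theta P) x (cv u) (cv v) = 0" for v
      unfolding levi_form_def u(2) using Z0 Zb0 by (simp add: diff1_simps ctheta_def[abs_def])
    then show ?thesis
      using nondeg open_V V_sub cf x u(1) unfolding nondegenerate_on_def by blast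
  qed
  have "Rev Z = 0"
    by (rule 0[of _ "1/2" "1/2"]) (use ZT in \<open>auto simp: T10_def vec_eq_iff complex_eq_iff\<close>)
  moreover have "Imv Z = 0"
    by (rule 0[of _ "-\<i>/2" "\<i>/2"]) (use ZT in \<open>auto simp: T10_def vec_eq_iff complex_eq_iff\<close>)
  ultimately have "Z = 0" by (subst cvec_decomp[of Z]) simp
  then have "ev (coframe P \<alpha> x) Z = 0" by simp
  then show ?thesis using x by (simp add: Z_def ev_simps if_distrib cong: if_cong)
qed

lemma det_hmat: assumes x: "x \<in> V" shows "det (hmat J P x) \<noteq> 0"
proof -
  have "\<forall>v. transpose (hmat J P x) *v v = 0 \<longrightarrow> v = 0"
  proof (intro allI impI)
    fix v assume "transpose (hmat J P x) *v v = 0"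
    then have "(\<Sum>\<alpha>\<in>UNIV. v $ \<alpha> * hmat J P x $ \<alpha> $ \<beta>) = 0" for \<beta>
      by (simp add: vec_eq_iff matrix_vector_mult_def transpose_def mult.commute)
    then show "v = 0" using hmat_nondegenerate[OF x, of "\<lambda>\<alpha>. v $ \<alpha>"] by (simp add: vec_eq_iff)
  qed
  then have "invertible (transpose (hmat J P x))"
    unfolding invertible_left_inverse matrix_left_invertible_ker .
  then show ?thesis by (simp add: invertible_det_nz det_transpose)
qed

lemma hinv:
  assumes x: "x \<in> V"
  shows "hmat J P x ** matrix_inv (hmat J P x) = mat 1" "matrix_inv (hmat J P x) ** hmat J P x = mat 1"
proof -
  have "\<exists>B. hmat J P x ** B = mat 1 \<and> B ** hmat J P x = mat 1"
    using det_hmat[OF x] unfolding invertible_det_nz[symmetric] invertible_def .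
  from someI_ex[OF this]
  show "hmat J P x ** matrix_inv (hmat J P x) = mat 1" "matrix_inv (hmat J P x) ** hmat J P x = mat 1"
    by (simp_all add: matrix_inv_def)
qed

text \<open>Of the blocks of d\<theta> in the frame only the mixed one survives: the Reeb field is
  annihilated, and the (1,0) and (0,1) blocks vanish by integrability.\<close>

lemma dtheta_formula:
  assumes x: "x \<in> V"
  shows "diff1 (ctheta P) x X Y = \<i> * (\<Sum>\<alpha>\<in>UNIV. \<Sum>\<beta>\<in>UNIV. hmat J P x $ \<alpha> $ \<beta> *
    (ev (coframe P \<alpha> x) X * ev (cobar P \<beta> x) Y - ev (coframe P \<alpha> x) Y * ev (cobar P \<beta> x) X))"
proof -
  have 1: "diff1 (ctheta P) x (E \<alpha> x) Y = \<i> * (\<Sum>\<beta>\<in>UNIV. hmat J P x $ \<alpha> $ \<beta> * ev (cobar P \<beta> x) Y)" for \<alpha>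
    by (subst decomposition[OF x, of Y]) (simp add: diff1_simps x dtheta_EEb sum_distrib_left mult_ac)
  have 2: "diff1 (ctheta P) x (Eb \<beta> x) Y = - \<i> * (\<Sum>\<alpha>\<in>UNIV. hmat J P x $ \<alpha> $ \<beta> * ev (coframe P \<alpha> x) Y)" for \<beta>
    by (subst decomposition[OF x, of Y]) (simp add: diff1_simps x dtheta_EbE sum_distrib_left sum_negf mult_ac)
  have "diff1 (ctheta P) x X Y = (\<Sum>\<alpha>\<in>UNIV. \<Sum>\<beta>\<in>UNIV. \<i> * (hmat J P x $ \<alpha> $ \<beta> * (ev (coframe P \<alpha> x) X * ev (cobar P \<beta> x) Y)))
     - (\<Sum>\<beta>\<in>UNIV. \<Sum>\<alpha>\<in>UNIV. \<i> * (hmat J P x $ \<alpha> $ \<beta> * (ev (coframe P \<alpha> x) Y * ev (cobar P \<beta> x) X)))"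
    by (subst decomposition[OF x, of X]) (simp add: diff1_simps x 1 2 sum_distrib_left sum_negf mult_ac)
  then show ?thesis
    by (subst (asm) (2) sum.swap) (simp add: sum_distrib_left sum_subtractf[symmetric] algebra_simps)
qed

end

section \<open>Traces of the structure equations\<close>

lemma smooth_on_cnj: "open S \<Longrightarrow> smooth_on S f \<Longrightarrow> smooth_on S (\<lambda>y. cnj (f y))"
  by (rule smooth_on_bounded_linear[OF bounded_linear_cnj])

lemma smooth_on_of_real: "open S \<Longrightarrow> smooth_on S f \<Longrightarrow> smooth_on S (\<lambda>y. complex_of_real (f y))"
  by (rule smooth_on_bounded_linear[OF bounded_linear_of_real])

lemma smooth_on_inner: "open S \<Longrightarrow> smooth_on S f \<Longrightarrow> smooth_on S g \<Longrightarrow> smooth_on S (\<lambda>y. f y \<bullet> g y)"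
  for f g :: "'a::real_normed_vector \<Rightarrow> 'b::real_inner"
  by (rule smooth_on_bilinear[OF bounded_bilinear_inner])

lemma smooth_on_ev: "open S \<Longrightarrow> smooth_on S a \<Longrightarrow> smooth_on S Z \<Longrightarrow> smooth_on S (\<lambda>y. ev (a y) (Z y))"
  unfolding ev_def by (intro smooth_on_sum smooth_on_mult smooth_on_nth)

lemma smooth_on_cv: "open S \<Longrightarrow> smooth_on S v \<Longrightarrow> smooth_on S (\<lambda>y. cv (v y))"
  by (rule smooth_on_vec) (auto intro: smooth_on_of_real smooth_on_nth)

lemma smooth_on_cnjv: "open S \<Longrightarrow> smooth_on S v \<Longrightarrow> smooth_on S (\<lambda>y. cnjv (v y))"
  by (rule smooth_on_vec) (auto intro: smooth_on_cnj smooth_on_nth)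

lemma smooth_on_smult: "open S \<Longrightarrow> smooth_on S f \<Longrightarrow> smooth_on S v \<Longrightarrow> smooth_on S (\<lambda>y. f y *s v y)"
  for v :: "'a::real_normed_vector \<Rightarrow> complex ^ 'j::finite"
  by (rule smooth_on_vec) (auto intro: smooth_on_mult smooth_on_nth)

lemma smooth_on_diff0: "open S \<Longrightarrow> smooth_on S f \<Longrightarrow> smooth_on S (diff0 f)"
  by (rule smooth_on_vec) (auto intro: smooth_on_pd)

lemma smooth_on_diff: "open S \<Longrightarrow> smooth_on S f \<Longrightarrow> smooth_on S g \<Longrightarrow> smooth_on S (\<lambda>x. f x - g x)"
  using smooth_on_add[of S f "\<lambda>x. - g x"] smooth_on_bounded_linear[OF bounded_linear_minus[OF bounded_linear_ident], of S g]
  by simp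

lemma smooth_on_diff1:
  assumes "open S" "smooth_on S \<eta>" "smooth_on S Z" "smooth_on S W"
  shows "smooth_on S (\<lambda>y. diff1 \<eta> y (Z y) (W y))"
  unfolding diff1_def
  by (intro smooth_on_sum smooth_on_mult smooth_on_diff smooth_on_pd smooth_on_nth assms)

lemma diff1_diff:
  assumes "\<eta> differentiable (at x)" "\<xi> differentiable (at x)"
  shows "diff1 (\<lambda>y. \<eta> y - \<xi> y) x Z W = diff1 \<eta> x Z W - diff1 \<xi> x Z W"
  using diff1_add[of "\<lambda>y. \<eta> y - \<xi> y" x \<xi> Z W] assms by (simp add: differentiable_diff)

lemma matrix_inv_unique:
  fixes A B :: "'a::field ^ 'n ^ 'n"
  assumes "A ** B = mat 1" shows "matrix_inv A = B"
proof -
  have BA: "B ** A = mat 1" using assms matrix_left_right_inverse by blast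
  have "\<exists>X. A ** X = mat 1 \<and> X ** A = mat 1" using assms BA by blast
  from someI_ex[OF this] have "matrix_inv A ** A = mat 1" by (simp add: matrix_inv_def)
  then have "matrix_inv A ** (A ** B) = B" by (simp add: matrix_mul_assoc)
  then show ?thesis by (simp add: assms)
qed

lemma trace_scaleR: "trace (r *\<^sub>R (A :: complex ^ 'n ^ 'n)) = complex_of_real r * trace A"
  by (simp add: trace_def sum_distrib_left) (simp add: scaleR_conv_of_real)

lemma trace_mult: "trace (A ** B) = (\<Sum>i\<in>UNIV. \<Sum>j\<in>UNIV. A $ i $ j * B $ j $ i)"
  by (simp add: trace_def matrix_matrix_mult_def)

lemma trace_rotate: "trace ((A :: complex ^ 'n ^ 'n) ** B ** C) = trace (B ** C ** A)"
  using trace_mul_sym[of A "B ** C"] by (simp add: matrix_mul_assoc)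

definition adj :: "complex ^ 'n ^ 'm \<Rightarrow> complex ^ 'm ^ 'n" where
  "adj A = (\<chi> i j. cnj (A $ j $ i))"

lemma adj_nth [simp]: "adj A $ i $ j = cnj (A $ j $ i)" by (simp add: adj_def)
lemma adj_mult: "adj (A ** B) = adj B ** adj A"
  by (simp add: vec_eq_iff matrix_matrix_mult_def mult.commute)
lemma adj_mat [simp]: "adj (mat 1) = mat 1"
  by (simp add: vec_eq_iff mat_def)
lemma trace_adj: "trace (adj A) = cnj (trace A)" by (simp add: trace_def)

context
  fixes A Ai M Mi :: "complex ^ 'n ^ 'n"
  assumes A: "A ** Ai = mat 1" "Ai ** A = mat 1" and M: "M ** Mi = mat 1" "Mi ** M = mat 1"
begin

lemma adjM: "adj M ** adj Mi = mat 1" "adj Mi ** adj M = mat 1"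
  using M by (simp_all add: adj_mult[symmetric])

text \<open>\<open>M ** A ** adj M\<close> is the shape of the Levi matrix in a new frame, with r
  the ratio of the contact forms. The trace identities that follow contract with its
  inverse.\<close>

lemma sandwich_inv:
  assumes "r \<noteq> 0"
  shows "matrix_inv (r *\<^sub>R (M ** A ** adj M)) = (1 / r) *\<^sub>R (adj Mi ** Ai ** Mi)"
proof (rule matrix_inv_unique)
  have "M ** A ** adj M ** (adj Mi ** Ai ** Mi) = M ** A ** (adj M ** adj Mi) ** Ai ** Mi"
    by (simp only: matrix_mul_assoc)
  also have "\<dots> = M ** (A ** Ai) ** Mi" by (simp add: adjM matrix_mul_assoc)
  also have "\<dots> = mat 1" by (simp add: A M)
  finally show "r *\<^sub>R (M ** A ** adj M) ** ((1 / r) *\<^sub>R (adj Mi ** Ai ** Mi)) = mat 1"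
    using assms by (simp add: matrix_scalar_ac scalar_matrix_assoc[symmetric])
qed

text \<open>Contraction with the inverse Levi matrix does not depend on the frame: the factors
  \<open>M\<close> and \<open>adj M\<close> cancel cyclically.\<close>

lemma sandwich_trace: "trace (adj Mi ** Ai ** Mi ** (M ** B ** adj M)) = trace (Ai ** B)"
proof -
  have "adj Mi ** Ai ** Mi ** (M ** B ** adj M) = adj Mi ** Ai ** (Mi ** M) ** B ** adj M"
    by (simp only: matrix_mul_assoc)
  also have "\<dots> = adj Mi ** (Ai ** B) ** adj M" by (simp add: M matrix_mul_assoc)
  also have "trace \<dots> = trace (Ai ** B ** adj M ** adj Mi)" by (rule trace_rotate)
  also have "Ai ** B ** adj M ** adj Mi = Ai ** B ** (adj M ** adj Mi)" by (simp only: matrix_mul_assoc)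
  finally show ?thesis by (simp add: adjM)
qed

text \<open>For M' a derivative of M this is the logarithmic derivative of det M, contributed by the
  left factor of \<open>M ** A ** adj M\<close>; the right factor contributes the conjugate in the
  companion lemma.\<close>

lemma sandwich_trace1: "trace (adj Mi ** Ai ** Mi ** (M' ** A ** adj M)) = trace (Mi ** M')"
proof -
  have "trace (adj Mi ** Ai ** Mi ** (M' ** A ** adj M)) = trace (adj Mi ** (Ai ** Mi ** M' ** A) ** adj M)"
    by (simp only: matrix_mul_assoc)
  also have "\<dots> = trace ((Ai ** Mi ** M' ** A) ** adj M ** adj Mi)" by (rule trace_rotate)
  also have "(Ai ** Mi ** M' ** A) ** adj M ** adj Mi = (Ai ** Mi ** M' ** A) ** (adj M ** adj Mi)"
    by (simp only: matrix_mul_assoc)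
  also have "\<dots> = Ai ** (Mi ** M') ** A" by (simp add: adjM matrix_mul_assoc)
  also have "trace \<dots> = trace (Mi ** M' ** A ** Ai)" by (rule trace_rotate)
  also have "Mi ** M' ** A ** Ai = Mi ** M' ** (A ** Ai)" by (simp only: matrix_mul_assoc)
  finally show ?thesis by (simp add: A)
qed

lemma sandwich_trace2: "trace (adj Mi ** Ai ** Mi ** (M ** A ** adj M')) = cnj (trace (Mi ** M'))"
proof -
  have "adj Mi ** Ai ** Mi ** (M ** A ** adj M') = adj Mi ** Ai ** (Mi ** M) ** A ** adj M'"
    by (simp only: matrix_mul_assoc)
  also have "\<dots> = adj Mi ** (Ai ** A) ** adj M'" by (simp only: M matrix_mul_assoc matrix_mul_rid)
  also have "\<dots> = adj (M' ** Mi)" by (simp add: A adj_mult)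
  finally show ?thesis by (simp add: trace_adj trace_mul_sym[of M'])
qed

end

context pseudohermitian_chart
begin

lemma smooth_ctheta: "smooth_on V (ctheta P)" and smooth_cobar: "smooth_on V (cobar P \<alpha>)"
  and smooth_TT: "smooth_on V (\<lambda>y. TT y)" and smooth_conn_trace: "smooth_on V (conn_trace P)"
  unfolding ctheta_def[abs_def] cobar_def[abs_def] conn_trace_def[abs_def]
  by (intro smooth_on_cv smooth_on_cnjv smooth_on_sum open_V smooth_theta smooth_reeb smooth_coframe smooth_conn)+

lemma smooth_hmat: "smooth_on V (\<lambda>y. hmat J P y $ \<alpha> $ \<beta>)"
proof -
  have "smooth_on V (\<lambda>y. - \<i> * diff1 (ctheta P) y (E \<alpha> y) (Eb \<beta> y))"
    by (intro smooth_on_mult smooth_on_const smooth_on_diff1 open_V smooth_ctheta smooth_frame smooth_on_cnjv)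
  from smooth_on_cong[THEN iffD1, OF open_V _ this] show ?thesis by (simp add: hmat_eq)
qed

lemma diff_hmat: "x \<in> V \<Longrightarrow> (\<lambda>y. hmat J P y $ \<alpha> $ \<beta>) differentiable (at x)"
  by (rule smooth_on_differentiable[OF smooth_hmat])

lemma tw_coframe:
  assumes "x \<in> V"
  shows "diff1 (coframe P \<alpha>) x Z W =
         (\<Sum>\<beta>\<in>UNIV. wedge (coframe P \<beta> x) (conn P \<beta> \<alpha> x) Z W)
       + (\<Sum>\<beta>\<in>UNIV. tors P \<beta> \<alpha> x * wedge (ctheta P x) (cobar P \<beta> x) Z W)"
  using tw assms unfolding tanaka_webster_def by blast

lemma tw_hmat:
  assumes "x \<in> V"
  shows "diff0 (\<lambda>y. hmat J P y $ \<alpha> $ \<beta>) x =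
         (\<Sum>\<gamma>\<in>UNIV. (hmat J P x $ \<gamma> $ \<beta>) *s conn P \<alpha> \<gamma> x)
       + (\<Sum>\<gamma>\<in>UNIV. (hmat J P x $ \<alpha> $ \<gamma>) *s cnjv (conn P \<beta> \<gamma> x))"
  using tw assms unfolding tanaka_webster_def by blast

text \<open>Contracting the first structure equation with the frame isolates the connection trace.
  The torsion term drops out because \<theta> and the conjugate coframe both vanish on (1,0)
  vectors.\<close>

lemma trace_dcoframe:
  assumes x: "x \<in> V"
  shows "(\<Sum>\<alpha>\<in>UNIV. diff1 (coframe P \<alpha>) x (E \<alpha> x) X) = ev (conn_trace P x) X
    - (\<Sum>\<alpha>\<in>UNIV. \<Sum>\<beta>\<in>UNIV. ev (coframe P \<beta> x) X * ev (conn P \<beta> \<alpha> x) (E \<alpha> x))"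
proof -
  have "diff1 (coframe P \<alpha>) x (E \<alpha> x) X = ev (conn P \<alpha> \<alpha> x) X
      - (\<Sum>\<beta>\<in>UNIV. ev (coframe P \<beta> x) X * ev (conn P \<beta> \<alpha> x) (E \<alpha> x))" for \<alpha>
    unfolding tw_coframe[OF x]
    by (simp add: wedge_def x sum_subtractf if_distrib[of "\<lambda>a. a * b" for b] cong: if_cong)
  then show ?thesis by (simp add: sum_subtractf conn_trace_def ev_simps)
qed

lemma dcobar_EEb:
  assumes x: "x \<in> V"
  shows "diff1 (cobar P \<alpha>) x (E \<gamma> x) (Eb \<delta> x) = - cnj (ev (conn P \<delta> \<alpha> x) (Eb \<gamma> x))"
proof -
  have "diff1 (coframe P \<alpha>) x (Eb \<gamma> x) (E \<delta> x) = - ev (conn P \<delta> \<alpha> x) (Eb \<gamma> x)"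
    unfolding tw_coframe[OF x]
    by (simp add: wedge_def x sum_negf if_distrib[of "\<lambda>a. a * b" for b] cong: if_cong)
  then show ?thesis
    using diff1_cnjv[OF diff_coframe[OF x], of \<alpha> "E \<gamma> x" "Eb \<delta> x"] by (simp add: cobar_def[abs_def])
qed

text \<open>The trace of metric compatibility. The right-hand side is d ln det h, so the real part
  of the connection trace is determined by the Levi matrix.\<close>

lemma conn_trace_re:
  assumes x: "x \<in> V"
  shows "conn_trace P x $ i + cnj (conn_trace P x $ i) =
    trace (matrix_inv (hmat J P x) ** (\<chi> \<alpha> \<beta>. pd i (\<lambda>y. hmat J P y $ \<alpha> $ \<beta>) x))"
proof -
  let ?h = "hmat J P x" and ?k = "matrix_inv (hmat J P x)"
  define C where "C = (\<chi> \<alpha> \<gamma>. conn P \<alpha> \<gamma> x $ i)"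
  have "pd i (\<lambda>y. hmat J P y $ \<alpha> $ \<beta>) x = (C ** ?h + ?h ** adj C) $ \<alpha> $ \<beta>" for \<alpha> \<beta>
    using arg_cong[OF tw_hmat[OF x, of \<alpha> \<beta>], of "\<lambda>a. a $ i"]
    by (simp add: matrix_matrix_mult_def C_def mult.commute)
  then have "(\<chi> \<alpha> \<beta>. pd i (\<lambda>y. hmat J P y $ \<alpha> $ \<beta>) x) = C ** ?h + ?h ** adj C"
    by (simp add: vec_eq_iff)
  then have "trace (?k ** (\<chi> \<alpha> \<beta>. pd i (\<lambda>y. hmat J P y $ \<alpha> $ \<beta>) x)) =
      trace (?k ** C ** ?h) + trace (?k ** ?h ** adj C)"
    by (simp add: matrix_add_ldistrib trace_add matrix_mul_assoc)
  also have "trace (?k ** C ** ?h) = trace (C ** ?h ** ?k)" by (rule trace_rotate)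
  also have "C ** ?h ** ?k = C" using hinv(1)[OF x] by (simp add: matrix_mul_assoc[symmetric])
  also have "?k ** ?h ** adj C = adj C" by (simp add: hinv(2)[OF x])
  finally show ?thesis by (simp add: trace_adj) (simp add: trace_def C_def conn_trace_def)
qed

lemma ricci_eq:
  assumes x: "x \<in> V"
  shows "ricci P \<beta> \<gamma> x = diff1 (conn_trace P) x (E \<beta> x) (Eb \<gamma> x)"
proof -
  obtain \<eta> where "\<And>Z W. diff1 (conn_trace P) x Z W =
      (\<Sum>\<beta>\<in>UNIV. \<Sum>\<gamma>\<in>UNIV. ricci P \<beta> \<gamma> x * wedge (coframe P \<beta> x) (cobar P \<gamma> x) Z W)
    + wedge (ctheta P x) \<eta> Z W"
    using ric x unfolding ricci_tensor_def by blast
  then show ?thesis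
    by (simp add: wedge_def x if_distrib[of "\<lambda>a. a * b" for b] if_distrib[of "\<lambda>a. b * a" for b] cong: if_cong)
qed

text \<open>Of the connection the Fefferman metric sees only the trace: directly in \<sigma>, and
  through its exterior derivative in the scalar curvature.\<close>

lemma scalar_curv_eq:
  assumes x: "x \<in> V"
  shows "scalar_curv J P x = Re (trace (matrix_inv (hmat J P x) **
    (\<chi> \<beta> \<gamma>. diff1 (conn_trace P) x (E \<beta> x) (Eb \<gamma> x))))"
  unfolding scalar_curv_def trace_mult by (subst sum.swap) (simp add: ricci_eq[OF x])

end

section \<open>Change of contact form\<close>

locale two_pseudohermitian = P: pseudohermitian_chart \<Omega> V H J P + Q: pseudohermitian_chart \<Omega> V H J Q
  for \<Omega> V :: "'n::finite rvec set" and H J P Q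
begin

text \<open>Here \<open>theta Q = rat \<cdot> theta P\<close> and \<open>rat \<cdot> reeb Q = reeb P + W1 + cnjv W1\<close>; the frame of \<open>Q\<close> is
  \<open>U\<close> times that of \<open>P\<close>, with inverse \<open>Ui\<close>. The forms \<open>phi\<close> are the coframe dual to the old frame
  and the new Reeb field, \<open>du = d ln |rat|\<close>, and \<open>lam = d ln det U\<close> written without a logarithm.\<close>

definition "rat y = theta Q y \<bullet> reeb P y"
abbreviation "crat y \<equiv> complex_of_real (rat y)"
definition "W \<alpha> y = crat y * ev (coframe P \<alpha> y) (cv (reeb Q y))"
definition "U \<alpha> \<beta> y = ev (coframe P \<beta> y) (frame Q \<alpha> y)"
definition "Ui \<alpha> \<beta> y = ev (coframe Q \<alpha> y) (frame P \<beta> y)"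
definition "phi \<beta> y = coframe P \<beta> y - W \<beta> y *s ctheta P y"
definition "du y = complex_of_real (theta P y \<bullet> reeb Q y) *s diff0 (\<lambda>z. crat z) y"
definition "lam y = (\<Sum>\<alpha>\<in>UNIV. \<Sum>\<beta>\<in>UNIV. Ui \<alpha> \<beta> y *s diff0 (U \<alpha> \<beta>) y)"
definition "W1 y = (\<Sum>\<alpha>\<in>UNIV. W \<alpha> y *s frame P \<alpha> y)"

lemma theta_Q: assumes y: "y \<in> V" shows "theta Q y = rat y *\<^sub>R theta P y"
proof (rule vector_eq_ldot[THEN iffD1], rule allI)
  fix v
  have t: "theta P y \<bullet> reeb P y = 1" using P.adm y by (simp add: admissible_coframe_def)
  have "theta P y \<bullet> (v - (theta P y \<bullet> v) *\<^sub>R reeb P y) = 0"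
    by (simp add: inner_diff_right t)
  then have "v - (theta P y \<bullet> v) *\<^sub>R reeb P y \<in> H y" using P.theta_kernel[OF y] by blast
  then have "theta Q y \<bullet> (v - (theta P y \<bullet> v) *\<^sub>R reeb P y) = 0" using Q.theta_kernel[OF y] by blast
  then show "v \<bullet> theta Q y = v \<bullet> (rat y *\<^sub>R theta P y)"
    by (simp add: inner_diff_right rat_def inner_commute)
qed

lemma rat_inverse: "y \<in> V \<Longrightarrow> rat y * (theta P y \<bullet> reeb Q y) = 1"
  using arg_cong[OF theta_Q, of y "\<lambda>a. a \<bullet> reeb Q y"] Q.adm by (simp add: admissible_coframe_def)

lemma rat_nz: "y \<in> V \<Longrightarrow> rat y \<noteq> 0"
  using rat_inverse by force

lemma ctheta_Q: "y \<in> V \<Longrightarrow> ctheta Q y = crat y *s ctheta P y"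
  by (simp add: ctheta_def theta_Q cv_scaleR)

lemma smooth_rat: "smooth_on V (\<lambda>y. crat y)"
  unfolding rat_def by (intro smooth_on_of_real smooth_on_inner P.open_V Q.smooth_theta P.smooth_reeb)
lemma smooth_W: "smooth_on V (W \<alpha>)"
  unfolding W_def[abs_def]
  by (intro smooth_on_mult smooth_rat smooth_on_ev P.open_V P.smooth_coframe Q.smooth_TT)
lemma smooth_U: "smooth_on V (U \<alpha> \<beta>)"
  unfolding U_def[abs_def] by (intro smooth_on_ev P.open_V P.smooth_coframe Q.smooth_frame)
lemma smooth_Ui: "smooth_on V (Ui \<alpha> \<beta>)"
  unfolding Ui_def[abs_def] by (intro smooth_on_ev P.open_V P.smooth_frame Q.smooth_coframe)
lemma smooth_du: "smooth_on V du"
  unfolding du_def[abs_def]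
  by (intro smooth_on_smult smooth_on_diff0 smooth_rat smooth_on_of_real smooth_on_inner P.open_V P.smooth_theta Q.smooth_reeb)
lemma smooth_lam: "smooth_on V lam"
  unfolding lam_def[abs_def] by (intro smooth_on_sum smooth_on_smult smooth_on_diff0 smooth_U smooth_Ui P.open_V)
lemma smooth_phi: "smooth_on V (phi \<alpha>)"
  unfolding phi_def[abs_def] by (intro smooth_on_diff smooth_on_smult smooth_W P.open_V P.smooth_coframe P.smooth_ctheta)

lemmas diffs = smooth_on_differentiable[OF smooth_rat] smooth_on_differentiable[OF smooth_W]
  smooth_on_differentiable[OF smooth_U] smooth_on_differentiable[OF smooth_Ui] smooth_on_differentiable[OF smooth_du]
  smooth_on_differentiable[OF smooth_lam] smooth_on_differentiable[OF smooth_phi]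
  P.diff_ctheta Q.diff_ctheta P.diff_coframe Q.diff_coframe P.diff_cobar P.diff_conn_trace Q.diff_conn_trace

lemma frame_Q: assumes y: "y \<in> V" shows "frame Q \<alpha> y = (\<Sum>\<beta>\<in>UNIV. U \<alpha> \<beta> y *s frame P \<beta> y)"
proof -
  obtain a where a: "frame Q \<alpha> y = (\<Sum>\<beta>\<in>UNIV. a \<beta> *s frame P \<beta> y)"
    using P.T10_span[OF y Q.frame_T10[OF y]] by blast
  have "U \<alpha> \<beta> y = a \<beta>" for \<beta>
    unfolding U_def a by (simp add: ev_simps y if_distrib cong: if_cong)
  then show ?thesis using a by simp
qed

lemma frame_P: assumes y: "y \<in> V" shows "frame P \<beta> y = (\<Sum>\<alpha>\<in>UNIV. Ui \<alpha> \<beta> y *s frame Q \<alpha> y)"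
proof -
  obtain a where a: "frame P \<beta> y = (\<Sum>\<alpha>\<in>UNIV. a \<alpha> *s frame Q \<alpha> y)"
    using Q.T10_span[OF y P.frame_T10[OF y]] by blast
  have "Ui \<alpha> \<beta> y = a \<alpha>" for \<alpha>
    unfolding Ui_def a by (simp add: ev_simps y if_distrib cong: if_cong)
  then show ?thesis using a by simp
qed

lemma Ui_U: assumes y: "y \<in> V" shows "(\<Sum>\<alpha>\<in>UNIV. Ui \<alpha> \<beta> y * U \<alpha> \<gamma> y) = (if \<beta> = \<gamma> then 1 else 0)"
proof -
  have "ev (coframe P \<gamma> y) (frame P \<beta> y) = (\<Sum>\<alpha>\<in>UNIV. Ui \<alpha> \<beta> y * U \<alpha> \<gamma> y)"
    by (subst frame_P[OF y]) (simp add: ev_simps U_def)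
  then show ?thesis using y by auto
qed

lemma U_Ui: assumes y: "y \<in> V" shows "(\<Sum>\<beta>\<in>UNIV. U \<alpha> \<beta> y * Ui \<gamma> \<beta> y) = (if \<alpha> = \<gamma> then 1 else 0)"
proof -
  have "ev (coframe Q \<gamma> y) (frame Q \<alpha> y) = (\<Sum>\<beta>\<in>UNIV. U \<alpha> \<beta> y * Ui \<gamma> \<beta> y)"
    by (subst frame_Q[OF y]) (simp add: ev_simps Ui_def)
  then show ?thesis using y by auto
qed

text \<open>The rescaled new Reeb field is real and has \<open>theta P\<close>-value 1, so it
  differs from the old one by a real vector of H, which is determined by its (1,0)-part.\<close>

lemma reeb_Q:
  assumes y: "y \<in> V"
  shows "crat y *s cv (reeb Q y) = cv (reeb P y) + W1 y + cnjv (W1 y)"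
proof -
  let ?X = "crat y *s cv (reeb Q y)"
  have 1: "ev (ctheta P y) ?X = 1"
    using Q.theta_T[OF y] ctheta_Q[OF y] by (simp add: ev_simps)
  have 2: "ev (coframe P \<alpha> y) ?X = W \<alpha> y" for \<alpha> by (simp add: W_def ev_simps)
  have "cnjv ?X = ?X" by (simp add: cnjv_smult)
  then have 3: "ev (cobar P \<alpha> y) ?X = cnj (W \<alpha> y)" for \<alpha>
    unfolding cobar_def using 2 ev_cnjv by metis
  show ?thesis
    by (subst P.decomposition[OF y]) (simp only: 1 2 3 W1_def cnjv_sum cnjv_smult vector_smult_lid)
qed

lemma phi_Eb [simp]: "y \<in> V \<Longrightarrow> ev (phi \<beta> y) (cnjv (frame P \<gamma> y)) = 0"
  and phi_E [simp]: "y \<in> V \<Longrightarrow> ev (phi \<beta> y) (frame P \<gamma> y) = (if \<beta> = \<gamma> then 1 else 0)"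
  and phi_T [simp]: "y \<in> V \<Longrightarrow> ev (phi \<beta> y) (cv (reeb P y)) = - W \<beta> y"
  by (simp_all add: phi_def ev_simps)

text \<open>The new coframe has to annihilate the new Reeb field, which accounts for the shift from
  \<open>coframe P\<close> to \<open>phi\<close>; on H only the inverse change of frame is
  left.\<close>

lemma coframe_Q: assumes y: "y \<in> V" shows "coframe Q \<alpha> y = (\<Sum>\<beta>\<in>UNIV. Ui \<alpha> \<beta> y *s phi \<beta> y)"
proof (rule P.covector_eqI[OF y])
  have e: "ev (coframe Q \<alpha> y) (frame P \<beta> y) = Ui \<alpha> \<beta> y" for \<beta> by (simp add: Ui_def)
  have b: "ev (coframe Q \<alpha> y) (cnjv (frame P \<beta> y)) = 0" for \<beta>
    by (subst frame_P[OF y]) (simp add: cnjv_sum cnjv_smult ev_simps y)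
  have "cv (reeb P y) = crat y *s cv (reeb Q y) - W1 y - cnjv (W1 y)" by (simp add: reeb_Q[OF y])
  from arg_cong[OF this, of "ev (coframe Q \<alpha> y)"]
  have "ev (coframe Q \<alpha> y) (cv (reeb P y)) = - (\<Sum>\<beta>\<in>UNIV. W \<beta> y * Ui \<alpha> \<beta> y)"
    using y by (simp add: ev_simps W1_def cnjv_sum cnjv_smult b e)
  then show "ev (coframe Q \<alpha> y) (cv (reeb P y)) = ev (\<Sum>\<beta>\<in>UNIV. Ui \<alpha> \<beta> y *s phi \<beta> y) (cv (reeb P y))"
    by (simp add: ev_simps y sum_negf mult.commute)
  show "ev (coframe Q \<alpha> y) (frame P \<beta> y) = ev (\<Sum>\<beta>\<in>UNIV. Ui \<alpha> \<beta> y *s phi \<beta> y) (frame P \<beta> y)" for \<beta>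
    by (simp add: e ev_simps y if_distrib cong: if_cong)
  show "ev (coframe Q \<alpha> y) (cnjv (frame P \<beta> y)) = ev (\<Sum>\<beta>\<in>UNIV. Ui \<alpha> \<beta> y *s phi \<beta> y) (cnjv (frame P \<beta> y))" for \<beta>
    by (simp add: b ev_simps y)
qed

lemma du_inverse: "y \<in> V \<Longrightarrow> diff0 (\<lambda>z. crat z) y = crat y *s du y"
  using arg_cong[OF rat_inverse, of y complex_of_real]
  by (simp add: du_def vector_smult_assoc)

lemma dtheta_Q:
  assumes y: "y \<in> V"
  shows "diff1 (ctheta Q) y Z X = crat y * (wedge (du y) (ctheta P y) Z X + diff1 (ctheta P) y Z X)"
proof -
  have "diff1 (ctheta Q) y Z X = diff1 (\<lambda>y. crat y *s ctheta P y) y Z X"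
    by (rule diff1_cong[OF P.open_V y]) (rule ctheta_Q)
  also have "\<dots> = wedge (diff0 (\<lambda>z. crat z) y) (ctheta P y) Z X + crat y * diff1 (ctheta P) y Z X"
    by (rule diff1_smult) (use y in \<open>auto intro: diffs\<close>)
  finally show ?thesis by (simp add: du_inverse[OF y] wedge_def ev_simps algebra_simps)
qed

lemma theta_W1 [simp]: "y \<in> V \<Longrightarrow> ev (ctheta P y) (W1 y) = 0"
  by (simp add: W1_def ev_simps)

text \<open>The new Reeb field contracts to 0 with the differential of the new contact form. On H
  this identifies du with the contraction of the old d\<theta> by the horizontal shift of the Reeb
  field, so \<open>W\<close> is a gradient of ln |rat|.\<close>

lemma du_H:
  assumes y: "y \<in> V" and X: "ev (ctheta P y) X = 0"
  shows "ev (du y) X = diff1 (ctheta P) y (W1 y) X + diff1 (ctheta P) y (cnjv (W1 y)) X"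
proof -
  let ?T = "crat y *s cv (reeb Q y)"
  have "0 = diff1 (ctheta Q) y ?T X" using y by (simp add: diff1_simps)
  also have "\<dots> = crat y * (wedge (du y) (ctheta P y) ?T X + diff1 (ctheta P) y ?T X)" by (rule dtheta_Q[OF y])
  finally have "wedge (du y) (ctheta P y) ?T X + diff1 (ctheta P) y ?T X = 0" using rat_nz[OF y] by simp
  then show ?thesis unfolding reeb_Q[OF y] wedge_def X using y
    by (simp add: ev_simps diff1_simps)
qed

lemma dtheta_W1_E: "y \<in> V \<Longrightarrow> diff1 (ctheta P) y (W1 y) (frame P \<gamma> y) = 0"
  and dtheta_W1_Eb: "y \<in> V \<Longrightarrow> diff1 (ctheta P) y (W1 y) (cnjv (frame P \<gamma> y)) = \<i> * (\<Sum>\<alpha>\<in>UNIV. hmat J P y $ \<alpha> $ \<gamma> * W \<alpha> y)"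
  and dtheta_W1b_Eb: "y \<in> V \<Longrightarrow> diff1 (ctheta P) y (cnjv (W1 y)) (cnjv (frame P \<gamma> y)) = 0"
  by (simp_all add: W1_def diff1_simps P.dtheta_EEb cnjv_sum cnjv_smult sum_distrib_left mult_ac)

lemma du_Eb: "y \<in> V \<Longrightarrow> ev (du y) (cnjv (frame P \<gamma> y)) = \<i> * (\<Sum>\<alpha>\<in>UNIV. hmat J P y $ \<alpha> $ \<gamma> * W \<alpha> y)"
  by (simp add: du_H dtheta_W1_Eb dtheta_W1b_Eb)

lemma du_real: assumes y: "y \<in> V" shows "cnjv (du y) = du y"
proof -
  have "diff0 (\<lambda>z. cnj (crat z)) y = cnjv (diff0 (\<lambda>z. crat z) y)"
    by (rule diff0_cnj) (use y in \<open>auto intro: diffs\<close>)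
  then show ?thesis by (simp add: du_def cnjv_smult)
qed

text \<open>\<open>DD\<close> is the covariant divergence of \<open>W1\<close>, and \<open>tau\<close> is the \<open>(0,1)\<close>-part of \<open>du\<close> along \<open>H\<close>. They
  express the change \<open>mu\<close> of the connection trace as \<open>(n + 1) du - (n + 2) tau + rho \<theta>\<close>; the scalar
  curvature changes by the trace of \<open>d mu\<close>, which is why its multiple in the Fefferman metric cancels
  the \<open>\<theta>\<close>-component of this change.\<close>

definition "NN y = (\<Sum>\<alpha>\<in>UNIV. \<Sum>\<beta>\<in>UNIV. hmat J P y $ \<alpha> $ \<beta> * W \<alpha> y * cnj (W \<beta> y))"
definition "D y \<gamma> \<epsilon> = ev (diff0 (W \<epsilon>) y) (frame P \<gamma> y) + (\<Sum>\<beta>\<in>UNIV. W \<beta> y * ev (conn P \<beta> \<epsilon> y) (frame P \<gamma> y))"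
definition "DD y = (\<Sum>\<gamma>\<in>UNIV. D y \<gamma> \<gamma>)"
definition "mu y = conn_trace Q y - conn_trace P y - lam y"
definition "tau y = (\<Sum>\<alpha>\<in>UNIV. (\<i> * (\<Sum>\<beta>\<in>UNIV. hmat J P y $ \<beta> $ \<alpha> * W \<beta> y)) *s cobar P \<alpha> y)"
definition "rho y = ev (mu y) (cv (reeb P y)) - (real CARD('n) + 1) * ev (du y) (cv (reeb P y))"

lemma dtheta_W1_W1b: "y \<in> V \<Longrightarrow> diff1 (ctheta P) y (W1 y) (cnjv (W1 y)) = \<i> * NN y"
proof -
  assume y: "y \<in> V"
  have "diff1 (ctheta P) y (W1 y) (cnjv (W1 y)) = (\<Sum>\<gamma>\<in>UNIV. cnj (W \<gamma> y) * diff1 (ctheta P) y (W1 y) (cnjv (frame P \<gamma> y)))"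
    by (subst (2) W1_def) (simp add: cnjv_sum cnjv_smult diff1_simps)
  also have "\<dots> = (\<Sum>\<gamma>\<in>UNIV. \<Sum>\<alpha>\<in>UNIV. \<i> * (hmat J P y $ \<alpha> $ \<gamma> * W \<alpha> y * cnj (W \<gamma> y)))"
    by (simp add: dtheta_W1_Eb[OF y] sum_distrib_left mult_ac)
  also have "\<dots> = \<i> * NN y" unfolding NN_def sum_distrib_left by (rule sum.swap)
  finally show ?thesis .
qed

lemma NN_real: assumes y: "y \<in> V" shows "cnj (NN y) = NN y"
proof -
  have "cnj (NN y) = (\<Sum>\<alpha>\<in>UNIV. \<Sum>\<beta>\<in>UNIV. hmat J P y $ \<beta> $ \<alpha> * W \<beta> y * cnj (W \<alpha> y))"
    by (simp add: NN_def P.hmat_hermitian[OF y] mult_ac)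
  also have "\<dots> = NN y" unfolding NN_def by (rule sum.swap)
  finally show ?thesis .
qed

lemma dphi:
  assumes y: "y \<in> V"
  shows "diff1 (phi \<beta>) y (frame P \<beta> y) X = diff1 (coframe P \<beta>) y (frame P \<beta> y) X
    - ev (diff0 (W \<beta>) y) (frame P \<beta> y) * ev (ctheta P y) X - W \<beta> y * diff1 (ctheta P) y (frame P \<beta> y) X"
proof -
  have "diff1 (phi \<beta>) y (frame P \<beta> y) X = diff1 (coframe P \<beta>) y (frame P \<beta> y) X
      - diff1 (\<lambda>y. W \<beta> y *s ctheta P y) y (frame P \<beta> y) X"
    unfolding phi_def[abs_def] by (rule diff1_diff) (use y in \<open>auto intro!: differentiable_smult diffs\<close>)
  also have "diff1 (\<lambda>y. W \<beta> y *s ctheta P y) y (frame P \<beta> y) X =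
      wedge (diff0 (W \<beta>) y) (ctheta P y) (frame P \<beta> y) X + W \<beta> y * diff1 (ctheta P) y (frame P \<beta> y) X"
    by (rule diff1_smult) (use y in \<open>auto intro!: diffs\<close>)
  finally show ?thesis using y by (simp add: wedge_def)
qed

text \<open>Obtained by differentiating the constant trace of U times its inverse. In this form
  \<open>lam\<close> matches the derivatives of the coefficients \<open>Ui\<close> that appear in
  the exterior derivative of the new coframe.\<close>

lemma lam_alt:
  assumes y: "y \<in> V"
  shows "ev (lam y) X = - (\<Sum>\<alpha>\<in>UNIV. \<Sum>\<beta>\<in>UNIV. U \<alpha> \<beta> y * ev (diff0 (Ui \<alpha> \<beta>) y) X)"
proof -
  have "diff0 (\<lambda>y. \<Sum>\<alpha>\<in>UNIV. \<Sum>\<beta>\<in>UNIV. U \<alpha> \<beta> y * Ui \<alpha> \<beta> y) y = diff0 (\<lambda>y. \<Sum>\<alpha>\<in>(UNIV :: 'n set). 1) y"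
    by (rule diff0_cong[OF P.open_V y]) (simp add: U_Ui)
  then have "0 = diff0 (\<lambda>y. \<Sum>\<alpha>\<in>UNIV. \<Sum>\<beta>\<in>UNIV. U \<alpha> \<beta> y * Ui \<alpha> \<beta> y) y" by simp
  also have "\<dots> = (\<Sum>\<alpha>\<in>UNIV. \<Sum>\<beta>\<in>UNIV. U \<alpha> \<beta> y *s diff0 (Ui \<alpha> \<beta>) y + Ui \<alpha> \<beta> y *s diff0 (U \<alpha> \<beta>) y)"
    by (simp add: diff0_sum diff0_mult diffs y differentiable_sum differentiable_mult)
  also have "\<dots> = (\<Sum>\<alpha>\<in>UNIV. \<Sum>\<beta>\<in>UNIV. U \<alpha> \<beta> y *s diff0 (Ui \<alpha> \<beta>) y) + lam y"
    by (simp add: sum.distrib lam_def)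
  finally have "lam y = - (\<Sum>\<alpha>\<in>UNIV. \<Sum>\<beta>\<in>UNIV. U \<alpha> \<beta> y *s diff0 (Ui \<alpha> \<beta>) y)"
    by (simp add: eq_neg_iff_add_eq_0 add.commute)
  then show ?thesis by (simp add: ev_simps)
qed

text \<open>On vectors killed by all \<open>phi\<close> the connection trace is the trace of the differentials of the
  coframe, which is computable without knowing the connection of \<open>Q\<close>.\<close>

lemma conn_trace_Q:
  assumes y: "y \<in> V" and X: "\<And>\<beta>. ev (phi \<beta> y) X = 0"
  shows "ev (mu y) X = - DD y * ev (ctheta P y) X - diff1 (ctheta P) y (W1 y) X"
proof -
  have cQ: "ev (coframe Q \<beta> y) X = 0" for \<beta> by (simp add: coframe_Q[OF y] ev_simps X)
  have cP: "ev (coframe P \<beta> y) X = W \<beta> y * ev (ctheta P y) X" for \<beta>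
    using X[of \<beta>] by (simp add: phi_def ev_simps)
  have phiQ: "ev (phi \<beta> y) (frame Q \<alpha> y) = U \<alpha> \<beta> y" for \<alpha> \<beta>
    by (simp add: frame_Q[OF y] ev_simps y if_distrib cong: if_cong)
  have d: "diff1 (coframe Q \<alpha>) y Z X =
      (\<Sum>\<beta>\<in>UNIV. Ui \<alpha> \<beta> y * diff1 (phi \<beta>) y Z X - ev (diff0 (Ui \<alpha> \<beta>) y) X * ev (phi \<beta> y) Z)" for \<alpha> Z
  proof -
    have "diff1 (coframe Q \<alpha>) y Z X = diff1 (\<lambda>y. \<Sum>\<beta>\<in>UNIV. Ui \<alpha> \<beta> y *s phi \<beta> y) y Z X"
      by (rule diff1_cong[OF P.open_V y]) (rule coframe_Q)
    also have "\<dots> = (\<Sum>\<beta>\<in>UNIV. diff1 (\<lambda>y. Ui \<alpha> \<beta> y *s phi \<beta> y) y Z X)"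
      by (rule diff1_sum) (use y in \<open>auto intro!: differentiable_smult diffs\<close>)
    also have "\<dots> = (\<Sum>\<beta>\<in>UNIV. wedge (diff0 (Ui \<alpha> \<beta>) y) (phi \<beta> y) Z X + Ui \<alpha> \<beta> y * diff1 (phi \<beta>) y Z X)"
      by (intro sum.cong refl diff1_smult) (use y in \<open>auto intro!: diffs\<close>)
    finally show ?thesis by (simp add: wedge_def X)
  qed
  \<comment> \<open>All \<open>coframe Q\<close> vanish on X, so the correction in
    \<open>trace_dcoframe\<close>, which involves individual connection forms of Q, is 0.\<close>
  have "ev (conn_trace Q y) X = (\<Sum>\<alpha>\<in>UNIV. diff1 (coframe Q \<alpha>) y (frame Q \<alpha> y) X)"
    using Q.trace_dcoframe[OF y, of X] by (simp add: cQ)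
  also have "\<dots> = (\<Sum>\<alpha>\<in>UNIV. \<Sum>\<beta>\<in>UNIV. Ui \<alpha> \<beta> y * diff1 (phi \<beta>) y (frame Q \<alpha> y) X) + ev (lam y) X"
    by (simp add: d phiQ lam_alt[OF y] sum_subtractf mult.commute)
  also have "(\<Sum>\<alpha>\<in>UNIV. \<Sum>\<beta>\<in>UNIV. Ui \<alpha> \<beta> y * diff1 (phi \<beta>) y (frame Q \<alpha> y) X) = (\<Sum>\<beta>\<in>UNIV. diff1 (phi \<beta>) y (frame P \<beta> y) X)"
    by (subst sum.swap) (simp add: frame_P[OF y] diff1_simps)
  also have "\<dots> = (\<Sum>\<beta>\<in>UNIV. diff1 (coframe P \<beta>) y (frame P \<beta> y) X)
      - (\<Sum>\<beta>\<in>UNIV. ev (diff0 (W \<beta>) y) (frame P \<beta> y)) * ev (ctheta P y) X - diff1 (ctheta P) y (W1 y) X"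
    by (simp add: dphi[OF y] sum_subtractf sum_distrib_right W1_def diff1_simps)
  also have "(\<Sum>\<beta>\<in>UNIV. diff1 (coframe P \<beta>) y (frame P \<beta> y) X) = ev (conn_trace P y) X
      - (\<Sum>\<alpha>\<in>UNIV. \<Sum>\<beta>\<in>UNIV. W \<beta> y * ev (conn P \<beta> \<alpha> y) (frame P \<alpha> y)) * ev (ctheta P y) X"
    by (simp add: P.trace_dcoframe[OF y] cP sum_distrib_left mult_ac)
  finally show ?thesis
    by (simp add: mu_def ev_simps DD_def D_def sum.distrib algebra_simps)
qed

lemma mu_Eb: "y \<in> V \<Longrightarrow> ev (mu y) (cnjv (frame P \<gamma> y)) = - ev (du y) (cnjv (frame P \<gamma> y))"
  by (subst conn_trace_Q) (simp_all add: dtheta_W1_Eb du_Eb)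

lemma phi_W1: "y \<in> V \<Longrightarrow> ev (phi \<beta> y) (W1 y) = W \<beta> y"
  and phi_W1b: "y \<in> V \<Longrightarrow> ev (phi \<beta> y) (cnjv (W1 y)) = 0"
  by (simp_all add: W1_def cnjv_sum cnjv_smult ev_simps if_distrib cong: if_cong)

text \<open>By \<open>reeb_Q\<close> the argument is a multiple of the new Reeb field, on which all
  \<open>phi\<close> vanish.\<close>

lemma mu_T: "y \<in> V \<Longrightarrow> ev (mu y) (cv (reeb P y) + W1 y + cnjv (W1 y)) = - DD y - \<i> * NN y"
  by (subst conn_trace_Q)
    (simp_all add: phi_W1 phi_W1b ev_add_right diff1_add_right dtheta_W1_W1b)

end

section \<open>Levi matrix, connection trace and scalar curvature under a change of contact
  form\<close>

context two_pseudohermitian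
begin

lemma hmat_Q: assumes y: "y \<in> V"
  shows "hmat J Q y = rat y *\<^sub>R ((\<chi> \<alpha> \<beta>. U \<alpha> \<beta> y) ** hmat J P y ** adj (\<chi> \<alpha> \<beta>. U \<alpha> \<beta> y))"
proof -
  have "hmat J Q y $ \<alpha> $ \<beta> = crat y * (\<Sum>\<gamma>\<in>UNIV. \<Sum>\<delta>\<in>UNIV. U \<alpha> \<gamma> y * hmat J P y $ \<gamma> $ \<delta> * cnj (U \<beta> \<delta> y))" for \<alpha> \<beta>
  proof -
    have th: "ev (ctheta P y) (frame Q \<alpha> y) = 0" "ev (ctheta P y) (cnjv (frame Q \<alpha> y)) = 0" for \<alpha>
      using Q.frame_T10[OF y] y by simp_all
    have "hmat J Q y $ \<alpha> $ \<beta> = - \<i> * (crat y * diff1 (ctheta P) y (frame Q \<alpha> y) (cnjv (frame Q \<beta> y)))"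
      unfolding Q.hmat_eq[OF y] dtheta_Q[OF y] by (simp add: wedge_def th)
    also have "diff1 (ctheta P) y (frame Q \<alpha> y) (cnjv (frame Q \<beta> y)) =
        \<i> * (\<Sum>\<gamma>\<in>UNIV. \<Sum>\<delta>\<in>UNIV. U \<alpha> \<gamma> y * hmat J P y $ \<gamma> $ \<delta> * cnj (U \<beta> \<delta> y))"
      by (simp add: frame_Q[OF y] cnjv_sum cnjv_smult diff1_simps P.dtheta_EEb[OF y] sum_distrib_left mult_ac)
        (rule sum.swap)
    finally show ?thesis by (simp add: complex_eq_iff)
  qed
  moreover have "(\<Sum>\<gamma>\<in>UNIV. \<Sum>\<delta>\<in>UNIV. U \<alpha> \<gamma> y * hmat J P y $ \<gamma> $ \<delta> * cnj (U \<beta> \<delta> y)) =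
     ((\<chi> \<alpha> \<beta>. U \<alpha> \<beta> y) ** hmat J P y ** adj (\<chi> \<alpha> \<beta>. U \<alpha> \<beta> y)) $ \<alpha> $ \<beta>" for \<alpha> \<beta>
    by (subst sum.swap) (simp add: matrix_matrix_mult_def sum_distrib_right)
  ultimately show ?thesis by (simp add: vec_eq_iff) (simp add: scaleR_conv_of_real)
qed

lemma U_inverse:
  assumes y: "y \<in> V"
  shows "(\<chi> \<alpha> \<beta>. U \<alpha> \<beta> y) ** (\<chi> \<beta> \<alpha>. Ui \<alpha> \<beta> y) = mat 1" "(\<chi> \<beta> \<alpha>. Ui \<alpha> \<beta> y) ** (\<chi> \<alpha> \<beta>. U \<alpha> \<beta> y) = mat 1"
  by (simp_all add: vec_eq_iff matrix_matrix_mult_def mat_def U_Ui[OF y] Ui_U[OF y])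

lemma lam_trace: "lam y $ i = trace ((\<chi> \<beta> \<alpha>. Ui \<alpha> \<beta> y) ** (\<chi> \<alpha> \<beta>. pd i (U \<alpha> \<beta>) y))"
  unfolding trace_mult lam_def by (subst sum.swap) simp

lemma pd_hmat_Q:
  fixes i
  assumes y: "y \<in> V"
  defines "M \<equiv> (\<chi> \<alpha> \<beta>. U \<alpha> \<beta> y)" and "M' \<equiv> (\<chi> \<alpha> \<beta>. pd i (U \<alpha> \<beta>) y)" and "h \<equiv> hmat J P y"
    and "h' \<equiv> (\<chi> \<alpha> \<beta>. pd i (\<lambda>z. hmat J P z $ \<alpha> $ \<beta>) y)"
  shows "(\<chi> \<alpha> \<beta>. pd i (\<lambda>z. hmat J Q z $ \<alpha> $ \<beta>) y) = rat y *\<^sub>R (M' ** h ** adj M + M ** h' ** adj M + M ** h ** adj M')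
    + pd i rat y *\<^sub>R (M ** h ** adj M)"
proof -
  have dr: "rat differentiable (at y)"
    using smooth_on_differentiable[OF smooth_on_inner[OF P.open_V Q.smooth_theta P.smooth_reeb] y]
    by (simp add: rat_def[abs_def])
  have dh: "(\<lambda>z. hmat J P z $ \<alpha> $ \<beta>) differentiable (at y)" for \<alpha> \<beta> by (rule P.diff_hmat[OF y])
  have dU: "(\<lambda>z. U \<alpha> \<beta> z) differentiable (at y)" for \<alpha> \<beta> by (rule diffs(3)[OF y])
  have sm: "hmat J Q z $ \<alpha> $ \<beta> = (\<Sum>\<delta>\<in>UNIV. \<Sum>\<gamma>\<in>UNIV. crat z * (U \<alpha> \<gamma> z * hmat J P z $ \<gamma> $ \<delta> * cnj (U \<beta> \<delta> z)))"
    if "z \<in> V" for z \<alpha> \<beta>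
    unfolding hmat_Q[OF that]
    by (simp add: matrix_matrix_mult_def sum_distrib_right sum_distrib_left)
      (simp add: scaleR_conv_of_real sum_distrib_left)
  have "pd i (\<lambda>z. hmat J Q z $ \<alpha> $ \<beta>) y = (\<Sum>\<delta>\<in>UNIV. \<Sum>\<gamma>\<in>UNIV.
      crat y * (pd i (U \<alpha> \<gamma>) y * hmat J P y $ \<gamma> $ \<delta> * cnj (U \<beta> \<delta> y) + U \<alpha> \<gamma> y * pd i (\<lambda>z. hmat J P z $ \<gamma> $ \<delta>) y * cnj (U \<beta> \<delta> y)
        + U \<alpha> \<gamma> y * hmat J P y $ \<gamma> $ \<delta> * cnj (pd i (U \<beta> \<delta>) y))
      + complex_of_real (pd i rat y) * (U \<alpha> \<gamma> y * hmat J P y $ \<gamma> $ \<delta> * cnj (U \<beta> \<delta> y)))" for \<alpha> \<beta>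
    by (subst pd_cong[OF P.open_V y sm], assumption)
      (simp add: pd_sum pd_mult pd_cnj pd_of_real dr dh dU differentiable_sum differentiable_mult
        differentiable_cnj differentiable_of_real algebra_simps)
  then show ?thesis
    by (simp add: vec_eq_iff M_def M'_def h_def h'_def matrix_matrix_mult_def sum_distrib_right sum_distrib_left)
      (simp add: scaleR_conv_of_real sum_distrib_left sum.distrib algebra_simps)
qed

text \<open>Twice the real part of a connection trace is d ln det h. Passing from P to Q multiplies
  det h by rat^n |det U|^2, which contributes n du together with \<open>lam\<close> and its
  conjugate; the latter two are subtracted in the definition of \<open>mu\<close>.\<close>

lemma mu_re: assumes y: "y \<in> V" shows "mu y + cnjv (mu y) = of_nat CARD('n) *s du y"
proof -
  define M where "M = (\<chi> \<alpha> \<beta>. U \<alpha> \<beta> y)"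
  define Mi where "Mi = (\<chi> \<beta> \<alpha>. Ui \<alpha> \<beta> y)"
  define h where "h = hmat J P y"
  define k where "k = matrix_inv h"
  have hk: "h ** k = mat 1" "k ** h = mat 1" unfolding h_def k_def by (rule P.hinv[OF y])+
  have M: "M ** Mi = mat 1" "Mi ** M = mat 1" unfolding M_def Mi_def by (rule U_inverse[OF y])+
  have "(mu y + cnjv (mu y)) $ i = (of_nat CARD('n) *s du y) $ i" for i
  proof -
    define M' where "M' = (\<chi> \<alpha> \<beta>. pd i (U \<alpha> \<beta>) y)"
    define h' where "h' = (\<chi> \<alpha> \<beta>. pd i (\<lambda>z. hmat J P z $ \<alpha> $ \<beta>) y)"
    define K where "K = adj Mi ** k ** Mi"
    have r: "rat y \<noteq> 0" by (rule rat_nz[OF y])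
    have "conn_trace Q y $ i + cnj (conn_trace Q y $ i) =
        trace ((1 / rat y) *\<^sub>R K ** (rat y *\<^sub>R (M' ** h ** adj M + M ** h' ** adj M + M ** h ** adj M')
        + pd i rat y *\<^sub>R (M ** h ** adj M)))"
      unfolding Q.conn_trace_re[OF y] pd_hmat_Q[OF y] hmat_Q[OF y]
      unfolding M_def[symmetric] h_def[symmetric] M'_def[symmetric] h'_def[symmetric] K_def
        sandwich_inv[OF hk M r] ..
    also have "\<dots> = trace (K ** (M' ** h ** adj M)) + trace (K ** (M ** h' ** adj M)) + trace (K ** (M ** h ** adj M'))
        + complex_of_real (pd i rat y / rat y) * trace (K ** (M ** h ** adj M))"
      using r by (simp add: matrix_add_ldistrib trace_add matrix_scalar_ac scalar_matrix_assoc[symmetric] trace_scaleR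
          scaleR_right_distrib)
    also have "\<dots> = trace (Mi ** M') + trace (k ** h') + cnj (trace (Mi ** M')) + complex_of_real (pd i rat y / rat y) * of_nat CARD('n)"
      unfolding K_def sandwich_trace[OF hk M] sandwich_trace1[OF hk M] sandwich_trace2[OF hk M]
      by (simp add: hk M trace_I)
    also have "trace (k ** h') = conn_trace P y $ i + cnj (conn_trace P y $ i)"
      unfolding P.conn_trace_re[OF y] k_def h_def h'_def ..
    also have "trace (Mi ** M') = lam y $ i" by (simp add: lam_trace M'_def Mi_def)
    also have "complex_of_real (pd i rat y / rat y) = du y $ i"
    proof -
      have dr: "rat differentiable (at y)"
        using smooth_on_differentiable[OF smooth_on_inner[OF P.open_V Q.smooth_theta P.smooth_reeb] y]
        by (simp add: rat_def[abs_def])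
      have "theta P y \<bullet> reeb Q y = 1 / rat y" using rat_inverse[OF y] r by (simp add: field_simps)
      then show ?thesis by (simp add: du_def pd_of_real[OF dr])
    qed
    finally show ?thesis by (simp add: mu_def algebra_simps)
  qed
  then show ?thesis by (simp add: vec_eq_iff)
qed

lemma du_cnj: "y \<in> V \<Longrightarrow> ev (du y) (cnjv X) = cnj (ev (du y) X)"
  by (metis du_real ev_cnjv)

text \<open>Of the factor n + 1, n comes from \<open>mu_re\<close> and 1 from the conjugate of the
  value in \<open>mu_Eb\<close>.\<close>

lemma mu_E: assumes y: "y \<in> V"
  shows "ev (mu y) (frame P \<gamma> y) = (real CARD('n) + 1) * ev (du y) (frame P \<gamma> y)"
proof -
  have "ev (mu y + cnjv (mu y)) (frame P \<gamma> y) = of_nat CARD('n) * ev (du y) (frame P \<gamma> y)"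
    by (simp add: mu_re[OF y] ev_simps)
  moreover have "ev (cnjv (mu y)) (frame P \<gamma> y) = - ev (du y) (frame P \<gamma> y)"
    using mu_Eb[OF y, of \<gamma>] by (simp add: ev_cnjv_left du_cnj[OF y])
  ultimately show ?thesis by (simp add: ev_simps algebra_simps)
qed

text \<open>\<open>mu\<close> is known on the new Reeb direction and on H, so its value on the old
  Reeb field follows by subtracting the parts along \<open>W1\<close> and its conjugate. There du
  equals - i NN and i NN, weighted by n + 1 and -1 respectively, so the two parts do not
  cancel.\<close>

lemma rho_eq: assumes y: "y \<in> V"
  shows "rho y = - DD y + \<i> * (real CARD('n) + 1) * NN y - (real CARD('n) + 1) * ev (du y) (cv (reeb P y))"
proof -
  have 1: "ev (mu y) (W1 y) = (real CARD('n) + 1) * ev (du y) (W1 y)"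
    by (simp add: W1_def ev_simps mu_E[OF y] sum_distrib_left mult_ac)
  have 2: "ev (mu y) (cnjv (W1 y)) = - ev (du y) (cnjv (W1 y))"
    by (simp add: W1_def cnjv_sum cnjv_smult ev_simps mu_Eb[OF y] sum_negf)
  have 3: "ev (du y) (cnjv (W1 y)) = \<i> * NN y"
    using du_H[OF y, of "cnjv (W1 y)"] y by (simp add: dtheta_W1_W1b)
  have 4: "ev (du y) (W1 y) = - \<i> * NN y"
    using du_H[OF y, of "W1 y"] y dtheta_W1_W1b[OF y] diff1_antisym[of "ctheta P" y "cnjv (W1 y)" "W1 y"] by simp
  have "ev (mu y) (cv (reeb P y)) = - DD y - \<i> * NN y - ev (mu y) (W1 y) - ev (mu y) (cnjv (W1 y))"
    using mu_T[OF y] by (simp add: ev_simps algebra_simps)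
  then show ?thesis unfolding rho_def 1 2 3 4 by (simp add: algebra_simps)
qed

lemma tau_E: "y \<in> V \<Longrightarrow> ev (tau y) (frame P \<gamma> y) = 0"
  and tau_T: "y \<in> V \<Longrightarrow> ev (tau y) (cv (reeb P y)) = 0"
  and tau_Eb: "y \<in> V \<Longrightarrow> ev (tau y) (cnjv (frame P \<gamma> y)) = ev (du y) (cnjv (frame P \<gamma> y))"
  by (simp_all add: tau_def ev_simps du_Eb if_distrib cong: if_cong)

text \<open>On (1,0) vectors \<open>tau\<close> vanishes and the coefficient is n + 1; on (0,1)
  vectors \<open>tau\<close> equals du and the coefficient is (n + 1) - (n + 2) = -1;
  \<open>rho\<close> is defined so that the values on the Reeb field agree.\<close>

lemma mu_eq: assumes y: "y \<in> V"
  shows "mu y = (real CARD('n) + 1) *s du y - (real CARD('n) + 2) *s tau y + rho y *s ctheta P y"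
  by (rule P.covector_eqI[OF y])
    (simp_all add: ev_simps y tau_E tau_T tau_Eb mu_E mu_Eb rho_def algebra_simps)

lemma smooth_mu: "smooth_on V mu"
  unfolding mu_def[abs_def] by (intro smooth_on_diff P.open_V Q.smooth_conn_trace P.smooth_conn_trace smooth_lam)

lemma diff_tau_coeff: "y \<in> V \<Longrightarrow> (\<lambda>z. \<i> * (\<Sum>\<beta>\<in>UNIV. hmat J P z $ \<beta> $ \<alpha> * W \<beta> z)) differentiable (at y)"
  by (intro differentiable_mult differentiable_sum finite ballI differentiable_const P.diff_hmat diffs)

lemma diff_tau: "y \<in> V \<Longrightarrow> tau differentiable (at y)"
  unfolding tau_def[abs_def]
  by (intro differentiable_sum finite ballI differentiable_smult diff_tau_coeff P.diff_cobar)

lemma smooth_rho: "smooth_on V rho"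
  unfolding rho_def[abs_def]
  by (intro smooth_on_diff smooth_on_mult smooth_on_const smooth_on_ev P.open_V smooth_mu smooth_du P.smooth_TT)

lemmas diff_rho = smooth_on_differentiable[OF smooth_rho]

text \<open>The conjugate connection forms enter twice, from differentiating h and from the exterior
  derivative of the conjugate coframe, and cancel. The unconjugated ones complete dW to the
  covariant derivative \<open>D\<close>, lowered by h.\<close>

lemma dtau: assumes y: "y \<in> V"
  shows "diff1 tau y (frame P \<gamma> y) (cnjv (frame P \<delta> y)) = \<i> * (\<Sum>\<epsilon>\<in>UNIV. D y \<gamma> \<epsilon> * hmat J P y $ \<epsilon> $ \<delta>)"
proof -
  define c where "c \<alpha> z = \<i> * (\<Sum>\<beta>\<in>UNIV. hmat J P z $ \<beta> $ \<alpha> * W \<beta> z)" for \<alpha> z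
  let ?E = "frame P \<gamma> y" and ?Eb = "cnjv (frame P \<delta> y)"
  let ?h = "\<lambda>\<alpha> \<beta>. hmat J P y $ \<alpha> $ \<beta>"
  have dc: "c \<alpha> differentiable (at y)" for \<alpha> unfolding c_def[abs_def] by (rule diff_tau_coeff[OF y])
  have hE: "ev (diff0 (\<lambda>z. hmat J P z $ \<beta> $ \<delta>) y) ?E = (\<Sum>\<epsilon>\<in>UNIV. ?h \<epsilon> \<delta> * ev (conn P \<beta> \<epsilon> y) ?E)
      + (\<Sum>\<epsilon>\<in>UNIV. ?h \<beta> \<epsilon> * cnj (ev (conn P \<delta> \<epsilon> y) (cnjv ?E)))" for \<beta>
    unfolding P.tw_hmat[OF y] by (simp add: ev_simps ev_cnjv_left)
  have "diff1 tau y ?E ?Eb = (\<Sum>\<alpha>\<in>UNIV. diff1 (\<lambda>z. c \<alpha> z *s cobar P \<alpha> z) y ?E ?Eb)"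
    unfolding tau_def[abs_def] c_def[symmetric]
    by (rule diff1_sum) (use y dc in \<open>auto intro!: differentiable_smult diffs\<close>)
  also have "\<dots> = (\<Sum>\<alpha>\<in>UNIV. wedge (diff0 (c \<alpha>) y) (cobar P \<alpha> y) ?E ?Eb + c \<alpha> y * diff1 (cobar P \<alpha>) y ?E ?Eb)"
    by (intro sum.cong refl diff1_smult dc diffs y)
  also have "\<dots> = ev (diff0 (c \<delta>) y) ?E - (\<Sum>\<alpha>\<in>UNIV. c \<alpha> y * cnj (ev (conn P \<delta> \<alpha> y) (cnjv (frame P \<gamma> y))))"
    by (simp add: wedge_def y P.dcobar_EEb sum_subtractf if_distrib[of "\<lambda>a. b * a" for b] cong: if_cong)
  also have "ev (diff0 (c \<delta>) y) ?E = \<i> * (\<Sum>\<beta>\<in>UNIV. ?h \<beta> \<delta> * ev (diff0 (W \<beta>) y) ?E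
      + W \<beta> y * ev (diff0 (\<lambda>z. hmat J P z $ \<beta> $ \<delta>) y) ?E)"
  proof -
    have "diff0 (c \<delta>) y = \<i> *s (\<Sum>\<beta>\<in>UNIV. ?h \<beta> \<delta> *s diff0 (W \<beta>) y + W \<beta> y *s diff0 (\<lambda>z. hmat J P z $ \<beta> $ \<delta>) y)"
      unfolding c_def[abs_def] using y
      by (simp add: diff0_mult diff0_sum P.diff_hmat diffs differentiable_mult differentiable_sum)
    then show ?thesis by (simp add: ev_simps)
  qed
  finally have e: "diff1 tau y ?E ?Eb = \<i> * (\<Sum>\<beta>\<in>UNIV. ?h \<beta> \<delta> * ev (diff0 (W \<beta>) y) ?E)
     + \<i> * (\<Sum>\<beta>\<in>UNIV. \<Sum>\<epsilon>\<in>UNIV. W \<beta> y * (?h \<epsilon> \<delta> * ev (conn P \<beta> \<epsilon> y) ?E))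
     + \<i> * (\<Sum>\<beta>\<in>UNIV. \<Sum>\<epsilon>\<in>UNIV. W \<beta> y * (?h \<beta> \<epsilon> * cnj (ev (conn P \<delta> \<epsilon> y) (cnjv ?E))))
     - \<i> * (\<Sum>\<epsilon>\<in>UNIV. \<Sum>\<beta>\<in>UNIV. W \<beta> y * (?h \<beta> \<epsilon> * cnj (ev (conn P \<delta> \<epsilon> y) (cnjv ?E))))"
    by (simp add: hE c_def sum.distrib sum_distrib_left sum_distrib_right distrib_left mult_ac)
  also have "(\<Sum>\<epsilon>\<in>UNIV. \<Sum>\<beta>\<in>UNIV. W \<beta> y * (?h \<beta> \<epsilon> * cnj (ev (conn P \<delta> \<epsilon> y) (cnjv ?E))))
      = (\<Sum>\<beta>\<in>UNIV. \<Sum>\<epsilon>\<in>UNIV. W \<beta> y * (?h \<beta> \<epsilon> * cnj (ev (conn P \<delta> \<epsilon> y) (cnjv ?E))))"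
    by (rule sum.swap)
  also have "(\<Sum>\<beta>\<in>UNIV. \<Sum>\<epsilon>\<in>UNIV. W \<beta> y * (?h \<epsilon> \<delta> * ev (conn P \<beta> \<epsilon> y) ?E))
      = (\<Sum>\<epsilon>\<in>UNIV. \<Sum>\<beta>\<in>UNIV. W \<beta> y * (?h \<epsilon> \<delta> * ev (conn P \<beta> \<epsilon> y) ?E))"
    by (rule sum.swap)
  finally show ?thesis
    by (simp add: D_def sum.distrib sum_distrib_left sum_distrib_right distrib_left distrib_right mult_ac)
qed

text \<open>\<open>lam\<close> is tr(U^-1 dU). Since d(U^-1) = - U^-1 dU U^-1, its exterior
  derivative is minus the trace of the wedge square of U^-1 dU, which vanishes by cyclicity. No
  branch of ln det U has to be chosen.\<close>

lemma dlam: assumes y: "y \<in> V" shows "diff1 lam y X Z = 0"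
proof -
  define M where "M = (\<chi> \<alpha> \<beta>. U \<alpha> \<beta> y)"
  define Mi where "Mi = (\<chi> \<beta> \<alpha>. Ui \<alpha> \<beta> y)"
  have M: "M ** Mi = mat 1" "Mi ** M = mat 1" unfolding M_def Mi_def by (rule U_inverse[OF y])+
  define A where "A X = (\<chi> \<alpha> \<beta>. ev (diff0 (U \<alpha> \<beta>) y) X)" for X
  define B where "B X = (\<chi> \<beta> \<alpha>. ev (diff0 (Ui \<alpha> \<beta>) y) X)" for X
  have "diff1 lam y X Z = (\<Sum>\<alpha>\<in>UNIV. \<Sum>\<beta>\<in>UNIV. diff1 (\<lambda>y. Ui \<alpha> \<beta> y *s diff0 (U \<alpha> \<beta>) y) y X Z)"
  proof -
    have d: "(\<lambda>y. Ui \<alpha> \<beta> y *s diff0 (U \<alpha> \<beta>) y) differentiable (at y)" for \<alpha> \<beta>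
      by (intro differentiable_smult diffs y smooth_on_differentiable[OF smooth_on_diff0[OF P.open_V smooth_U]])
    show ?thesis unfolding lam_def[abs_def]
      by (simp add: diff1_sum d differentiable_sum)
  qed
  also have "\<dots> = (\<Sum>\<alpha>\<in>UNIV. \<Sum>\<beta>\<in>UNIV. wedge (diff0 (Ui \<alpha> \<beta>) y) (diff0 (U \<alpha> \<beta>) y) X Z)"
    by (intro sum.cong refl, subst diff1_smult)
      (auto intro!: diffs y smooth_on_differentiable[OF smooth_on_diff0[OF P.open_V smooth_U]]
        simp: diff1_diff0[OF P.open_V y smooth_U])
  also have "\<dots> = trace (B X ** A Z) - trace (B Z ** A X)"
    unfolding trace_mult by (subst (1 2) sum.swap) (simp add: wedge_def A_def B_def sum_subtractf)
  finally have 1: "diff1 lam y X Z = trace (B X ** A Z) - trace (B Z ** A X)" .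
  have 2: "B X = - (Mi ** A X ** Mi)" for X
  proof -
    have "diff0 (\<lambda>y. \<Sum>\<alpha>\<in>UNIV. Ui \<alpha> \<beta> y * U \<alpha> \<gamma> y) y = diff0 (\<lambda>y. if \<beta> = \<gamma> then 1 else 0) y" for \<beta> \<gamma>
      by (rule diff0_cong[OF P.open_V y]) (rule Ui_U)
    then have "0 = ev (diff0 (\<lambda>y. \<Sum>\<alpha>\<in>UNIV. Ui \<alpha> \<beta> y * U \<alpha> \<gamma> y) y) X" for \<beta> \<gamma> by simp
    then have "0 = (\<Sum>\<alpha>\<in>UNIV. Ui \<alpha> \<beta> y * ev (diff0 (U \<alpha> \<gamma>) y) X + U \<alpha> \<gamma> y * ev (diff0 (Ui \<alpha> \<beta>) y) X)" for \<beta> \<gamma>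
      by (simp add: diff0_sum diff0_mult diffs y differentiable_sum differentiable_mult ev_simps)
    then have "B X ** M + Mi ** A X = 0"
      by (simp add: vec_eq_iff matrix_matrix_mult_def B_def A_def M_def Mi_def sum.distrib add.commute mult.commute)
    then have "B X ** M = - (Mi ** A X)" by (simp add: eq_neg_iff_add_eq_0)
    then have "B X ** M ** Mi = - (Mi ** A X) ** Mi" by simp
    moreover have "B X ** M ** Mi = B X" by (simp add: M matrix_mul_assoc[symmetric])
    moreover have "- (Mi ** A X) ** Mi = - (Mi ** A X ** Mi)"
      by (simp add: vec_eq_iff matrix_matrix_mult_def sum_negf)
    ultimately show ?thesis by simp
  qed
  have neg: "trace (- C ** F) = - trace (C ** F)" for C F :: "complex ^ 'n ^ 'n"
    by (simp add: trace_mult sum_negf)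
  have "trace (Mi ** A X ** Mi ** A Z) = trace ((Mi ** A X) ** (Mi ** A Z))" by (simp only: matrix_mul_assoc)
  also have "\<dots> = trace ((Mi ** A Z) ** (Mi ** A X))" by (rule trace_mul_sym)
  also have "\<dots> = trace (Mi ** A Z ** Mi ** A X)" by (simp only: matrix_mul_assoc)
  finally show ?thesis unfolding 1 2 neg by simp
qed

text \<open>du is g d rat with g = 1 / rat, and dg is again a multiple of d rat.\<close>

lemma ddu: assumes y: "y \<in> V" shows "diff1 du y X Z = 0"
proof -
  define g where "g z = complex_of_real (theta P z \<bullet> reeb Q z)" for z
  have sg: "smooth_on V g" unfolding g_def[abs_def]
    by (intro smooth_on_of_real smooth_on_inner P.open_V P.smooth_theta Q.smooth_reeb)
  have gr: "g z * crat z = 1" if "z \<in> V" for z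
    using arg_cong[OF rat_inverse[OF that], of complex_of_real] by (simp add: g_def mult.commute)
  have "diff0 (\<lambda>z. g z * crat z) y = diff0 (\<lambda>z. 1) y"
    by (rule diff0_cong[OF P.open_V y gr])
  then have "g y *s diff0 (\<lambda>z. crat z) y + crat y *s diff0 g y = 0"
    by (simp add: diff0_mult diffs y smooth_on_differentiable[OF sg y])
  then have "g y *s (g y *s diff0 (\<lambda>z. crat z) y + crat y *s diff0 g y) = 0" by simp
  then have dg: "diff0 g y = - (g y * g y) *s diff0 (\<lambda>z. crat z) y"
    using gr[OF y] by (simp add: vec.scale_right_distrib vector_smult_assoc add_eq_0_iff vec_eq_iff)
  have "diff1 du y X Z = wedge (diff0 g y) (diff0 (\<lambda>z. crat z) y) X Z + g y * diff1 (diff0 (\<lambda>z. crat z)) y X Z"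
    unfolding du_def[abs_def] g_def[symmetric]
    by (rule diff1_smult) (auto intro!: y smooth_on_differentiable[OF sg]
        smooth_on_differentiable[OF smooth_on_diff0[OF P.open_V smooth_rat]])
  then show ?thesis
    by (simp add: dg diff1_diff0[OF P.open_V y smooth_rat] wedge_def ev_simps)
qed

lemma dmu: assumes y: "y \<in> V"
  shows "diff1 mu y (frame P \<gamma> y) (cnjv (frame P \<delta> y)) =
    - (real CARD('n) + 2) * \<i> * (\<Sum>\<epsilon>\<in>UNIV. D y \<gamma> \<epsilon> * hmat J P y $ \<epsilon> $ \<delta>) + rho y * \<i> * hmat J P y $ \<gamma> $ \<delta>"
proof -
  let ?E = "frame P \<gamma> y" and ?Eb = "cnjv (frame P \<delta> y)"
  let ?a = "\<lambda>z. (complex_of_real (real CARD('n)) + 1) *s du z" and ?b = "\<lambda>z. (complex_of_real (real CARD('n)) + 2) *s tau z"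
    and ?c = "\<lambda>z. rho z *s ctheta P z"
  have d: "?a differentiable (at y)" "?b differentiable (at y)" "?c differentiable (at y)"
    by (intro differentiable_smult differentiable_const diffs y diff_tau diff_rho)+
  have "diff1 mu y ?E ?Eb = diff1 (\<lambda>z. ?a z - ?b z + ?c z) y ?E ?Eb"
    by (rule diff1_cong[OF P.open_V y]) (simp add: mu_eq)
  also have "\<dots> = diff1 ?a y ?E ?Eb - diff1 ?b y ?E ?Eb + diff1 ?c y ?E ?Eb"
    using d by (simp add: diff1_add diff1_diff differentiable_diff)
  also have "diff1 ?a y ?E ?Eb = 0"
    by (subst diff1_smult) (auto intro!: diffs y simp: ddu[OF y] wedge_def)
  also have "diff1 ?b y ?E ?Eb = (real CARD('n) + 2) * diff1 tau y ?E ?Eb"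
    by (subst diff1_smult) (auto intro!: diff_tau y simp: wedge_def)
  also have "diff1 ?c y ?E ?Eb = rho y * diff1 (ctheta P) y ?E ?Eb"
    by (subst diff1_smult) (auto intro!: diff_rho diffs y simp: wedge_def y)
  finally show ?thesis unfolding dtau[OF y] P.dtheta_EEb[OF y] by (simp add: algebra_simps)
qed

text \<open>Tracing \<open>dmu\<close> with the inverse Levi matrix turns \<open>D\<close> into
  \<open>DD\<close> and h into n; the two corrections are the real parts of - (n + 2) i DD and n i
  rho. The factor rat undoes the scaling of the inverse Levi matrix.\<close>

lemma scalar_curv_Q: assumes y: "y \<in> V"
  shows "rat y * scalar_curv J Q y = scalar_curv J P y + (real CARD('n) + 2) * Im (DD y) - real CARD('n) * Im (rho y)"
proof -
  define M where "M = (\<chi> \<alpha> \<beta>. U \<alpha> \<beta> y)"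
  define Mi where "Mi = (\<chi> \<beta> \<alpha>. Ui \<alpha> \<beta> y)"
  define h where "h = hmat J P y"
  define k where "k = matrix_inv h"
  have hk: "h ** k = mat 1" "k ** h = mat 1" unfolding h_def k_def by (rule P.hinv[OF y])+
  have M: "M ** Mi = mat 1" "Mi ** M = mat 1" unfolding M_def Mi_def by (rule U_inverse[OF y])+
  have r: "rat y \<noteq> 0" by (rule rat_nz[OF y])
  define B where "B = (\<chi> \<beta> \<gamma>. diff1 (conn_trace Q) y (frame P \<beta> y) (cnjv (frame P \<gamma> y)))"
  define BP where "BP = (\<chi> \<beta> \<gamma>. diff1 (conn_trace P) y (frame P \<beta> y) (cnjv (frame P \<gamma> y)))"
  define DM where "DM = (\<chi> \<gamma> \<epsilon>. D y \<gamma> \<epsilon>)"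
  have BQ: "(\<chi> \<beta> \<gamma>. diff1 (conn_trace Q) y (frame Q \<beta> y) (cnjv (frame Q \<gamma> y))) = M ** B ** adj M"
  proof -
    have "diff1 (conn_trace Q) y (frame Q \<beta> y) (cnjv (frame Q \<gamma> y)) =
      (\<Sum>\<delta>\<in>UNIV. \<Sum>\<epsilon>\<in>UNIV. U \<beta> \<epsilon> y * B $ \<epsilon> $ \<delta> * cnj (U \<gamma> \<delta> y))" for \<beta> \<gamma>
      by (simp add: frame_Q[OF y] cnjv_sum cnjv_smult diff1_simps B_def sum_distrib_left mult_ac)
    then show ?thesis by (simp add: vec_eq_iff matrix_matrix_mult_def M_def sum_distrib_right)
  qed
  have BB: "B $ \<beta> $ \<gamma> = BP $ \<beta> $ \<gamma> + (- (real CARD('n) + 2) * \<i> * (DM ** h) $ \<beta> $ \<gamma> + rho y * \<i> * h $ \<beta> $ \<gamma>)" for \<beta> \<gamma>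
  proof -
    let ?E = "frame P \<beta> y" and ?Eb = "cnjv (frame P \<gamma> y)"
    have "diff1 mu y ?E ?Eb = diff1 (conn_trace Q) y ?E ?Eb - diff1 (conn_trace P) y ?E ?Eb - diff1 lam y ?E ?Eb"
      unfolding mu_def[abs_def] using y by (simp add: diff1_diff diffs differentiable_diff)
    then show ?thesis
      unfolding dmu[OF y] dlam[OF y] by (simp add: B_def BP_def DM_def h_def matrix_matrix_mult_def)
  qed
  have "trace (k ** B) = trace (k ** BP) - (real CARD('n) + 2) * \<i> * trace (k ** (DM ** h)) + rho y * \<i> * trace (k ** h)"
    unfolding trace_mult BB by (simp add: algebra_simps sum.distrib sum_subtractf sum_distrib_left)
  also have "trace (k ** (DM ** h)) = DD y"
    using trace_rotate[of k DM h] by (simp add: matrix_mul_assoc[symmetric] hk) (simp add: trace_def DM_def DD_def)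
  also have "trace (k ** h) = of_nat CARD('n)" by (simp add: hk trace_I)
  finally have t: "trace (k ** B) = trace (k ** BP) - (real CARD('n) + 2) * \<i> * DD y + rho y * \<i> * of_nat CARD('n)" .
  have "scalar_curv J Q y = Re (trace ((1 / rat y) *\<^sub>R (adj Mi ** k ** Mi) ** (M ** B ** adj M)))"
    unfolding Q.scalar_curv_eq[OF y] BQ hmat_Q[OF y]
    unfolding M_def[symmetric] h_def[symmetric] sandwich_inv[OF hk M r] ..
  also have "\<dots> = Re (trace (k ** B)) / rat y"
    by (simp add: scalar_matrix_assoc[symmetric] trace_scaleR sandwich_trace[OF hk M])
  finally have "rat y * scalar_curv J Q y = Re (trace (k ** B))" using r by simp
  then show ?thesis
    unfolding t P.scalar_curv_eq[OF y] by (simp add: k_def h_def BP_def algebra_simps)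
qed

end

section \<open>The chain equation\<close>

definition dext :: "('a::real_inner \<Rightarrow> 'a) \<Rightarrow> 'a \<Rightarrow> 'a \<Rightarrow> 'a \<Rightarrow> real" where
  "dext \<theta> x v w = frechet_derivative (\<lambda>y. \<theta> y \<bullet> w) (at x) v - frechet_derivative (\<lambda>y. \<theta> y \<bullet> v) (at x) w"

text \<open>The \<open>w\<close>-component of the Euler-Lagrange expression of \<open>L(v, v) / \<theta>(v)\<close> at a curve with
  velocity \<open>v\<close> and acceleration \<open>q\<close>, multiplied by \<open>\<theta>(v) / 2\<close> and reduced for \<open>\<theta>(w) = 0\<close>.\<close>

definition chain_EL :: "('a::real_inner \<Rightarrow> 'a \<Rightarrow> 'a \<Rightarrow> real) \<Rightarrow> ('a \<Rightarrow> 'a) \<Rightarrow> 'a \<Rightarrow> 'a \<Rightarrow> 'a \<Rightarrow> 'a \<Rightarrow> real" where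
  "chain_EL L \<theta> x v q w = L x q w + frechet_derivative (\<lambda>y. L y v w) (at x) v
    - frechet_derivative (\<lambda>y. L y v v) (at x) w / 2
    - L x v v / (2 * (\<theta> x \<bullet> v)) * dext \<theta> x v w
    - (\<theta> x \<bullet> q + frechet_derivative (\<lambda>y. \<theta> y \<bullet> v) (at x) v) / (\<theta> x \<bullet> v) * L x v w"

lemma has_derivative_cong_open:
  assumes "open S" "x \<in> S" "\<And>y. y \<in> S \<Longrightarrow> f y = g y" "(g has_derivative D) (at x)"
  shows "(f has_derivative D) (at x)"
  by (rule has_derivative_transform_within_open[OF assms(4,1,2)]) (simp add: assms(3))

text \<open>The factor f reflects the normalisation of \<open>chain_EL\<close> by \<theta>(v) / 2.
  The derivatives of \<beta> combine to d\<beta>(v, w) = 0; the remaining extra terms carry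
  \<theta>(w) = 0 or cancel against the derivatives of f and \<theta>.\<close>

lemma chain_EL_conformal:
  fixes L :: "'a::euclidean_space \<Rightarrow> 'a \<Rightarrow> 'a \<Rightarrow> real"
  assumes V: "open V" "x \<in> V"
    and th: "\<And>y. y \<in> V \<Longrightarrow> \<theta>' y = f y *\<^sub>R \<theta> y"
    and L: "\<And>y u w. y \<in> V \<Longrightarrow> L' y u w = f y * (L y u w + (\<theta> y \<bullet> u * \<beta> y w + \<theta> y \<bullet> w * \<beta> y u) / 2)"
    and df: "f differentiable (at x)" and dL: "\<And>u w. (\<lambda>y. L y u w) differentiable (at x)"
    and dth: "\<theta> differentiable (at x)" and dbeta: "\<And>u. (\<lambda>y. \<beta> y u) differentiable (at x)"
    and f: "f x \<noteq> 0" and v: "\<theta> x \<bullet> v \<noteq> 0" and w: "\<theta> x \<bullet> w = 0"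
    and closed: "frechet_derivative (\<lambda>y. \<beta> y w) (at x) v = frechet_derivative (\<lambda>y. \<beta> y v) (at x) w"
  shows "chain_EL L' \<theta>' x v q w = f x * chain_EL L \<theta> x v q w"
proof -
  let ?D = "\<lambda>g h. frechet_derivative g (at x) h"
  have hf: "(f has_derivative ?D f) (at x)" using df by (simp add: frechet_derivative_works)
  have hL: "((\<lambda>y. L y u w) has_derivative ?D (\<lambda>y. L y u w)) (at x)" for u w
    using dL by (simp add: frechet_derivative_works)
  have hb: "((\<lambda>y. \<beta> y u) has_derivative ?D (\<lambda>y. \<beta> y u)) (at x)" for u
    using dbeta by (simp add: frechet_derivative_works)
  have ht: "((\<lambda>y. \<theta> y \<bullet> u) has_derivative ?D (\<lambda>y. \<theta> y \<bullet> u)) (at x)" for u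
    using differentiable_linear[OF bounded_linear_inner_left dth, of u] by (simp add: frechet_derivative_works)
  have Dth: "?D (\<lambda>y. \<theta>' y \<bullet> u) h = f x * ?D (\<lambda>y. \<theta> y \<bullet> u) h + ?D f h * (\<theta> x \<bullet> u)" for u h
    by (rule frechet_eqI, rule has_derivative_cong_open[OF V, where g="\<lambda>y. f y * (\<theta> y \<bullet> u)"])
      (auto simp: th intro!: has_derivative_mult hf ht)
  have DL: "?D (\<lambda>y. L' y u w) h = f x * (?D (\<lambda>y. L y u w) h
      + 1 / 2 * (\<theta> x \<bullet> u * ?D (\<lambda>y. \<beta> y w) h + ?D (\<lambda>y. \<theta> y \<bullet> u) h * \<beta> x w
         + (\<theta> x \<bullet> w * ?D (\<lambda>y. \<beta> y u) h + ?D (\<lambda>y. \<theta> y \<bullet> w) h * \<beta> x u)))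
      + ?D f h * (L x u w + 1 / 2 * (\<theta> x \<bullet> u * \<beta> x w + \<theta> x \<bullet> w * \<beta> x u))" for u w h
    by (rule frechet_eqI, rule has_derivative_cong_open[OF V, where g="\<lambda>y. f y * (L y u w + 1 / 2 * (\<theta> y \<bullet> u * \<beta> y w + \<theta> y \<bullet> w * \<beta> y u))"])
      (simp add: L, intro has_derivative_mult has_derivative_mult_right has_derivative_add hf ht hL hb)
  define t where "t = \<theta> x \<bullet> v"
  have t: "t \<noteq> 0" using v by (simp add: t_def)
  show ?thesis
    unfolding chain_EL_def dext_def Dth DL L[OF V(2)] th[OF V(2)] inner_scaleR_left w closed t_def[symmetric]
    using f t by (simp add: field_simps)
qed

lemma frechet_scale:
  assumes "g differentiable (at x)"
  shows "frechet_derivative (\<lambda>y. a * g y) (at x) h = a * (frechet_derivative g (at x) h :: real)"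
  by (rule frechet_eqI) (use assms in \<open>auto simp: frechet_derivative_works intro!: has_derivative_mult_right\<close>)

text \<open>L(v, v) / \<theta>(v) is homogeneous of degree 1, so its Euler-Lagrange equation does
  not see the parameter. Concretely, the b v in the acceleration contributes b L(v, w) to the first
  term and takes it away in the last one.\<close>

lemma chain_EL_reparam:
  fixes L :: "'a::euclidean_space \<Rightarrow> 'a \<Rightarrow> 'a \<Rightarrow> real"
  assumes bil: "\<And>y. bilinear (L y)" and dL: "\<And>u w. (\<lambda>y. L y u w) differentiable (at x)"
    and dth: "\<theta> differentiable (at x)" and a: "a \<noteq> 0" and v: "\<theta> x \<bullet> v \<noteq> 0"
  shows "chain_EL L \<theta> x (a *\<^sub>R v) (a\<^sup>2 *\<^sub>R q + b *\<^sub>R v) w = a\<^sup>2 * chain_EL L \<theta> x v q w"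
proof -
  let ?D = "\<lambda>g h. frechet_derivative g (at x) h"
  have ht: "(\<lambda>y. \<theta> y \<bullet> u) differentiable (at x)" for u
    by (rule differentiable_linear[OF bounded_linear_inner_left dth])
  have sc: "?D g (c *\<^sub>R h) = c * ?D g h" if "g differentiable (at x)" for g :: "'a \<Rightarrow> real" and c h
    using linear_scale[OF linear_frechet_derivative[OF that]] by simp
  have L1: "L y (c *\<^sub>R u) w = c * L y u w" and L2: "L y u (c *\<^sub>R w) = c * L y u w"
    and L3: "L y (u + u') w = L y u w + L y u' w" for y c u u' w
    using bilinear_lmul[OF bil] bilinear_rmul[OF bil] bilinear_ladd[OF bil] by auto
  define t where "t = \<theta> x \<bullet> v"
  have t: "t \<noteq> 0" using v by (simp add: t_def)
  show ?thesis
    unfolding chain_EL_def dext_def L1 L2 L3 inner_scaleR_right inner_add_right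
    using t a by (simp add: frechet_scale dL ht sc differentiable_mult t_def[symmetric] field_simps power2_eq_square)
qed

section \<open>The chain equation under a change of coordinates, and the Koszul formula\<close>

lemma bilinear_expand:
  fixes B :: "'a::euclidean_space \<Rightarrow> 'a \<Rightarrow> real"
  assumes "bilinear B"
  shows "B u w = (\<Sum>i\<in>Basis. \<Sum>j\<in>Basis. (u \<bullet> i) * (w \<bullet> j) * B i j)"
proof -
  have "B u w = B (\<Sum>i\<in>Basis. (u \<bullet> i) *\<^sub>R i) (\<Sum>j\<in>Basis. (w \<bullet> j) *\<^sub>R j)"
    by (simp only: euclidean_representation)
  also have "\<dots> = (\<Sum>(i, j)\<in>Basis \<times> Basis. B ((u \<bullet> i) *\<^sub>R i) ((w \<bullet> j) *\<^sub>R j))"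
    by (rule bilinear_sum[OF assms])
  also have "\<dots> = (\<Sum>i\<in>Basis. \<Sum>j\<in>Basis. (u \<bullet> i) * (w \<bullet> j) * B i j)"
    by (simp add: sum.cartesian_product[symmetric] bilinear_lmul[OF assms] bilinear_rmul[OF assms] mult_ac)
  finally show ?thesis .
qed

text \<open>Differentiability of the family L is known only for fixed arguments, so the product rule
  goes through the expansion over a basis.\<close>

lemma has_derivative_bilinear_family:
  fixes L :: "'a::euclidean_space \<Rightarrow> 'a \<Rightarrow> 'a \<Rightarrow> real" and \<phi> A B :: "'c::real_normed_vector \<Rightarrow> 'a"
  assumes bil: "\<And>y. bilinear (L y)" and dL: "\<And>u w. (\<lambda>y. L y u w) differentiable (at (\<phi> x))"
    and phi: "(\<phi> has_derivative \<phi>') (at x)" and A: "(A has_derivative A') (at x)" and B: "(B has_derivative B') (at x)"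
  shows "((\<lambda>y. L (\<phi> y) (A y) (B y)) has_derivative
    (\<lambda>h. frechet_derivative (\<lambda>y. L y (A x) (B x)) (at (\<phi> x)) (\<phi>' h) + L (\<phi> x) (A' h) (B x) + L (\<phi> x) (A x) (B' h))) (at x)"
proof -
  let ?D = "\<lambda>i j. frechet_derivative (\<lambda>y. L y i j) (at (\<phi> x))"
  have hL: "((\<lambda>y. L y u w) has_derivative ?D u w) (at (\<phi> x))" for u w
    using dL by (simp add: frechet_derivative_works)
  have hc: "((\<lambda>y. L (\<phi> y) u w) has_derivative (\<lambda>h. ?D u w (\<phi>' h))) (at x)" for u w
    by (rule has_derivative_compose[OF phi hL])
  have eq: "?D u w h = (\<Sum>i\<in>Basis. \<Sum>j\<in>Basis. (u \<bullet> i) * (w \<bullet> j) * ?D i j h)" for u w h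
    by (subst bilinear_expand[OF bil, of _ u w], rule frechet_eqI)
      (auto intro!: has_derivative_sum has_derivative_mult_right hL)
  have "((\<lambda>y. \<Sum>i\<in>Basis. \<Sum>j\<in>Basis. (A y \<bullet> i) * (B y \<bullet> j) * L (\<phi> y) i j) has_derivative
     (\<lambda>h. \<Sum>i\<in>Basis. \<Sum>j\<in>Basis. (A x \<bullet> i) * (B x \<bullet> j) * ?D i j (\<phi>' h)
        + ((A x \<bullet> i) * (B' h \<bullet> j) + (A' h \<bullet> i) * (B x \<bullet> j)) * L (\<phi> x) i j)) (at x)"
    by (intro has_derivative_sum has_derivative_mult hc has_derivative_inner_left A B)
  moreover have "(\<Sum>i\<in>Basis. \<Sum>j\<in>Basis. (A x \<bullet> i) * (B x \<bullet> j) * ?D i j (\<phi>' h)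
        + ((A x \<bullet> i) * (B' h \<bullet> j) + (A' h \<bullet> i) * (B x \<bullet> j)) * L (\<phi> x) i j) =
     ?D (A x) (B x) (\<phi>' h) + L (\<phi> x) (A' h) (B x) + L (\<phi> x) (A x) (B' h)" for h
    unfolding eq[of "A x"] bilinear_expand[OF bil, of "\<phi> x" "A' h" "B x"] bilinear_expand[OF bil, of "\<phi> x" "A x" "B' h"]
    by (simp add: sum.distrib algebra_simps)
  ultimately show ?thesis
    by (simp add: bilinear_expand[OF bil, of "\<phi> _" "A _" "B _", symmetric])
qed

text \<open>A curve with jet (v, q) is mapped to one with velocity D\<phi> v and acceleration
  D\<phi> q + D^2\<phi>(v, v). Differentiating the pulled back forms produces exactly this second
  derivative term; those involving D^2\<phi>(v, w) cancel by symmetry of the second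
  derivative.\<close>

lemma chain_EL_natural:
  fixes L :: "'a::euclidean_space \<Rightarrow> 'a \<Rightarrow> 'a \<Rightarrow> real" and \<phi> :: "'a \<Rightarrow> 'a"
  assumes bil: "\<And>y. bilinear (L y)" and dL: "\<And>u w. (\<lambda>y. L y u w) differentiable (at (\<phi> x))"
    and symL: "\<And>y u w. L y u w = L y w u" and dth: "\<theta> differentiable (at (\<phi> x))"
    and S: "open S" "x \<in> S" "smooth_on S \<phi>"
    and L': "\<And>y u w. y \<in> S \<Longrightarrow> L' y u w = L (\<phi> y) (frechet_derivative \<phi> (at y) u) (frechet_derivative \<phi> (at y) w)"
    and th': "\<And>y u. y \<in> S \<Longrightarrow> \<theta>' y \<bullet> u = \<theta> (\<phi> y) \<bullet> frechet_derivative \<phi> (at y) u"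
  shows "chain_EL L' \<theta>' x v q w = chain_EL L \<theta> (\<phi> x) (frechet_derivative \<phi> (at x) v)
    (frechet_derivative \<phi> (at x) q + frechet_derivative (\<lambda>y. frechet_derivative \<phi> (at y) v) (at x) v)
    (frechet_derivative \<phi> (at x) w)"
proof -
  let ?d = "\<lambda>u. frechet_derivative \<phi> (at x) u"
  let ?dd = "\<lambda>u h. frechet_derivative (\<lambda>y. frechet_derivative \<phi> (at y) u) (at x) h"
  let ?D = "\<lambda>g h. frechet_derivative g (at (\<phi> x)) h"
  have p1: "(\<phi> has_derivative ?d) (at x)"
    using smooth_on_differentiable[OF S(3,2)] by (simp add: frechet_derivative_works)
  have p2: "((\<lambda>y. frechet_derivative \<phi> (at y) u) has_derivative ?dd u) (at x)" for u
    using smooth_on_differentiable[OF smooth_on_frechet[OF S(3)] S(2)] by (simp add: frechet_derivative_works)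
  have sym: "?dd u h = ?dd h u" for u h by (rule second_derivative_symmetric[OF S])
  have DL: "frechet_derivative (\<lambda>y. L' y u w) (at x) h = ?D (\<lambda>y. L y (?d u) (?d w)) (?d h)
      + L (\<phi> x) (?dd u h) (?d w) + L (\<phi> x) (?d u) (?dd w h)" for u w h
    by (rule frechet_eqI, rule has_derivative_cong_open[OF S(1,2) L'], assumption,
        rule has_derivative_bilinear_family[OF bil dL p1 p2 p2])
  have hth: "(\<theta> has_derivative frechet_derivative \<theta> (at (\<phi> x))) (at (\<phi> x))"
    using dth by (simp add: frechet_derivative_works)
  have Dth1: "?D (\<lambda>y. \<theta> y \<bullet> u) h = ?D \<theta> h \<bullet> u" for u h
    by (rule frechet_eqI[OF has_derivative_inner_left[OF hth]])
  have Dth: "frechet_derivative (\<lambda>y. \<theta>' y \<bullet> u) (at x) h = ?D (\<lambda>y. \<theta> y \<bullet> ?d u) (?d h) + \<theta> (\<phi> x) \<bullet> ?dd u h" for u h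
  proof -
    have "((\<lambda>y. \<theta> (\<phi> y) \<bullet> frechet_derivative \<phi> (at y) u) has_derivative
        (\<lambda>h. \<theta> (\<phi> x) \<bullet> ?dd u h + ?D \<theta> (?d h) \<bullet> ?d u)) (at x)"
      by (rule has_derivative_inner[OF has_derivative_compose[OF p1 hth] p2])
    from has_derivative_cong_open[OF S(1,2) th' this]
    have "((\<lambda>y. \<theta>' y \<bullet> u) has_derivative (\<lambda>h. \<theta> (\<phi> x) \<bullet> ?dd u h + ?D \<theta> (?d h) \<bullet> ?d u)) (at x)" by simp
    from frechet_eqI[OF this] show ?thesis by (simp add: Dth1)
  qed
  have dx: "dext \<theta>' x v w = dext \<theta> (\<phi> x) (?d v) (?d w)"
    unfolding dext_def Dth by (simp add: sym[of w v])
  have L3: "L y (u + u') w = L y u w + L y u' w" for y u u' w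
    using bilinear_ladd[OF bil] by auto
  show ?thesis
    unfolding chain_EL_def dx L'[OF S(2)] th'[OF S(2)] DL Dth L3 inner_add_right
    by (simp add: sym[of w v] symL[of _ "?d v" "?dd v w"] add.commute add.left_commute diff_divide_distrib add_divide_distrib)
qed

text \<open>The definite description in \<open>christoffel\<close> does denote a vector: the Koszul
  expression is linear in w, and a non-degenerate form represents each linear functional by exactly
  one vector.\<close>

lemma christoffel_eq:
  fixes g :: "'a::euclidean_space \<Rightarrow> 'a \<Rightarrow> 'a \<Rightarrow> real"
  assumes bil: "\<And>y. bilinear (g y)" and dg: "\<And>u w. (\<lambda>y. g y u w) differentiable (at x)"
    and nd: "\<And>z. (\<And>w. g x z w = 0) \<Longrightarrow> z = 0"
  shows "2 * g x (christoffel g x u v) w = frechet_derivative (\<lambda>y. g y v w) (at x) u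
    + frechet_derivative (\<lambda>y. g y u w) (at x) v - frechet_derivative (\<lambda>y. g y u v) (at x) w"
proof -
  define r where "r w = frechet_derivative (\<lambda>y. g y v w) (at x) u
    + frechet_derivative (\<lambda>y. g y u w) (at x) v - frechet_derivative (\<lambda>y. g y u v) (at x) w" for w
  have hg: "((\<lambda>y. g y u w) has_derivative frechet_derivative (\<lambda>y. g y u w) (at x)) (at x)" for u w
    using dg by (simp add: frechet_derivative_works)
  have add: "frechet_derivative (\<lambda>y. g y a (w + w')) (at x) h =
      frechet_derivative (\<lambda>y. g y a w) (at x) h + frechet_derivative (\<lambda>y. g y a w') (at x) h" for a w w' h
    unfolding bilinear_radd[OF bil] by (rule frechet_eqI[OF has_derivative_add[OF hg hg]])
  have scale: "frechet_derivative (\<lambda>y. g y a (c *\<^sub>R w)) (at x) h = c * frechet_derivative (\<lambda>y. g y a w) (at x) h" for a c w h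
    unfolding bilinear_rmul[OF bil] real_scaleR_def by (rule frechet_eqI[OF has_derivative_mult_right[OF hg]])
  have lf: "linear (frechet_derivative (\<lambda>y. g y u v) (at x))" by (rule linear_frechet_derivative[OF dg])
  have lr: "linear r"
    by (rule linearI) (simp_all add: r_def add scale linear_add[OF lf] linear_scale[OF lf] algebra_simps)
  define T where "T z = (\<Sum>b\<in>Basis. g x z b *\<^sub>R b)" for z
  have lT: "linear T"
    by (rule linearI) (simp_all add: T_def bilinear_ladd[OF bil] bilinear_lmul[OF bil] scaleR_add_left sum.distrib scaleR_sum_right)
  have gT: "g x z w = T z \<bullet> w" for z w
  proof -
    have lin: "linear (g x z)" using bil by (simp add: bilinear_def)
    have "g x z w = g x z (\<Sum>b\<in>Basis. (w \<bullet> b) *\<^sub>R b)" by (simp only: euclidean_representation)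
    also have "\<dots> = (\<Sum>b\<in>Basis. (w \<bullet> b) * g x z b)" by (simp add: linear_sum[OF lin] linear_scale[OF lin])
    also have "\<dots> = T z \<bullet> w"
      unfolding T_def inner_sum_left inner_scaleR_left by (intro sum.cong refl) (simp add: inner_commute)
    finally show ?thesis .
  qed
  have "inj T"
    unfolding linear_injective_0[OF lT] using nd gT by (metis inner_zero_left)
  then have "surj T" using linear_injective_imp_surjective[OF lT] by simp
  then obtain z0 where z0: "T z0 = (\<Sum>b\<in>Basis. (r b / 2) *\<^sub>R b)" by (metis surjD)
  have z: "2 * g x z0 w = r w" for w
  proof -
    have "r w = r (\<Sum>b\<in>Basis. (w \<bullet> b) *\<^sub>R b)" by (simp only: euclidean_representation)
    also have "\<dots> = (\<Sum>b\<in>Basis. (w \<bullet> b) * r b)" by (simp add: linear_sum[OF lr] linear_scale[OF lr])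
    also have "\<dots> = 2 * (T z0 \<bullet> w)"
      unfolding z0 inner_sum_left inner_scaleR_left sum_distrib_left by (intro sum.cong refl) (simp add: inner_commute)
    finally show ?thesis by (simp add: gT)
  qed
  have "christoffel g x u v = z0"
    unfolding christoffel_def r_def[symmetric]
  proof (rule the_equality)
    show "\<forall>w. 2 * g x z0 w = r w" using z by blast
    fix z' assume "\<forall>w. 2 * g x z' w = r w"
    then have "2 * g x z' w = 2 * g x z0 w" for w using z[of w] by simp
    then have "g x (z' - z0) w = 0" for w by (simp add: bilinear_lsub[OF bil])
    then show "z' = z0" using nd[of "z' - z0"] by simp
  qed
  then show ?thesis using z by (simp add: r_def)
qed

section \<open>The Fefferman metric\<close>

text \<open>The form L of the overview. The metric does not depend on the fibre coordinate, so
  evaluation at 0 loses nothing; the form itself does depend on the coframe, through the section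
  \<open>zeta0\<close>.\<close>

definition chain_form :: "('n::finite rvec \<Rightarrow> 'n rvec \<Rightarrow> 'n rvec) \<Rightarrow> 'n ph_data \<Rightarrow> 'n rvec \<Rightarrow> 'n rvec \<Rightarrow> 'n rvec \<Rightarrow> real" where
  "chain_form J P x u w = fefferman_metric J P (x, 0) (u, 0) (w, 0)"

definition Sform :: "('n::finite rvec \<Rightarrow> 'n rvec \<Rightarrow> 'n rvec) \<Rightarrow> 'n ph_data \<Rightarrow> 'n rvec \<Rightarrow> 'n rvec \<Rightarrow> 'n rvec \<Rightarrow> complex" where
  "Sform J P x u w = (\<Sum>\<alpha>\<in>UNIV. \<Sum>\<beta>\<in>UNIV. hmat J P x $ \<alpha> $ \<beta> * (ev (coframe P \<alpha> x) (cv u) * ev (cobar P \<beta> x) (cv w)))"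

text \<open>The 1-form with \<sigma> = (ds - aform) / (n + 2).\<close>

definition aform :: "('n::finite rvec \<Rightarrow> 'n rvec \<Rightarrow> 'n rvec) \<Rightarrow> 'n ph_data \<Rightarrow> 'n rvec \<Rightarrow> 'n rvec \<Rightarrow> real" where
  "aform J P x v = Im (ev (conn_trace P x) (cv v)) + scalar_curv J P x / (2 * (real CARD('n) + 1)) * (theta P x \<bullet> v)"

lemma fefferman_metric_eq:
  fixes P :: "'n::finite ph_data"
  shows "fefferman_metric J P (x, s) (u, \<tau>) (w, \<tau>') = Re (Sform J P x u w + Sform J P x w u) / 2
    + (theta P x \<bullet> u) * ((\<tau>' - aform J P x w) / (real CARD('n) + 2))
    + (theta P x \<bullet> w) * ((\<tau> - aform J P x u) / (real CARD('n) + 2))"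
proof -
  have e: "(\<Sum>\<alpha>\<in>UNIV. \<Sum>\<beta>\<in>UNIV. hmat J P x $ \<alpha> $ \<beta> *
      ((ev (coframe P \<alpha> x) (cv u) * ev (cobar P \<beta> x) (cv w) +
        ev (coframe P \<alpha> x) (cv w) * ev (cobar P \<beta> x) (cv u)) / 2)) = (Sform J P x u w + Sform J P x w u) / 2"
    unfolding Sform_def sum.distrib[symmetric] sum_divide_distrib
    by (intro sum.cong refl) (simp add: algebra_simps)
  show ?thesis
    unfolding fefferman_metric_def fefferman_sigma_def aform_def fst_conv snd_conv prod.case e
    by (simp add: diff_diff_eq)
qed

lemma chain_form_eq:
  fixes P :: "'n::finite ph_data"
  shows "chain_form J P x u w = Re (Sform J P x u w + Sform J P x w u) / 2
    - ((theta P x \<bullet> u) * aform J P x w + (theta P x \<bullet> w) * aform J P x u) / (real CARD('n) + 2)"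
  unfolding chain_form_def fefferman_metric_eq by (simp add: add_divide_distrib)

lemma fefferman_metric_split:
  fixes P :: "'n::finite ph_data"
  shows "fefferman_metric J P (x, s) (u, \<tau>) (w, \<tau>') = chain_form J P x u w
    + ((theta P x \<bullet> u) * \<tau>' + (theta P x \<bullet> w) * \<tau>) / (real CARD('n) + 2)"
  unfolding chain_form_eq fefferman_metric_eq by (simp add: add_divide_distrib diff_divide_distrib algebra_simps)

lemma Sform_linear:
  "Sform J P x (u + u') w = Sform J P x u w + Sform J P x u' w"
  "Sform J P x u (w + w') = Sform J P x u w + Sform J P x u w'"
  "Sform J P x (c *\<^sub>R u) w = complex_of_real c * Sform J P x u w"
  "Sform J P x u (c *\<^sub>R w) = complex_of_real c * Sform J P x u w"
  by (simp_all add: Sform_def cv_add cv_scaleR ev_simps sum.distrib sum_distrib_left algebra_simps)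

lemma aform_linear: "aform J P x (u + u') = aform J P x u + aform J P x u'" "aform J P x (c *\<^sub>R u) = c * aform J P x u"
  by (simp_all add: aform_def cv_add cv_scaleR ev_simps inner_add_right divide_inverse algebra_simps)

lemma chain_form_sym: "chain_form J P x u w = chain_form J P x w u"
  by (simp add: chain_form_eq add.commute)

lemma bilinear_chain_form: "bilinear (chain_form J P x)"
proof -
  have 1: "chain_form J P x (u + u') w = chain_form J P x u w + chain_form J P x u' w" for u u' w
    unfolding chain_form_eq Sform_linear aform_linear inner_add_right plus_complex.sel
    by (simp add: algebra_simps add_divide_distrib diff_divide_distrib)
  have 2: "chain_form J P x (c *\<^sub>R u) w = c * chain_form J P x u w" for c u w
  proof -
    have "Re (Sform J P x (c *\<^sub>R u) w + Sform J P x w (c *\<^sub>R u)) = c * Re (Sform J P x u w + Sform J P x w u)"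
      unfolding Sform_linear by (simp add: algebra_simps)
    moreover have "theta P x \<bullet> (c *\<^sub>R u) * aform J P x w + theta P x \<bullet> w * aform J P x (c *\<^sub>R u)
        = c * (theta P x \<bullet> u * aform J P x w + theta P x \<bullet> w * aform J P x u)"
      unfolding aform_linear by (simp add: algebra_simps)
    ultimately show ?thesis unfolding chain_form_eq by (simp only: right_diff_distrib times_divide_eq_right)
  qed
  show ?thesis
    unfolding bilinear_def
  proof (intro conjI allI)
    fix w
    show "linear (\<lambda>u. chain_form J P x u w)" by (rule linearI) (simp_all add: 1 2)
    show "linear (chain_form J P x w)"
      by (rule linearI) (simp_all add: 1 2 chain_form_sym[of J P x w])
  qed
qed

lemma bilinear_fefferman: "bilinear (fefferman_metric J P p)"
proof -
  obtain x s where p: "p = (x, s)" by (cases p)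
  note c = bilinear_ladd[OF bilinear_chain_form, of J P x] bilinear_lmul[OF bilinear_chain_form, of J P x]
  have sym: "fefferman_metric J P (x, s) \<xi> \<eta> = fefferman_metric J P (x, s) \<eta> \<xi>" for \<xi> \<eta>
    by (cases \<xi>, cases \<eta>) (simp add: fefferman_metric_split chain_form_sym[of J P x] add.commute)
  have 1: "fefferman_metric J P (x, s) (\<xi> + \<xi>') \<eta> = fefferman_metric J P (x, s) \<xi> \<eta> + fefferman_metric J P (x, s) \<xi>' \<eta>" for \<xi> \<xi>' \<eta>
    by (cases \<xi>, cases \<xi>', cases \<eta>)
      (simp add: fefferman_metric_split c inner_add_right algebra_simps add_divide_distrib)
  have 2: "fefferman_metric J P (x, s) (a *\<^sub>R \<xi>) \<eta> = a * fefferman_metric J P (x, s) \<xi> \<eta>" for a \<xi> \<eta>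
  proof -
    obtain u \<tau> w \<tau>' where e: "\<xi> = (u, \<tau>)" "\<eta> = (w, \<tau>')" by (cases \<xi>, cases \<eta>)
    have "theta P x \<bullet> (a *\<^sub>R u) * \<tau>' + theta P x \<bullet> w * (a * \<tau>) = a * (theta P x \<bullet> u * \<tau>' + theta P x \<bullet> w * \<tau>)"
      by (simp add: algebra_simps)
    then show ?thesis
      unfolding e scaleR_Pair real_scaleR_def fefferman_metric_split c
      by (simp only: distrib_left times_divide_eq_right real_scaleR_def)
  qed
  show ?thesis
    unfolding bilinear_def p
  proof (intro conjI allI)
    fix \<eta>
    show "linear (\<lambda>\<xi>. fefferman_metric J P (x, s) \<xi> \<eta>)" by (rule linearI) (simp_all add: 1 2)
    show "linear (fefferman_metric J P (x, s) \<eta>)"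
      by (rule linearI) (simp_all add: 1 2 sym[of \<eta>])
  qed
qed

section \<open>Regularity of the scalar curvature and of the metric\<close>

lemma differentiable_prod:
  fixes f :: "'i \<Rightarrow> 'a::real_normed_vector \<Rightarrow> complex"
  assumes "finite I" "\<And>i. i \<in> I \<Longrightarrow> f i differentiable (at x)"
  shows "(\<lambda>y. \<Prod>i\<in>I. f i y) differentiable (at x)"
  using assms by (induction I rule: finite_induct) (auto intro: differentiable_mult)

lemma differentiable_det:
  fixes A :: "'a::real_normed_vector \<Rightarrow> complex ^ 'k ^ 'k"
  assumes "\<And>i j. (\<lambda>y. A y $ i $ j) differentiable (at x)"
  shows "(\<lambda>y. det (A y)) differentiable (at x)"
  unfolding det_def
  by (intro differentiable_sum finite_permutations finite ballI differentiable_mult differentiable_const differentiable_prod assms)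

lemma differentiable_matrix_inv:
  fixes A :: "'a::real_normed_vector \<Rightarrow> complex ^ 'k ^ 'k"
  assumes S: "open S" "x \<in> S" and nz: "\<And>y. y \<in> S \<Longrightarrow> det (A y) \<noteq> 0"
    and d: "\<And>i j. (\<lambda>y. A y $ i $ j) differentiable (at x)"
  shows "(\<lambda>y. matrix_inv (A y) $ k $ l) differentiable (at x)"
proof -
  \<comment> \<open>Column l of the inverse solves the linear system with right-hand side
    \<open>axis l 1\<close>, so Cramer's rule writes its entries as quotients of
    determinants.\<close>
  have eq: "matrix_inv (A y) $ k $ l = det (\<chi> i j. if j = k then axis l 1 $ i else A y $ i $ j) / det (A y)" if "y \<in> S" for y
  proof -
    have "invertible (A y)" using nz[OF that] by (simp add: invertible_det_nz)
    then have "A y ** matrix_inv (A y) = mat 1"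
      unfolding invertible_def matrix_inv_def by (rule someI2_ex) simp
    then have "A y *v (matrix_inv (A y) *v axis l 1) = axis l 1"
      by (simp add: matrix_vector_mul_assoc)
    then have "matrix_inv (A y) *v axis l 1 = (\<chi> k. det (\<chi> i j. if j = k then axis l 1 $ i else A y $ i $ j) / det (A y))"
      unfolding cramer[OF nz[OF that]] .
    then have "(matrix_inv (A y) *v axis l 1) $ k = det (\<chi> i j. if j = k then axis l 1 $ i else A y $ i $ j) / det (A y)"
      by simp
    moreover have "(matrix_inv (A y) *v axis l 1) $ k = matrix_inv (A y) $ k $ l"
      by (simp add: matrix_vector_mult_def axis_def if_distrib[of "\<lambda>a. b * a" for b] cong: if_cong)
    ultimately show ?thesis by simp
  qed
  have "(\<lambda>y. (\<chi> i j. if j = k then axis l 1 $ i else A y $ i $ j) $ i' $ j' :: complex) differentiable (at x)" for i' j'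
    by (cases "j' = k") (simp_all add: d)
  then have "(\<lambda>y. det (\<chi> i j. if j = k then axis l 1 $ i else A y $ i $ j) / det (A y)) differentiable (at x)"
    by (intro differentiable_divide differentiable_det d nz S)
  then show ?thesis by (rule differentiable_cong[OF S, rotated]) (rule eq)
qed

context pseudohermitian_chart
begin

text \<open>The Ricci coefficients are given pointwise; regularity comes from
  \<open>scalar_curv_eq\<close>, that is, from the connection trace and the inverse Levi
  matrix.\<close>

lemma diff_scalar_curv: assumes x: "x \<in> V" shows "scalar_curv J P differentiable (at x)"
proof -
  have d1: "(\<lambda>y. matrix_inv (hmat J P y) $ k $ l) differentiable (at x)" for k l
    by (rule differentiable_matrix_inv[OF open_V x det_hmat]) (auto intro: diff_hmat x)
  have d2: "(\<lambda>y. diff1 (conn_trace P) y (E \<beta> y) (Eb \<gamma> y)) differentiable (at x)" for \<beta> \<gamma>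
    by (rule smooth_on_differentiable[OF _ x])
      (intro smooth_on_diff1 open_V smooth_conn_trace smooth_frame smooth_on_cnjv)
  have "(\<lambda>y. Re (\<Sum>i\<in>UNIV. \<Sum>j\<in>UNIV. matrix_inv (hmat J P y) $ i $ j * diff1 (conn_trace P) y (E j y) (Eb i y))) differentiable (at x)"
    by (intro differentiable_linear[OF bounded_linear_Re] differentiable_sum finite ballI differentiable_mult d1 d2)
  then show ?thesis
    by (rule differentiable_cong[OF open_V x, rotated]) (simp add: scalar_curv_eq trace_mult)
qed

lemma diff_chain_form: assumes x: "x \<in> V" shows "(\<lambda>y. chain_form J P y u w) differentiable (at x)"
proof -
  have t: "(\<lambda>y. theta P y \<bullet> v) differentiable (at x)" for v
    by (rule differentiable_linear[OF bounded_linear_inner_left diff_theta[OF x]])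
  have a: "(\<lambda>y. aform J P y v) differentiable (at x)" for v
    unfolding aform_def
    by (intro differentiable_add differentiable_mult t differentiable_divide differentiable_const diff_scalar_curv x
        differentiable_linear[OF bounded_linear_Im] differentiable_ev diff_conn_trace) simp
  have S: "(\<lambda>y. Sform J P y u w) differentiable (at x)" for u w
    unfolding Sform_def
    by (intro differentiable_sum finite ballI differentiable_mult differentiable_ev diff_hmat diff_coframe diff_cobar x)
  show ?thesis
    unfolding chain_form_eq
    by (intro differentiable_diff differentiable_add differentiable_mult differentiable_divide differentiable_const
        differentiable_linear[OF bounded_linear_Re] S t a) simp_all
qed

section \<open>The metric on H, its non-degeneracy and its geodesics\<close>

lemma T10_coframe:
  assumes x: "x \<in> V" and Z: "Z \<in> T10 H J x"
  shows "ev (coframe P \<alpha> x) (cnjv Z) = 0" "ev (cobar P \<alpha> x) Z = 0"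
proof -
  obtain a where "Z = (\<Sum>\<alpha>\<in>UNIV. a \<alpha> *s E \<alpha> x)" using T10_span[OF x Z] by blast
  then show "ev (coframe P \<alpha> x) (cnjv Z) = 0" "ev (cobar P \<alpha> x) Z = 0"
    using x by (simp_all add: cnjv_sum cnjv_smult ev_simps)
qed

text \<open>On H the terms with \<theta> vanish and the Hermitian part remains, so L is half the
  Levi form. This is the link through which L and d\<theta> determine J.\<close>

lemma chain_form_H:
  assumes x: "x \<in> V" and u: "u \<in> H x" and w: "w \<in> H x"
  shows "complex_of_real (2 * chain_form J P x u w) = diff1 (ctheta P) x (cv u) (cv (J x w))"
proof -
  obtain Z where Z: "Z \<in> T10 H J x" "cv u = Z + cnjv Z" using half_T10[OF x u] by blast
  obtain Y where Y: "Y \<in> T10 H J x" "cv w = Y + cnjv Y" "cv (J x w) = \<i> *s Y - \<i> *s cnjv Y" using half_T10[OF x w] by blast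
  have S: "Sform J P x u w = - \<i> * diff1 (ctheta P) x Z (cnjv Y)" if "Z \<in> T10 H J x" "cv u = Z + cnjv Z"
    "Y \<in> T10 H J x" "cv w = Y + cnjv Y" for u w Z Y
    unfolding dtheta_formula[OF x] Sform_def that(2,4)
    using T10_coframe[OF x that(1)] T10_coframe[OF x that(3)] by (simp add: ev_simps)
  have d0: "diff1 (ctheta P) x Z Y = 0" "diff1 (ctheta P) x (cnjv Z) (cnjv Y) = 0"
    unfolding dtheta_formula[OF x] using T10_coframe[OF x Z(1)] T10_coframe[OF x Y(1)] by simp_all
  have c: "Sform J P x w u = cnj (Sform J P x u w)"
    unfolding S[OF Z(1,2) Y(1,2)] S[OF Y(1,2) Z(1,2)]
    using dtheta_cnj[OF x, of Z "cnjv Y"] diff1_antisym[of "ctheta P" x Y "cnjv Z"] by simp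
  have "diff1 (ctheta P) x (cv u) (cv (J x w)) = Sform J P x u w + cnj (Sform J P x u w)"
    unfolding Z(2) Y(3) S[OF Z(1,2) Y(1,2)] using dtheta_cnj[OF x, of Z "cnjv Y"]
    by (simp add: diff1_simps d0)
  moreover have "theta P x \<bullet> u = 0" "theta P x \<bullet> w = 0" using theta_kernel[OF x] u w by auto
  ultimately show ?thesis by (simp add: chain_form_eq c complex_eq_iff)
qed

lemma levi_cv: assumes x: "x \<in> V" and v: "v \<in> H x"
  shows "levi_form J (theta P) x (cv u) (cv v) = diff1 (ctheta P) x (cv u) (cv (J x v))"
proof -
  have "J x 0 = 0" using J_linear[OF x v v, of 0 0] by simp
  moreover have "Rev (cv v) = v" "Imv (cv v) = 0" by (simp_all add: vec_eq_iff)
  ultimately show ?thesis by (simp add: levi_form_def cext_def ctheta_def[abs_def])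
qed

lemma chain_form_nondegenerate:
  assumes x: "x \<in> V" and u: "u \<in> H x" and z: "\<And>w. w \<in> H x \<Longrightarrow> chain_form J P x u w = 0"
  shows "u = 0"
proof -
  have cf: "contact_form V H (theta P)" using adm by (simp add: admissible_coframe_def)
  have "\<forall>v\<in>H x. levi_form J (theta P) x (cv u) (cv v) = 0"
    using z chain_form_H[OF x u] by (simp add: levi_cv[OF x])
  then show ?thesis
    using nondeg[unfolded nondegenerate_on_def, rule_format, OF open_V V_sub cf x u] by blast
qed

lemma dtheta_dext: assumes x: "x \<in> V" shows "diff1 (ctheta P) x (cv v) (cv w) = complex_of_real (dext (theta P) x v w)"
proof -
  have "frechet_derivative (\<lambda>y. ev (ctheta P y) (cv u)) (at x) h = complex_of_real (frechet_derivative (\<lambda>y. theta P y \<bullet> u) (at x) h)" for u h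
    unfolding ctheta_def ev_cv
    by (intro frechet_eqI has_derivative_of_real)
      (simp add: frechet_derivative_works[symmetric] differentiable_linear[OF bounded_linear_inner_left diff_theta[OF x]])
  then show ?thesis using diff1_cv[OF diff_ctheta[OF x]] by (simp add: dext_def)
qed

lemma chain_form_dext: "x \<in> V \<Longrightarrow> u \<in> H x \<Longrightarrow> w \<in> H x \<Longrightarrow> 2 * chain_form J P x u w = dext (theta P) x u (J x w)"
  using chain_form_H[of x u w] dtheta_dext[of x u "J x w"] by (simp only: of_real_eq_iff)

text \<open>Pairing with the fibre direction forces the base component into H, pairing with H then
  kills it by non-degeneracy of the Levi form, and pairing with the Reeb field kills the fibre
  component.\<close>

lemma fefferman_nondegenerate:
  assumes x: "x \<in> V" and z: "\<And>w. fefferman_metric J P (x, s) \<zeta> w = 0"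
  shows "\<zeta> = 0"
proof -
  obtain u \<tau> where \<zeta>: "\<zeta> = (u, \<tau>)" by (cases \<zeta>)
  have n: "real CARD('n) + 2 \<noteq> 0" by linarith
  have c0: "chain_form J P x u 0 = 0" for u
    using bilinear_rzero[OF bilinear_chain_form] .
  have "theta P x \<bullet> u = 0" using z[of "(0, 1)"] n by (simp add: \<zeta> fefferman_metric_split c0)
  then have u: "u \<in> H x" using theta_kernel[OF x] by blast
  have "chain_form J P x u w = 0" if "w \<in> H x" for w
    using z[of "(w, 0)"] theta_kernel[OF x, of w] that by (simp add: \<zeta> fefferman_metric_split)
  then have u0: "u = 0" by (rule chain_form_nondegenerate[OF x u])
  have "theta P x \<bullet> reeb P x = 1" using adm x by (simp add: admissible_coframe_def)
  moreover have "chain_form J P x 0 w = 0" for w using bilinear_lzero[OF bilinear_chain_form] .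
  ultimately have "\<tau> = 0" using z[of "(reeb P x, 0)"] n by (simp add: \<zeta> fefferman_metric_split u0)
  then show ?thesis by (simp add: \<zeta> u0 zero_prod_def)
qed

lemma fefferman_has_derivative:
  assumes x: "x \<in> V"
  shows "((\<lambda>p. fefferman_metric J P p (u, \<tau>) (w, \<tau>')) has_derivative
    (\<lambda>(h, k). frechet_derivative (\<lambda>y. chain_form J P y u w) (at x) h
      + (frechet_derivative (\<lambda>y. theta P y \<bullet> u) (at x) h * \<tau>' + frechet_derivative (\<lambda>y. theta P y \<bullet> w) (at x) h * \<tau>) / (real CARD('n) + 2))) (at (x, s))"
proof -
  have f: "(fst has_derivative fst) (at (x, s))"
    by (rule bounded_linear_imp_has_derivative[OF bounded_linear_fst])
  have c: "((\<lambda>p. F (fst p)) has_derivative (\<lambda>h. frechet_derivative F (at x) (fst h))) (at (x, s))"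
    if "F differentiable (at x)" for F :: "'n rvec \<Rightarrow> real"
    by (rule has_derivative_compose[OF f]) (use that in \<open>simp add: frechet_derivative_works\<close>)
  have t: "(\<lambda>y. theta P y \<bullet> v) differentiable (at x)" for v
    by (rule differentiable_linear[OF bounded_linear_inner_left diff_theta[OF x]])
  have "((\<lambda>p. chain_form J P (fst p) u w + (\<tau>' / (real CARD('n) + 2) * (theta P (fst p) \<bullet> u)
      + \<tau> / (real CARD('n) + 2) * (theta P (fst p) \<bullet> w))) has_derivative
    (\<lambda>h. frechet_derivative (\<lambda>y. chain_form J P y u w) (at x) (fst h)
      + (\<tau>' / (real CARD('n) + 2) * frechet_derivative (\<lambda>y. theta P y \<bullet> u) (at x) (fst h)
       + \<tau> / (real CARD('n) + 2) * frechet_derivative (\<lambda>y. theta P y \<bullet> w) (at x) (fst h)))) (at (x, s))"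
    by (intro has_derivative_add has_derivative_mult_right c t diff_chain_form x)
  moreover have "fefferman_metric J P p (u, \<tau>) (w, \<tau>') = chain_form J P (fst p) u w + (\<tau>' / (real CARD('n) + 2) * (theta P (fst p) \<bullet> u)
      + \<tau> / (real CARD('n) + 2) * (theta P (fst p) \<bullet> w))" for p
    using fefferman_metric_split[of J P "fst p" "snd p" u \<tau> w \<tau>'] by (simp add: add_divide_distrib mult.commute)
  ultimately show ?thesis by (simp add: case_prod_unfold add_divide_distrib mult.commute)
qed

lemma geodesic_equation:
  assumes x: "fst p \<in> V" and acc: "c'' + christoffel (fefferman_metric J P) p c' c' = 0"
    and null: "fefferman_metric J P p c' c' = 0"
  shows "theta P (fst p) \<bullet> fst c'' + frechet_derivative (\<lambda>y. theta P y \<bullet> fst c') (at (fst p)) (fst c') = 0"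
    and "theta P (fst p) \<bullet> fst c' \<noteq> 0 \<Longrightarrow> w \<in> H (fst p) \<Longrightarrow>
      chain_EL (chain_form J P) (theta P) (fst p) (fst c') (fst c'') w = 0"
proof -
  obtain x s where p: "p = (x, s)" by (cases p)
  obtain v \<tau> where c': "c' = (v, \<tau>)" by (cases c')
  obtain q \<sigma> where c'': "c'' = (q, \<sigma>)" by (cases c'')
  have x: "x \<in> V" using x p by simp
  let ?G = "fefferman_metric J P"
  define N where "N = real CARD('n) + 2"
  note split = fefferman_metric_split[where J=J and P=P, folded N_def]
  let ?D = "\<lambda>f h. frechet_derivative f (at x) h"
  have n: "N > 0" unfolding N_def by linarith
  have D: "frechet_derivative (\<lambda>p. ?G p (a, b) (c, d)) (at p) (h, k) = ?D (\<lambda>y. chain_form J P y a c) h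
      + (?D (\<lambda>y. theta P y \<bullet> a) h * d + ?D (\<lambda>y. theta P y \<bullet> c) h * b) / N" for a b c d h k
    unfolding p using frechet_eqI[OF fefferman_has_derivative[OF x, of a b c d s], of "(h, k)"] by (simp add: N_def)
  have dG: "(\<lambda>p. ?G p a b) differentiable (at p)" for a b
    unfolding p by (cases a, cases b) (use differentiableI[OF fefferman_has_derivative[OF x]] in simp)
  have nd: "z = 0" if "\<And>w. ?G p z w = 0" for z
    using fefferman_nondegenerate[OF x] that unfolding p by blast
  have gamma: "christoffel ?G p c' c' = - c''" using acc by (simp add: eq_neg_iff_add_eq_0 add.commute)
  have eq: "- 2 * ?G p c'' X = 2 * frechet_derivative (\<lambda>p. ?G p c' X) (at p) c' - frechet_derivative (\<lambda>p. ?G p c' c') (at p) X" for X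
    using christoffel_eq[where g="fefferman_metric J P" and x=p and u=c' and v=c' and w=X, OF bilinear_fefferman dG nd, unfolded gamma]
      bilinear_lneg[OF bilinear_fefferman, of J P p c'' X] by simp
  have c0: "chain_form J P y u 0 = 0" for u y using bilinear_rzero[OF bilinear_chain_form] .
  have lin0: "?D f 0 = 0" if "f differentiable (at x)" for f :: "'n rvec \<Rightarrow> real"
    using linear_0[OF linear_frechet_derivative[OF that]] .
  have t: "(\<lambda>y. theta P y \<bullet> v) differentiable (at x)" for v
    by (rule differentiable_linear[OF bounded_linear_inner_left diff_theta[OF x]])
  \<comment> \<open>The test vector points along the fibre. The metric is independent of the fibre
    coordinate and pairing with this vector is \<theta> / N, so the equation says that \<theta>(v)
    has derivative 0.\<close>
  have "- 2 * (theta P x \<bullet> q / N) = 2 * (?D (\<lambda>y. theta P y \<bullet> v) v / N)"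
    using eq[of "(0, 1)"] unfolding c' c'' D
    by (simp add: p split c0 lin0 t diff_chain_form x)
  then have "theta P x \<bullet> q + ?D (\<lambda>y. theta P y \<bullet> v) v = 0"
    using n by (simp add: field_simps)
  then show 1: "theta P (fst p) \<bullet> fst c'' + frechet_derivative (\<lambda>y. theta P y \<bullet> fst c') (at (fst p)) (fst c') = 0"
    by (simp add: p c' c'')
  assume "theta P (fst p) \<bullet> fst c' \<noteq> 0" "w \<in> H (fst p)"
  then have tv: "theta P x \<bullet> v \<noteq> 0" and w: "w \<in> H x" by (auto simp: p c')
  have tw: "theta P x \<bullet> w = 0" using theta_kernel[OF x] w by blast
  \<comment> \<open>The null condition L(v, v) + 2 \<theta>(v) \<tau> / N = 0, solved for the fibre
    velocity; inserting it is the elimination that leads to the Kropina function.\<close>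
  have nl: "\<tau> / N = - chain_form J P x v v / (2 * (theta P x \<bullet> v))"
    using null n tv by (simp add: p c' split field_simps)
  define k where "k = \<tau> / N"
  have "- 2 * chain_form J P x q w = 2 * (?D (\<lambda>y. chain_form J P y v w) v + k * ?D (\<lambda>y. theta P y \<bullet> w) v)
      - (?D (\<lambda>y. chain_form J P y v v) w + 2 * k * ?D (\<lambda>y. theta P y \<bullet> v) w)"
    using eq[of "(w, 0)"] unfolding c' c'' D
    by (simp add: p split tw k_def add_divide_distrib mult.commute)
  then have "chain_form J P x q w + ?D (\<lambda>y. chain_form J P y v w) v - ?D (\<lambda>y. chain_form J P y v v) w / 2
      + \<tau> / N * dext (theta P) x v w = 0"
    unfolding dext_def k_def[symmetric] by (simp add: algebra_simps)
  \<comment> \<open>The last term of \<open>chain_EL\<close> contains the derivative of \<theta>(v),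
    which is 0 in the parameter of the geodesic.\<close>
  then show "chain_EL (chain_form J P) (theta P) (fst p) (fst c') (fst c'') w = 0"
    using 1 unfolding nl chain_EL_def by (simp add: p c' c'')
qed

end

section \<open>Invariance of the chain equation\<close>

text \<open>In terms of the (1,0)-part of u and the (0,1)-part of w the Hermitian form needs no
  indices; these parts are what a change of coframe is easy to follow on.\<close>

lemma (in pseudohermitian_chart) Sform_dtheta:
  assumes x: "x \<in> V"
  shows "Sform J P x u w = - \<i> * diff1 (ctheta P) x (\<Sum>\<alpha>\<in>UNIV. ev (coframe P \<alpha> x) (cv u) *s E \<alpha> x)
    (\<Sum>\<beta>\<in>UNIV. ev (cobar P \<beta> x) (cv w) *s Eb \<beta> x)"
proof -
  have "diff1 (ctheta P) x (\<Sum>\<alpha>\<in>UNIV. ev (coframe P \<alpha> x) (cv u) *s E \<alpha> x) (\<Sum>\<beta>\<in>UNIV. ev (cobar P \<beta> x) (cv w) *s Eb \<beta> x)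
     = (\<Sum>\<alpha>\<in>UNIV. \<Sum>\<beta>\<in>UNIV. \<i> * (hmat J P x $ \<alpha> $ \<beta> * (ev (coframe P \<alpha> x) (cv u) * ev (cobar P \<beta> x) (cv w))))"
    unfolding diff1_sum_left diff1_sum_right
    by (subst sum.swap, intro sum.cong refl) (simp add: diff1_simps dtheta_EEb x mult_ac)
  also have "\<dots> = \<i> * Sform J P x u w" by (simp add: Sform_def sum_distrib_left)
  finally show ?thesis by simp
qed

context two_pseudohermitian
begin

text \<open>The (1,0)-part of u relative to the new Reeb field differs from the old one by -
  \<theta>(u) W1. Expanding the Hermitian form gives cross terms, where h lowers \<open>W\<close> to
  \<open>tau\<close>, and the square \<open>NN\<close>.\<close>

lemma Sform_Q:
  assumes y: "y \<in> V"
  shows "Sform J Q y u w = crat y * (Sform J P y u w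
    + complex_of_real (theta P y \<bullet> u) * (\<i> * ev (tau y) (cv w))
    + complex_of_real (theta P y \<bullet> w) * cnj (\<i> * ev (tau y) (cv u))
    + complex_of_real (theta P y \<bullet> u) * complex_of_real (theta P y \<bullet> w) * NN y)"
proof -
  have X: "(\<Sum>\<alpha>\<in>UNIV. ev (coframe Q \<alpha> y) (cv u) *s frame Q \<alpha> y) = (\<Sum>\<beta>\<in>UNIV. ev (phi \<beta> y) (cv u) *s frame P \<beta> y)" for u
  proof -
    have "(\<Sum>\<alpha>\<in>UNIV. ev (coframe Q \<alpha> y) (cv u) *s frame Q \<alpha> y)
       = (\<Sum>\<alpha>\<in>UNIV. \<Sum>\<beta>\<in>UNIV. ev (phi \<beta> y) (cv u) *s (Ui \<alpha> \<beta> y *s frame Q \<alpha> y))"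
      by (simp add: coframe_Q[OF y] ev_simps vec.scale_sum_left vector_smult_assoc mult.commute)
    also have "\<dots> = (\<Sum>\<beta>\<in>UNIV. ev (phi \<beta> y) (cv u) *s frame P \<beta> y)"
      by (subst sum.swap) (simp add: frame_P[OF y] vec.scale_sum_right)
    finally show ?thesis .
  qed
  have Y: "(\<Sum>\<beta>\<in>UNIV. ev (cobar Q \<beta> y) (cv w) *s cnjv (frame Q \<beta> y)) = (\<Sum>\<beta>\<in>UNIV. cnj (ev (phi \<beta> y) (cv w)) *s cnjv (frame P \<beta> y))"
    using arg_cong[OF X[of w], of cnjv] by (simp add: cnjv_sum cnjv_smult cobar_def ev_cnjv_left)
  let ?X = "\<Sum>\<beta>\<in>UNIV. ev (phi \<beta> y) (cv u) *s frame P \<beta> y"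
  let ?Y = "\<Sum>\<beta>\<in>UNIV. cnj (ev (phi \<beta> y) (cv w)) *s cnjv (frame P \<beta> y)"
  let ?tu = "complex_of_real (theta P y \<bullet> u)" and ?tw = "complex_of_real (theta P y \<bullet> w)"
  let ?h = "\<lambda>\<alpha> \<beta>. hmat J P y $ \<alpha> $ \<beta>"
  have "Sform J Q y u w = - \<i> * diff1 (ctheta Q) y ?X ?Y"
    unfolding Q.Sform_dtheta[OF y] X Y ..
  also have "diff1 (ctheta Q) y ?X ?Y = crat y * diff1 (ctheta P) y ?X ?Y"
    unfolding dtheta_Q[OF y] wedge_def using y by (simp add: ev_simps)
  also have "diff1 (ctheta P) y ?X ?Y = \<i> * (\<Sum>\<alpha>\<in>UNIV. \<Sum>\<beta>\<in>UNIV. ?h \<alpha> \<beta> * (ev (phi \<alpha> y) (cv u) * cnj (ev (phi \<beta> y) (cv w))))"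
    unfolding diff1_sum_left diff1_sum_right sum_distrib_left
    by (subst sum.swap, intro sum.cong refl) (simp add: diff1_simps P.dtheta_EEb y mult_ac)
  finally have 1: "Sform J Q y u w = crat y * (\<Sum>\<alpha>\<in>UNIV. \<Sum>\<beta>\<in>UNIV. ?h \<alpha> \<beta> * (ev (phi \<alpha> y) (cv u) * cnj (ev (phi \<beta> y) (cv w))))"
    by (simp add: complex_eq_iff)
  have ph: "ev (phi \<alpha> y) (cv u) = ev (coframe P \<alpha> y) (cv u) - W \<alpha> y * complex_of_real (theta P y \<bullet> u)" for \<alpha> u
    by (simp add: phi_def ev_simps ctheta_def ev_cv)
  have cb: "cnj (ev (coframe P \<alpha> y) (cv u)) = ev (cobar P \<alpha> y) (cv u)" for \<alpha> u
    by (simp add: cobar_def ev_cnjv_left)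
  have t1: "(\<Sum>\<alpha>\<in>UNIV. \<Sum>\<beta>\<in>UNIV. ?h \<alpha> \<beta> * (W \<alpha> y * ev (cobar P \<beta> y) (cv u))) = - \<i> * ev (tau y) (cv u)" for u
    by (subst sum.swap) (simp add: tau_def ev_simps sum_distrib_left sum_distrib_right mult_ac)
  have t2: "(\<Sum>\<alpha>\<in>UNIV. \<Sum>\<beta>\<in>UNIV. ?h \<alpha> \<beta> * (ev (coframe P \<alpha> y) (cv u) * cnj (W \<beta> y))) = cnj (- \<i> * ev (tau y) (cv u))" for u
    unfolding t1[symmetric]
    by (subst sum.swap) (simp add: P.hmat_hermitian[OF y] cb[symmetric] mult_ac)
  have "(\<Sum>\<alpha>\<in>UNIV. \<Sum>\<beta>\<in>UNIV. ?h \<alpha> \<beta> * (ev (phi \<alpha> y) (cv u) * cnj (ev (phi \<beta> y) (cv w)))) =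
     (\<Sum>\<alpha>\<in>UNIV. \<Sum>\<beta>\<in>UNIV. ?h \<alpha> \<beta> * (ev (coframe P \<alpha> y) (cv u) * ev (cobar P \<beta> y) (cv w))
      - ?tu * (?h \<alpha> \<beta> * (W \<alpha> y * ev (cobar P \<beta> y) (cv w)))
      - ?tw * (?h \<alpha> \<beta> * (ev (coframe P \<alpha> y) (cv u) * cnj (W \<beta> y)))
      + ?tu * ?tw * (?h \<alpha> \<beta> * W \<alpha> y * cnj (W \<beta> y)))"
    by (intro sum.cong refl) (simp add: ph cb algebra_simps)
  also have "\<dots> = Sform J P y u w - ?tu * (- \<i> * ev (tau y) (cv w)) - ?tw * cnj (- \<i> * ev (tau y) (cv u)) + ?tu * ?tw * NN y"
    unfolding sum.distrib sum_subtractf sum_distrib_left[symmetric] t1 t2 Sform_def NN_def ..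
  finally have 2: "(\<Sum>\<alpha>\<in>UNIV. \<Sum>\<beta>\<in>UNIV. ?h \<alpha> \<beta> * (ev (phi \<alpha> y) (cv u) * cnj (ev (phi \<beta> y) (cv w)))) =
    Sform J P y u w - ?tu * (- \<i> * ev (tau y) (cv w)) - ?tw * cnj (- \<i> * ev (tau y) (cv u)) + ?tu * ?tw * NN y" .
  show ?thesis unfolding 1 2 by (simp add: algebra_simps)
qed

text \<open>Since \<open>lam\<close> is d ln det U, this is a multiple of d arg det U, the rate at
  which the phases of the two sections \<open>zeta0\<close> drift apart. The constant makes
  \<open>chain_form_Q\<close> come out with polarised product \<theta> \<beta>.\<close>

definition "beta y w = - 2 / (real CARD('n) + 2) * Im (ev (lam y) (cv w))"

lemma du_cv_real: "y \<in> V \<Longrightarrow> Im (ev (du y) (cv w)) = 0"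
  using du_cnj[of y "cv w"] by (simp add: complex_eq_iff)

text \<open>The \<theta>-component collects Im rho from the connection trace and ((n + 2) Im DD - n
  Im rho) / (2 (n + 1)) from the curvature, together (n + 2) (Im rho + Im DD) / (2 (n + 1)). By
  \<open>rho_eq\<close> the bracket is (n + 1) NN, so the derivatives of \<open>W\<close> in
  \<open>DD\<close> disappear.\<close>

lemma aform_Q:
  assumes y: "y \<in> V"
  shows "aform J Q y w = aform J P y w + Im (ev (lam y) (cv w)) - (real CARD('n) + 2) * Im (ev (tau y) (cv w))
    + (real CARD('n) + 2) / 2 * Re (NN y) * (theta P y \<bullet> w)"
proof -
  define n where "n = real CARD('n)"
  have n: "n + 1 > 0" by (simp add: n_def)
  have N: "Im (NN y) = 0" using NN_real[OF y] by (simp add: complex_eq_iff)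
  have rho: "Im (rho y) = - Im (DD y) + (n + 1) * Re (NN y)"
    unfolding rho_eq[OF y] n_def using du_cv_real[OF y] by (simp add: N algebra_simps)
  have "conn_trace Q y = conn_trace P y + lam y + mu y" by (simp add: mu_def)
  then have "Im (ev (conn_trace Q y) (cv w)) = Im (ev (conn_trace P y) (cv w)) + Im (ev (lam y) (cv w)) + Im (ev (mu y) (cv w))"
    by (simp add: ev_simps)
  also have "Im (ev (mu y) (cv w)) = - (n + 2) * Im (ev (tau y) (cv w)) + Im (rho y) * (theta P y \<bullet> w)"
    unfolding mu_eq[OF y] n_def using du_cv_real[OF y] by (simp add: ev_simps ctheta_def ev_cv algebra_simps)
  finally have 1: "Im (ev (conn_trace Q y) (cv w)) = Im (ev (conn_trace P y) (cv w)) + Im (ev (lam y) (cv w))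
     + (- (n + 2) * Im (ev (tau y) (cv w)) + Im (rho y) * (theta P y \<bullet> w))" .
  have "scalar_curv J Q y / (2 * (n + 1)) * (theta Q y \<bullet> w) = (rat y * scalar_curv J Q y) / (2 * (n + 1)) * (theta P y \<bullet> w)"
    by (simp add: theta_Q[OF y])
  also have "\<dots> = (scalar_curv J P y + (n + 2) * Im (DD y) - n * Im (rho y)) / (2 * (n + 1)) * (theta P y \<bullet> w)"
    unfolding scalar_curv_Q[OF y] n_def ..
  finally have 2: "scalar_curv J Q y / (2 * (n + 1)) * (theta Q y \<bullet> w) =
     (scalar_curv J P y + (n + 2) * Im (DD y) - n * Im (rho y)) / (2 * (n + 1)) * (theta P y \<bullet> w)" .
  show ?thesis
    unfolding aform_def n_def[symmetric] 1 2 rho using n by (simp add: field_simps)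
qed

text \<open>The \<open>tau\<close> and \<open>NN\<close> terms of \<open>Sform_Q\<close> cancel
  against those of \<open>aform_Q\<close> divided by n + 2, the latter counted twice in the
  symmetric product with \<theta>; only \<open>lam\<close> survives.\<close>

lemma chain_form_Q:
  assumes y: "y \<in> V"
  shows "chain_form J Q y u w = rat y * (chain_form J P y u w + (theta P y \<bullet> u * beta y w + theta P y \<bullet> w * beta y u) / 2)"
proof -
  define N where "N = real CARD('n) + 2"
  have N: "N > 0" unfolding N_def by linarith
  have R: "Re (Sform J Q y u w + Sform J Q y w u) / 2 = rat y * (Re (Sform J P y u w + Sform J P y w u) / 2
     - (theta P y \<bullet> u) * Im (ev (tau y) (cv w)) - (theta P y \<bullet> w) * Im (ev (tau y) (cv u))
     + (theta P y \<bullet> u) * (theta P y \<bullet> w) * Re (NN y))"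
    unfolding Sform_Q[OF y] by (simp add: field_simps)
  show ?thesis
    unfolding chain_form_eq R aform_Q[OF y] beta_def N_def[symmetric] theta_Q[OF y] inner_scaleR_left
    using N by (simp add: field_simps)
qed

lemma chain_EL_Q:
  assumes x: "x \<in> V" and v: "theta P x \<bullet> v \<noteq> 0" and w: "w \<in> H x"
  shows "chain_EL (chain_form J Q) (theta Q) x v q w = rat x * chain_EL (chain_form J P) (theta P) x v q w"
proof (rule chain_EL_conformal[OF P.open_V x theta_Q chain_form_Q])
  show "rat differentiable (at x)"
    using smooth_on_differentiable[OF smooth_on_inner[OF P.open_V Q.smooth_theta P.smooth_reeb] x]
    by (simp add: rat_def[abs_def])
  show "(\<lambda>y. chain_form J P y u w) differentiable (at x)" for u w by (rule P.diff_chain_form[OF x])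
  show "theta P differentiable (at x)" by (rule P.diff_theta[OF x])
  show "rat x \<noteq> 0" by (rule rat_nz[OF x])
  show "theta P x \<bullet> v \<noteq> 0" by (rule v)
  show "theta P x \<bullet> w = 0" using P.theta_kernel[OF x] w by blast
  have dl: "(\<lambda>y. ev (lam y) (cv u)) differentiable (at x)" for u
    by (rule differentiable_ev[OF smooth_on_differentiable[OF smooth_lam x]])
  have h: "((\<lambda>y. beta y u) has_derivative (\<lambda>h. - 2 / (real CARD('n) + 2) * Im (frechet_derivative (\<lambda>y. ev (lam y) (cv u)) (at x) h))) (at x)" for u
    unfolding beta_def
    by (intro has_derivative_mult_right has_derivative_Im) (simp add: frechet_derivative_works[symmetric] dl)
  show "(\<lambda>y. beta y u) differentiable (at x)" for u using h by (rule differentiableI)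
  have "frechet_derivative (\<lambda>y. ev (lam y) (cv w)) (at x) v = frechet_derivative (\<lambda>y. ev (lam y) (cv v)) (at x) w"
    using diff1_cv[OF smooth_on_differentiable[OF smooth_lam x], of v w] dlam[OF x] by simp
  then show "frechet_derivative (\<lambda>y. beta y w) (at x) v = frechet_derivative (\<lambda>y. beta y v) (at x) w"
    by (simp add: frechet_eqI[OF h])
qed

end

section \<open>Two-jets of chains\<close>

lemma admissible_coframe_subset:
  assumes "admissible_coframe V H J P" "U \<subseteq> V" shows "admissible_coframe U H J P"
proof -
  note h = assms(1)[unfolded admissible_coframe_def contact_form_def]
  have ball: "\<forall>x\<in>U. R x" if "\<forall>x\<in>V. R x" for R using that assms(2) by blast
  note sub = smooth_on_subset[OF _ assms(2)]
  show ?thesis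
    unfolding admissible_coframe_def contact_form_def
  proof (intro conjI allI)
    show "smooth_on U (theta P)" by (rule sub[OF h[THEN conjunct1, THEN conjunct1]])
    show "\<forall>x\<in>U. {v. theta P x \<bullet> v = 0} = H x" by (rule ball[OF h[THEN conjunct1, THEN conjunct2]])
    show "smooth_on U (reeb P)" by (rule sub[OF h[THEN conjunct2, THEN conjunct1]])
    show "smooth_on U (frame P \<alpha>)" "smooth_on U (coframe P \<alpha>)" for \<alpha>
      using h[THEN conjunct2, THEN conjunct2, THEN conjunct1] by (auto intro: sub)
  qed (rule ball[OF h[THEN conjunct2, THEN conjunct2, THEN conjunct2]])
qed

lemma pseudohermitian_subset:
  assumes "pseudohermitian V H J P" "U \<subseteq> V" shows "pseudohermitian U H J P"
proof -
  have a: "admissible_coframe U H J P"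
    using assms admissible_coframe_subset unfolding pseudohermitian_def by blast
  have t: "tanaka_webster U J P"
  proof -
    have h: "tanaka_webster V J P" using assms(1) by (simp add: pseudohermitian_def)
    have ball: "\<forall>x\<in>U. R x" if "\<forall>x\<in>V. R x" for R using that assms(2) by blast
    show ?thesis
      unfolding tanaka_webster_def
      by (intro conjI allI smooth_on_subset[OF _ assms(2)] ball[OF h[unfolded tanaka_webster_def, THEN conjunct2]])
        (use h in \<open>simp add: tanaka_webster_def\<close>)
  qed
  have r: "ricci_tensor U P"
    using assms unfolding pseudohermitian_def ricci_tensor_def by blast
  show ?thesis using a t r by (simp add: pseudohermitian_def)
qed

text \<open>\<open>v\<close> and \<open>q\<close> are the velocity and acceleration at \<open>x\<close>, in an arbitrary parametrisation, of a
  curve that satisfies the chain equation at \<open>x\<close>.\<close>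

definition chain_jet :: "'n::finite rvec set \<Rightarrow> ('n rvec \<Rightarrow> 'n rvec set) \<Rightarrow> ('n rvec \<Rightarrow> 'n rvec \<Rightarrow> 'n rvec) \<Rightarrow>
    'n ph_data \<Rightarrow> 'n rvec \<Rightarrow> 'n rvec \<Rightarrow> 'n rvec \<Rightarrow> bool" where
  "chain_jet V H J P x v q \<longleftrightarrow> open V \<and> x \<in> V \<and> pseudohermitian V H J P \<and> theta P x \<bullet> v \<noteq> 0 \<and>
    (\<forall>w\<in>H x. chain_EL (chain_form J P) (theta P) x v q w = 0)"

text \<open>The two sets of data are compared on the intersection of their domains. Afterwards all
  jets at a point can be expressed by one fixed choice of data.\<close>

lemma chain_jet_invariant:
  assumes cr0: "cr_structure_on \<Omega> H J" "nondegenerate_on \<Omega> H J"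
    and Q: "chain_jet V' H J Q x v q" "V' \<subseteq> \<Omega>" and P: "open V" "x \<in> V" "V \<subseteq> \<Omega>" "pseudohermitian V H J P"
  shows "chain_jet V H J P x v q"
proof -
  have o: "open (V \<inter> V')" "x \<in> V \<inter> V'" "V \<inter> V' \<subseteq> \<Omega>" using assms by (auto simp: chain_jet_def)
  have ph: "pseudohermitian (V \<inter> V') H J P" "pseudohermitian (V \<inter> V') H J Q"
    using Q(1) P(4) pseudohermitian_subset[of V H J P] pseudohermitian_subset[of V' H J Q]
    by (auto simp: chain_jet_def)
  interpret two_pseudohermitian \<Omega> "V \<inter> V'" H J P Q
    by (intro two_pseudohermitian.intro; unfold_locales) (use o cr0 ph in auto)
  have tv: "theta P x \<bullet> v \<noteq> 0"
    using Q(1) theta_Q[OF o(2)] by (auto simp: chain_jet_def)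
  have "chain_EL (chain_form J P) (theta P) x v q w = 0" if "w \<in> H x" for w
    using chain_EL_Q[OF o(2) tv that, of q] rat_nz[OF o(2)] Q(1) that by (simp add: chain_jet_def)
  then show ?thesis using tv P by (simp add: chain_jet_def)
qed

text \<open>Transversality is required at parameter 0 only, but \<open>chain_EL\<close> divides by
  \<theta>(v) everywhere. Since \<theta>(v) is conserved and the interval is connected, it is
  nonzero along the whole geodesic.\<close>

lemma (in pseudohermitian_chart) null_geodesic_jet:
  assumes I: "open_interval I" "0 \<in> I" and g: "null_geodesic (fefferman_metric J P) I g g'"
    and V: "\<And>t. t \<in> I \<Longrightarrow> fst (g t) \<in> V" and tr: "fefferman_metric J P (g 0) fefferman_K (g' 0) \<noteq> 0"
  shows "\<exists>q. \<forall>t\<in>I. ((\<lambda>t. fst (g t)) has_vector_derivative fst (g' t)) (at t) \<and>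
    ((\<lambda>t. fst (g' t)) has_vector_derivative q t) (at t) \<and>
    chain_jet V H J P (fst (g t)) (fst (g' t)) (q t)"
proof -
  obtain c'' where c: "\<And>t. t \<in> I \<Longrightarrow> (g has_vector_derivative g' t) (at t) \<and> (g' has_vector_derivative c'' t) (at t) \<and>
      c'' t + christoffel (fefferman_metric J P) (g t) (g' t) (g' t) = 0 \<and> fefferman_metric J P (g t) (g' t) (g' t) = 0"
    using g unfolding null_geodesic_def by blast
  define F where "F t = theta P (fst (g t)) \<bullet> fst (g' t)" for t
  have d1: "((\<lambda>t. fst (g t)) has_vector_derivative fst (g' t)) (at t)" if "t \<in> I" for t
    using bounded_linear.has_vector_derivative[OF bounded_linear_fst, of g "g' t" "at t"] c[OF that] by blast
  have d2: "((\<lambda>t. fst (g' t)) has_vector_derivative fst (c'' t)) (at t)" if "t \<in> I" for t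
    using bounded_linear.has_vector_derivative[OF bounded_linear_fst, of g' "c'' t" "at t"] c[OF that] by blast
  have "(F has_field_derivative 0) (at t within I)" if t: "t \<in> I" for t
  proof -
    let ?x = "fst (g t)" and ?v = "fst (g' t)"
    have th: "(theta P has_derivative frechet_derivative (theta P) (at ?x)) (at ?x)"
      using diff_theta[OF V[OF t]] by (simp add: frechet_derivative_works)
    have D1: "((\<lambda>t. fst (g t)) has_derivative (\<lambda>h. h *\<^sub>R ?v)) (at t)" and D2: "((\<lambda>t. fst (g' t)) has_derivative (\<lambda>h. h *\<^sub>R fst (c'' t))) (at t)"
      using d1[OF t] d2[OF t] by (auto simp: has_vector_derivative_def)
    have "(F has_derivative (\<lambda>h. theta P ?x \<bullet> (h *\<^sub>R fst (c'' t)) + frechet_derivative (theta P) (at ?x) (h *\<^sub>R ?v) \<bullet> ?v)) (at t)"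
      unfolding F_def by (rule has_derivative_inner[OF has_derivative_compose[OF D1 th] D2])
    moreover have "theta P ?x \<bullet> (h *\<^sub>R fst (c'' t)) + frechet_derivative (theta P) (at ?x) (h *\<^sub>R ?v) \<bullet> ?v = 0" for h
    proof -
      have "frechet_derivative (\<lambda>y. theta P y \<bullet> ?v) (at ?x) ?v = frechet_derivative (theta P) (at ?x) ?v \<bullet> ?v"
        by (rule frechet_eqI[OF has_derivative_inner_left[OF th]])
      then have "theta P ?x \<bullet> fst (c'' t) + frechet_derivative (theta P) (at ?x) ?v \<bullet> ?v = 0"
        using geodesic_equation(1)[of "g t" "c'' t" "g' t"] V[OF t] c[OF t] by simp
      moreover have "frechet_derivative (theta P) (at ?x) (h *\<^sub>R ?v) = h *\<^sub>R frechet_derivative (theta P) (at ?x) ?v"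
        using linear_scale[OF linear_frechet_derivative[OF diff_theta[OF V[OF t]]]] .
      ultimately show ?thesis by (simp flip: distrib_left)
    qed
    ultimately have "(F has_derivative (\<lambda>h. 0)) (at t)" by simp
    moreover have "((*) 0 :: real \<Rightarrow> real) = (\<lambda>h. 0)" by auto
    ultimately show ?thesis
      by (simp add: has_field_derivative_def has_derivative_at_withinI)
  qed
  moreover have "convex I" using I is_interval_connected_1[of I] is_interval_convex_1[of I] by (simp add: open_interval_def)
  ultimately obtain k where k: "\<And>t. t \<in> I \<Longrightarrow> F t = k"
    using has_field_derivative_zero_constant[of I F] by auto
  have "fefferman_metric J P (g 0) fefferman_K (g' 0) = F 0"
  proof -
    obtain x s v \<tau> where e: "g 0 = (x, s)" "g' 0 = (v, \<tau>)" by (cases "g 0", cases "g' 0")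
    have "real CARD('n) + 2 \<noteq> 0" by linarith
    then show ?thesis
      by (simp add: e F_def fefferman_K_def fefferman_metric_split bilinear_lzero[OF bilinear_chain_form])
  qed
  then have "k \<noteq> 0" using tr k[OF I(2)] by simp
  then have nz: "F t \<noteq> 0" if "t \<in> I" for t using k[OF that] by simp
  have "chain_jet V H J P (fst (g t)) (fst (g' t)) (fst (c'' t))" if t: "t \<in> I" for t
    unfolding chain_jet_def
    using geodesic_equation(2)[of "g t" "c'' t" "g' t"] V[OF t] c[OF t] nz[OF t] open_V ph by (simp add: F_def)
  then show ?thesis using d1 d2 by (intro exI[of _ "\<lambda>t. fst (c'' t)"]) blast
qed

lemma chain_jet_reparam:
  assumes cr0: "cr_structure_on \<Omega> H J" "nondegenerate_on \<Omega> H J" "V \<subseteq> \<Omega>"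
    and j: "chain_jet V H J P x v q" and a: "a \<noteq> 0"
  shows "chain_jet V H J P x (a *\<^sub>R v) (a\<^sup>2 *\<^sub>R q + b *\<^sub>R v)"
proof -
  interpret pseudohermitian_chart \<Omega> V H J P
    by unfold_locales (use cr0 j in \<open>auto simp: chain_jet_def\<close>)
  have x: "x \<in> V" and tv: "theta P x \<bullet> v \<noteq> 0" using j by (auto simp: chain_jet_def)
  have "chain_EL (chain_form J P) (theta P) x (a *\<^sub>R v) (a\<^sup>2 *\<^sub>R q + b *\<^sub>R v) w = a\<^sup>2 * chain_EL (chain_form J P) (theta P) x v q w" for w
    by (rule chain_EL_reparam[OF bilinear_chain_form diff_chain_form[OF x] diff_theta[OF x] a tv])
  then show ?thesis using j a by (simp add: chain_jet_def)
qed

lemma coordinate_chain_jet: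
  assumes cr0: "cr_structure_on \<Omega> H J" "nondegenerate_on \<Omega> H J"
    and ch: "coordinate_chain \<Omega> H J N y" and N: "open N"
  shows "\<exists>V P y1 q. V \<subseteq> \<Omega> \<and> (\<forall>t\<in>N. (y has_vector_derivative y1 t) (at t) \<and> (y1 has_vector_derivative q t) (at t) \<and>
    chain_jet V H J P (y t) (y1 t) (q t))"
proof -
  obtain V P I \<Gamma> \<phi> where h: "open V" "V \<subseteq> \<Omega>" "pseudohermitian V H J P" "open_interval I" "0 \<in> I"
    "transversal_null_geodesic V H J P I \<Gamma>" "smooth_on N \<phi>" "\<forall>t\<in>N. deriv \<phi> t \<noteq> 0" "\<phi> ` N = I" "\<forall>t\<in>N. y t = fst (\<Gamma> (\<phi> t))"
    using ch unfolding coordinate_chain_def by blast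
  obtain g g' where g: "\<forall>t\<in>I. \<Gamma> t = bundle_point P (g t)" "null_geodesic (fefferman_metric J P) I g g'"
    "fefferman_metric J P (g 0) fefferman_K (g' 0) \<noteq> 0" and cb: "\<forall>t\<in>I. \<Gamma> t \<in> circle_bundle V H J"
    using h(6) unfolding transversal_null_geodesic_def by blast
  interpret pseudohermitian_chart \<Omega> V H J P
    by unfold_locales (use cr0 h in auto)
  have fg: "fst (\<Gamma> t) = fst (g t)" if "t \<in> I" for t
    using g(1) that by (simp add: bundle_point_def case_prod_unfold)
  have inV: "fst (g t) \<in> V" if "t \<in> I" for t
    using cb fg[OF that] that by (auto simp: circle_bundle_def)
  obtain q where q: "\<And>t. t \<in> I \<Longrightarrow> ((\<lambda>t. fst (g t)) has_vector_derivative fst (g' t)) (at t) \<and>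
    ((\<lambda>t. fst (g' t)) has_vector_derivative q t) (at t) \<and> chain_jet V H J P (fst (g t)) (fst (g' t)) (q t)"
    using null_geodesic_jet[OF h(4,5) g(2) inV g(3)] by blast
  have yI: "\<phi> t \<in> I" "y t = fst (g (\<phi> t))" if "t \<in> N" for t
    using h(9,10) fg that by auto
  have dphi: "(\<phi> has_real_derivative deriv \<phi> t) (at t)" if "t \<in> N" for t
    using smooth_on_differentiable[OF h(7) that]
    by (simp add: DERIV_deriv_iff_real_differentiable)
  have fphi: "frechet_derivative \<phi> (at t) 1 = deriv \<phi> t" if "t \<in> N" for t
    using frechet_eqI[OF dphi[OF that, unfolded has_field_derivative_def], of 1] by simp
  have d2phi: "\<exists>b. (deriv \<phi> has_real_derivative b) (at t)" if t: "t \<in> N" for t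
  proof -
    have "(\<lambda>t. frechet_derivative \<phi> (at t) 1) differentiable (at t)"
      by (rule smooth_on_differentiable[OF smooth_on_frechet[OF h(7)] t])
    then have "deriv \<phi> differentiable (at t)"
      by (rule differentiable_cong[OF N t, rotated]) (simp add: fphi)
    then show ?thesis by (simp add: real_differentiable_def)
  qed
  then obtain b where b: "\<And>t. t \<in> N \<Longrightarrow> (deriv \<phi> has_real_derivative b t) (at t)" by metis
  define y1 where "y1 t = deriv \<phi> t *\<^sub>R fst (g' (\<phi> t))" for t
  define q1 where "q1 t = (deriv \<phi> t)\<^sup>2 *\<^sub>R q (\<phi> t) + b t *\<^sub>R fst (g' (\<phi> t))" for t
  have "(y has_vector_derivative y1 t) (at t) \<and> (y1 has_vector_derivative q1 t) (at t) \<and> chain_jet V H J P (y t) (y1 t) (q1 t)"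
    if t: "t \<in> N" for t
  proof (intro conjI)
    have dp: "(\<phi> has_vector_derivative deriv \<phi> t) (at t)"
      using dphi[OF t] by (simp add: has_real_derivative_iff_has_vector_derivative)
    have "((\<lambda>t. fst (g t)) \<circ> \<phi> has_vector_derivative y1 t) (at t)"
      unfolding y1_def by (rule vector_diff_chain_at[OF dp]) (use q[OF yI(1)[OF t]] in blast)
    then show "(y has_vector_derivative y1 t) (at t)"
      unfolding has_vector_derivative_def
      by (rule has_derivative_cong_open[OF N t, rotated]) (simp add: yI(2))
    have v1: "((\<lambda>t. fst (g' (\<phi> t))) has_vector_derivative deriv \<phi> t *\<^sub>R q (\<phi> t)) (at t)"
      using vector_diff_chain_at[OF dp, of "\<lambda>t. fst (g' t)" "q (\<phi> t)"] q[OF yI(1)[OF t]] by (simp add: o_def)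
    have "((\<lambda>t. deriv \<phi> t *\<^sub>R fst (g' (\<phi> t))) has_vector_derivative
        deriv \<phi> t *\<^sub>R (deriv \<phi> t *\<^sub>R q (\<phi> t)) + b t *\<^sub>R fst (g' (\<phi> t))) (at t)"
      by (rule has_vector_derivative_scaleR[OF b[OF t] v1])
    then show "(y1 has_vector_derivative q1 t) (at t)"
      by (simp add: y1_def[abs_def] q1_def power2_eq_square)
    show "chain_jet V H J P (y t) (y1 t) (q1 t)"
      unfolding y1_def q1_def yI(2)[OF t]
      by (rule chain_jet_reparam[OF cr0 h(2)]) (use q[OF yI(1)[OF t]] h(8) t in auto)
  qed
  then show ?thesis using h(2) by blast
qed

section \<open>Chains through a point\<close>

text \<open>On the line from a point of U to v the function is a polynomial in one variable with
  infinitely many zeros.\<close>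

lemma real_polynomial_vanishing:
  fixes f :: "'a::real_normed_vector \<Rightarrow> real"
  assumes f: "real_polynomial_function f" and U: "open U" "U \<noteq> {}" and z: "\<And>v. v \<in> U \<Longrightarrow> f v = 0"
  shows "f v = 0"
proof -
  obtain a where a: "a \<in> U" using U by blast
  define g where "g t = f (a + t *\<^sub>R (v - a))" for t
  have "polynomial_function (\<lambda>t. a + t *\<^sub>R (v - a))"
    by (intro polynomial_function_add polynomial_function_const polynomial_function_bounded_linear bounded_linear_scaleR_left)
  from real_polynomial_function_compose[OF this f]
  have "real_polynomial_function g" by (simp add: g_def[abs_def] o_def)
  then obtain c n where c: "g = (\<lambda>t. \<Sum>i\<le>n. c i * t ^ i)" using real_polynomial_function_iff_sum by blast
  have "continuous (at 0) (\<lambda>t. a + t *\<^sub>R (v - a))" by (intro continuous_intros)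
  then have "\<forall>\<^sub>F t in at (0::real). a + t *\<^sub>R (v - a) \<in> U"
    using topological_tendstoD[OF _ U(1), of "\<lambda>t. a + t *\<^sub>R (v - a)" a "at 0"] a by (simp add: continuous_at)
  then obtain e where e: "e > 0" "\<And>t. t \<noteq> 0 \<Longrightarrow> \<bar>t\<bar> < e \<Longrightarrow> a + t *\<^sub>R (v - a) \<in> U"
    unfolding eventually_at by (auto simp: dist_real_def)
  have "g t = 0" if "t \<in> {0<..<e}" for t using e(2)[of t] that z by (simp add: g_def)
  then have sub: "{0<..<e} \<subseteq> {t. (\<Sum>i\<le>n. c i * t ^ i) = 0}" using c by auto
  have inf: "infinite {0<..<e}" using e(1) by (simp add: infinite_Ioo)
  have "infinite {t. (\<Sum>i\<le>n. c i * t ^ i) = 0}" by (rule infinite_super[OF sub inf])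
  then have "\<forall>i\<le>n. c i = 0"
    using polyfun_finite_roots[of c n] by auto
  then have "g 1 = 0" by (simp add: c)
  then show ?thesis by (simp add: g_def)
qed

lemma polynomial_bilinear:
  fixes B :: "'a::euclidean_space \<Rightarrow> 'a \<Rightarrow> real"
  assumes "bilinear B" shows "real_polynomial_function (\<lambda>v. B v v)"
proof -
  have "real_polynomial_function (\<lambda>v. \<Sum>i\<in>Basis. \<Sum>j\<in>Basis. (v \<bullet> i) * (v \<bullet> j) * B i j)"
    by (intro real_polynomial_function_sum finite_Basis real_polynomial_function.intros bounded_linear_inner_left)
  moreover have "(\<lambda>v. B v v) = (\<lambda>v. \<Sum>i\<in>Basis. \<Sum>j\<in>Basis. (v \<bullet> i) * (v \<bullet> j) * B i j)"
    by (rule ext) (rule bilinear_expand[OF assms])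
  ultimately show ?thesis by (simp only:)
qed

lemma minors_zero_imp_parallel:
  fixes a v :: "'a::euclidean_space"
  assumes v: "v \<noteq> 0" and m: "\<And>i j. i \<in> Basis \<Longrightarrow> j \<in> Basis \<Longrightarrow> (a \<bullet> i) * (v \<bullet> j) = (a \<bullet> j) * (v \<bullet> i)"
  shows "\<exists>k. a = k *\<^sub>R v"
proof -
  have e: "a \<bullet> i * (v \<bullet> v) = (a \<bullet> v) * (v \<bullet> i)" if i: "i \<in> Basis" for i
  proof -
    have "a \<bullet> i * (v \<bullet> v) = (\<Sum>j\<in>Basis. (a \<bullet> i) * (v \<bullet> j) * (v \<bullet> j))"
      by (subst euclidean_inner) (simp add: sum_distrib_left mult.assoc)
    also have "\<dots> = (\<Sum>j\<in>Basis. (a \<bullet> j) * (v \<bullet> i) * (v \<bullet> j))"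
      by (intro sum.cong refl) (simp add: m[OF i])
    also have "\<dots> = (a \<bullet> v) * (v \<bullet> i)"
      by (subst euclidean_inner[of a v]) (simp add: sum_distrib_left mult_ac)
    finally show ?thesis .
  qed
  have vv: "v \<bullet> v \<noteq> 0" using v by simp
  have "a \<bullet> i = (a \<bullet> v) * (v \<bullet> i) / (v \<bullet> v)" if "i \<in> Basis" for i
    by (simp only: nonzero_eq_divide_eq[OF vv] e[OF that])
  then have "\<And>i. i \<in> Basis \<Longrightarrow> a \<bullet> i = (((a \<bullet> v) / (v \<bullet> v)) *\<^sub>R v) \<bullet> i" by simp
  then have "a = ((a \<bullet> v) / (v \<bullet> v)) *\<^sub>R v" using euclidean_eqI by blast
  then show ?thesis by blast
qed

lemma polynomial_nth: assumes "polynomial_function p" shows "real_polynomial_function (\<lambda>v. p v \<bullet> b)"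
  using assms[unfolded polynomial_function_def, rule_format, OF bounded_linear_inner_left[of b]] by (simp add: o_def)

text \<open>Being parallel to v means that all 2 x 2 minors of the pair vanish. These are
  polynomials in v, so the property passes from U to every nonzero v.\<close>

lemma parallel_extend:
  fixes F :: "'a::euclidean_space \<Rightarrow> 'a"
  assumes F: "polynomial_function F" and U: "open U" "U \<noteq> {}" and p: "\<And>v. v \<in> U \<Longrightarrow> \<exists>k. F v = k *\<^sub>R v" and v: "v \<noteq> 0"
  shows "\<exists>k. F v = k *\<^sub>R v"
proof (rule minors_zero_imp_parallel[OF v])
  fix i j :: 'a
  have "real_polynomial_function (\<lambda>v. (F v \<bullet> i) * (v \<bullet> j) - (F v \<bullet> j) * (v \<bullet> i))"
    by (intro real_polynomial_function_diff real_polynomial_function.intros(4) polynomial_nth[OF F]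
        real_polynomial_function.intros(1) bounded_linear_inner_left)
  from real_polynomial_vanishing[OF this U, of v]
  have "(F v \<bullet> i) * (v \<bullet> j) - (F v \<bullet> j) * (v \<bullet> i) = 0" using p by fastforce
  then show "(F v \<bullet> i) * (v \<bullet> j) = (F v \<bullet> j) * (v \<bullet> i)" by simp
qed

section \<open>The polynomial spray of chains at a point\<close>

context pseudohermitian_chart
begin

lemma bilinear_dext: assumes x: "x \<in> V" shows "bilinear (dext (theta P) x)"
proof -
  have c: "complex_of_real (dext (theta P) x v w) = diff1 (ctheta P) x (cv v) (cv w)" for v w
    using dtheta_dext[OF x] by simp
  have 1: "dext (theta P) x (u + u') w = dext (theta P) x u w + dext (theta P) x u' w" for u u' w
    unfolding of_real_eq_iff[where 'a=complex, symmetric] of_real_add c by (simp add: cv_add diff1_simps)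
  have 2: "dext (theta P) x (a *\<^sub>R u) w = a * dext (theta P) x u w" for a u w
    unfolding of_real_eq_iff[where 'a=complex, symmetric] of_real_mult c by (simp add: cv_scaleR diff1_simps)
  have 3: "dext (theta P) x u w = - dext (theta P) x w u" for u w by (simp add: dext_def)
  show ?thesis unfolding bilinear_def
  proof (intro conjI allI)
    fix w
    show "linear (\<lambda>u. dext (theta P) x u w)" by (rule linearI) (simp_all add: 1 2)
    show "linear (dext (theta P) x w)"
      by (rule linearI) (simp_all add: 3[of w] 1 2)
  qed
qed

lemma dext_antisym: "dext (theta P) x u w = - dext (theta P) x w u" by (simp add: dext_def)

lemma bilinear_frechet:
  fixes K :: "'n rvec \<Rightarrow> 'n rvec \<Rightarrow> real"
  assumes d: "\<And>u. (\<lambda>y. K y u) differentiable (at x)" and l: "\<And>y. linear (K y)"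
  shows "bilinear (\<lambda>u h. frechet_derivative (\<lambda>y. K y u) (at x) h)"
proof -
  have k: "((\<lambda>y. K y u) has_derivative frechet_derivative (\<lambda>y. K y u) (at x)) (at x)" for u
    using d by (simp add: frechet_derivative_works)
  have 1: "frechet_derivative (\<lambda>y. K y (u + u')) (at x) h = frechet_derivative (\<lambda>y. K y u) (at x) h + frechet_derivative (\<lambda>y. K y u') (at x) h" for u u' h
    unfolding linear_add[OF l] by (rule frechet_eqI[OF has_derivative_add[OF k k]])
  have 2: "frechet_derivative (\<lambda>y. K y (a *\<^sub>R u)) (at x) h = a * frechet_derivative (\<lambda>y. K y u) (at x) h" for a u h
    unfolding linear_scale[OF l] real_scaleR_def by (rule frechet_eqI[OF has_derivative_mult_right[OF k]])
  show ?thesis unfolding bilinear_def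
    by (intro conjI allI linear_frechet_derivative[OF d] linearI) (simp_all add: 1 2)
qed

text \<open>The chain equation tests only against H and leaves a multiple of v free. Prescribing the
  \<theta>-component as well turns it into an invertible linear system for \<theta>(v) q - k v whose
  right-hand side is a polynomial in v. On H all terms with the factor \<theta>(v) vanish, and only
  L(v, v) d\<theta>(v, .) / 2 remains.\<close>

lemma chain_spray:
  assumes x: "x \<in> V"
  shows "\<exists>p. polynomial_function p \<and>
    (\<forall>v q. chain_jet V H J P x v q \<longrightarrow> (\<exists>k. (theta P x \<bullet> v) *\<^sub>R q = p v + k *\<^sub>R v)) \<and>
    (\<forall>v\<in>H x. p v \<in> H x \<and> (\<forall>w\<in>H x. chain_form J P x (p v) w = chain_form J P x v v / 2 * dext (theta P) x v w))"
proof -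
  let ?L = "chain_form J P" and ?T = "reeb P x"
  let ?t = "\<lambda>v. theta P x \<bullet> v"
  let ?D = "\<lambda>f h. frechet_derivative f (at x) h"
  have T: "?t ?T = 1" using adm x by (simp add: admissible_coframe_def)
  define pr where "pr w = w - (?t w) *\<^sub>R ?T" for w
  have lin_pr: "linear pr"
    by (rule linearI) (simp_all add: pr_def inner_add_right algebra_simps)
  have prH: "pr w \<in> H x" for w
    using theta_kernel[OF x, of "pr w"] T by (simp add: pr_def inner_diff_right)
  have pr_id: "pr w = w" if "w \<in> H x" for w using theta_kernel[OF x, of w] that by (simp add: pr_def)
  have linL: "linear (?L y u)" for y u using bilinear_chain_form[of J P y] by (simp add: bilinear_def)
  have linL': "linear (\<lambda>u. ?L y u w)" for y w using bilinear_chain_form[of J P y] by (simp add: bilinear_def)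
  \<comment> \<open>M represents L(z, pr w) + \<theta>(z) \<theta>(w). It is injective because L is
    non-degenerate on H; L itself may be degenerate on the whole space.\<close>
  define M where "M z = (\<Sum>b\<in>Basis. (?L x z (pr b) + ?t z * ?t b) *\<^sub>R b)" for z
  have lM: "linear M"
    by (rule linearI)
      (simp_all add: M_def linear_add[OF linL'] linear_scale[OF linL'] inner_add_right algebra_simps sum.distrib scaleR_sum_right)
  have Mb: "M z \<bullet> b = ?L x z (pr b) + ?t z * ?t b" if "b \<in> Basis" for z b
    using that by (simp add: M_def inner_sum_left_Basis)
  have ext: "f w = g w" if "linear f" "linear g" "\<And>b. b \<in> Basis \<Longrightarrow> f b = g b" for f g :: "'n rvec \<Rightarrow> real" and w
    using linear_eq_stdbasis[OF that(1,2)] that(3) by metis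
  have Mw: "M z \<bullet> w = ?L x z (pr w) + ?t z * ?t w" for z w
  proof (rule ext[of "\<lambda>w. M z \<bullet> w" "\<lambda>w. ?L x z (pr w) + ?t z * ?t w"])
    show "linear (\<lambda>w. M z \<bullet> w)" by (rule linearI) (simp_all add: inner_add_right)
    show "linear (\<lambda>w. ?L x z (pr w) + ?t z * ?t w)"
      by (rule linearI)
        (simp_all add: linear_add[OF lin_pr] linear_scale[OF lin_pr] linear_add[OF linL] linear_scale[OF linL] inner_add_right algebra_simps)
  qed (rule Mb)
  have "inj M"
    unfolding linear_injective_0[OF lM]
  proof (intro allI impI)
    fix z assume z: "M z = 0"
    have "pr ?T = 0" by (simp add: pr_def T)
    then have "?t z = 0" using Mw[of z ?T] T z linear_0[OF linL] by simp
    then have zH: "z \<in> H x" using theta_kernel[OF x] by blast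
    have "?L x z w = 0" if "w \<in> H x" for w
      using Mw[of z w] z pr_id[OF that] \<open>?t z = 0\<close> by simp
    then show "z = 0" by (rule chain_form_nondegenerate[OF x zH])
  qed
  then obtain Mi where Mi: "linear Mi" "\<And>z. Mi (M z) = z" "\<And>z. M (Mi z) = z"
    using linear_injective_isomorphism[OF lM] by blast
  \<comment> \<open>The chain equation against \<open>pr b\<close>, multiplied by \<theta>(v) so
    that no denominator is left; the last summand prescribes the \<theta>-component.\<close>
  define rb where "rb v b = ?t v * (- ?D (\<lambda>y. ?L y v (pr b)) v + ?D (\<lambda>y. ?L y v v) (pr b) / 2)
     + ?L x v v / 2 * dext (theta P) x v (pr b) - ?t v * ?D (\<lambda>y. theta P y \<bullet> v) v * ?t b" for v b
  define r where "r v = (\<Sum>b\<in>Basis. rb v b *\<^sub>R b)" for v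
  have rv: "r v \<bullet> b = rb v b" if "b \<in> Basis" for v b using that by (simp add: r_def inner_sum_left_Basis)
  have dth: "(\<lambda>y. theta P y \<bullet> v) differentiable (at x)" for v
    by (rule differentiable_linear[OF bounded_linear_inner_left diff_theta[OF x]])
  have polt: "real_polynomial_function ?t" by (intro real_polynomial_function.intros(1) bounded_linear_inner_right)
  have pol: "real_polynomial_function (\<lambda>v. rb v b)" for b
  proof -
    have 1: "real_polynomial_function (\<lambda>v. ?D (\<lambda>y. ?L y v (pr b)) v)"
      by (rule polynomial_bilinear[OF bilinear_frechet[OF diff_chain_form[OF x] linL']])
    have 2: "real_polynomial_function (\<lambda>v. ?D (\<lambda>y. ?L y v v) (pr b))"
    proof (rule polynomial_bilinear[of "\<lambda>u v. ?D (\<lambda>y. ?L y u v) (pr b)"])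
      have a: "linear (\<lambda>u. ?D (\<lambda>y. ?L y u v) h)" for v h
        using bilinear_frechet[OF diff_chain_form[OF x] linL', of v] by (simp add: bilinear_def)
      have b: "linear (\<lambda>u. ?D (\<lambda>y. ?L y v u) h)" for v h
        using bilinear_frechet[OF diff_chain_form[OF x] linL, of v] by (simp add: bilinear_def)
      show "bilinear (\<lambda>u v. ?D (\<lambda>y. ?L y u v) (pr b))"
        unfolding bilinear_def using a b by blast
    qed
    have 3: "real_polynomial_function (\<lambda>v. ?D (\<lambda>y. theta P y \<bullet> v) v)"
      by (rule polynomial_bilinear[OF bilinear_frechet[OF dth]]) (rule linearI, simp_all add: inner_add_right)
    have 4: "real_polynomial_function (\<lambda>v. dext (theta P) x v (pr b))"
      using bilinear_dext[OF x] by (intro real_polynomial_function.intros(1)) (simp add: bilinear_def linear_linear)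
    show ?thesis
      unfolding rb_def diff_conv_add_uminus divide_inverse
      by (intro real_polynomial_function.intros(2-4) real_polynomial_function_minus polt 1 2 3 4
          polynomial_bilinear[OF bilinear_chain_form])
  qed
  have polr: "polynomial_function r"
    unfolding polynomial_function_iff_Basis_inner using pol rv by simp
  define p where "p v = Mi (r v)" for v
  have "polynomial_function p"
    unfolding polynomial_function_def
  proof (intro allI impI)
    fix f :: "'n rvec \<Rightarrow> real" assume "bounded_linear f"
    then have "bounded_linear (f \<circ> Mi)"
      using bounded_linear_compose[of f Mi] Mi(1) by (simp add: o_def linear_linear)
    then have "real_polynomial_function ((f \<circ> Mi) \<circ> r)" using polr unfolding polynomial_function_def by blast
    then show "real_polynomial_function (f \<circ> p)" by (simp add: p_def[abs_def] o_def)
  qed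
  moreover have "\<exists>k. ?t v *\<^sub>R q = p v + k *\<^sub>R v" if j: "chain_jet V H J P x v q" for v q
  proof -
    have tv: "?t v \<noteq> 0" and EL: "\<And>w. w \<in> H x \<Longrightarrow> chain_EL ?L (theta P) x v q w = 0"
      using j by (auto simp: chain_jet_def)
    \<comment> \<open>This k is the coefficient of L(v, w) / \<theta>(v) in \<open>chain_EL\<close>;
      subtracting k v removes that term and at the same time the unknown \<theta>(q).\<close>
    define k where "k = ?t q + ?D (\<lambda>y. theta P y \<bullet> v) v"
    have "M (?t v *\<^sub>R q - k *\<^sub>R v) = r v"
    proof (rule euclidean_eqI)
      fix b :: "'n rvec" assume b: "b \<in> Basis"
      have "?t v * ?L x q (pr b) - k * ?L x v (pr b) =
        ?t v * (- ?D (\<lambda>y. ?L y v (pr b)) v + ?D (\<lambda>y. ?L y v v) (pr b) / 2) + ?L x v v / 2 * dext (theta P) x v (pr b)"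
      proof -
        have "?L x q (pr b) = - ?D (\<lambda>y. ?L y v (pr b)) v + ?D (\<lambda>y. ?L y v v) (pr b) / 2
            + ?L x v v / (2 * ?t v) * dext (theta P) x v (pr b) + k / ?t v * ?L x v (pr b)"
          using EL[OF prH[of b]] unfolding chain_EL_def k_def[symmetric] by linarith
        then show ?thesis using tv by (simp only:) (simp add: field_simps)
      qed
      then show "M (?t v *\<^sub>R q - k *\<^sub>R v) \<bullet> b = r v \<bullet> b"
        unfolding Mb[OF b] rv[OF b] rb_def linear_diff[OF linL'] linear_scale[OF linL'] inner_diff_right inner_scaleR_right
        by (simp add: k_def algebra_simps)
    qed
    then have "p v = ?t v *\<^sub>R q - k *\<^sub>R v" unfolding p_def using Mi(2) by metis
    then show ?thesis by (intro exI[of _ k]) simp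
  qed
  moreover have "p v \<in> H x \<and> (\<forall>w\<in>H x. ?L x (p v) w = ?L x v v / 2 * dext (theta P) x v w)" if v: "v \<in> H x" for v
  proof -
    have tv: "?t v = 0" using theta_kernel[OF x] v by blast
    have bd: "linear (dext (theta P) x v)" using bilinear_dext[OF x] by (simp add: bilinear_def)
    have rw: "r v \<bullet> w = ?L x v v / 2 * dext (theta P) x v (pr w)" for w
    proof (rule ext[of "\<lambda>w. r v \<bullet> w" "\<lambda>w. ?L x v v / 2 * dext (theta P) x v (pr w)"])
      show "linear (\<lambda>w. r v \<bullet> w)" by (rule linearI) (simp_all add: inner_add_right)
      show "linear (\<lambda>w. ?L x v v / 2 * dext (theta P) x v (pr w))"
        by (rule linearI) (simp_all add: linear_add[OF lin_pr] linear_scale[OF lin_pr] linear_add[OF bd] linear_scale[OF bd] algebra_simps)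
    qed (simp add: rv rb_def tv)
    have "M (p v) = r v" by (simp add: p_def Mi(3))
    then have e: "?L x (p v) (pr w) + ?t (p v) * ?t w = ?L x v v / 2 * dext (theta P) x v (pr w)" for w
      using Mw[of "p v" w] rw[of w] by simp
    have "pr ?T = 0" by (simp add: pr_def T)
    then have "?t (p v) = 0" using e[of ?T] T linear_0[OF linL] linear_0[OF bd] by simp
    then have "p v \<in> H x" using theta_kernel[OF x] by blast
    moreover have "?L x (p v) w = ?L x v v / 2 * dext (theta P) x v w" if "w \<in> H x" for w
      using e[of w] pr_id[OF that] \<open>?t (p v) = 0\<close> by simp
    ultimately show ?thesis by blast
  qed
  ultimately show ?thesis by blast
qed

text \<open>By polarisation, vanishing of L(v, v) on H would make L vanish on H altogether.\<close>

lemma H_not_null: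
  assumes x: "x \<in> V" and v0: "v0 \<in> H x" "v0 \<noteq> 0"
  shows "\<exists>v\<in>H x. chain_form J P x v v \<noteq> 0"
proof (rule ccontr)
  assume "\<not> ?thesis"
  then have z: "chain_form J P x v v = 0" if "v \<in> H x" for v using that by blast
  have "chain_form J P x v0 w = 0" if w: "w \<in> H x" for w
    using z[OF subspace_add[OF H_subspace[OF x] v0(1) w]] z[OF v0(1)] z[OF w] chain_form_sym[of J P x w v0]
    by (simp add: bilinear_ladd[OF bilinear_chain_form] bilinear_radd[OF bilinear_chain_form])
  then have "v0 = 0" by (rule chain_form_nondegenerate[OF x v0(1)])
  then show False using v0(2) by simp
qed

lemma dext_J:
  assumes x: "x \<in> V" and u: "u \<in> H x" and w: "w \<in> H x"
  shows "dext (theta P) x u w = - 2 * chain_form J P x u (J x w)"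
  using chain_form_dext[OF x u J_in_H[OF x w]] J_J[OF x w]
  by (simp add: bilinear_rneg[OF bilinear_dext[OF x]])

lemma chain_form_J_self: "x \<in> V \<Longrightarrow> v \<in> H x \<Longrightarrow> chain_form J P x v (J x v) = 0"
  using dext_J[of x v v] by (simp add: dext_def)

end

section \<open>Comparison of two structures at a point\<close>

lemma spray_H_subset:
  assumes P: "pseudohermitian_chart \<Omega> V H J P" and Q: "pseudohermitian_chart \<Omega> V' H' J' Q"
    and x: "x \<in> V" "x \<in> V'" and U: "open U" "U \<noteq> {}"
    and j: "\<And>v. v \<in> U \<Longrightarrow> \<exists>q. chain_jet V H J P x v q \<and> chain_jet V' H' J' Q x v q"
  shows "H x \<subseteq> H' x"
proof (rule ccontr)
  interpret P: pseudohermitian_chart \<Omega> V H J P by (rule P)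
  interpret Q: pseudohermitian_chart \<Omega> V' H' J' Q by (rule Q)
  assume "\<not> H x \<subseteq> H' x"
  then obtain v0 where v0: "v0 \<in> H x" "v0 \<notin> H' x" by blast
  obtain p where p: "polynomial_function p" "\<And>v q. chain_jet V H J P x v q \<Longrightarrow> \<exists>k. (theta P x \<bullet> v) *\<^sub>R q = p v + k *\<^sub>R v"
    "\<And>v. v \<in> H x \<Longrightarrow> p v \<in> H x \<and> (\<forall>w\<in>H x. chain_form J P x (p v) w = chain_form J P x v v / 2 * dext (theta P) x v w)"
    using P.chain_spray[OF x(1)] by blast
  obtain p' where p': "polynomial_function p'" "\<And>v q. chain_jet V' H' J' Q x v q \<Longrightarrow> \<exists>k. (theta Q x \<bullet> v) *\<^sub>R q = p' v + k *\<^sub>R v"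
    using Q.chain_spray[OF x(2)] by blast
  \<comment> \<open>In this combination the common acceleration q cancels, which leaves a multiple
    of v for every common direction.\<close>
  define F where "F v = (theta Q x \<bullet> v) *\<^sub>R p v - (theta P x \<bullet> v) *\<^sub>R p' v" for v
  have polF: "polynomial_function F"
    unfolding F_def by (intro polynomial_function_diff polynomial_function_mult p(1) p'(1))
      (simp_all add: real_polynomial_function_eq[symmetric] real_polynomial_function.intros(1) bounded_linear_inner_right)
  have par: "\<exists>k. F v = k *\<^sub>R v" if v: "v \<in> U" for v
  proof -
    obtain q where q: "chain_jet V H J P x v q" "chain_jet V' H' J' Q x v q" using j[OF v] by blast
    obtain k k' where k: "(theta P x \<bullet> v) *\<^sub>R q = p v + k *\<^sub>R v" "(theta Q x \<bullet> v) *\<^sub>R q = p' v + k' *\<^sub>R v"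
      using p(2)[OF q(1)] p'(2)[OF q(2)] by blast
    have e: "p v = (theta P x \<bullet> v) *\<^sub>R q - k *\<^sub>R v" "p' v = (theta Q x \<bullet> v) *\<^sub>R q - k' *\<^sub>R v"
      using k by simp_all
    have "F v = ((theta P x \<bullet> v) * k' - (theta Q x \<bullet> v) * k) *\<^sub>R v"
      unfolding F_def e by (simp add: algebra_simps)
    then show ?thesis by blast
  qed
  have null: "chain_form J P x v v = 0" if v: "v \<in> H x" "v \<notin> H' x" for v
  proof -
    have "v \<noteq> 0" using v(2) subspace_0[OF Q.H_subspace[OF x(2)]] by auto
    then obtain k where "F v = k *\<^sub>R v" using parallel_extend[OF polF U par] by blast
    moreover have tP: "theta P x \<bullet> v = 0" using P.theta_kernel[OF x(1)] v(1) by blast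
    moreover have tQ: "theta Q x \<bullet> v \<noteq> 0" using Q.theta_kernel[OF x(2)] v(2) by blast
    ultimately have "(theta Q x \<bullet> v) *\<^sub>R p v = k *\<^sub>R v" by (simp add: F_def)
    then have "(1 / (theta Q x \<bullet> v)) *\<^sub>R ((theta Q x \<bullet> v) *\<^sub>R p v) = (1 / (theta Q x \<bullet> v)) *\<^sub>R (k *\<^sub>R v)" by simp
    then have pv: "p v = (k / (theta Q x \<bullet> v)) *\<^sub>R v" using tQ by simp
    \<comment> \<open>J v is the test vector: L(v, J v) = 0 by antisymmetry of d\<theta>, while
      d\<theta>(v, J v) = 2 L(v, v), so the identity for p reads 0 = L(v, v)^2.\<close>
    have "chain_form J P x (p v) (J x v) = 0"
      unfolding pv using P.chain_form_J_self[OF x(1) v(1)] by (simp add: bilinear_lmul[OF bilinear_chain_form])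
    then have "chain_form J P x v v / 2 * dext (theta P) x v (J x v) = 0"
      using p(3)[OF v(1)] P.J_in_H[OF x(1) v(1)] by simp
    then show ?thesis by (simp add: P.chain_form_dext[OF x(1) v(1) v(1), symmetric])
  qed
  have "chain_form J P x v v = 0" if v: "v \<in> H x" for v
  proof (cases "v \<in> H' x")
    case True
    \<comment> \<open>For v in both distributions the previous argument applies to v0, v + v0 and v
      - v0 instead, and the parallelogram law gives L(v, v) = 0.\<close>
    have "v + v0 \<notin> H' x" "v - v0 \<notin> H' x"
      using subspace_diff[OF Q.H_subspace[OF x(2)] _ True, of "v + v0"]
        subspace_diff[OF Q.H_subspace[OF x(2)] True, of "v - v0"] v0(2) by auto
    then have "chain_form J P x (v + v0) (v + v0) = 0" "chain_form J P x (v - v0) (v - v0) = 0" "chain_form J P x v0 v0 = 0"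
      using null v v0 P.H_subspace[OF x(1)] by (auto intro: subspace_add subspace_diff)
    then show ?thesis
      by (simp add: bilinear_ladd[OF bilinear_chain_form] bilinear_radd[OF bilinear_chain_form]
          bilinear_lsub[OF bilinear_chain_form] bilinear_rsub[OF bilinear_chain_form])
  qed (use null v in blast)
  moreover have "v0 \<noteq> 0" using v0(2) subspace_0[OF Q.H_subspace[OF x(2)]] by auto
  ultimately show False using P.H_not_null[OF x(1) v0(1)] by blast
qed

text \<open>The two contact forms have the same kernel, so their differentials agree on H up to the
  factor f x. As 2 L(u, w) = d\<theta>(u, J w) on H, it is enough to identify the forms L up to this
  factor and a sign.\<close>

lemma spray_J:
  assumes P: "pseudohermitian_chart \<Omega> V H J P" and Q: "pseudohermitian_chart \<Omega> V H J' Q"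
    and x: "x \<in> V" and U: "open U" "U \<noteq> {}"
    and j: "\<And>v. v \<in> U \<Longrightarrow> \<exists>q. chain_jet V H J P x v q \<and> chain_jet V H J' Q x v q"
  shows "(\<forall>u\<in>H x. J x u = J' x u) \<or> (\<forall>u\<in>H x. J x u = - J' x u)"
proof -
  interpret P: pseudohermitian_chart \<Omega> V H J P by (rule P)
  interpret Q: pseudohermitian_chart \<Omega> V H J' Q by (rule Q)
  let ?L = "chain_form J P x" and ?L' = "chain_form J' Q x"
  let ?om = "dext (theta P) x"
  define f where "f y = theta Q y \<bullet> reeb P y" for y
  have T: "theta P y \<bullet> reeb P y = 1" if "y \<in> V" for y using P.adm that by (simp add: admissible_coframe_def)
  have thQ: "theta Q y = f y *\<^sub>R theta P y" if y: "y \<in> V" for y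
  proof (rule vector_eq_ldot[THEN iffD1], rule allI)
    fix v
    have "theta P y \<bullet> (v - (theta P y \<bullet> v) *\<^sub>R reeb P y) = 0" by (simp add: inner_diff_right T[OF y])
    then have "theta Q y \<bullet> (v - (theta P y \<bullet> v) *\<^sub>R reeb P y) = 0"
      using Q.theta_kernel[OF y] P.theta_kernel[OF y] by blast
    then show "v \<bullet> theta Q y = v \<bullet> (f y *\<^sub>R theta P y)"
      by (simp add: inner_diff_right f_def inner_commute)
  qed
  have f0: "f x \<noteq> 0"
  proof
    assume "f x = 0"
    then have "theta Q x = 0" using thQ[OF x] by simp
    moreover have "theta Q x \<bullet> reeb Q x = 1" using Q.adm x by (simp add: admissible_coframe_def)
    ultimately show False by simp
  qed
  have dx: "dext (theta Q) x v w = f x * ?om v w" if "v \<in> H x" "w \<in> H x" for v w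
  proof -
    have "f differentiable (at x)" unfolding f_def[abs_def]
      by (rule smooth_on_differentiable[OF smooth_on_inner[OF P.open_V Q.smooth_theta P.smooth_reeb] x])
    then have hf: "(f has_derivative frechet_derivative f (at x)) (at x)" by (simp add: frechet_derivative_works)
    have ht: "((\<lambda>y. theta P y \<bullet> u) has_derivative frechet_derivative (\<lambda>y. theta P y \<bullet> u) (at x)) (at x)" for u
      using differentiable_linear[OF bounded_linear_inner_left P.diff_theta[OF x], of u] by (simp add: frechet_derivative_works)
    have "frechet_derivative (\<lambda>y. theta Q y \<bullet> u) (at x) h = f x * frechet_derivative (\<lambda>y. theta P y \<bullet> u) (at x) h + frechet_derivative f (at x) h * (theta P x \<bullet> u)" for u h
      by (rule frechet_eqI, rule has_derivative_cong_open[OF P.open_V x, where g="\<lambda>y. f y * (theta P y \<bullet> u)"])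
        (auto simp: thQ intro!: has_derivative_mult hf ht)
    moreover have "theta P x \<bullet> v = 0" "theta P x \<bullet> w = 0" using P.theta_kernel[OF x] that by auto
    ultimately show ?thesis by (simp add: dext_def right_diff_distrib)
  qed
  obtain p where p: "polynomial_function p" "\<And>v q. chain_jet V H J P x v q \<Longrightarrow> \<exists>k. (theta P x \<bullet> v) *\<^sub>R q = p v + k *\<^sub>R v"
    "\<And>v. v \<in> H x \<Longrightarrow> p v \<in> H x \<and> (\<forall>w\<in>H x. ?L (p v) w = ?L v v / 2 * ?om v w)"
    using P.chain_spray[OF x] by blast
  obtain p' where p': "polynomial_function p'" "\<And>v q. chain_jet V H J' Q x v q \<Longrightarrow> \<exists>k. (theta Q x \<bullet> v) *\<^sub>R q = p' v + k *\<^sub>R v"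
    "\<And>v. v \<in> H x \<Longrightarrow> p' v \<in> H x \<and> (\<forall>w\<in>H x. ?L' (p' v) w = ?L' v v / 2 * dext (theta Q) x v w)"
    using Q.chain_spray[OF x] by blast
  \<comment> \<open>With a common kernel the factor \<theta>(v) in the comparison can be divided
    out, leaving only the ratio f x of the contact forms.\<close>
  define F where "F v = f x *\<^sub>R p v - p' v" for v
  have polF: "polynomial_function F"
    unfolding F_def by (intro polynomial_function_diff polynomial_function_mult polynomial_function_const p(1) p'(1))
  have par: "\<exists>k. F v = k *\<^sub>R v" if v: "v \<in> U" for v
  proof -
    obtain q where q: "chain_jet V H J P x v q" "chain_jet V H J' Q x v q" using j[OF v] by blast
    obtain k k' where k: "(theta P x \<bullet> v) *\<^sub>R q = p v + k *\<^sub>R v" "(theta Q x \<bullet> v) *\<^sub>R q = p' v + k' *\<^sub>R v"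
      using p(2)[OF q(1)] p'(2)[OF q(2)] by blast
    have e: "p v = (theta P x \<bullet> v) *\<^sub>R q - k *\<^sub>R v" "p' v = (theta Q x \<bullet> v) *\<^sub>R q - k' *\<^sub>R v"
      using k by simp_all
    have "F v = (k' - f x * k) *\<^sub>R v"
      unfolding F_def e thQ[OF x] by (simp add: algebra_simps)
    then show ?thesis by blast
  qed
  have sq: "(?L' v v)\<^sup>2 = (f x * ?L v v)\<^sup>2" if v: "v \<in> H x" for v
  proof (cases "v = 0")
    case True
    then show ?thesis by (simp add: bilinear_lzero[OF bilinear_chain_form])
  next
    case False
    then obtain k where k: "F v = k *\<^sub>R v" using parallel_extend[OF polF U par] by blast
    have pH: "p v \<in> H x" "p' v \<in> H x" using p(3)[OF v] p'(3)[OF v] by auto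
    have 1: "?om v (p v) = 2 * (?L v v)\<^sup>2"
    proof -
      have "?om v (p v) = - ?om (p v) v" by (rule P.dext_antisym)
      also have "\<dots> = 2 * ?L (p v) (J x v)" by (simp add: P.dext_J[OF x pH(1) v])
      also have "\<dots> = ?L v v * ?om v (J x v)" using bspec[OF conjunct2[OF p(3)[OF v]] P.J_in_H[OF x v]] by simp
      also have "?om v (J x v) = 2 * ?L v v" using P.chain_form_dext[OF x v v] by simp
      finally show ?thesis by (simp add: power2_eq_square)
    qed
    have 2: "dext (theta Q) x v (p' v) = 2 * (?L' v v)\<^sup>2"
    proof -
      have "dext (theta Q) x v (p' v) = - dext (theta Q) x (p' v) v" by (rule Q.dext_antisym)
      also have "\<dots> = 2 * ?L' (p' v) (J' x v)" by (simp add: Q.dext_J[OF x pH(2) v])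
      also have "\<dots> = ?L' v v * dext (theta Q) x v (J' x v)" using bspec[OF conjunct2[OF p'(3)[OF v]] Q.J_in_H[OF x v]] by simp
      also have "dext (theta Q) x v (J' x v) = 2 * ?L' v v" using Q.chain_form_dext[OF x v v] by simp
      finally show ?thesis by (simp add: power2_eq_square)
    qed
    \<comment> \<open>Pairing with d\<theta>(v, .) annihilates the multiple of v and leaves a scalar
      identity. A second factor f x enters because d\<theta>' = f d\<theta> on H.\<close>
    have "?om v (F v) = 0" unfolding k by (simp add: bilinear_rmul[OF P.bilinear_dext[OF x]]) (simp add: dext_def)
    then have "f x * ?om v (p v) = ?om v (p' v)"
      unfolding F_def by (simp add: bilinear_rsub[OF P.bilinear_dext[OF x]] bilinear_rmul[OF P.bilinear_dext[OF x]])
    then have "f x * (f x * ?om v (p v)) = dext (theta Q) x v (p' v)" using dx[OF v pH(2)] by simp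
    then show ?thesis unfolding 1 2 by (simp add: power2_eq_square algebra_simps)
  qed
  define pr where "pr w = w - (theta P x \<bullet> w) *\<^sub>R reeb P x" for w
  have lin_pr: "linear pr" by (rule linearI) (simp_all add: pr_def inner_add_right algebra_simps)
  have prH: "pr w \<in> H x" for w using P.theta_kernel[OF x, of "pr w"] T[OF x] by (simp add: pr_def inner_diff_right)
  have pr_id: "pr w = w" if "w \<in> H x" for w using P.theta_kernel[OF x, of w] that by (simp add: pr_def)
  define A where "A s u w = ?L' (pr u) (pr w) - s * (f x * ?L (pr u) (pr w))" for s u w
  have bilA: "bilinear (A s)" for s
    unfolding bilinear_def A_def
    by (intro conjI allI linearI)
      (simp_all add: linear_add[OF lin_pr] linear_scale[OF lin_pr] bilinear_ladd[OF bilinear_chain_form]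
        bilinear_radd[OF bilinear_chain_form] bilinear_lmul[OF bilinear_chain_form] bilinear_rmul[OF bilinear_chain_form] algebra_simps)
  \<comment> \<open>A product of two quadratic forms vanishes on \<open>H\<close>, so one of them does; the projection \<open>pr\<close>
    makes them polynomials on the whole space.\<close>
  have prod: "A 1 v v * A (-1) v v = 0" for v
    using sq[OF prH[of v]] by (simp add: A_def power2_eq_square algebra_simps)
  have polA: "real_polynomial_function (\<lambda>v. A s v v)" for s by (rule polynomial_bilinear[OF bilA])
  have dich: "(\<forall>v. A 1 v v = 0) \<or> (\<forall>v. A (-1) v v = 0)"
  proof (rule disjCI)
    assume "\<not> (\<forall>v. A (-1) v v = 0)"
    then obtain a where a: "A (-1) a a \<noteq> 0" by blast
    have cont: "continuous_on UNIV (\<lambda>v. A (-1) v v)"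
      using polA[of "-1"] by (simp add: continuous_on_polymonial_function real_polynomial_function_eq)
    have "open ((\<lambda>v. A (-1) v v) -` (- {0}))"
      by (rule open_vimage[OF _ cont]) (rule open_Compl, simp)
    moreover have "(\<lambda>v. A (-1) v v) -` (- {0}) \<noteq> {}" using a by auto
    ultimately have "A 1 v v = 0" for v
    proof (rule real_polynomial_vanishing[OF polA[of 1]])
      show "A 1 v v = 0" if "v \<in> (\<lambda>v. A (-1) v v) -` (- {0})" for v
        using prod[of v] that by simp
    qed
    then show "\<forall>v. A 1 v v = 0" by blast
  qed
  have main: "\<forall>w\<in>H x. J x w = s *\<^sub>R J' x w" if s: "\<forall>v. A s v v = 0" "s = 1 \<or> s = -1" for s
  proof
    fix w assume w: "w \<in> H x"
    have Auw: "A s u w = 0" for u w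
    proof -
      have "A s u w = A s w u" by (simp add: A_def chain_form_sym)
      moreover have "A s (u + w) (u + w) = 0" "A s u u = 0" "A s w w = 0" using s by auto
      ultimately show ?thesis by (simp add: bilinear_ladd[OF bilA] bilinear_radd[OF bilA])
    qed
    have Lu: "?L' u w = s * (f x * ?L u w)" if "u \<in> H x" for u
      using Auw[of u w] pr_id[OF that] pr_id[OF w] by (simp add: A_def)
    define z where "z = J x w - s *\<^sub>R J' x w"
    have zH: "z \<in> H x" unfolding z_def
      using P.J_in_H[OF x w] Q.J_in_H[OF x w] P.H_subspace[OF x] by (intro subspace_diff subspace_scale)
    have ss: "s * s = 1" using s(2) by auto
    \<comment> \<open>The relation between the forms L becomes one between d\<theta>(u, J' w) and
      d\<theta>(u, J w), hence z is in the kernel of d\<theta> on H; this kernel is 0, again by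
      non-degeneracy of L.\<close>
    have oz: "?om u z = 0" if u: "u \<in> H x" for u
    proof -
      have "f x * ?om u (J' x w) = 2 * ?L' u w"
        using Q.chain_form_dext[OF x u w] dx[OF u Q.J_in_H[OF x w]] by simp
      also have "\<dots> = f x * (s * ?om u (J x w))"
        using P.chain_form_dext[OF x u w] Lu[OF u] by simp
      finally have "?om u (J' x w) = s * ?om u (J x w)" using f0 by simp
      then show ?thesis unfolding z_def
        using ss by (simp add: bilinear_rsub[OF P.bilinear_dext[OF x]] bilinear_rmul[OF P.bilinear_dext[OF x]] mult.assoc[symmetric])
    qed
    have "?L (J x z) u = 0" if u: "u \<in> H x" for u
      using P.dext_J[OF x u zH] oz[OF u] chain_form_sym[of J P x "J x z" u] by simp
    then have "J x z = 0" by (rule P.chain_form_nondegenerate[OF x P.J_in_H[OF x zH]])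
    moreover have "J x 0 = 0" using P.J_linear[OF x w w, of 0 0] by simp
    ultimately have "z = 0" using P.J_J[OF x zH] by simp
    then show "J x w = s *\<^sub>R J' x w" by (simp add: z_def)
  qed
  from dich show ?thesis using main[of 1] main[of "-1"] by auto
qed

section \<open>Change of coordinates\<close>

lemma Rev_cext [simp]: "Rev (cext f Z) = f (Rev Z)" and Imv_cext [simp]: "Imv (cext f Z) = f (Imv Z)"
  by (simp_all add: cext_def vec_eq_iff)

lemma cext_compose: "cext f (cext g Z) = cext (\<lambda>u. f (g u)) Z"
  unfolding cext_def[of f] cext_def[of "\<lambda>u. f (g u)"] by simp

lemma cvec_eqI: "Rev Z = Rev W \<Longrightarrow> Imv Z = Imv W \<Longrightarrow> Z = W"
  by (simp add: vec_eq_iff complex_eq_iff)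

lemma cext_id [simp]: "cext (\<lambda>u. u) Z = Z"
  by (rule cvec_eqI) simp_all

lemma cext_cong: "f (Rev Z) = g (Rev Z) \<Longrightarrow> f (Imv Z) = g (Imv Z) \<Longrightarrow> cext f Z = cext g Z"
  by (simp add: cext_def)

context
  fixes f :: "'n::finite rvec \<Rightarrow> 'n rvec"
  assumes f: "linear f"
begin

lemma cext_add: "cext f (Z + W) = cext f Z + cext f W"
proof -
  have "Rev (Z + W) = Rev Z + Rev W" "Imv (Z + W) = Imv Z + Imv W" for Z W :: "'n cvec" by (simp_all add: vec_eq_iff)
  then show ?thesis by (intro cvec_eqI) (simp_all add: linear_add[OF f])
qed

lemma cext_smult: "cext f (a *s Z) = a *s cext f Z"
proof -
  have "Rev (a *s Z) = Re a *\<^sub>R Rev Z - Im a *\<^sub>R Imv Z" "Imv (a *s Z) = Re a *\<^sub>R Imv Z + Im a *\<^sub>R Rev Z" for Z :: "'n cvec"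
    by (simp_all add: vec_eq_iff)
  then show ?thesis by (intro cvec_eqI) (simp_all add: linear_add[OF f] linear_diff[OF f] linear_scale[OF f])
qed

lemma cext_0: "cext f 0 = 0"
  using cext_smult[of 0 0] by simp

lemma cext_sum: "cext f (\<Sum>i\<in>I. g i) = (\<Sum>i\<in>I. cext f (g i))"
  by (induction I rule: infinite_finite_induct) (simp_all add: cext_0 cext_add)

lemma cext_cv: "cext f (cv v) = cv (f v)"
  by (rule cvec_eqI) (simp_all add: vec_eq_iff Rev_def[of "cv v"] Imv_def[of "cv v"] vec_lambda_eta zero_vec_def[symmetric] linear_0[OF f])

lemma cext_cnjv: "cext f (cnjv Z) = cnjv (cext f Z)"
proof -
  have "Rev (cnjv Z) = Rev Z" "Imv (cnjv Z) = - Imv Z" for Z :: "'n cvec" by (simp_all add: vec_eq_iff)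
  then show ?thesis by (intro cvec_eqI) (simp_all add: linear_neg[OF f])
qed

lemma cext_nth: "cext f Z $ j = (\<Sum>i\<in>UNIV. complex_of_real (f (axis i 1) $ j) * Z $ i)"
proof -
  have "Z = (\<Sum>i\<in>UNIV. Z $ i *s cv (axis i 1))"
    by (simp add: vec_eq_iff axis_def if_distrib cong: if_cong)
  then have "cext f Z = (\<Sum>i\<in>UNIV. Z $ i *s cv (f (axis i 1)))"
    by (metis (no_types, lifting) cext_sum cext_smult cext_cv sum.cong)
  then show ?thesis by (simp add: mult.commute)
qed

end

definition pullc :: "('n::finite rvec \<Rightarrow> 'n rvec) \<Rightarrow> 'n cvec \<Rightarrow> 'n cvec" where
  "pullc f a = (\<chi> i. ev a (cv (f (axis i 1))))"

lemma ev_pullc: "linear f \<Longrightarrow> ev (pullc f a) Z = ev a (cext f Z)"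
proof -
  assume f: "linear f"
  have "ev (pullc f a) Z = (\<Sum>i\<in>UNIV. Z $ i * ev a (cv (f (axis i 1))))"
    unfolding ev_def[of "pullc f a"] by (simp add: pullc_def mult.commute)
  also have "\<dots> = ev a (\<Sum>i\<in>UNIV. Z $ i *s cv (f (axis i 1)))" by (simp add: ev_simps)
  also have "(\<Sum>i\<in>UNIV. Z $ i *s cv (f (axis i 1))) = cext f Z"
    by (simp add: vec_eq_iff cext_nth[OF f] mult.commute)
  finally show ?thesis .
qed

lemma pullc_add: "pullc f (a + b) = pullc f a + pullc f b"
  and pullc_smult: "pullc f (c *s a) = c *s pullc f a"
  and pullc_sum: "pullc f (\<Sum>i\<in>I. g i) = (\<Sum>i\<in>I. pullc f (g i))"
  and pullc_cnjv: "pullc f (cnjv a) = cnjv (pullc f a)"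
  by (simp_all add: pullc_def vec_eq_iff ev_simps ev_cnjv_left)

lemma wedge_pullc: "linear f \<Longrightarrow> wedge (pullc f a) (pullc f b) Z W = wedge a b (cext f Z) (cext f W)"
  by (simp add: wedge_def ev_pullc)

locale chart_change =
  fixes W W' :: "'n::finite rvec set" and \<phi> \<psi> :: "'n rvec \<Rightarrow> 'n rvec"
  assumes W: "open W" "open W'" and smooth: "smooth_on W \<phi>" "smooth_on W' \<psi>"
    and img: "\<phi> ` W \<subseteq> W'" "\<psi> ` W' \<subseteq> W"
    and inv: "\<And>x. x \<in> W \<Longrightarrow> \<psi> (\<phi> x) = x" "\<And>y. y \<in> W' \<Longrightarrow> \<phi> (\<psi> y) = y"
begin

abbreviation "D x \<equiv> frechet_derivative \<phi> (at x)"
abbreviation "Di x \<equiv> frechet_derivative \<psi> (at (\<phi> x))"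

lemma hasD: "x \<in> W \<Longrightarrow> (\<phi> has_derivative D x) (at x)"
  using smooth_on_differentiable[OF smooth(1)] by (simp add: frechet_derivative_works)

lemma hasDi: "x \<in> W \<Longrightarrow> (\<psi> has_derivative Di x) (at (\<phi> x))"
  using smooth_on_differentiable[OF smooth(2)] img(1) by (auto simp: frechet_derivative_works)

lemma linD: "x \<in> W \<Longrightarrow> linear (D x)"
  by (rule has_derivative_linear[OF hasD])

lemma linDi: "x \<in> W \<Longrightarrow> linear (Di x)"
  by (rule has_derivative_linear[OF hasDi])

lemma Di_D [simp]: assumes x: "x \<in> W" shows "Di x (D x v) = v"
proof -
  have "((\<lambda>y. \<psi> (\<phi> y)) has_derivative (\<lambda>v. Di x (D x v))) (at x)"
    by (rule has_derivative_compose[OF hasD[OF x] hasDi[OF x]])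
  moreover have "((\<lambda>y. \<psi> (\<phi> y)) has_derivative (\<lambda>v. v)) (at x)"
    by (rule has_derivative_cong_open[OF W(1) x, where g="\<lambda>y. y"]) (auto simp: inv)
  ultimately show ?thesis using has_derivative_unique by metis
qed

lemma D_Di [simp]: assumes x: "x \<in> W" shows "D x (Di x v) = v"
proof -
  have y: "\<phi> x \<in> W'" using img(1) x by blast
  have "((\<lambda>y. \<phi> (\<psi> y)) has_derivative (\<lambda>v. D x (Di x v))) (at (\<phi> x))"
    by (rule has_derivative_compose[OF hasDi[OF x]]) (simp add: inv x hasD)
  moreover have "((\<lambda>y. \<phi> (\<psi> y)) has_derivative (\<lambda>v. v)) (at (\<phi> x))"
    by (rule has_derivative_cong_open[OF W(2) y, where g="\<lambda>y. y"]) (auto simp: inv)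
  ultimately show ?thesis using has_derivative_unique by metis
qed

lemma cD_cDi [simp]: "x \<in> W \<Longrightarrow> cext (D x) (cext (Di x) Z) = Z" "x \<in> W \<Longrightarrow> cext (Di x) (cext (D x) Z) = Z"
  by (simp_all add: cext_compose)

lemma diff0_pull:
  assumes x: "x \<in> W" and F: "F differentiable (at (\<phi> x))"
  shows "diff0 (\<lambda>y. F (\<phi> y)) x = pullc (D x) (diff0 F (\<phi> x))"
proof -
  have "((\<lambda>y. F (\<phi> y)) has_derivative (\<lambda>v. frechet_derivative F (at (\<phi> x)) (D x v))) (at x)"
    by (rule has_derivative_compose[OF hasD[OF x]]) (use F in \<open>simp add: frechet_derivative_works\<close>)
  then show ?thesis
    by (simp add: vec_eq_iff pullc_def diff0_cv[OF F] pd_eqI)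
qed

text \<open>The terms with second derivatives of \<phi> are symmetric and cancel. The computation is
  done for real vectors, and complex bilinearity gives the rest.\<close>

lemma diff1_pull:
  assumes x: "x \<in> W" and eta: "\<eta> differentiable (at (\<phi> x))"
  shows "diff1 (\<lambda>y. pullc (D y) (\<eta> (\<phi> y))) x Z X = diff1 \<eta> (\<phi> x) (cext (D x) Z) (cext (D x) X)"
proof -
  let ?dd = "\<lambda>u h. frechet_derivative (\<lambda>y. D y u) (at x) h"
  let ?E = "\<lambda>v. frechet_derivative \<eta> (at (\<phi> x)) v"
  have p2: "((\<lambda>y. D y u) has_derivative ?dd u) (at x)" for u
    using smooth_on_differentiable[OF smooth_on_frechet[OF smooth(1)] x] by (simp add: frechet_derivative_works)
  have he: "(\<eta> has_derivative ?E) (at (\<phi> x))" using eta by (simp add: frechet_derivative_works)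
  have hn: "((\<lambda>z. \<eta> z $ k) has_derivative (\<lambda>v. ?E v $ k)) (at (\<phi> x))" for k
    by (rule bounded_linear.has_derivative[OF bounded_linear_vec_nth he])
  have hc: "((\<lambda>y. complex_of_real (D y u $ k)) has_derivative (\<lambda>h. complex_of_real (?dd u h $ k))) (at x)" for u k
    by (intro has_derivative_of_real bounded_linear.has_derivative[OF bounded_linear_vec_nth p2])
  have hev: "((\<lambda>y. ev (\<eta> (\<phi> y)) (cv (D y u))) has_derivative
      (\<lambda>h. ev (\<eta> (\<phi> x)) (cv (?dd u h)) + ev (?E (D x h)) (cv (D x u)))) (at x)" for u
  proof -
    have "((\<lambda>y. \<Sum>k\<in>UNIV. \<eta> (\<phi> y) $ k * complex_of_real (D y u $ k)) has_derivative
      (\<lambda>h. \<Sum>k\<in>UNIV. \<eta> (\<phi> x) $ k * complex_of_real (?dd u h $ k) + ?E (D x h) $ k * complex_of_real (D x u $ k))) (at x)"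
      by (intro has_derivative_sum has_derivative_mult hc has_derivative_compose[OF hasD[OF x] hn])
    then show ?thesis by (simp add: ev_def sum.distrib)
  qed
  have sym: "?dd u h = ?dd h u" for u h by (rule second_derivative_symmetric[OF W(1) x smooth(1)])
  have d1: "frechet_derivative (\<lambda>y. ev (\<eta> y) (cv u)) (at (\<phi> x)) h = ev (?E h) (cv u)" for u h
  proof (rule frechet_eqI)
    have "((\<lambda>y. \<Sum>k\<in>UNIV. \<eta> y $ k * complex_of_real (u $ k)) has_derivative (\<lambda>h. \<Sum>k\<in>UNIV. ?E h $ k * complex_of_real (u $ k))) (at (\<phi> x))"
      by (intro has_derivative_sum has_derivative_mult_left hn)
    then show "((\<lambda>y. ev (\<eta> y) (cv u)) has_derivative (\<lambda>h. ev (?E h) (cv u))) (at (\<phi> x))" by (simp add: ev_def)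
  qed
  have dp: "(\<lambda>y. pullc (D y) (\<eta> (\<phi> y))) differentiable (at x)"
    by (rule differentiable_vec) (use hev in \<open>auto simp: pullc_def intro: differentiableI\<close>)
  have ee: "ev (pullc (D y) (\<eta> (\<phi> y))) (cv u) = ev (\<eta> (\<phi> y)) (cv (D y u))" if "y \<in> W" for y u
    by (simp add: ev_pullc[OF linD[OF that]] cext_cv[OF linD[OF that]])
  have dpu: "frechet_derivative (\<lambda>y. ev (pullc (D y) (\<eta> (\<phi> y))) (cv u)) (at x) h =
     ev (\<eta> (\<phi> x)) (cv (?dd u h)) + ev (?E (D x h)) (cv (D x u))" for u h
    by (rule frechet_eqI, rule has_derivative_cong_open[OF W(1) x ee hev])
  have real: "diff1 (\<lambda>y. pullc (D y) (\<eta> (\<phi> y))) x (cv v) (cv w) = diff1 \<eta> (\<phi> x) (cv (D x v)) (cv (D x w))" for v w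
    unfolding diff1_cv[OF dp] diff1_cv[OF eta] dpu d1 by (simp add: sym[of v w])
  have c: "cext (D x) Z = cv (D x (Rev Z)) + \<i> *s cv (D x (Imv Z))" for Z by (simp add: cext_def)
  show ?thesis
    unfolding c by (subst cvec_decomp[of Z], subst cvec_decomp[of X]) (simp only: diff1_simps real)
qed

definition pull :: "'n ph_data \<Rightarrow> 'n ph_data" where
  "pull P = \<lparr>theta = \<lambda>x. \<chi> i. theta P (\<phi> x) \<bullet> D x (axis i 1), reeb = \<lambda>x. Di x (reeb P (\<phi> x)),
    frame = \<lambda>\<alpha> x. cext (Di x) (frame P \<alpha> (\<phi> x)), coframe = \<lambda>\<alpha> x. pullc (D x) (coframe P \<alpha> (\<phi> x)),
    conn = \<lambda>\<beta> \<alpha> x. pullc (D x) (conn P \<beta> \<alpha> (\<phi> x)), tors = \<lambda>\<beta> \<alpha> x. tors P \<beta> \<alpha> (\<phi> x),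
    ricci = \<lambda>\<beta> \<gamma> x. ricci P \<beta> \<gamma> (\<phi> x)\<rparr>"

lemma pull_simps [simp]:
  "theta (pull P) x = (\<chi> i. theta P (\<phi> x) \<bullet> D x (axis i 1))" "reeb (pull P) x = Di x (reeb P (\<phi> x))"
  "frame (pull P) \<alpha> x = cext (Di x) (frame P \<alpha> (\<phi> x))" "coframe (pull P) \<alpha> x = pullc (D x) (coframe P \<alpha> (\<phi> x))"
  "conn (pull P) \<beta> \<alpha> x = pullc (D x) (conn P \<beta> \<alpha> (\<phi> x))" "tors (pull P) \<beta> \<alpha> x = tors P \<beta> \<alpha> (\<phi> x)"
  "ricci (pull P) \<beta> \<gamma> x = ricci P \<beta> \<gamma> (\<phi> x)"
  by (simp_all add: pull_def)

lemma theta_pull: assumes x: "x \<in> W" shows "theta (pull P) x \<bullet> v = theta P (\<phi> x) \<bullet> D x v"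
proof -
  have "theta (pull P) x \<bullet> v = (\<Sum>i\<in>UNIV. v $ i * (theta P (\<phi> x) \<bullet> D x (axis i 1)))"
    by (simp add: inner_vec_def mult.commute)
  also have "\<dots> = theta P (\<phi> x) \<bullet> D x (\<Sum>i\<in>UNIV. v $ i *\<^sub>R axis i 1)"
    by (simp add: linear_sum[OF linD[OF x]] linear_scale[OF linD[OF x]] inner_sum_right)
  also have "(\<Sum>i\<in>UNIV. v $ i *\<^sub>R axis i 1) = v"
    by (simp add: vec_eq_iff axis_def if_distrib cong: if_cong)
  finally show ?thesis .
qed

lemma ctheta_pull: "ctheta (pull P) x = pullc (D x) (ctheta P (\<phi> x))"
  by (simp add: vec_eq_iff ctheta_def pullc_def ev_cv)

lemma cobar_pull: "cobar (pull P) \<alpha> x = pullc (D x) (cobar P \<alpha> (\<phi> x))"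
  by (simp add: cobar_def pullc_cnjv)

lemma conn_trace_pull: "conn_trace (pull P) x = pullc (D x) (conn_trace P (\<phi> x))"
  by (simp add: conn_trace_def pullc_sum)

end

text \<open>The differential of \<phi> intertwines the CR structures of the two charts; the data P
  are transported to the part of W that \<phi> maps into V.\<close>

locale chart_change_cr = chart_change W W' \<phi> \<psi> + pseudohermitian_chart \<Omega> V Hd Jd P
  for W W' :: "'n::finite rvec set" and \<phi> \<psi> and \<Omega> V :: "'n rvec set" and Hd Jd P +
  fixes Hc :: "'n rvec \<Rightarrow> 'n rvec set" and Jc :: "'n rvec \<Rightarrow> 'n rvec \<Rightarrow> 'n rvec"
  assumes H_rel: "\<And>x u. x \<in> W \<Longrightarrow> u \<in> Hc x \<longleftrightarrow> D x u \<in> Hd (\<phi> x)"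
    and J_rel: "\<And>x u. x \<in> W \<Longrightarrow> u \<in> Hc x \<Longrightarrow> D x (Jc x u) = Jd (\<phi> x) (D x u)"
begin

definition "cdom = {x \<in> W. \<phi> x \<in> V}"

lemma cdomD: "x \<in> cdom \<Longrightarrow> x \<in> W" "x \<in> cdom \<Longrightarrow> \<phi> x \<in> V" by (auto simp: cdom_def)

lemma open_dom: "open cdom"
proof -
  have "open (W \<inter> \<phi> -` V)"
    by (rule continuous_open_preimage[OF smooth_on_continuous[OF smooth(1)] W(1) open_V])
  moreover have "cdom = W \<inter> \<phi> -` V" by (auto simp: cdom_def)
  ultimately show ?thesis by simp
qed

lemma smooth_phi_dom: "smooth_on cdom \<phi>"
  by (rule smooth_on_subset[OF smooth(1)]) (auto simp: cdom_def)

lemma smooth_pull_fun: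
  fixes F :: "'n rvec \<Rightarrow> 'b::real_normed_vector"
  shows "smooth_on V F \<Longrightarrow> smooth_on cdom (\<lambda>x. F (\<phi> x))"
  by (rule smooth_on_compose[OF open_dom smooth_phi_dom]) (auto simp: cdom_def)

lemma smooth_D: "smooth_on cdom (\<lambda>x. D x u)"
  by (rule smooth_on_frechet[OF smooth_phi_dom])

lemma smooth_Di: "smooth_on cdom (\<lambda>x. Di x u)"
  using smooth_on_compose[OF open_dom smooth_phi_dom smooth_on_frechet[OF smooth(2)], of u] img(1)
  by (auto simp: cdom_def)

lemma smooth_pullc: "smooth_on V \<eta> \<Longrightarrow> smooth_on cdom (\<lambda>x. pullc (D x) (\<eta> (\<phi> x)))"
  by (rule smooth_on_vec[OF open_dom])
    (simp add: pullc_def, intro smooth_on_ev smooth_on_cv open_dom smooth_D smooth_pull_fun)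

lemma smooth_pull_theta: "smooth_on cdom (theta (pull P))"
  by (rule smooth_on_vec[OF open_dom])
    (simp, intro smooth_on_inner open_dom smooth_D smooth_pull_fun[OF smooth_theta])

lemma smooth_pull_reeb: "smooth_on cdom (reeb (pull P))"
proof (rule smooth_on_vec[OF open_dom])
  fix j
  have "smooth_on cdom (\<lambda>x. \<Sum>i\<in>UNIV. reeb P (\<phi> x) $ i * Di x (axis i 1) $ j)"
    by (intro smooth_on_sum smooth_on_mult smooth_on_nth open_dom smooth_Di smooth_pull_fun[OF smooth_reeb])
  moreover have "(\<Sum>i\<in>UNIV. reeb P (\<phi> x) $ i * Di x (axis i 1) $ j) = reeb (pull P) x $ j" if "x \<in> cdom" for x
  proof -
    have "reeb P (\<phi> x) = (\<Sum>i\<in>UNIV. reeb P (\<phi> x) $ i *\<^sub>R axis i 1)"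
      by (simp add: vec_eq_iff axis_def if_distrib cong: if_cong)
    then have "Di x (reeb P (\<phi> x)) = (\<Sum>i\<in>UNIV. reeb P (\<phi> x) $ i *\<^sub>R Di x (axis i 1))"
      using linear_sum[OF linDi[OF cdomD(1)[OF that]]] linear_scale[OF linDi[OF cdomD(1)[OF that]]]
      by (metis (no_types, lifting) sum.cong)
    then show ?thesis by simp
  qed
  ultimately show "smooth_on cdom (\<lambda>x. reeb (pull P) x $ j)"
    using smooth_on_cong[OF open_dom, of "\<lambda>x. \<Sum>i\<in>UNIV. reeb P (\<phi> x) $ i * Di x (axis i 1) $ j" "\<lambda>x. reeb (pull P) x $ j"] by simp
qed

lemma smooth_pull_frame: "smooth_on cdom (frame (pull P) \<alpha>)"
proof (rule smooth_on_vec[OF open_dom])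
  fix j
  have "smooth_on cdom (\<lambda>x. \<Sum>i\<in>UNIV. complex_of_real (Di x (axis i 1) $ j) * frame P \<alpha> (\<phi> x) $ i)"
    by (intro smooth_on_sum smooth_on_mult smooth_on_nth smooth_on_of_real open_dom smooth_Di smooth_pull_fun[OF smooth_frame])
  moreover have "(\<Sum>i\<in>UNIV. complex_of_real (Di x (axis i 1) $ j) * frame P \<alpha> (\<phi> x) $ i) = frame (pull P) \<alpha> x $ j" if "x \<in> cdom" for x
    by (simp add: cext_nth[OF linDi[OF cdomD(1)[OF that]]])
  ultimately show "smooth_on cdom (\<lambda>x. frame (pull P) \<alpha> x $ j)"
    using smooth_on_cong[OF open_dom, of "\<lambda>x. \<Sum>i\<in>UNIV. complex_of_real (Di x (axis i 1) $ j) * frame P \<alpha> (\<phi> x) $ i" "\<lambda>x. frame (pull P) \<alpha> x $ j"] by simp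
qed

lemma T10_rel: assumes x: "x \<in> W" shows "Z \<in> T10 Hc Jc x \<longleftrightarrow> cext (D x) Z \<in> T10 Hd Jd (\<phi> x)"
proof -
  have c: "cext (Jd (\<phi> x)) (cext (D x) Z) = cext (D x) (cext (Jc x) Z)" if "Rev Z \<in> Hc x" "Imv Z \<in> Hc x"
    unfolding cext_compose by (rule cext_cong) (simp_all add: J_rel[OF x] that)
  have i: "cext (Jc x) Z = \<i> *s Z \<longleftrightarrow> cext (D x) (cext (Jc x) Z) = \<i> *s cext (D x) Z"
    by (metis cD_cDi(2)[OF x] cext_smult[OF linD[OF x]])
  show ?thesis unfolding T10_def using c i by (auto simp: H_rel[OF x])
qed

lemma dctheta_pull: "x \<in> cdom \<Longrightarrow> diff1 (ctheta (pull P)) x Z X = diff1 (ctheta P) (\<phi> x) (cext (D x) Z) (cext (D x) X)"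
  unfolding ctheta_pull[abs_def] by (rule diff1_pull) (auto intro: diff_ctheta cdomD)

lemma hmat_pull: assumes x: "x \<in> cdom" shows "hmat Jc (pull P) x = hmat Jd P (\<phi> x)"
proof -
  note xW = cdomD(1)[OF x] and xV = cdomD(2)[OF x]
  have lev: "levi_form Jc (theta (pull P)) x (frame (pull P) \<alpha> x) (cnjv (frame (pull P) \<beta> x)) =
     levi_form Jd (theta P) (\<phi> x) (frame P \<alpha> (\<phi> x)) (cnjv (frame P \<beta> (\<phi> x)))" for \<alpha> \<beta>
  proof -
    define Z where "Z = cext (Di x) (cnjv (frame P \<beta> (\<phi> x)))"
    have "cext (Di x) (frame P \<beta> (\<phi> x)) \<in> T10 Hc Jc x" using T10_rel[OF xW] frame_T10[OF xV] xW by simp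
    then have h: "Rev (cext (Di x) (frame P \<beta> (\<phi> x))) \<in> Hc x" "Imv (cext (Di x) (frame P \<beta> (\<phi> x))) \<in> Hc x"
      by (auto simp: T10_def)
    \<comment> \<open>Linear structure of \<open>Hc\<close> is available only through
      \<open>H_rel\<close>, so closure under negation is read off from \<open>Hd\<close>.\<close>
    have neg: "- u \<in> Hc x" if "u \<in> Hc x" for u
      using that subspace_neg[OF H_subspace[OF xV]] by (simp add: H_rel[OF xW] linear_neg[OF linD[OF xW]])
    have r: "Rev (cnjv Z) = Rev Z" "Imv (cnjv Z) = - Imv Z" for Z :: "'n cvec" by (simp_all add: vec_eq_iff)
    have "Rev Z \<in> Hc x" "Imv Z \<in> Hc x"
      using h neg[OF h(2)] by (simp_all add: Z_def r linear_neg[OF linDi[OF xW]])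
    then have "cext (D x) (cext (Jc x) Z) = cext (Jd (\<phi> x)) (cext (D x) Z)"
      unfolding cext_compose[of "D x"] cext_compose[of "Jd (\<phi> x)"] by (intro cext_cong) (simp_all add: J_rel[OF xW])
    then have e: "cext (D x) (cext (Jc x) Z) = cext (Jd (\<phi> x)) (cnjv (frame P \<beta> (\<phi> x)))"
      using xW by (simp add: Z_def)
    have f: "cnjv (frame (pull P) \<beta> x) = Z" by (simp add: Z_def cext_cnjv[OF linDi[OF xW]])
    have l: "levi_form J' (theta P') x' Z1 Z2 = diff1 (ctheta P') x' Z1 (cext (J' x') Z2)" for J' P' x' and Z1 Z2 :: "'n cvec"
      by (simp only: levi_form_def ctheta_def[abs_def])
    show ?thesis
      unfolding f l dctheta_pull[OF x] e using xW by simp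
  qed
  show ?thesis unfolding hmat_def lev ..
qed

lemma admissible_pull: "admissible_coframe cdom Hc Jc (pull P)"
  unfolding admissible_coframe_def contact_form_def
proof (intro conjI allI ballI)
  show "smooth_on cdom (theta (pull P))" "smooth_on cdom (reeb (pull P))" by (rule smooth_pull_theta smooth_pull_reeb)+
  fix \<alpha>
  show "smooth_on cdom (frame (pull P) \<alpha>)" by (rule smooth_pull_frame)
  have "coframe (pull P) \<alpha> = (\<lambda>x. pullc (D x) (coframe P \<alpha> (\<phi> x)))" by (rule ext) simp
  then show "smooth_on cdom (coframe (pull P) \<alpha>)" using smooth_pullc[OF smooth_coframe] by simp
next
  fix x assume x: "x \<in> cdom"
  note xW = cdomD(1)[OF x] and xV = cdomD(2)[OF x]
  show "{v. theta (pull P) x \<bullet> v = 0} = Hc x"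
    using theta_kernel[OF xV] H_rel[OF xW] by (auto simp: theta_pull[OF xW] simp del: pull_simps)
  have "theta P (\<phi> x) \<bullet> reeb P (\<phi> x) = 1" using adm xV by (simp add: admissible_coframe_def)
  then show "theta (pull P) x \<bullet> reeb (pull P) x = 1"
    unfolding theta_pull[OF xW] using xW by simp
  show "diff1 (ctheta (pull P)) x (cv (reeb (pull P) x)) Z = 0" for Z
    unfolding dctheta_pull[OF x] by (simp add: cext_cv[OF linD[OF xW]] xW xV)
  show "frame (pull P) \<alpha> x \<in> T10 Hc Jc x" for \<alpha>
    unfolding T10_rel[OF xW] using xW frame_T10[OF xV] by simp
  show "\<exists>!a :: complex ^ 'n. Z = (\<Sum>\<alpha>\<in>UNIV. a $ \<alpha> *s frame (pull P) \<alpha> x)" if Z: "Z \<in> T10 Hc Jc x" for Z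
  proof -
    have "\<exists>!a :: complex ^ 'n. cext (D x) Z = (\<Sum>\<alpha>\<in>UNIV. a $ \<alpha> *s frame P \<alpha> (\<phi> x))"
      using adm xV T10_rel[OF xW] Z by (simp add: admissible_coframe_def)
    moreover have "cext (D x) Z = (\<Sum>\<alpha>\<in>UNIV. a $ \<alpha> *s frame P \<alpha> (\<phi> x)) \<longleftrightarrow> Z = (\<Sum>\<alpha>\<in>UNIV. a $ \<alpha> *s frame (pull P) \<alpha> x)" for a :: "complex ^ 'n"
    proof -
      define S where "S = (\<Sum>\<alpha>\<in>UNIV. a $ \<alpha> *s frame P \<alpha> (\<phi> x))"
      have 1: "(\<Sum>\<alpha>\<in>UNIV. a $ \<alpha> *s frame (pull P) \<alpha> x) = cext (Di x) S"
        by (simp add: S_def cext_sum[OF linDi[OF xW]] cext_smult[OF linDi[OF xW]])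
      have "cext (D x) Z = S \<longleftrightarrow> Z = cext (Di x) S" using xW by auto
      then show ?thesis unfolding 1 S_def .
    qed
    ultimately show ?thesis by simp
  qed
  show "ev (coframe (pull P) \<alpha> x) (cv (reeb (pull P) x)) = 0" for \<alpha>
    by (simp add: ev_pullc[OF linD[OF xW]] cext_cv[OF linD[OF xW]] xW xV)
  show "ev (coframe (pull P) \<alpha> x) (frame (pull P) \<beta> x) = (if \<alpha> = \<beta> then 1 else 0)" for \<alpha> \<beta>
    by (simp add: ev_pullc[OF linD[OF xW]] xW xV)
  show "ev (coframe (pull P) \<alpha> x) (cnjv (frame (pull P) \<beta> x)) = 0" for \<alpha> \<beta>
    by (simp add: ev_pullc[OF linD[OF xW]] cext_cnjv[OF linDi[OF xW], symmetric] xW xV)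
qed

lemma tanaka_webster_pull: "tanaka_webster cdom Jc (pull P)"
  unfolding tanaka_webster_def
proof (intro conjI allI ballI)
  fix \<beta> \<alpha>
  have "conn (pull P) \<beta> \<alpha> = (\<lambda>x. pullc (D x) (conn P \<beta> \<alpha> (\<phi> x)))" by (rule ext) simp
  then show "smooth_on cdom (conn (pull P) \<beta> \<alpha>)" using smooth_pullc[OF smooth_conn] by simp
next
  fix x assume x: "x \<in> cdom"
  note xW = cdomD(1)[OF x] and xV = cdomD(2)[OF x]
  show "diff1 (coframe (pull P) \<alpha>) x Z X = (\<Sum>\<beta>\<in>UNIV. wedge (coframe (pull P) \<beta> x) (conn (pull P) \<beta> \<alpha> x) Z X)
     + (\<Sum>\<beta>\<in>UNIV. tors (pull P) \<beta> \<alpha> x * wedge (ctheta (pull P) x) (cobar (pull P) \<beta> x) Z X)" for \<alpha> Z X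
  proof -
    have "coframe (pull P) \<alpha> = (\<lambda>x. pullc (D x) (coframe P \<alpha> (\<phi> x)))" by (rule ext) simp
    then have "diff1 (coframe (pull P) \<alpha>) x Z X = diff1 (coframe P \<alpha>) (\<phi> x) (cext (D x) Z) (cext (D x) X)"
      using diff1_pull[OF xW diff_coframe[OF xV]] by simp
    then show ?thesis
      by (simp add: tw_coframe[OF xV] ctheta_pull cobar_pull wedge_pullc[OF linD[OF xW]])
  qed
  show "diff0 (\<lambda>y. hmat Jc (pull P) y $ \<alpha> $ \<beta>) x =
         (\<Sum>\<gamma>\<in>UNIV. (hmat Jc (pull P) x $ \<gamma> $ \<beta>) *s conn (pull P) \<alpha> \<gamma> x)
       + (\<Sum>\<gamma>\<in>UNIV. (hmat Jc (pull P) x $ \<alpha> $ \<gamma>) *s cnjv (conn (pull P) \<beta> \<gamma> x))" for \<alpha> \<beta>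
  proof -
    have "diff0 (\<lambda>y. hmat Jc (pull P) y $ \<alpha> $ \<beta>) x = diff0 (\<lambda>y. hmat Jd P (\<phi> y) $ \<alpha> $ \<beta>) x"
      by (rule diff0_cong[OF open_dom x]) (simp add: hmat_pull)
    also have "\<dots> = pullc (D x) (diff0 (\<lambda>y. hmat Jd P y $ \<alpha> $ \<beta>) (\<phi> x))"
      by (rule diff0_pull[OF xW diff_hmat[OF xV]])
    finally show ?thesis
      by (simp add: tw_hmat[OF xV] hmat_pull[OF x] pullc_add pullc_sum pullc_smult pullc_cnjv)
  qed
  show "(\<Sum>\<gamma>\<in>UNIV. hmat Jc (pull P) x $ \<beta> $ \<gamma> * cnj (tors (pull P) \<alpha> \<gamma> x)) =
      (\<Sum>\<gamma>\<in>UNIV. hmat Jc (pull P) x $ \<alpha> $ \<gamma> * cnj (tors (pull P) \<beta> \<gamma> x))" for \<alpha> \<beta>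
    using tw xV by (simp add: hmat_pull[OF x] tanaka_webster_def)
qed

lemma ricci_pull: "ricci_tensor cdom (pull P)"
  unfolding ricci_tensor_def
proof
  fix x assume x: "x \<in> cdom"
  note xW = cdomD(1)[OF x] and xV = cdomD(2)[OF x]
  obtain \<eta> where \<eta>: "\<And>Z X. diff1 (conn_trace P) (\<phi> x) Z X =
      (\<Sum>\<beta>\<in>UNIV. \<Sum>\<gamma>\<in>UNIV. ricci P \<beta> \<gamma> (\<phi> x) * wedge (coframe P \<beta> (\<phi> x)) (cobar P \<gamma> (\<phi> x)) Z X)
    + wedge (ctheta P (\<phi> x)) \<eta> Z X"
    using ric xV unfolding ricci_tensor_def by blast
  have "diff1 (conn_trace (pull P)) x Z X = diff1 (conn_trace P) (\<phi> x) (cext (D x) Z) (cext (D x) X)" for Z X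
    unfolding conn_trace_pull[abs_def] by (rule diff1_pull[OF xW diff_conn_trace[OF xV]])
  then show "\<exists>\<eta>. \<forall>Z X. diff1 (conn_trace (pull P)) x Z X =
      (\<Sum>\<beta>\<in>UNIV. \<Sum>\<gamma>\<in>UNIV. ricci (pull P) \<beta> \<gamma> x * wedge (coframe (pull P) \<beta> x) (cobar (pull P) \<gamma> x) Z X)
    + wedge (ctheta (pull P) x) \<eta> Z X"
    by (intro exI[of _ "pullc (D x) \<eta>"]) (simp add: \<eta> cobar_pull ctheta_pull wedge_pullc[OF linD[OF xW]])
qed

lemma pseudohermitian_pull: "pseudohermitian cdom Hc Jc (pull P)"
  using admissible_pull tanaka_webster_pull ricci_pull by (simp add: pseudohermitian_def)

lemma chain_form_pull:
  assumes x: "x \<in> cdom"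
  shows "chain_form Jc (pull P) x u w = chain_form Jd P (\<phi> x) (D x u) (D x w)"
proof -
  note xW = cdomD(1)[OF x]
  have S: "Sform Jc (pull P) x u w = Sform Jd P (\<phi> x) (D x u) (D x w)" for u w
    by (simp add: Sform_def hmat_pull[OF x] cobar_pull ev_pullc[OF linD[OF xW]] cext_cv[OF linD[OF xW]])
  have "scalar_curv Jc (pull P) x = scalar_curv Jd P (\<phi> x)"
    by (simp add: scalar_curv_def hmat_pull[OF x])
  then have a: "aform Jc (pull P) x u = aform Jd P (\<phi> x) (D x u)" for u
    by (simp add: aform_def conn_trace_pull ev_pullc[OF linD[OF xW]] cext_cv[OF linD[OF xW]] theta_pull[OF xW] del: pull_simps)
  show ?thesis by (simp add: chain_form_eq S a theta_pull[OF xW] del: pull_simps)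
qed

lemma chain_jet_pull:
  assumes x: "x \<in> cdom" and j: "chain_jet V Hd Jd P (\<phi> x) (D x v) (D x q + frechet_derivative (\<lambda>y. D y v) (at x) v)"
  shows "chain_jet cdom Hc Jc (pull P) x v q"
proof -
  note xW = cdomD(1)[OF x] and xV = cdomD(2)[OF x]
  have "chain_EL (chain_form Jc (pull P)) (theta (pull P)) x v q w =
    chain_EL (chain_form Jd P) (theta P) (\<phi> x) (D x v) (D x q + frechet_derivative (\<lambda>y. D y v) (at x) v) (D x w)" for w
    by (rule chain_EL_natural[OF bilinear_chain_form diff_chain_form[OF xV] chain_form_sym diff_theta[OF xV] open_dom x smooth_phi_dom])
      (auto simp: chain_form_pull theta_pull cdomD simp del: pull_simps)
  then show ?thesis
    using j x open_dom pseudohermitian_pull H_rel[OF xW] by (simp add: chain_jet_def theta_pull[OF xW] del: pull_simps)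
qed

end

text \<open>The differential of \<phi> is smooth in the base point for each fixed direction, while
  here the direction moves with the curve; the basis expansion of the velocity separates the
  two.\<close>

lemma second_derivative_compose:
  fixes \<phi> :: "'a::euclidean_space \<Rightarrow> 'a"
  assumes oS: "open S" and S: "smooth_on S \<phi>" and N: "open N" and t: "t \<in> N" and y: "\<And>s. s \<in> N \<Longrightarrow> y s \<in> S"
    "\<And>s. s \<in> N \<Longrightarrow> (y has_vector_derivative y1 s) (at s)" and y1: "(y1 has_vector_derivative q) (at t)"
  shows "\<And>s. s \<in> N \<Longrightarrow> ((\<lambda>s. \<phi> (y s)) has_vector_derivative frechet_derivative \<phi> (at (y s)) (y1 s)) (at s)"
    and "((\<lambda>s. frechet_derivative \<phi> (at (y s)) (y1 s)) has_vector_derivative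
      frechet_derivative \<phi> (at (y t)) q + frechet_derivative (\<lambda>z. frechet_derivative \<phi> (at z) (y1 t)) (at (y t)) (y1 t)) (at t)"
proof -
  let ?D = "\<lambda>x. frechet_derivative \<phi> (at x)"
  have D: "(\<phi> has_derivative ?D x) (at x)" if "x \<in> S" for x
    using smooth_on_differentiable[OF S that] by (simp add: frechet_derivative_works)
  have lin: "linear (?D x)" if "x \<in> S" for x by (rule has_derivative_linear[OF D[OF that]])
  have yd: "(y has_derivative (\<lambda>h. h *\<^sub>R y1 s)) (at s)" if "s \<in> N" for s
    using y(2)[OF that] by (simp add: has_vector_derivative_def)
  show "((\<lambda>s. \<phi> (y s)) has_vector_derivative ?D (y s) (y1 s)) (at s)" if s: "s \<in> N" for s
    using has_derivative_compose[OF yd[OF s] D[OF y(1)[OF s]]] linear_scale[OF lin[OF y(1)[OF s]]]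
    by (simp add: has_vector_derivative_def)
  let ?dd = "\<lambda>b h. frechet_derivative (\<lambda>z. ?D z b) (at (y t)) h"
  have yt: "y t \<in> S" by (rule y(1)[OF t])
  have d2: "((\<lambda>z. ?D z b) has_derivative ?dd b) (at (y t))" for b
    using smooth_on_differentiable[OF smooth_on_frechet[OF S] yt] by (simp add: frechet_derivative_works)
  have d3: "((\<lambda>s. ?D (y s) b) has_vector_derivative ?dd b (y1 t)) (at t)" for b
    using has_derivative_compose[OF yd[OF t] d2[of b]] linear_scale[OF has_derivative_linear[OF d2[of b]]]
    by (simp add: has_vector_derivative_def)
  have d4: "((\<lambda>s. y1 s \<bullet> b) has_real_derivative q \<bullet> b) (at t)" for b
    using bounded_linear.has_vector_derivative[OF bounded_linear_inner_left y1]
    by (simp add: has_real_derivative_iff_has_vector_derivative)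
  have expand: "?D z v = (\<Sum>b\<in>Basis. (v \<bullet> b) *\<^sub>R ?D z b)" if "z \<in> S" for z v
    by (subst (1) euclidean_representation[of v, symmetric]) (simp only: linear_sum[OF lin[OF that]] linear_scale[OF lin[OF that]])
  have "((\<lambda>s. \<Sum>b\<in>Basis. (y1 s \<bullet> b) *\<^sub>R ?D (y s) b) has_vector_derivative
      (\<Sum>b\<in>Basis. (y1 t \<bullet> b) *\<^sub>R ?dd b (y1 t) + (q \<bullet> b) *\<^sub>R ?D (y t) b)) (at t)"
    by (intro has_vector_derivative_sum has_vector_derivative_scaleR d4 d3)
  then have "((\<lambda>s. ?D (y s) (y1 s)) has_vector_derivative
      (\<Sum>b\<in>Basis. (y1 t \<bullet> b) *\<^sub>R ?dd b (y1 t) + (q \<bullet> b) *\<^sub>R ?D (y t) b)) (at t)"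
    unfolding has_vector_derivative_def
    by (rule has_derivative_cong_open[OF N t, rotated]) (rule expand[OF y(1)])
  moreover have "(\<Sum>b\<in>Basis. (y1 t \<bullet> b) *\<^sub>R ?dd b (y1 t)) = ?dd (y1 t) (y1 t)"
  proof -
    have lf: "linear (\<lambda>v. ?dd v h)" for h
    proof (rule linearI)
      show "?dd (u + v) h = ?dd u h + ?dd v h" for u v
        by (rule frechet_eqI, rule has_derivative_cong_open[OF oS yt _ has_derivative_add[OF d2 d2]])
          (simp add: linear_add[OF lin])
      show "?dd (c *\<^sub>R u) h = c *\<^sub>R ?dd u h" for c u
        by (rule frechet_eqI, rule has_derivative_cong_open[OF oS yt _ has_derivative_scaleR_right[OF d2]])
          (simp add: linear_scale[OF lin])
    qed
    have "?dd (y1 t) h = ?dd (\<Sum>b\<in>Basis. (y1 t \<bullet> b) *\<^sub>R b) h" for h by (simp only: euclidean_representation)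
    then show ?thesis by (simp only: linear_sum[OF lf] linear_scale[OF lf])
  qed
  ultimately show "((\<lambda>s. ?D (y s) (y1 s)) has_vector_derivative ?D (y t) q + ?dd (y1 t) (y1 t)) (at t)"
    by (simp only: sum.distrib expand[OF yt, of q] add.commute)
qed

section \<open>Charts of the manifold\<close>

lemma has_vector_derivative_cong_open:
  assumes "open N" "t \<in> N" "\<And>s. s \<in> N \<Longrightarrow> f s = g s" "(g has_vector_derivative D) (at t)"
  shows "(f has_vector_derivative D) (at t)"
  using assms unfolding has_vector_derivative_def by (intro has_derivative_cong_open[of N t f g])

lemma chain_jet_subset:
  assumes "cr_structure_on \<Omega> H J" "nondegenerate_on \<Omega> H J" "chain_jet V H J P x v q" "V \<subseteq> \<Omega>" "open U" "x \<in> U" "U \<subseteq> V"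
  shows "chain_jet U H J P x v q"
  by (rule chain_jet_invariant[OF assms(1-4)]) (use assms pseudohermitian_subset in \<open>auto simp: chain_jet_def\<close>)

locale manifold_atlas =
  fixes A :: "('m::topological_space, 'n::finite) chart set"
  assumes atlas: "smooth_atlas A"
begin

abbreviation "img c \<equiv> snd c ` fst c"

lemma open_fst: "c \<in> A \<Longrightarrow> open (fst c)" and open_img: "c \<in> A \<Longrightarrow> open (img c)"
  and homeo: "c \<in> A \<Longrightarrow> homeomorphism (fst c) (img c) (snd c) (chart_inv c)"
  and cover: "\<exists>c\<in>A. p \<in> fst c"
  using atlas by (auto simp: smooth_atlas_def)

lemma inv_snd [simp]: "c \<in> A \<Longrightarrow> p \<in> fst c \<Longrightarrow> chart_inv c (snd c p) = p"
  using homeo unfolding homeomorphism_def by blast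

definition "ovl c d = snd c ` (fst c \<inter> fst d)"

lemma ovl_iff: "c \<in> A \<Longrightarrow> x \<in> ovl c d \<longleftrightarrow> x \<in> img c \<and> chart_inv c x \<in> fst d"
  by (auto simp: ovl_def)

lemma open_ovl: assumes c: "c \<in> A" and d: "d \<in> A" shows "open (ovl c d)"
proof -
  have "continuous_on (img c) (chart_inv c)" using homeo[OF c] by (simp add: homeomorphism_def)
  then have "open (img c \<inter> chart_inv c -` fst d)"
    by (rule continuous_open_preimage[OF _ open_img[OF c] open_fst[OF d]])
  moreover have "ovl c d = img c \<inter> chart_inv c -` fst d" using ovl_iff[OF c] by blast
  ultimately show ?thesis by simp
qed

lemma smooth_transition: "c \<in> A \<Longrightarrow> d \<in> A \<Longrightarrow> smooth_on (ovl c d) (transition c d)"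
  using atlas by (auto simp: smooth_atlas_def ovl_def)

lemma chart_change_transition: assumes c: "c \<in> A" and d: "d \<in> A"
  shows "chart_change (ovl c d) (ovl d c) (transition c d) (transition d c)"
proof
  show "open (ovl c d)" "open (ovl d c)" by (rule open_ovl c d)+
  show "smooth_on (ovl c d) (transition c d)" "smooth_on (ovl d c) (transition d c)" by (rule smooth_transition c d)+
  show "transition c d ` ovl c d \<subseteq> ovl d c" "transition d c ` ovl d c \<subseteq> ovl c d"
    using c d by (auto simp: ovl_def transition_def)
  show "transition d c (transition c d x) = x" if "x \<in> ovl c d" for x
    using that c d by (auto simp: ovl_def transition_def)
  show "transition c d (transition d c x) = x" if "x \<in> ovl d c" for x
    using that c d by (auto simp: ovl_def transition_def)
qed

lemma transition_has_derivative:
  assumes "c \<in> A" "d \<in> A" "p \<in> fst c" "p \<in> fst d"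
  shows "(transition c d has_derivative frechet_derivative (transition c d) (at (snd c p))) (at (snd c p))"
  using smooth_on_differentiable[OF smooth_transition[OF assms(1,2)], of "snd c p"] assms(3,4)
  by (auto simp: frechet_derivative_works ovl_def)

lemma transition_chain:
  assumes c: "c \<in> A" "p \<in> fst c" and d: "d \<in> A" "p \<in> fst d" and e: "e \<in> A" "p \<in> fst e"
  shows "frechet_derivative (transition c e) (at (snd c p)) u =
    frechet_derivative (transition d e) (at (snd d p)) (frechet_derivative (transition c d) (at (snd c p)) u)"
proof (rule frechet_eqI)
  have o: "open (ovl c d)" by (rule open_ovl[OF c(1) d(1)])
  have x: "snd c p \<in> ovl c d" using c d by (auto simp: ovl_def)
  have t: "transition c d (snd c p) = snd d p" using c by (simp add: transition_def)
  have "((\<lambda>x. transition d e (transition c d x)) has_derivative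
     (\<lambda>u. frechet_derivative (transition d e) (at (snd d p)) (frechet_derivative (transition c d) (at (snd c p)) u))) (at (snd c p))"
    by (rule has_derivative_compose[OF transition_has_derivative[OF c(1) d(1) c(2) d(2)]])
      (simp add: t transition_has_derivative[OF d(1) e(1) d(2) e(2)])
  then show "(transition c e has_derivative
     (\<lambda>u. frechet_derivative (transition d e) (at (snd d p)) (frechet_derivative (transition c d) (at (snd c p)) u))) (at (snd c p))"
    by (rule has_derivative_cong_open[OF o x, rotated]) (use c d in \<open>auto simp: ovl_def transition_def\<close>)
qed

lemma tvec_of_change:
  assumes c: "c \<in> A" "p \<in> fst c" and d: "d \<in> A" "p \<in> fst d"
  shows "tvec_of A p c u = tvec_of A p d (frechet_derivative (transition c d) (at (snd c p)) u)"
  unfolding tvec_of_def using transition_chain[OF c d] by (intro ext) auto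

lemma transition_self: assumes c: "c \<in> A" "p \<in> fst c"
  shows "frechet_derivative (transition c c) (at (snd c p)) u = u"
proof (rule frechet_eqI)
  show "(transition c c has_derivative (\<lambda>u. u)) (at (snd c p))"
    by (rule has_derivative_cong_open[OF open_img[OF c(1)], where g="\<lambda>x. x"])
      (use c in \<open>auto simp: transition_def\<close>)
qed

lemma tvec_of_self [simp]: "c \<in> A \<Longrightarrow> p \<in> fst c \<Longrightarrow> tvec_of A p c u c = u"
  by (simp add: tvec_of_def transition_self)

end

locale nondegenerate_cr = manifold_atlas A
  for A :: "('m::topological_space, 'n::finite) chart set" +
  fixes H :: "'m \<Rightarrow> ('m, 'n) tvec set" and J :: "'m \<Rightarrow> ('m, 'n) tvec \<Rightarrow> ('m, 'n) tvec"
  assumes cr_nondeg: "nondegenerate_cr_structure A H J"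
begin

abbreviation "HH c \<equiv> chart_H A H c"
abbreviation "JJ c \<equiv> chart_J A J c"

lemma H_tangent: "H p \<subseteq> tangent_space A p" and J_H: "v \<in> H p \<Longrightarrow> J p v \<in> H p"
  and cr_on: "c \<in> A \<Longrightarrow> cr_structure_on (img c) (HH c) (JJ c)"
  and nondeg_on: "c \<in> A \<Longrightarrow> nondegenerate_on (img c) (HH c) (JJ c)"
  using cr_nondeg by (auto simp: nondegenerate_cr_structure_def cr_structure_def)

lemma chart_H_at: "c \<in> A \<Longrightarrow> p \<in> fst c \<Longrightarrow> u \<in> HH c (snd c p) \<longleftrightarrow> tvec_of A p c u \<in> H p"
  by (simp add: chart_H_def)

lemma chart_J_at: "c \<in> A \<Longrightarrow> p \<in> fst c \<Longrightarrow> JJ c (snd c p) u = J p (tvec_of A p c u) c"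
  by (simp add: chart_J_def)

lemma H_components: "c \<in> A \<Longrightarrow> p \<in> fst c \<Longrightarrow> v \<in> H p \<Longrightarrow> v = tvec_of A p c (v c)"
  using H_tangent unfolding tangent_space_def by blast

text \<open>A piece of the chain comes in a chart d of its own, whereas v is prescribed in chart c.
  The jet is carried from d to c and the data are pulled back along the transition map. The velocity
  near t is returned too, so that accelerations obtained from different structures can be
  compared.\<close>

lemma chain_transfer:
  assumes ch: "is_chain A H J (I, \<gamma>)" and t: "t \<in> I" "\<gamma> t = p" and c: "c \<in> A" "p \<in> fst c"
    and v: "((snd c \<circ> \<gamma>) has_vector_derivative v) (at t)"
  shows "\<exists>V P N y1 q. V \<subseteq> img c \<and> chain_jet V (HH c) (JJ c) P (snd c p) v q \<and> open N \<and> t \<in> N \<and>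
    (\<forall>s\<in>N. ((snd c \<circ> \<gamma>) has_vector_derivative y1 s) (at s)) \<and> (y1 has_vector_derivative q) (at t)"
proof -
  obtain d N where d: "d \<in> A" and N: "open_interval N" "t \<in> N" "N \<subseteq> I" "\<gamma> ` N \<subseteq> fst d"
    and cc: "coordinate_chain (img d) (HH d) (JJ d) N (snd d \<circ> \<gamma>)"
    using ch t(1) unfolding is_chain_def by auto
  have oN: "open N" using N(1) by (simp add: open_interval_def)
  obtain V P y1 q where jet: "V \<subseteq> img d" "\<And>s. s \<in> N \<Longrightarrow> ((snd d \<circ> \<gamma>) has_vector_derivative y1 s) (at s)"
    "\<And>s. s \<in> N \<Longrightarrow> (y1 has_vector_derivative q s) (at s)" "\<And>s. s \<in> N \<Longrightarrow> chain_jet V (HH d) (JJ d) P ((snd d \<circ> \<gamma>) s) (y1 s) (q s)"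
    using coordinate_chain_jet[OF cr_on[OF d] nondeg_on[OF d] cc oN] by blast
  have pd: "p \<in> fst d" using N(2,4) t(2) by auto
  interpret cg: chart_change "ovl c d" "ovl d c" "transition c d" "transition d c"
    by (rule chart_change_transition[OF c(1) d])
  let ?yd = "snd d \<circ> \<gamma>" and ?yc = "snd c \<circ> \<gamma>"
  let ?\<phi> = "transition c d" and ?\<psi> = "transition d c"
  have ydt: "?yd t \<in> ovl d c" using pd c t(2) by (auto simp: ovl_def)
  define N' where "N' = N \<inter> ?yd -` ovl d c"
  have "continuous_on N ?yd"
    using jet(2) by (intro continuous_at_imp_continuous_on ballI) (blast intro: has_vector_derivative_continuous)
  then have oN': "open N'" unfolding N'_def
    by (rule continuous_open_preimage[OF _ oN open_ovl[OF d c(1)]])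
  have tN': "t \<in> N'" using N(2) ydt by (simp add: N'_def)
  have gd: "\<gamma> s \<in> fst d" if "s \<in> N'" for s using that N(4) by (auto simp: N'_def)
  have gc: "\<gamma> s \<in> fst c" if "s \<in> N'" for s
    using that gd[OF that] ovl_iff[OF d, of "?yd s" c] d by (simp add: N'_def)
  have yc: "?yc s = ?\<psi> (?yd s)" if "s \<in> N'" for s using gd[OF that] d by (simp add: transition_def)
  have yd: "?yd s = ?\<phi> (?yc s)" if "s \<in> N'" for s using gc[OF that] c by (simp add: transition_def)
  define z1 where "z1 s = frechet_derivative ?\<psi> (at (?yd s)) (y1 s)" for s
  define q2 where "q2 = frechet_derivative ?\<psi> (at (?yd t)) (q t) + frechet_derivative (\<lambda>z. frechet_derivative ?\<psi> (at z) (y1 t)) (at (?yd t)) (y1 t)"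
  have A1: "((\<lambda>s. ?\<psi> (?yd s)) has_vector_derivative z1 s) (at s)" if "s \<in> N'" for s
    unfolding z1_def
    by (rule second_derivative_compose(1)[OF open_ovl[OF d c(1)] smooth_transition[OF d c(1)] oN' tN' _ _ jet(3)[OF N(2)] that])
      (use jet(2) in \<open>auto simp: N'_def comp_def\<close>)
  have A2: "(z1 has_vector_derivative q2) (at t)"
    unfolding z1_def q2_def
    by (rule second_derivative_compose(2)[OF open_ovl[OF d c(1)] smooth_transition[OF d c(1)] oN' tN' _ _ jet(3)[OF N(2)]])
      (use jet(2) in \<open>auto simp: N'_def comp_def\<close>)
  have ycd: "(?yc has_vector_derivative z1 s) (at s)" if "s \<in> N'" for s
    by (rule has_vector_derivative_cong_open[OF oN' that yc A1[OF that]])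
  have z1t: "z1 t = v" using vector_derivative_unique_at[OF ycd[OF tN'] v] .
  have ycS: "?yc s \<in> ovl c d" if "s \<in> N'" for s using gc[OF that] gd[OF that] by (auto simp: ovl_def)
  have B1: "((\<lambda>s. ?\<phi> (?yc s)) has_vector_derivative frechet_derivative ?\<phi> (at (?yc s)) (z1 s)) (at s)" if "s \<in> N'" for s
    by (rule second_derivative_compose(1)[OF open_ovl[OF c(1) d] smooth_transition[OF c(1) d] oN' tN' ycS ycd A2 that])
  have B2: "((\<lambda>s. frechet_derivative ?\<phi> (at (?yc s)) (z1 s)) has_vector_derivative
      frechet_derivative ?\<phi> (at (?yc t)) q2 + frechet_derivative (\<lambda>z. frechet_derivative ?\<phi> (at z) (z1 t)) (at (?yc t)) (z1 t)) (at t)"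
    by (rule second_derivative_compose(2)[OF open_ovl[OF c(1) d] smooth_transition[OF c(1) d] oN' tN' ycS ycd A2])
  \<comment> \<open>Mapping the curve back to d reproduces its original jet, by uniqueness of
    derivatives; this is the form in which \<open>chain_jet_pull\<close> takes the jet.\<close>
  have y1eq: "y1 s = frechet_derivative ?\<phi> (at (?yc s)) (z1 s)" if "s \<in> N'" for s
  proof (rule vector_derivative_unique_at)
    show "(?yd has_vector_derivative y1 s) (at s)" using jet(2) that by (auto simp: N'_def)
    show "(?yd has_vector_derivative frechet_derivative ?\<phi> (at (?yc s)) (z1 s)) (at s)"
      by (rule has_vector_derivative_cong_open[OF oN' that yd B1[OF that]])
  qed
  have qeq: "q t = frechet_derivative ?\<phi> (at (?yc t)) q2 + frechet_derivative (\<lambda>z. frechet_derivative ?\<phi> (at z) (z1 t)) (at (?yc t)) (z1 t)"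
    by (rule vector_derivative_unique_at[OF jet(3)[OF N(2)] has_vector_derivative_cong_open[OF oN' tN' y1eq B2]])
  have jt: "chain_jet V (HH d) (JJ d) P (?yd t) (y1 t) (q t)" by (rule jet(4)[OF N(2)])
  have ytc: "?yc t = snd c p" "?yd t = snd d p" using t(2) by auto
  have ph: "open V" "pseudohermitian V (HH d) (JJ d) P" "snd d p \<in> V" using jt ytc by (auto simp: chain_jet_def)
  interpret pc: chart_change_cr "ovl c d" "ovl d c" ?\<phi> ?\<psi> "img d" V "HH d" "JJ d" P "HH c" "JJ c"
  proof
    show "open V" "V \<subseteq> img d" "cr_structure_on (img d) (HH d) (JJ d)" "nondegenerate_on (img d) (HH d) (JJ d)"
      "pseudohermitian V (HH d) (JJ d) P"
      using ph jet(1) cr_on[OF d] nondeg_on[OF d] by auto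
  next
    fix x u assume "x \<in> ovl c d"
    then obtain r where r: "r \<in> fst c" "r \<in> fst d" "x = snd c r" by (auto simp: ovl_def)
    have tx: "?\<phi> (snd c r) = snd d r" using r c by (simp add: transition_def)
    note tv = tvec_of_change[OF c(1) r(1) d r(2), of u]
    show H: "u \<in> HH c x \<longleftrightarrow> frechet_derivative ?\<phi> (at x) u \<in> HH d (?\<phi> x)"
      unfolding r(3) tx chart_H_at[OF c(1) r(1)] chart_H_at[OF d r(2)] tv ..
    assume "u \<in> HH c x"
    then have "tvec_of A r c u \<in> H r" using chart_H_at[OF c(1) r(1)] r(3) by simp
    then have JH: "J r (tvec_of A r c u) \<in> H r" by (rule J_H)
    \<comment> \<open>The image under J lies in H, so it is a genuine tangent vector and its
      components transform by the differential of the transition map.\<close>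
    have "J r (tvec_of A r c u) d = frechet_derivative ?\<phi> (at x) (J r (tvec_of A r c u) c)"
      by (subst H_components[OF c(1) r(1) JH]) (simp add: tvec_of_def d r)
    then show "frechet_derivative ?\<phi> (at x) (JJ c x u) = JJ d (?\<phi> x) (frechet_derivative ?\<phi> (at x) u)"
      unfolding r(3) tx chart_J_at[OF c(1) r(1)] chart_J_at[OF d r(2)] by (simp add: tv[symmetric])
  qed
  have xd: "snd c p \<in> pc.cdom"
    unfolding pc.cdom_def using c pd ph(3) by (auto simp: ovl_def transition_def)
  have tp: "?\<phi> (snd c p) = snd d p" using c by (simp add: transition_def)
  have "chain_jet pc.cdom (HH c) (JJ c) (cg.pull P) (snd c p) v q2"
    by (rule pc.chain_jet_pull[OF xd]) (use jt y1eq[OF tN'] qeq in \<open>simp add: tp t(2) z1t\<close>)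
  moreover have "pc.cdom \<subseteq> img c" unfolding pc.cdom_def by (auto simp: ovl_def)
  ultimately show ?thesis
    using oN' tN' ycd A2 by blast
qed

end

section \<open>Common chains of two structures and the global sign\<close>

locale common_chains = C1: nondegenerate_cr A H J + C2: nondegenerate_cr A H' J'
  for A :: "('m::topological_space, 'n::finite) chart set" and H J H' J' +
  fixes C :: "'m curve set"
  assumes big: "sufficiently_big A C"
    and chains: "\<And>\<gamma>. \<gamma> \<in> C \<Longrightarrow> is_chain A H J \<gamma> \<and> is_chain A H' J' \<gamma>"
begin

lemma common_jets:
  assumes c: "c \<in> A" "p \<in> fst c"
  obtains U V P V' Q where "open U" "U \<noteq> {}" "V \<subseteq> C1.img c" "V' \<subseteq> C1.img c"
    "pseudohermitian_chart (C1.img c) V (C1.HH c) (C1.JJ c) P"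
    "pseudohermitian_chart (C1.img c) V' (C2.HH c) (C2.JJ c) Q" "snd c p \<in> V" "snd c p \<in> V'"
    "\<And>v. v \<in> U \<Longrightarrow> \<exists>q. chain_jet V (C1.HH c) (C1.JJ c) P (snd c p) v q \<and> chain_jet V' (C2.HH c) (C2.JJ c) Q (snd c p) v q"
proof -
  obtain U where U: "open U" "U \<noteq> {}" "tvec_of A p c ` U \<subseteq> tangent_vectors A C p"
    using big c unfolding sufficiently_big_def by blast
  have jets: "\<exists>q. (\<exists>V P. V \<subseteq> C1.img c \<and> chain_jet V (C1.HH c) (C1.JJ c) P (snd c p) v q) \<and>
      (\<exists>V P. V \<subseteq> C1.img c \<and> chain_jet V (C2.HH c) (C2.JJ c) P (snd c p) v q)" if v: "v \<in> U" for v
  proof -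
    have "tvec_of A p c v \<in> tangent_vectors A C p" using U(3) v by blast
    then obtain I \<gamma> t where g: "(I, \<gamma>) \<in> C" "t \<in> I" "\<gamma> t = p"
      "\<forall>c'\<in>A. p \<in> fst c' \<longrightarrow> ((snd c' \<circ> \<gamma>) has_vector_derivative tvec_of A p c v c') (at t)"
      unfolding tangent_vectors_def by blast
    have d: "((snd c \<circ> \<gamma>) has_vector_derivative v) (at t)"
      using bspec[OF g(4) c(1)] c by simp
    have ch: "is_chain A H J (I, \<gamma>)" "is_chain A H' J' (I, \<gamma>)" using chains[OF g(1)] by auto
    obtain V P N y1 q where 1: "V \<subseteq> C1.img c" "chain_jet V (C1.HH c) (C1.JJ c) P (snd c p) v q" "open N" "t \<in> N"
      "\<forall>s\<in>N. ((snd c \<circ> \<gamma>) has_vector_derivative y1 s) (at s)" "(y1 has_vector_derivative q) (at t)"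
      using C1.chain_transfer[OF ch(1) g(2,3) c d] by blast
    obtain V' P' N' y1' q' where 2: "V' \<subseteq> C1.img c" "chain_jet V' (C2.HH c) (C2.JJ c) P' (snd c p) v q'" "open N'" "t \<in> N'"
      "\<forall>s\<in>N'. ((snd c \<circ> \<gamma>) has_vector_derivative y1' s) (at s)" "(y1' has_vector_derivative q') (at t)"
      using C2.chain_transfer[OF ch(2) g(2,3) c d] by blast
    \<comment> \<open>Both accelerations are derivatives of the velocity of one and the same
      coordinate curve, so they coincide although they come from different charts and
      metrics.\<close>
    have "y1 s = y1' s" if "s \<in> N \<inter> N'" for s
      using vector_derivative_unique_at[of "snd c \<circ> \<gamma>" "y1 s" s "y1' s"] 1(5) 2(5) that by blast
    then have "(y1 has_vector_derivative q') (at t)"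
      using has_vector_derivative_cong_open[of "N \<inter> N'" t y1 y1' q'] 1(3,4) 2(3,4,6) by auto
    then have "q = q'" using vector_derivative_unique_at[OF 1(6)] by blast
    then show ?thesis using 1(1,2) 2(1,2) by blast
  qed
  \<comment> \<open>Any one direction supplies local data for the two structures;
    \<open>chain_jet_invariant\<close> then expresses the jets of all other directions by these
    data.\<close>
  obtain v0 where "v0 \<in> U" using U(2) by blast
  from jets[OF this] obtain q0 V P V' Q where
    P: "V \<subseteq> C1.img c" "chain_jet V (C1.HH c) (C1.JJ c) P (snd c p) v0 q0" and
    Q: "V' \<subseteq> C1.img c" "chain_jet V' (C2.HH c) (C2.JJ c) Q (snd c p) v0 q0" by blast
  have o: "open V" "snd c p \<in> V" "pseudohermitian V (C1.HH c) (C1.JJ c) P"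
    "open V'" "snd c p \<in> V'" "pseudohermitian V' (C2.HH c) (C2.JJ c) Q"
    using P(2) Q(2) by (auto simp: chain_jet_def)
  have ch: "pseudohermitian_chart (C1.img c) V (C1.HH c) (C1.JJ c) P"
    "pseudohermitian_chart (C1.img c) V' (C2.HH c) (C2.JJ c) Q"
    by (unfold_locales; use o P(1) Q(1) C1.cr_on[OF c(1)] C1.nondeg_on[OF c(1)] C2.cr_on[OF c(1)] C2.nondeg_on[OF c(1)] in blast)+
  have "\<exists>q. chain_jet V (C1.HH c) (C1.JJ c) P (snd c p) v q \<and> chain_jet V' (C2.HH c) (C2.JJ c) Q (snd c p) v q" if v: "v \<in> U" for v
  proof -
    obtain q V1 P1 V2 Q2 where j: "V1 \<subseteq> C1.img c" "chain_jet V1 (C1.HH c) (C1.JJ c) P1 (snd c p) v q"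
      "V2 \<subseteq> C1.img c" "chain_jet V2 (C2.HH c) (C2.JJ c) Q2 (snd c p) v q" using jets[OF v] by blast
    show ?thesis
      using chain_jet_invariant[OF C1.cr_on[OF c(1)] C1.nondeg_on[OF c(1)] j(2,1) o(1,2) P(1) o(3)]
        chain_jet_invariant[OF C2.cr_on[OF c(1)] C2.nondeg_on[OF c(1)] j(4,3) o(4,5) Q(1) o(6)] by blast
  qed
  then show ?thesis using that[OF U(1,2) P(1) Q(1) ch o(2,5)] by blast
qed

lemma chart_H_eq: assumes c: "c \<in> A" "p \<in> fst c" shows "C1.HH c (snd c p) = C2.HH c (snd c p)"
proof -
  obtain U V P V' Q where h: "open U" "U \<noteq> {}"
    "pseudohermitian_chart (C1.img c) V (C1.HH c) (C1.JJ c) P"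
    "pseudohermitian_chart (C1.img c) V' (C2.HH c) (C2.JJ c) Q" "snd c p \<in> V" "snd c p \<in> V'"
    "\<And>v. v \<in> U \<Longrightarrow> \<exists>q. chain_jet V (C1.HH c) (C1.JJ c) P (snd c p) v q \<and> chain_jet V' (C2.HH c) (C2.JJ c) Q (snd c p) v q"
    using common_jets[OF c] by metis
  show ?thesis
  proof
    show "C1.HH c (snd c p) \<subseteq> C2.HH c (snd c p)"
      by (rule spray_H_subset[OF h(3,4,5,6,1,2,7)])
    show "C2.HH c (snd c p) \<subseteq> C1.HH c (snd c p)"
      by (rule spray_H_subset[OF h(4,3,6,5,1,2)]) (use h(7) in blast)
  qed
qed

lemma H_eq: "H = H'"
proof
  fix p
  obtain c where c: "c \<in> A" "p \<in> fst c" using C1.cover by blast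
  have "v \<in> H p \<longleftrightarrow> v \<in> H' p" for v
    using chart_H_eq[OF c] C1.chart_H_at[OF c, of "v c"] C2.chart_H_at[OF c, of "v c"]
      C1.H_components[OF c, of v] C2.H_components[OF c, of v] by metis
  then show "H p = H' p" by blast
qed

lemma chart_J_eq:
  assumes c: "c \<in> A" "p \<in> fst c"
  shows "(\<forall>u\<in>C1.HH c (snd c p). C1.JJ c (snd c p) u = C2.JJ c (snd c p) u) \<or>
    (\<forall>u\<in>C1.HH c (snd c p). C1.JJ c (snd c p) u = - C2.JJ c (snd c p) u)"
proof -
  have HH: "C2.HH c = C1.HH c" by (simp add: H_eq)
  obtain U V P V' Q where h: "open U" "U \<noteq> {}" "V \<subseteq> C1.img c" "V' \<subseteq> C1.img c"
    "pseudohermitian_chart (C1.img c) V (C1.HH c) (C1.JJ c) P"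
    "pseudohermitian_chart (C1.img c) V' (C1.HH c) (C2.JJ c) Q" "snd c p \<in> V" "snd c p \<in> V'"
    "\<And>v. v \<in> U \<Longrightarrow> \<exists>q. chain_jet V (C1.HH c) (C1.JJ c) P (snd c p) v q \<and> chain_jet V' (C1.HH c) (C2.JJ c) Q (snd c p) v q"
    using common_jets[OF c] unfolding HH by metis
  \<comment> \<open>\<open>spray_J\<close> differentiates the ratio of the two contact forms, so
    both sets of data have to live on one neighbourhood.\<close>
  let ?V = "V \<inter> V'"
  have o: "open V" "open V'" "pseudohermitian V (C1.HH c) (C1.JJ c) P" "pseudohermitian V' (C1.HH c) (C2.JJ c) Q"
    using h(5,6) by (auto simp: pseudohermitian_chart_def)
  have cr2: "cr_structure_on (C1.img c) (C1.HH c) (C2.JJ c)" "nondegenerate_on (C1.img c) (C1.HH c) (C2.JJ c)"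
    using C2.cr_on[OF c(1)] C2.nondeg_on[OF c(1)] by (simp_all add: HH)
  have p: "pseudohermitian_chart (C1.img c) ?V (C1.HH c) (C1.JJ c) P" "pseudohermitian_chart (C1.img c) ?V (C1.HH c) (C2.JJ c) Q"
    using o h(3) C1.cr_on[OF c(1)] C1.nondeg_on[OF c(1)] cr2 pseudohermitian_subset[OF o(3), of ?V] pseudohermitian_subset[OF o(4), of ?V]
    by (auto simp: pseudohermitian_chart_def)
  have j: "\<exists>q. chain_jet ?V (C1.HH c) (C1.JJ c) P (snd c p) v q \<and> chain_jet ?V (C1.HH c) (C2.JJ c) Q (snd c p) v q" if v: "v \<in> U" for v
  proof -
    obtain q where q: "chain_jet V (C1.HH c) (C1.JJ c) P (snd c p) v q" "chain_jet V' (C1.HH c) (C2.JJ c) Q (snd c p) v q"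
      using h(9)[OF v] by blast
    have "open ?V" "snd c p \<in> ?V" using o h by auto
    then show ?thesis
      using chain_jet_subset[OF C1.cr_on[OF c(1)] C1.nondeg_on[OF c(1)] q(1) h(3), of ?V]
        chain_jet_subset[OF cr2 q(2) h(4), of ?V] by blast
  qed
  show ?thesis
    by (rule spray_J[OF p _ h(1,2) j]) (use h(7,8) in auto)
qed

definition "agree s = {p. \<forall>v\<in>H p. J p v = (\<lambda>c. s *\<^sub>R J' p v c)}"

lemma agree_chart:
  assumes c: "c \<in> A" "p \<in> fst c"
  shows "p \<in> agree s \<longleftrightarrow> (\<forall>u\<in>C1.HH c (snd c p). C1.JJ c (snd c p) u = s *\<^sub>R C2.JJ c (snd c p) u)"
proof
  assume p: "p \<in> agree s"
  show "\<forall>u\<in>C1.HH c (snd c p). C1.JJ c (snd c p) u = s *\<^sub>R C2.JJ c (snd c p) u"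
  proof
    fix u assume "u \<in> C1.HH c (snd c p)"
    then have "J p (tvec_of A p c u) = (\<lambda>e. s *\<^sub>R J' p (tvec_of A p c u) e)"
      using p C1.chart_H_at[OF c] by (simp add: agree_def)
    then show "C1.JJ c (snd c p) u = s *\<^sub>R C2.JJ c (snd c p) u"
      unfolding C1.chart_J_at[OF c] C2.chart_J_at[OF c] by (rule fun_cong)
  qed
next
  assume h: "\<forall>u\<in>C1.HH c (snd c p). C1.JJ c (snd c p) u = s *\<^sub>R C2.JJ c (snd c p) u"
  show "p \<in> agree s"
    unfolding agree_def
  proof (intro CollectI ballI)
    fix v assume v: "v \<in> H p"
    have tv: "v = tvec_of A p c (v c)" by (rule C1.H_components[OF c v])
    have "v c \<in> C1.HH c (snd c p)" using C1.chart_H_at[OF c] v tv by metis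
    then have e: "J p v c = s *\<^sub>R J' p v c"
      using h C1.chart_J_at[OF c, of "v c"] C2.chart_J_at[OF c, of "v c"] tv by metis
    have 1: "J p v = tvec_of A p c (J p v c)" by (rule C1.H_components[OF c C1.J_H[OF v]])
    have 2: "J' p v = tvec_of A p c (J' p v c)" by (rule C2.H_components[OF c C2.J_H]) (use v H_eq in simp)
    have "tvec_of A p c (s *\<^sub>R u) = (\<lambda>e. s *\<^sub>R tvec_of A p c u e)" for u
    proof
      fix e
      show "tvec_of A p c (s *\<^sub>R u) e = s *\<^sub>R tvec_of A p c u e"
      proof (cases "e \<in> A \<and> p \<in> fst e")
        case True
        then have "linear (frechet_derivative (transition c e) (at (snd c p)))"
          using C1.transition_has_derivative[OF c(1) _ c(2)] has_derivative_linear by blast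
        then show ?thesis by (simp add: tvec_of_def linear_scale)
      qed (auto simp: tvec_of_def)
    qed
    then show "J p v = (\<lambda>e. s *\<^sub>R J' p v e)" using 1 2 e by metis
  qed
qed

lemma agree_cases: "p \<in> agree 1 \<or> p \<in> agree (-1)"
proof -
  obtain c where c: "c \<in> A" "p \<in> fst c" using C1.cover by blast
  show ?thesis using chart_J_eq[OF c] by (simp add: agree_chart[OF c])
qed

text \<open>Both signs at once would give J = 0 on H, contradicting J^2 = -1 on a space of positive
  dimension.\<close>

lemma agree_disjoint: "\<not> (p \<in> agree 1 \<and> p \<in> agree (-1))"
proof
  assume a: "p \<in> agree 1 \<and> p \<in> agree (-1)"
  obtain c where c: "c \<in> A" "p \<in> fst c" using C1.cover by blast
  let ?x = "snd c p"
  have x: "?x \<in> C1.img c" using c by blast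
  note cr = C1.cr_on[OF c(1), unfolded cr_structure_on_def]
  have dim: "subspace (C1.HH c ?x) \<and> dim (C1.HH c ?x) = 2 * CARD('n)" using cr[THEN conjunct1] x by blast
  have "C1.HH c ?x \<noteq> {0}"
  proof
    assume e: "C1.HH c ?x = {0}"
    show False using dim[unfolded e] by simp
  qed
  moreover have "0 \<in> C1.HH c ?x" using dim subspace_0 by blast
  ultimately obtain u where u: "u \<in> C1.HH c ?x" "u \<noteq> 0" by auto
  have "C1.JJ c ?x u = C2.JJ c ?x u" "C1.JJ c ?x u = - C2.JJ c ?x u"
    using a u(1) by (auto simp: agree_chart[OF c])
  then have "2 *\<^sub>R C1.JJ c ?x u = C2.JJ c ?x u + - C2.JJ c ?x u" unfolding scaleR_2 by (simp only:)
  then have J0: "C1.JJ c ?x u = 0" by simp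
  have "C1.JJ c ?x (C1.JJ c ?x u) = - u" "C1.JJ c ?x u \<in> C1.HH c ?x"
    using cr[THEN conjunct2, THEN conjunct2, THEN conjunct1] x u(1) by auto
  moreover have "C1.JJ c ?x (0 *\<^sub>R u + 0 *\<^sub>R u) = 0 *\<^sub>R C1.JJ c ?x u + 0 *\<^sub>R C1.JJ c ?x u"
    using cr[THEN conjunct2, THEN conjunct2, THEN conjunct1] x u(1) by blast
  ultimately show False using J0 u(2) by simp
qed

text \<open>Agreement is an equality and as such a closed condition; openness comes from excluding
  the other sign. Near p some local section X of H has J X + s J' X different from 0, which rules
  out the sign -s, and \<open>agree_cases\<close> leaves s.\<close>

lemma open_agree: assumes s: "s = 1 \<or> s = -1" shows "open (agree s)"
proof (rule topological_space_class.openI)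
  fix p assume p: "p \<in> agree s"
  obtain c where c: "c \<in> A" "p \<in> fst c" using C1.cover by blast
  let ?x = "snd c p"
  have x: "?x \<in> C1.img c" using c by blast
  have HH: "C2.HH c = C1.HH c" by (simp add: H_eq)
  note cr = C1.cr_on[OF c(1), unfolded cr_structure_on_def]
  note cr' = C2.cr_on[OF c(1), unfolded cr_structure_on_def HH]
  obtain V E where E: "open V" "?x \<in> V" "V \<subseteq> C1.img c" "finite E" "\<forall>X\<in>E. smooth_on V X"
    "\<forall>y\<in>V. C1.HH c y = span ((\<lambda>X. X y) ` E)"
    using bspec[OF cr[THEN conjunct2, THEN conjunct1, unfolded smooth_distribution_def] x] by (elim exE conjE) rule
  \<comment> \<open>Otherwise J = - s J' on the generators, hence by linearity on their span H, and
    p would belong to both agreement sets.\<close>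
  have "\<exists>X\<in>E. C1.JJ c ?x (X ?x) + s *\<^sub>R C2.JJ c ?x (X ?x) \<noteq> 0"
  proof (rule ccontr)
    assume "\<not> ?thesis"
    then have z: "C1.JJ c ?x (X ?x) = - s *\<^sub>R C2.JJ c ?x (X ?x)" if "X \<in> E" for X
      using that by (auto simp: eq_neg_iff_add_eq_0)
    have sub: "subspace (C1.HH c ?x)" using cr[THEN conjunct1] x by auto
    have J1: "C1.JJ c ?x (a *\<^sub>R u + b *\<^sub>R v) = a *\<^sub>R C1.JJ c ?x u + b *\<^sub>R C1.JJ c ?x v"
      and J2: "C2.JJ c ?x (a *\<^sub>R u + b *\<^sub>R v) = a *\<^sub>R C2.JJ c ?x u + b *\<^sub>R C2.JJ c ?x v"
      if "u \<in> C1.HH c ?x" "v \<in> C1.HH c ?x" for u v a b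
      using bspec[OF cr[THEN conjunct2, THEN conjunct2, THEN conjunct1] x]
        bspec[OF cr'[THEN conjunct2, THEN conjunct2, THEN conjunct1] x] that by auto
    let ?S = "{u \<in> C1.HH c ?x. C1.JJ c ?x u = (- s) *\<^sub>R C2.JJ c ?x u}"
    have "subspace ?S"
    proof (rule subspaceI)
      have "C1.JJ c ?x 0 = 0" "C2.JJ c ?x 0 = 0"
        using J1[of 0 0 0 0] J2[of 0 0 0 0] subspace_0[OF sub] by simp_all
      then show "0 \<in> ?S" using subspace_0[OF sub] by simp
      show "u + v \<in> ?S" if "u \<in> ?S" "v \<in> ?S" for u v
        using that J1[of u v 1 1] J2[of u v 1 1] subspace_add[OF sub, of u v] by (simp add: algebra_simps)
      show "a *\<^sub>R u \<in> ?S" if "u \<in> ?S" for a u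
        using that J1[of u u a 0] J2[of u u a 0] subspace_scale[OF sub, of u a] by simp
    qed
    moreover have "(\<lambda>X. X ?x) ` E \<subseteq> ?S"
      using z E(2,6) by (auto intro: span_base)
    ultimately have "span ((\<lambda>X. X ?x) ` E) \<subseteq> ?S" by (rule span_minimal[rotated])
    then have "C1.JJ c ?x u = (- s) *\<^sub>R C2.JJ c ?x u" if "u \<in> C1.HH c ?x" for u
      using that E(2,6) by blast
    then have "p \<in> agree (- s)" by (simp add: agree_chart[OF c])
    then show False using agree_disjoint[of p] p s by auto
  qed
  then obtain X where X: "X \<in> E" "C1.JJ c ?x (X ?x) + s *\<^sub>R C2.JJ c ?x (X ?x) \<noteq> 0" by blast
  define F where "F y = C1.JJ c y (X y) + s *\<^sub>R C2.JJ c y (X y)" for y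
  have XH: "X y \<in> C1.HH c y" if "y \<in> V" for y
  proof -
    have "X y \<in> span ((\<lambda>X. X y) ` E)" by (rule span_base) (use X(1) in simp)
    then show ?thesis using bspec[OF E(6) that] by simp
  qed
  have "smooth_on V (\<lambda>y. C1.JJ c y (X y))"
    using cr[THEN conjunct2, THEN conjunct2, THEN conjunct2, THEN conjunct1, rule_format, OF E(1,3), of X]
      bspec[OF E(5) X(1)] XH by simp
  moreover have "smooth_on V (\<lambda>y. C2.JJ c y (X y))"
    using cr'[THEN conjunct2, THEN conjunct2, THEN conjunct2, THEN conjunct1, rule_format, OF E(1,3), of X]
      bspec[OF E(5) X(1)] XH by simp
  ultimately have "continuous_on V F"
    unfolding F_def by (intro continuous_on_add continuous_on_scaleR continuous_on_const smooth_on_continuous)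
  then have oF: "open (V \<inter> F -` (- {0}))"
    by (rule continuous_open_preimage[OF _ E(1)]) (rule open_Compl, simp)
  define Nb where "Nb = fst c \<inter> snd c -` (V \<inter> F -` (- {0}))"
  have "continuous_on (fst c) (snd c)" using C1.homeo[OF c(1)] by (simp add: homeomorphism_def)
  then have "open Nb" unfolding Nb_def
    by (rule continuous_open_preimage[OF _ C1.open_fst[OF c(1)] oF])
  moreover have "p \<in> Nb" using c E(2) X(2) by (simp add: Nb_def F_def)
  moreover have "Nb \<subseteq> agree s"
  proof
    fix r assume r: "r \<in> Nb"
    then have rc: "r \<in> fst c" "snd c r \<in> V" "F (snd c r) \<noteq> 0" by (auto simp: Nb_def)
    have "r \<notin> agree (- s)"
    proof
      assume "r \<in> agree (- s)"
      then have "C1.JJ c (snd c r) (X (snd c r)) = (- s) *\<^sub>R C2.JJ c (snd c r) (X (snd c r))"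
        using agree_chart[OF c(1) rc(1)] XH[OF rc(2)] by blast
      then show False using rc(3) by (simp add: F_def)
    qed
    then show "r \<in> agree s" using agree_cases[of r] s by auto
  qed
  ultimately show "\<exists>T. open T \<and> p \<in> T \<and> T \<subseteq> agree s" by blast
qed

text \<open>The two agreement sets are open, disjoint and cover the manifold, so a connected set
  meets only one of them.\<close>

lemma agree_component:
  assumes "connected M"
  shows "M \<subseteq> agree 1 \<or> M \<subseteq> agree (-1)"
proof (rule ccontr)
  assume n: "\<not> ?thesis"
  have "agree 1 \<inter> M \<noteq> {}" "agree (-1) \<inter> M \<noteq> {}" using n agree_cases by blast+
  moreover have "agree 1 \<inter> agree (-1) \<inter> M = {}" using agree_disjoint by blast
  moreover have "M \<subseteq> agree 1 \<union> agree (-1)" using agree_cases by blast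
  ultimately show False
    using connectedD[OF assms, of "agree 1" "agree (-1)"] open_agree by blast
qed

end

theorem corollary1p3:
  fixes A :: "('m::{t2_space, second_countable_topology}, 'n::finite) chart set"
    and H H' :: "'m \<Rightarrow> ('m, 'n) tvec set"
    and J J' :: "'m \<Rightarrow> ('m, 'n) tvec \<Rightarrow> ('m, 'n) tvec"
    and C :: "'m curve set"
  assumes "smooth_atlas A"
    and "nondegenerate_cr_structure A H J"
    and "nondegenerate_cr_structure A H' J'"
    and "sufficiently_big A C"
    and "\<forall>\<gamma>\<in>C. is_chain A H J \<gamma> \<and> is_chain A H' J' \<gamma>"
  shows "(\<forall>p. H p = H' p) \<and>
    (\<forall>M\<in>components (UNIV :: 'm set).
       (\<forall>p\<in>M. \<forall>v\<in>H p. J p v = J' p v) \<or>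
       (\<forall>p\<in>M. \<forall>v\<in>H p. J p v = (\<lambda>c. - J' p v c)))"
proof -
  interpret common_chains A H J H' J' C
    by unfold_locales (use assms in auto)
  show ?thesis
  proof (intro conjI allI ballI)
    show "H p = H' p" for p by (simp add: H_eq)
    fix M assume "M \<in> components (UNIV :: 'm set)"
    then have "M \<subseteq> agree 1 \<or> M \<subseteq> agree (-1)" using agree_component in_components_connected by blast
    then show "(\<forall>p\<in>M. \<forall>v\<in>H p. J p v = J' p v) \<or> (\<forall>p\<in>M. \<forall>v\<in>H p. J p v = (\<lambda>c. - J' p v c))"
      by (auto simp: agree_def)
  qed
qed

end
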